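(* Let $k,n,D\in\mathbb{N}$ and $T>0$, and set $d:=1+n+D$. Let $V\in C^k([0,T]\times\mathbb{R}^n\times[0,1]^D;\mathbb{R}^n)$ and suppose there is $C>0$ with $|V(t,x,\eta)|\le C(1+|x|)$ for all $(t,x,\eta)\in[0,T]\times\mathbb{R}^n\times[0,1]^D$. Let $r>0$ and let $u_0\in C^1(\mathbb{R}^n)$ be $r$-approximable by NNs. Assume that one of the following holds: (a) $f(t,x,\eta)=f_1(t,x)$ with $f_1\in C^{s'}([0,T]\times\mathbb{R}^n)$ and $s':=\lceil (n+1)k/d\rceil$; or (b) $f(t,x,\eta)=f_2(t,x,\eta)$ with $f_2\in C^{s'}([0,T]\times\mathbb{R}^n\times[0,1]^D)$ and $s':=k$. Let $u\in C^1([0,T]\times\mathbb{R}^n\times[0,1]^D)$ denote the unique solution of the Cauchy problem $$\partial_t u(t,x,\eta)+V(t,x,\eta)\cdot\nabla_x u(t,x,\eta)=f(t,x,\eta),\qquad u(0,x,\eta)=u_0(x).$$ Then for every compact $K\subset\mathbb{R}^n$ there exists a constant $c=c(n,r,d,k,|K|,T,\|V\|_{C^k},u_0,\|f\|_{C^{s'}})>0$ (depending only on the indicated quantities, in particular not on $\varepsilon$) such that for every $\varepsilon\in(0,1)$ there exists a NN $\Phi^{\overline u,\varepsilon}$ with $d$-dimensional input such that, for the restriction $\overline u:=u|_{[0,T]\times K\times[0,1]^D}$, (i) $L(\Phi^{\overline u,\varepsilon})\le c\cdot(\ln(1/\varepsilon)+1)$; (ii) $W(\Phi^{\overline u,\varepsilon})\le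 c\cdot(\varepsilon^{-1/r}+\varepsilon^{-(d+1)/k-1})\cdot(\ln(1/\varepsilon)+1)$; (iii) $\|\overline u-\mathrm{R}(\Phi^{\overline u,\varepsilon})\|_{L^\infty([0,T]\times K\times[0,1]^D)}<\varepsilon$.
   Context: $\mathbb{N}=\{1,2,\dots\}$. Neural networks: for $m,L\in\mathbb{N}$, a neural network (NN) $\Phi$ with input dimension $m$ and $L$ layers is a sequence $\Phi=((A_1,b_1),\dots,(A_L,b_L))$ where, with $N_0=m$ and some $N_1,\dots,N_L\in\mathbb{N}$, each $A_\ell$ is a real $N_\ell\times\sum_{j=0}^{\ell-1}N_j$ matrix and $b_\ell\in\mathbb{R}^{N_\ell}$. With $\varrho(x)=\max\{0,x\}$ (ReLU, applied componentwise), its realisation $\mathrm{R}(\Phi):\mathbb{R}^m\to\mathbb{R}^{N_L}$ is $\mathrm{R}(\Phi)(x)=x_L$, where $x_0:=x$, $x_\ell:=\varrho(A_\ell[x_0^T|\dots|x_{\ell-1}^T]^T+b_\ell)$ for $\ell=1,\dots,L-1$, and $x_L:=A_L[x_0^T|\dots|x_{L-1}^T]^T+b_L$. $N_L$ is the output dimension, $L(\Phi):=L$ the number of layers, and $W(\Phi):=\sum_{j=1}^L(\|A_j\|_0+\|b_j\|_0)$ the number of weights, where $\|\cdot\|_0$ counts nonzero entries. NNs approximating scalar functions have output dimension $1$. Approximability: $f\in L^\infty(\mathbb{R}^n)$ is $r$-approximable by NNs ($r>0$) if for every compact $K\subset\mathbb{R}^n$ there is a constant $c=c(K,r,f)>0$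 such that for every $\varepsilon\in(0,1)$ there is a NN $\Phi^{f,\varepsilon}$ (input dimension $n$) with $L(\Phi^{f,\varepsilon})\le c\cdot(\ln(1/\varepsilon)+1)$, $W(\Phi^{f,\varepsilon})\le c\,\varepsilon^{-1/r}$, and $\|f-\mathrm{R}(\Phi^{f,\varepsilon})\|_{L^\infty(K)}\le\varepsilon$. Norms: $|K|:=\max_{x\in K}|x|$; $\|g\|_{C^k(\Omega)}=\max_{|\alpha|\le k}\sup_{x\in\Omega}|D^\alpha g(x)|$; $\|V\|_{C^k}$ and $\|f\|_{C^{s'}}$ are taken over $[0,T]\times B_G(0)\times[0,1]^D$, where $B_G(0)\subset\mathbb{R}^n$ is the closed ball about $0$ of radius $G:=(|K|+CT)\exp(CT)$. *)

theory Defs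
  imports
    "HOL-Analysis.Analysis"
    "HOL-Probability.Essential_Supremum"
    "Jordan_Normal_Form.Matrix"
begin

text \<open>
  Vectors of a dimension fixed throughout live in \<open>real ^ 'n\<close> from HOL-Analysis; the layers of a
  network have varying sizes, so weights use the matrices and vectors of Jordan_Normal_Form. Both
  libraries use the same infix notation, hence the plain names \<open>inner\<close> and \<open>vec_index\<close> below.
\<close>

subsection \<open>Neural networks with skip connections\<close>

type_synonym nn = "(real Matrix.mat \<times> real Matrix.vec) list"

text \<open>The list entry at position \<open>l\<close> (counted from 0) is the pair \<open>(A_{l+1}, b_{l+1})\<close>; its size
  \<open>N_{l+1}\<close> is \<open>dim_vec b_{l+1}\<close>.\<close>

definition is_nn :: "nat \<Rightarrow> nn \<Rightarrow> bool" where
  "is_nn m \<Phi> \<longleftrightarrow> m \<ge> 1 \<and> \<Phi> \<noteq> [] \<and>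
     (\<forall>l < length \<Phi>.
        dim_vec (snd (\<Phi> ! l)) \<ge> 1 \<and>
        fst (\<Phi> ! l) \<in> carrier_mat (dim_vec (snd (\<Phi> ! l))) (m + (\<Sum>j<l. dim_vec (snd (\<Phi> ! j)))))"

definition nn_out_dim :: "nn \<Rightarrow> nat" where
  "nn_out_dim \<Phi> = dim_vec (snd (last \<Phi>))"

definition nn_layers :: "nn \<Rightarrow> nat" where
  "nn_layers \<Phi> = length \<Phi>"

definition nnz_mat :: "real Matrix.mat \<Rightarrow> nat" where
  "nnz_mat A = card {(i, j). i < dim_row A \<and> j < dim_col A \<and> index_mat A (i, j) \<noteq> 0}"

definition nnz_vec :: "real Matrix.vec \<Rightarrow> nat" where
  "nnz_vec b = card {i. i < dim_vec b \<and> vec_index b i \<noteq> 0}"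

definition nn_weights :: "nn \<Rightarrow> nat" where
  "nn_weights \<Phi> = (\<Sum>(A, b)\<leftarrow>\<Phi>. nnz_mat A + nnz_vec b)"

definition relu :: "real \<Rightarrow> real" where
  "relu x = max 0 x"

text \<open>The argument \<open>z\<close> is the concatenation \<open>[x_0 | ... | x_{l-1}]\<close> of the input and all layers
  computed so far. The empty list is not a network.\<close>

fun nn_real :: "nn \<Rightarrow> real Matrix.vec \<Rightarrow> real Matrix.vec" where
  "nn_real [] z = z"
| "nn_real [(A, b)] z = A *\<^sub>v z + b"
| "nn_real ((A, b) # l # ls) z = nn_real (l # ls) (z @\<^sub>v map_vec relu (A *\<^sub>v z + b))"

text \<open>Points of a Euclidean space are fed to a network through their coordinates, in an arbitrary
  but fixed order. Another order permutes the columns of the weight matrices that act on the input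
  and so changes neither the number of layers nor the number of weights.\<close>

definition basis_list :: "'a::euclidean_space list" where
  "basis_list = (SOME bs. distinct bs \<and> set bs = Basis)"

definition coords :: "'a::euclidean_space \<Rightarrow> real Matrix.vec" where
  "coords x = vec_of_list (map (inner x) basis_list)"

lemma basis_list: "distinct (basis_list :: 'a::euclidean_space list)"
  "set (basis_list :: 'a list) = Basis"
proof -
  have "\<exists>bs :: 'a list. distinct bs \<and> set bs = Basis"
    using finite_distinct_list[OF finite_Basis] by blast
  from someI_ex[OF this] show "distinct (basis_list :: 'a list)" "set (basis_list :: 'a list) = Basis"
    by (simp_all add: basis_list_def)
qed

lemma dim_coords: "dim_vec (coords (x :: 'a::euclidean_space)) = DIM('a)"
  by (simp add: coords_def) (metis basis_list distinct_card)

text \<open>Realisation of a network with scalar output.\<close>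

definition nn_fun :: "nn \<Rightarrow> 'a::euclidean_space \<Rightarrow> real" where
  "nn_fun \<Phi> x = vec_index (nn_real \<Phi> (coords x)) 0"

subsection \<open>Approximability\<close>

text \<open>\<open>esssup\<close> is \<open>\<infinity>\<close> for non-measurable functions and \<open>-\<infinity>\<close> over null sets; the maximum
  makes the norm 0 in the latter case.\<close>

definition Linf_norm :: "'a::euclidean_space set \<Rightarrow> ('a \<Rightarrow> real) \<Rightarrow> ereal" where
  "Linf_norm S g = max 0 (esssup (lebesgue_on S) (\<lambda>x. ereal \<bar>g x\<bar>))"

definition r_approximable :: "real \<Rightarrow> ('a::euclidean_space \<Rightarrow> real) \<Rightarrow> bool" where
  "r_approximable r f \<longleftrightarrow>
     f \<in> borel_measurable lebesgue \<and> Linf_norm UNIV f < \<infinity> \<and>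
     (\<forall>K. compact K \<longrightarrow>
       (\<exists>c>0. \<forall>\<epsilon>. 0 < \<epsilon> \<and> \<epsilon> < 1 \<longrightarrow>
         (\<exists>\<Phi>. is_nn DIM('a) \<Phi> \<and> nn_out_dim \<Phi> = 1 \<and>
              real (nn_layers \<Phi>) \<le> c * (ln (1 / \<epsilon>) + 1) \<and>
              real (nn_weights \<Phi>) \<le> c * \<epsilon> powr (- (1 / r)) \<and>
              Linf_norm K (\<lambda>x. f x - nn_fun \<Phi> x) \<le> ereal \<epsilon>)))"

subsection \<open>Functions of class \<open>C\<^sup>k\<close> on sets that need not be open\<close>

text \<open>
  Partial derivatives are taken within the domain \<open>\<Omega>\<close>, i.e. one-sided at boundary points. This
  is meaningful for sets such as \<open>[0,T] \<times> \<real>\<^sup>n \<times> [0,1]\<^sup>D\<close>, which from each of their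
  points contain a nontrivial segment in every coordinate direction.
\<close>

definition pdiff_at_within ::
  "'a::euclidean_space set \<Rightarrow> 'a \<Rightarrow> ('a \<Rightarrow> 'b::real_normed_vector) \<Rightarrow> 'a \<Rightarrow> bool" where
  "pdiff_at_within \<Omega> b g x \<longleftrightarrow>
     (\<lambda>h. g (x + h *\<^sub>R b)) differentiable (at (0::real) within {h. x + h *\<^sub>R b \<in> \<Omega>})"

definition pderiv_within ::
  "'a::euclidean_space set \<Rightarrow> 'a \<Rightarrow> ('a \<Rightarrow> 'b::real_normed_vector) \<Rightarrow> 'a \<Rightarrow> 'b" where
  "pderiv_within \<Omega> b g x =
     vector_derivative (\<lambda>h. g (x + h *\<^sub>R b)) (at (0::real) within {h. x + h *\<^sub>R b \<in> \<Omega>})"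

fun Ck_on :: "nat \<Rightarrow> ('a::euclidean_space \<Rightarrow> 'b::real_normed_vector) \<Rightarrow> 'a set \<Rightarrow> bool" where
  "Ck_on 0 g \<Omega> \<longleftrightarrow> continuous_on \<Omega> g"
| "Ck_on (Suc k) g \<Omega> \<longleftrightarrow> continuous_on \<Omega> g \<and>
     (\<forall>b\<in>Basis. (\<forall>x\<in>\<Omega>. pdiff_at_within \<Omega> b g x) \<and> Ck_on k (pderiv_within \<Omega> b g) \<Omega>)"

text \<open>A multi-index of order \<open>m\<close> is represented by the lists of \<open>m\<close> basis vectors that contain
  each basis vector with the prescribed multiplicity; for a function of class \<open>C\<^sup>m\<close> they all give
  the same derivative.

  The norm has separate arguments for the domain \<open>\<Omega>\<close> in which derivatives are taken and the set
  \<open>S \<subseteq> \<Omega>\<close> over which the supremum is formed, because derivatives within a set such as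
  \<open>[0,T] \<times> cball 0 G \<times> [0,1]\<^sup>D\<close> degenerate at some boundary points of the ball.\<close>

definition iter_pderiv ::
  "'a::euclidean_space set \<Rightarrow> 'a list \<Rightarrow> ('a \<Rightarrow> 'b::real_normed_vector) \<Rightarrow> 'a \<Rightarrow> 'b" where
  "iter_pderiv \<Omega> bs g = foldr (pderiv_within \<Omega>) bs g"

definition Ck_norm ::
  "nat \<Rightarrow> 'a::euclidean_space set \<Rightarrow> 'a set \<Rightarrow> ('a \<Rightarrow> 'b::real_normed_vector) \<Rightarrow> real" where
  "Ck_norm k \<Omega> S g =
     Max ((\<lambda>bs. SUP x\<in>S. norm (iter_pderiv \<Omega> bs g x)) ` {bs. set bs \<subseteq> Basis \<and> length bs \<le> k})"

subsection \<open>The transport equation\<close>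

text \<open>The parameter cube \<open>[0,1]\<^sup>D\<close> is \<open>cbox 0 One\<close>.\<close>

definition tx_dom ::
  "real \<Rightarrow> (real ^ 'n) set \<Rightarrow> (real \<times> (real ^ 'n) \<times> (real ^ 'D)) set" where
  "tx_dom T X = {0..T} \<times> X \<times> cbox 0 One"

definition set_size :: "'a::real_normed_vector set \<Rightarrow> real" where
  "set_size K = (SUP x\<in>K. norm x)"

definition growth_radius :: "'a::real_normed_vector set \<Rightarrow> real \<Rightarrow> real \<Rightarrow> real" where
  "growth_radius K C T = (set_size K + C * T) * exp (C * T)"

definition cauchy_solution ::
  "real \<Rightarrow> (real \<times> (real ^ 'n) \<times> (real ^ 'D) \<Rightarrow> real ^ 'n) \<Rightarrow>
   (real \<times> (real ^ 'n) \<times> (real ^ 'D) \<Rightarrow> real) \<Rightarrow> (real ^ 'n \<Rightarrow> real) \<Rightarrow>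
   (real \<times> (real ^ 'n) \<times> (real ^ 'D) \<Rightarrow> real) \<Rightarrow> bool" where
  "cauchy_solution T V f u\<^sub>0 u \<longleftrightarrow>
     Ck_on 1 u (tx_dom T UNIV) \<and>
     (\<forall>p\<in>tx_dom T UNIV.
        pderiv_within (tx_dom T UNIV) (1, 0, 0) u p
        + (\<Sum>b\<in>Basis. inner (V p) b * pderiv_within (tx_dom T UNIV) (0, b, 0) u p) = f p) \<and>
     (\<forall>x. \<forall>\<eta>\<in>cbox 0 One. u (0, x, \<eta>) = u\<^sub>0 x)"

end

theory Submission
  imports Defs
begin

text \<open>Along the characteristic through \<open>(t, x)\<close>, traversed backwards to time \<open>0\<close>, the solution is
  \<open>u\<^sub>0\<close> at the end point plus the integral of \<open>f\<close>. Replacing the characteristic by an Euler polygon with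
  \<open>N = b^k\<close> steps costs an error \<open>O(1/N)\<close>; no flow is needed, since \<open>u\<close> itself can be followed
  along ever finer polygons.

  Computed node by node the polygon would need depth \<open>N\<close>. Instead its equations are solved by
  Picard iteration on all nodes simultaneously, a contraction with factor \<open>1/2\<close> in an
  exponentially weighted norm, so that \<open>O(log N)\<close> sweeps of bounded depth suffice. In each sweep \<open>V\<close> is
  evaluated at the \<open>N\<close> nodes with accuracy \<open>O(b\<^bsup>-k\<^esup>)\<close> by Taylor polynomials glued by a partition of
  unity on a grid of mesh \<open>1/b\<close>. The products are formed by squaring networks based on
  sawtooth functions with \<open>b\<close> teeth, whose depth does not depend on \<open>b\<close> and which have \<open>O(b)\<close>
  weights, so an evaluation costs \<open>O(b\<^bsup>d+1\<^esup>)\<close>. With \<open>b\<^bsup>-k\<^esup> \<approx> \<epsilon>\<close> this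
  gives \<open>N b\<^bsup>d+1\<^esup> log N \<approx> \<epsilon>\<^bsup>-(d+1)/k-1\<^esup> ln (1/\<epsilon>)\<close> weights.\<close>

text \<open>The depth bound shapes the construction. About log N sweeps exhaust a depth of order ln
  (1/\<epsilon>), so one evaluation of V has to make do with constant depth. Products of logarithmic
  size would need logarithmic depth; paying b weights for bounded depth is where d + 1 instead of d
  comes from. The further - 1 in the exponent counts the nodes: the Euler polygon is of first order
  however smooth V is, so about 1/\<epsilon> of them are required. The second obstacle is the list
  of quantities on which the constant may depend. It omits the growth constant C, although C enters
  the radius G of the ball on which the norms are taken. The polygons are therefore kept in a ball
  whose radius is the minimum of G and |K| + T v, where v is the norm of V: the first makes the
  norms applicable, the second bounds the domain independently of C. Finally, Picard iterates may
  leave that ball, so the networks for V and f must reproduce the value at a point q of the domain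
  even when fed with some y outside it, up to a multiple of the distance of y and q.\<close>

definition lc :: "(real \<times> ('x \<Rightarrow> real)) list \<Rightarrow> 'x \<Rightarrow> real" where
  "lc ts x = (\<Sum>(a, f)\<leftarrow>ts. a * f x)"

lemma lc_simps [simp]: "lc [] x = 0" "lc ((a, f) # ts) x = a * f x + lc ts x"
  "lc (ss @ ts) x = lc ss x + lc ts x"
  by (simp_all add: lc_def)

text \<open>A network is handled through the set of functions of the input that its neurons compute: by the
  skip connections a layer may use all functions computed so far. Affine neurons are allowed in hidden
  layers because \<open>x = relu x - relu (- x)\<close>; splitting them so at most quadruples the number of weights.\<close>

inductive lstep :: "('x \<Rightarrow> real) set \<Rightarrow> nat \<Rightarrow> ('x \<Rightarrow> real) set \<Rightarrow> bool" for A where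
  lstep_empty: "lstep A 0 {}"
| lstep_relu: "lstep A w C \<Longrightarrow> snd ` set ts \<subseteq> insert (\<lambda>_. 1) A \<Longrightarrow>
    lstep A (w + length ts) (insert (\<lambda>x. relu (lc ts x)) C)"
| lstep_lin: "lstep A w C \<Longrightarrow> snd ` set ts \<subseteq> insert (\<lambda>_. 1) A \<Longrightarrow>
    lstep A (w + length ts) (insert (lc ts) C)"

inductive reach :: "('x \<Rightarrow> real) set \<Rightarrow> nat \<Rightarrow> nat \<Rightarrow> ('x \<Rightarrow> real) set \<Rightarrow> bool" for A where
  reach_0: "reach A 0 0 A"
| reach_Suc: "reach A L w B \<Longrightarrow> lstep B v C \<Longrightarrow> reach A (Suc L) (w + v) (B \<union> C)"

text \<open>The closure of \<open>reach\<close> under weakening: a bound for the weights instead of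
  their number, and only the functions of interest. Circuits then compose without a record of
  everything else they compute.\<close>

definition computes :: "('x \<Rightarrow> real) set \<Rightarrow> nat \<Rightarrow> nat \<Rightarrow> ('x \<Rightarrow> real) set \<Rightarrow> bool" where
  "computes A L w C \<longleftrightarrow> (\<exists>B v. reach A L v B \<and> v \<le> w \<and> C \<subseteq> B)"

section \<open>Parallel and sequential composition of circuits\<close>

lemma lstep_mono: "lstep A w C \<Longrightarrow> A \<subseteq> A' \<Longrightarrow> lstep A' w C"
  by (induction rule: lstep.induct) (blast intro: lstep.intros)+

lemma lstep_union:
  assumes "lstep A w C" "lstep A v D"
  shows "lstep A (w + v) (C \<union> D)"
  using assms(2)
proof (induction rule: lstep.induct)
  case lstep_empty
  then show ?case using assms(1) by simp
next
  case (lstep_relu v D ts)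
  then show ?case using lstep.lstep_relu[of A "w + v" "C \<union> D" ts] by (simp add: add.assoc)
next
  case (lstep_lin v D ts)
  then show ?case using lstep.lstep_lin[of A "w + v" "C \<union> D" ts] by (simp add: add.assoc)
qed

lemma reach_subset: "reach A L w B \<Longrightarrow> A \<subseteq> B"
  by (induction rule: reach.induct) auto

lemma reach_mono:
  assumes "reach A L w B" "A \<subseteq> A'"
  shows "\<exists>B'. reach A' L w B' \<and> B \<subseteq> B'"
  using assms(1)
proof (induction rule: reach.induct)
  case reach_0
  then show ?case using assms(2) reach.reach_0 by blast
next
  case (reach_Suc L w B v C)
  then obtain B' where "reach A' L w B'" "B \<subseteq> B'" by blast
  then show ?case using reach.reach_Suc[of A' L w B' v C] lstep_mono[OF reach_Suc(2)] by blast
qed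

text \<open>Circuits run side by side only if their depths agree; \<open>reach_pad\<close> arranges
  this by empty layers. The induction merges the two last layers after merging everything below
  them.\<close>

lemma reach_union: "reach A L w B \<Longrightarrow> reach A L v C \<Longrightarrow> \<exists>D. reach A L (w + v) D \<and> B \<union> C \<subseteq> D"
proof (induction L arbitrary: w v B C)
  case 0
  then have "B = A" "C = A" "w = 0" "v = 0" by (auto elim: reach.cases)
  then show ?case using reach_0[of A] by auto
next
  case (Suc L)
  from Suc.prems obtain w1 B1 v1 C1 where 1: "reach A L w1 B1" "lstep B1 v1 C1" "w = w1 + v1" "B = B1 \<union> C1"
    by (auto elim: reach.cases)
  from Suc.prems obtain w2 B2 v2 C2 where 2: "reach A L w2 B2" "lstep B2 v2 C2" "v = w2 + v2" "C = B2 \<union> C2"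
    by (auto elim: reach.cases)
  obtain D where D: "reach A L (w1 + w2) D" "B1 \<union> B2 \<subseteq> D" using Suc.IH[OF 1(1) 2(1)] by blast
  have "lstep D (v1 + v2) (C1 \<union> C2)"
    using lstep_union[of D v1 C1 v2 C2] lstep_mono[OF 1(2)] lstep_mono[OF 2(2)] D(2) by blast
  from reach_Suc[OF D(1) this] have "reach A (Suc L) (w + v) (D \<union> (C1 \<union> C2))"
    by (simp add: 1 2 algebra_simps)
  then show ?case using D(2) 1(4) 2(4) by blast
qed

lemma reach_trans:
  assumes "reach A L w B" "reach B L' v C"
  shows "reach A (L + L') (w + v) C"
  using assms(2)
proof (induction rule: reach.induct)
  case reach_0
  then show ?case using assms(1) by simp
next
  case (reach_Suc L1 w1 B1 v1 C1)
  from reach.reach_Suc[OF this(3) this(2)] show ?case by (simp add: add.assoc)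
qed

lemma reach_pad: "reach A L w B \<Longrightarrow> L \<le> L' \<Longrightarrow> reach A L' w B"
proof (induction L' arbitrary: L)
  case 0
  then show ?case by simp
next
  case (Suc L')
  show ?case
  proof (cases "L = Suc L'")
    case False
    then have "reach A L' w B" using Suc by simp
    from reach_Suc[OF this lstep_empty] show ?thesis by simp
  qed (use Suc in simp)
qed

lemma computes_mono:
  assumes "computes A L w C" "A \<subseteq> A'" "L \<le> L'" "w \<le> w'" "C' \<subseteq> C"
  shows "computes A' L' w' C'"
proof -
  obtain B v where B: "reach A L v B" "v \<le> w" "C \<subseteq> B" using assms(1) by (auto simp: computes_def)
  obtain B' where "reach A' L v B'" "B \<subseteq> B'" using reach_mono[OF B(1) assms(2)] by blast
  with reach_pad[OF this(1) assms(3)] show ?thesis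
    unfolding computes_def using B assms by (meson order_trans)
qed

lemma computes_refl: "C \<subseteq> A \<Longrightarrow> computes A L w C"
  unfolding computes_def using reach_pad[OF reach_0, of L A] by blast

lemma computes_union:
  assumes "computes A L w B" "computes A L v C"
  shows "computes A L (w + v) (B \<union> C)"
proof -
  obtain B1 w1 where 1: "reach A L w1 B1" "w1 \<le> w" "B \<subseteq> B1" using assms(1) by (auto simp: computes_def)
  obtain C1 v1 where 2: "reach A L v1 C1" "v1 \<le> v" "C \<subseteq> C1" using assms(2) by (auto simp: computes_def)
  show ?thesis using reach_union[OF 1(1) 2(1)] 1 2 unfolding computes_def by (meson Un_mono add_mono order_trans)
qed

lemma computes_trans:
  assumes "computes A L w B" "computes (A \<union> B) L' v C"
  shows "computes A (L + L') (w + v) (A \<union> B \<union> C)"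
proof -
  obtain B1 w1 where 1: "reach A L w1 B1" "w1 \<le> w" "B \<subseteq> B1" using assms(1) by (auto simp: computes_def)
  have "computes B1 L' v C"
    by (rule computes_mono[OF assms(2)]) (use 1 reach_subset[OF 1(1)] in auto)
  then obtain C1 v1 where 2: "reach B1 L' v1 C1" "v1 \<le> v" "C \<subseteq> C1" by (auto simp: computes_def)
  show ?thesis using reach_trans[OF 1(1) 2(1)] 1 2 reach_subset[OF 2(1)] reach_subset[OF 1(1)]
    unfolding computes_def by (meson Un_least add_mono order_trans)
qed

lemma computes_UN:
  assumes "finite I" "\<And>i. i \<in> I \<Longrightarrow> computes A L (w i) (C i)"
  shows "computes A L (sum w I) (\<Union>i\<in>I. C i)"
  using assms
proof (induction I rule: finite_induct)
  case empty
  then show ?case by (simp add: computes_refl)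
next
  case (insert i I)
  then show ?case using computes_union[of A L "w i" "C i" "sum w I" "\<Union>i\<in>I. C i"] by simp
qed

lemma computes_UN_const:
  assumes "finite I" "\<And>i. i \<in> I \<Longrightarrow> computes A L w (C i)"
  shows "computes A L (card I * w) (\<Union>i\<in>I. C i)"
  using computes_UN[of I A L "\<lambda>_. w" C] assms by simp

lemma computes_lc: "snd ` set ts \<subseteq> insert (\<lambda>_. 1) A \<Longrightarrow> computes A 1 (length ts) {lc ts}"
  using reach_Suc[OF reach_0 lstep_lin[OF lstep_empty, of ts A]]
  by (auto simp: computes_def intro!: exI)

lemma computes_relu_lc: "snd ` set ts \<subseteq> insert (\<lambda>_. 1) A \<Longrightarrow> computes A 1 (length ts) {\<lambda>x. relu (lc ts x)}"
  using reach_Suc[OF reach_0 lstep_relu[OF lstep_empty, of ts A]]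
  by (auto simp: computes_def intro!: exI)

lemma affine_lc:
  assumes "finite J" "\<And>j. j \<in> J \<Longrightarrow> f j \<in> A"
  shows "\<exists>ts. length ts = card J + 1 \<and> snd ` set ts \<subseteq> insert (\<lambda>_. 1) A \<and>
    lc ts = (\<lambda>x. c + (\<Sum>j\<in>J. a j * f j x))"
  using assms
proof (induction J rule: finite_induct)
  case empty
  show ?case by (rule exI[of _ "[(c, \<lambda>_. 1)]"]) auto
next
  case (insert j J)
  then obtain ts where "length ts = card J + 1" "snd ` set ts \<subseteq> insert (\<lambda>_. 1) A"
    "lc ts = (\<lambda>x. c + (\<Sum>j\<in>J. a j * f j x))" by auto
  with insert show ?case by (intro exI[of _ "(a j, f j) # ts"]) (auto simp: fun_eq_iff)
qed

lemma computes_affine: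
  assumes "finite J" "\<And>j. j \<in> J \<Longrightarrow> f j \<in> A"
  shows "computes A 1 (card J + 1) {\<lambda>x. c + (\<Sum>j\<in>J. a j * f j x)}"
  proof -
  obtain ts where "length ts = card J + 1" "snd ` set ts \<subseteq> insert (\<lambda>_. 1) A"
    "lc ts = (\<lambda>x. c + (\<Sum>j\<in>J. a j * f j x))"
    using affine_lc[of J f A c a] assms by blast
  with computes_lc[of ts A] show ?thesis by simp
qed

text \<open>Continuity of realisations is used twice: to turn an essential bound on the initial
  network into a pointwise one, and to make the final error measurable.\<close>

lemma continuous_computes:
  fixes A :: "('x::topological_space \<Rightarrow> real) set"
  assumes "computes A L w C" "\<And>f. f \<in> A \<Longrightarrow> continuous_on UNIV f" "g \<in> C"
  shows "continuous_on UNIV g"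
proof -
  have lc: "continuous_on UNIV (lc ts)" if "snd ` set ts \<subseteq> insert (\<lambda>_. 1) A"
    "\<And>f. f \<in> A \<Longrightarrow> continuous_on UNIV f" for ts and A :: "('x \<Rightarrow> real) set"
    using that by (induction ts) (auto simp: lc_def split: prod.splits intro!: continuous_intros)
  have rel: "continuous_on UNIV (\<lambda>x. relu (h x))" if "continuous_on UNIV h" for h :: "'x \<Rightarrow> real"
    unfolding relu_def by (intro continuous_intros that)
  have ls: "\<forall>g\<in>C. continuous_on UNIV g" if "lstep A v C" "\<And>f. f \<in> A \<Longrightarrow> continuous_on UNIV f"
    for v and A C :: "('x \<Rightarrow> real) set"
    using that(1)
  proof (induction rule: lstep.induct)
    case (lstep_relu w C ts)
    then show ?case using rel[OF lc[OF lstep_relu(2) that(2)]] by blast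
  next
    case (lstep_lin w C ts)
    then show ?case using lc[OF lstep_lin(2) that(2)] by blast
  qed simp
  obtain B v where B: "reach A L v B" "C \<subseteq> B" using assms(1) by (auto simp: computes_def)
  from B(1) have "\<forall>g\<in>B. continuous_on UNIV g"
  proof (induction rule: reach.induct)
    case reach_0
    then show ?case using assms(2) by blast
  next
    case (reach_Suc L w B v C)
    then show ?case using ls[OF reach_Suc(2)] by blast
  qed
  then show ?thesis using B assms(3) by blast
qed

subsection \<open>From circuits to networks\<close>

text \<open>\<open>nn_real\<close> treats its last layer as affine, whereas a circuit grows by
  appending hidden layers. With every layer hidden, appending one is a single equation, and the
  output layer can be added at the very end.\<close>

fun hid :: "nn \<Rightarrow> real Matrix.vec \<Rightarrow> real Matrix.vec" where
  "hid [] z = z"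
| "hid ((A, b) # ls) z = hid ls (z @\<^sub>v map_vec relu (A *\<^sub>v z + b))"

lemma hid_snoc: "hid (ls @ [(A, b)]) z = hid ls z @\<^sub>v map_vec relu (A *\<^sub>v hid ls z + b)"
  by (induction ls z rule: hid.induct) auto

lemma nn_real_snoc: "nn_real (ls @ [(A, b)]) z = A *\<^sub>v hid ls z + b"
proof (induction ls arbitrary: z)
  case (Cons l ls)
  obtain A' b' where l: "l = (A', b')" by force
  obtain l2 ls2 where "ls @ [(A, b)] = l2 # ls2" by (cases ls) auto
  with Cons show ?case by (simp add: l)
qed simp

text \<open>Represents \<open>f\<close> by at most two neurons of the state \<open>st\<close>: one ReLU neuron, or the positive and
  the negative part of an affine one.\<close>

definition two_sparse :: "nat \<Rightarrow> ('x \<Rightarrow> real Matrix.vec) \<Rightarrow> ('x \<Rightarrow> real) \<Rightarrow> bool" where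
  "two_sparse m st f \<longleftrightarrow> (\<exists>r. card {j. j < m \<and> r j \<noteq> 0} \<le> 2 \<and> (\<forall>p. f p = (\<Sum>j<m. r j * vec_index (st p) j)))"

definition row_cost :: "nat \<Rightarrow> (nat \<Rightarrow> real) \<times> real \<Rightarrow> nat" where
  "row_cost m rc = card {j. j < m \<and> fst rc j \<noteq> 0} + (if snd rc = 0 then 0 else 1)"

definition row_val :: "nat \<Rightarrow> (nat \<Rightarrow> real) \<times> real \<Rightarrow> real Matrix.vec \<Rightarrow> real" where
  "row_val m rc z = (\<Sum>j<m. fst rc j * vec_index z j) + snd rc"

text \<open>Each term becomes at most two matrix entries, since its function is spread over at most
  two neurons, and the constant function becomes the bias. Coinciding entries can only lower the
  count.\<close>

lemma row_of_terms:
  assumes "\<And>f. f \<in> snd ` set ts \<Longrightarrow> f = (\<lambda>_. 1) \<or> two_sparse m st f"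
  shows "\<exists>rc. (\<forall>p. lc ts p = row_val m rc (st p)) \<and> row_cost m rc \<le> 2 * length ts"
  using assms
proof (induction ts)
  case Nil
  show ?case by (rule exI[of _ "(\<lambda>_. 0, 0)"]) (simp add: row_val_def row_cost_def)
next
  case (Cons t ts)
  obtain a f where t: "t = (a, f)" by force
  obtain r c where rc: "\<And>p. lc ts p = row_val m (r, c) (st p)" "row_cost m (r, c) \<le> 2 * length ts"
    using Cons by auto
  consider "f = (\<lambda>_. 1)" | "two_sparse m st f" using Cons(2)[of f] t by auto
  then show ?case
  proof cases
    case 1
    show ?thesis
      by (rule exI[of _ "(r, a + c)"])
        (use rc 1 t in \<open>auto simp: row_val_def row_cost_def split: if_splits\<close>)
  next
    case 2
    then obtain s where s: "card {j. j < m \<and> s j \<noteq> 0} \<le> 2" "\<And>p. f p = (\<Sum>j<m. s j * vec_index (st p) j)"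
      by (auto simp: two_sparse_def)
    have "card {j. j < m \<and> r j + a * s j \<noteq> 0} \<le> card ({j. j < m \<and> r j \<noteq> 0} \<union> {j. j < m \<and> s j \<noteq> 0})"
      by (rule card_mono) auto
    also have "\<dots> \<le> card {j. j < m \<and> r j \<noteq> 0} + card {j. j < m \<and> s j \<noteq> 0}" by (rule card_Un_le)
    finally have "card {j. j < m \<and> r j + a * s j \<noteq> 0} \<le> card {j. j < m \<and> r j \<noteq> 0} + 2" using s(1) by simp
    then show ?thesis using rc s(2) t
      by (intro exI[of _ "(\<lambda>j. r j + a * s j, c)"])
        (auto simp: row_val_def row_cost_def sum.distrib sum_distrib_left algebra_simps)
  qed
qed

text \<open>The analogue of \<open>two_sparse\<close> for a layer under construction, whose rows are
  still a growing list and not yet part of the state.\<close>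

definition gates_sparse :: "nat \<Rightarrow> ('x \<Rightarrow> real Matrix.vec) \<Rightarrow> ((nat \<Rightarrow> real) \<times> real) list \<Rightarrow> ('x \<Rightarrow> real) \<Rightarrow> bool" where
  "gates_sparse m st rs f \<longleftrightarrow> (\<exists>g. card {i. i < length rs \<and> g i \<noteq> 0} \<le> 2 \<and>
     (\<forall>p. f p = (\<Sum>i<length rs. g i * relu (row_val m (rs ! i) (st p)))))"

lemma gates_sparse_append:
  assumes "gates_sparse m st rs f"
  shows "gates_sparse m st (rs @ rs') f"
proof -
  obtain g where g: "card {i. i < length rs \<and> g i \<noteq> 0} \<le> 2"
    "\<And>p. f p = (\<Sum>i<length rs. g i * relu (row_val m (rs ! i) (st p)))"
    using assms by (auto simp: gates_sparse_def)
  define h where "h i = (if i < length rs then g i else 0)" for i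
  have "{i. i < length (rs @ rs') \<and> h i \<noteq> 0} = {i. i < length rs \<and> g i \<noteq> 0}"
    by (auto simp: h_def)
  moreover have "f p = (\<Sum>i<length (rs @ rs'). h i * relu (row_val m ((rs @ rs') ! i) (st p)))" for p
  proof -
    have "(\<Sum>i<length (rs @ rs'). h i * relu (row_val m ((rs @ rs') ! i) (st p)))
      = (\<Sum>i<length rs. h i * relu (row_val m ((rs @ rs') ! i) (st p)))"
      by (rule sum.mono_neutral_right) (auto simp: h_def)
    also have "\<dots> = f p" unfolding g(2) by (rule sum.cong) (auto simp: h_def nth_append)
    finally show ?thesis by simp
  qed
  ultimately show ?thesis using g(1) unfolding gates_sparse_def by (intro exI[of _ h]) auto
qed

text \<open>The 4 is a product of two effects: every function used is spread over up to two neurons,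
  and an affine gate is realised twice, once with each sign.\<close>

lemma rows_of_lstep:
  assumes "lstep B v C" "\<And>f. f \<in> B \<Longrightarrow> two_sparse m st f"
  shows "\<exists>rs. rs \<noteq> [] \<and> sum_list (map (row_cost m) rs) \<le> 4 * v \<and> (\<forall>f\<in>C. gates_sparse m st rs f)"
  using assms(1)
proof (induction rule: lstep.induct)
  case lstep_empty
  \<comment> \<open>A layer of a network must have at least one neuron, so an empty step turns into
    one zero row, which has no weight.\<close>
  show ?case by (rule exI[of _ "[(\<lambda>_. 0, 0)]"]) (simp add: row_cost_def)
next
  case (lstep_relu v C ts)
  then obtain rs where rs: "rs \<noteq> []" "sum_list (map (row_cost m) rs) \<le> 4 * v" "\<forall>f\<in>C. gates_sparse m st rs f"
    by blast
  obtain rc where rc: "\<And>p. lc ts p = row_val m rc (st p)" "row_cost m rc \<le> 2 * length ts"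
    using row_of_terms[of ts m st] lstep_relu(2) assms(2) by blast
  have "gates_sparse m st (rs @ [rc]) (\<lambda>p. relu (lc ts p))"
    unfolding gates_sparse_def
  proof (intro exI[of _ "\<lambda>i. if i = length rs then 1 else 0"] conjI allI)
    have "{i. i < length (rs @ [rc]) \<and> (if i = length rs then 1 else (0::real)) \<noteq> 0} = {length rs}"
      by (auto split: if_splits)
    then show "card {i. i < length (rs @ [rc]) \<and> (if i = length rs then 1 else (0::real)) \<noteq> 0} \<le> 2" by simp
  qed (simp add: rc)
  with rs rc gates_sparse_append[of m st rs] show ?case by (intro exI[of _ "rs @ [rc]"]) auto
next
  case (lstep_lin v C ts)
  then obtain rs where rs: "rs \<noteq> []" "sum_list (map (row_cost m) rs) \<le> 4 * v" "\<forall>f\<in>C. gates_sparse m st rs f"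
    by blast
  obtain rc where rc: "\<And>p. lc ts p = row_val m rc (st p)" "row_cost m rc \<le> 2 * length ts"
    using row_of_terms[of ts m st] lstep_lin(2) assms(2) by blast
  define rc' where "rc' = (\<lambda>j. - fst rc j, - snd rc)"
  have rc': "row_val m rc' z = - row_val m rc z" "row_cost m rc' = row_cost m rc" for z
    by (simp_all add: rc'_def row_val_def row_cost_def sum_negf)
  let ?g = "\<lambda>i. if i = length rs then 1 else if i = Suc (length rs) then -1 else (0::real)"
  have "gates_sparse m st (rs @ [rc, rc']) (lc ts)"
    unfolding gates_sparse_def
  proof (intro exI[of _ ?g] conjI allI)
    have "{i. i < length (rs @ [rc, rc']) \<and> ?g i \<noteq> 0} = {length rs, Suc (length rs)}"
      by (auto split: if_splits)
    then show "card {i. i < length (rs @ [rc, rc']) \<and> ?g i \<noteq> 0} \<le> 2" by simp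
    show "lc ts p = (\<Sum>i<length (rs @ [rc, rc']). ?g i * relu (row_val m ((rs @ [rc, rc']) ! i) (st p)))" for p
      by (simp add: rc rc' nth_append relu_def max_def)
  qed
  with rs rc rc' gates_sparse_append[of m st rs] show ?case by (intro exI[of _ "rs @ [rc, rc']"]) auto
qed

definition layer_of :: "nat \<Rightarrow> ((nat \<Rightarrow> real) \<times> real) list \<Rightarrow> real Matrix.mat \<times> real Matrix.vec" where
  "layer_of m rs = (Matrix.mat (length rs) m (\<lambda>(i, j). fst (rs ! i) j),
     Matrix.vec (length rs) (\<lambda>i. snd (rs ! i)))"

lemma layer_of_weights:
  "nnz_mat (fst (layer_of m rs)) + nnz_vec (snd (layer_of m rs)) = sum_list (map (row_cost m) rs)"
proof -
  let ?n = "length rs"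
  have "{(i, j). i < ?n \<and> j < m \<and> fst (rs ! i) j \<noteq> 0} = (SIGMA i:{..<?n}. {j. j < m \<and> fst (rs ! i) j \<noteq> 0})"
    by auto
  moreover have "{(i, j). i < ?n \<and> j < m \<and> index_mat (fst (layer_of m rs)) (i, j) \<noteq> 0}
      = {(i, j). i < ?n \<and> j < m \<and> fst (rs ! i) j \<noteq> 0}"
    by (auto simp: layer_of_def)
  ultimately have 1: "nnz_mat (fst (layer_of m rs)) = (\<Sum>i<?n. card {j. j < m \<and> fst (rs ! i) j \<noteq> 0})"
    unfolding nnz_mat_def by (simp add: layer_of_def)
  have "{i. i < ?n \<and> vec_index (snd (layer_of m rs)) i \<noteq> 0} = {i\<in>{..<?n}. snd (rs ! i) \<noteq> 0}"
    by (auto simp: layer_of_def)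
  then have 2: "nnz_vec (snd (layer_of m rs)) = (\<Sum>i<?n. if snd (rs ! i) = 0 then 0 else 1)"
    unfolding nnz_vec_def by (simp add: layer_of_def sum.If_cases Int_def Collect_neg_eq[symmetric] Collect_conj_eq[symmetric])
  show ?thesis unfolding 1 2 sum.distrib[symmetric]
    by (simp add: sum_list_sum_nth row_cost_def atLeast0LessThan)
qed

lemma layer_of_val:
  assumes "dim_vec z = m" "i < length rs"
  shows "vec_index (fst (layer_of m rs) *\<^sub>v z + snd (layer_of m rs)) i = row_val m (rs ! i) z"
  using assms by (simp add: layer_of_def row_val_def scalar_prod_def atLeast0LessThan)

lemma two_sparse_append:
  assumes "two_sparse m st f" "\<And>p. dim_vec (st p) = m"
  shows "two_sparse (m + n) (\<lambda>p. st p @\<^sub>v w p) f"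
proof -
  obtain g where g: "card {i. i < m \<and> g i \<noteq> 0} \<le> 2"
    "\<And>p. f p = (\<Sum>i<m. g i * vec_index (st p) i)"
    using assms by (auto simp: two_sparse_def)
  define h where "h i = (if i < m then g i else 0)" for i
  have "{i. i < m + n \<and> h i \<noteq> 0} = {i. i < m \<and> g i \<noteq> 0}"
    by (auto simp: h_def)
  moreover have "f p = (\<Sum>i<m+n. h i * vec_index (st p @\<^sub>v w p) i)" for p
  proof -
    have "(\<Sum>i<m+n. h i * vec_index (st p @\<^sub>v w p) i) = (\<Sum>i<m. h i * vec_index (st p @\<^sub>v w p) i)"
      by (rule sum.mono_neutral_right) (auto simp: h_def)
    also have "\<dots> = f p" unfolding g(2) by (rule sum.cong) (auto simp: h_def index_append_vec assms(2) index_append_vec(1))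
    finally show ?thesis by simp
  qed
  ultimately show ?thesis using g(1) unfolding two_sparse_def by (intro exI[of _ h]) auto
qed

lemma sum_lessThan_add: "(\<Sum>i<m+n. f i) = (\<Sum>i<m. f i) + (\<Sum>i<n. f (m + i :: nat) :: 'a::comm_monoid_add)"
  by (induction n) (simp_all add: add.assoc)

lemma two_sparse_append_new:
  assumes "\<And>p. dim_vec (st p) = m" "\<And>p. dim_vec (w p) = n"
    and g: "card {i. i < n \<and> g i \<noteq> 0} \<le> 2" "\<And>p. f p = (\<Sum>i<n. g i * vec_index (w p) i)"
  shows "two_sparse (m + n) (\<lambda>p. st p @\<^sub>v w p) f"
proof -
  define h where "h i = (if i < m then 0 else g (i - m))" for i
  have "{i. i < m + n \<and> h i \<noteq> 0} = (\<lambda>i. m + i) ` {i. i < n \<and> g i \<noteq> 0}"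
  proof (intro subset_antisym subsetI)
    fix x assume "x \<in> {i. i < m + n \<and> h i \<noteq> 0}"
    then show "x \<in> (\<lambda>i. m + i) ` {i. i < n \<and> g i \<noteq> 0}"
      by (intro image_eqI[of _ _ "x - m"]) (auto simp: h_def split: if_splits)
  qed (auto simp: h_def)
  then have 1: "card {i. i < m + n \<and> h i \<noteq> 0} = card {i. i < n \<and> g i \<noteq> 0}" by (simp add: card_image)
  have "f p = (\<Sum>i<m+n. h i * vec_index (st p @\<^sub>v w p) i)" for p
  proof -
    have "(\<Sum>i<m+n. h i * vec_index (st p @\<^sub>v w p) i)
        = (\<Sum>i<m. h i * vec_index (st p @\<^sub>v w p) i) + (\<Sum>i<n. h (m + i) * vec_index (st p @\<^sub>v w p) (m + i))"
      by (rule sum_lessThan_add)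
    also have "\<dots> = f p" unfolding g(2) by (simp add: h_def assms)
    finally show ?thesis by simp
  qed
  then show ?thesis using g(1) 1 unfolding two_sparse_def by (intro exI[of _ h]) auto
qed

text \<open>The shape condition of \<open>is_nn\<close> without the nonemptiness, so that the
  induction over layers can start from the empty list.\<close>

definition layers_ok :: "nat \<Rightarrow> nn \<Rightarrow> bool" where
  "layers_ok m \<Phi> \<longleftrightarrow>
     (\<forall>l < length \<Phi>. dim_vec (snd (\<Phi> ! l)) \<ge> 1 \<and>
        fst (\<Phi> ! l) \<in> carrier_mat (dim_vec (snd (\<Phi> ! l))) (m + (\<Sum>j<l. dim_vec (snd (\<Phi> ! j)))))"

lemma layers_ok_snoc:
  assumes "layers_ok m \<Phi>" "dim_vec b \<ge> 1"
    "A \<in> carrier_mat (dim_vec b) (m + (\<Sum>j<length \<Phi>. dim_vec (snd (\<Phi> ! j))))"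
  shows "layers_ok m (\<Phi> @ [(A, b)])"
  unfolding layers_ok_def
proof (intro allI impI)
  fix l assume l: "l < length (\<Phi> @ [(A, b)])"
  have *: "(\<Sum>j<l. dim_vec (snd ((\<Phi> @ [(A, b)]) ! j))) = (\<Sum>j<l. dim_vec (snd (\<Phi> ! j)))"
    by (rule sum.cong) (use l in \<open>auto simp: nth_append\<close>)
  show "dim_vec (snd ((\<Phi> @ [(A, b)]) ! l)) \<ge> 1 \<and>
        fst ((\<Phi> @ [(A, b)]) ! l) \<in> carrier_mat (dim_vec (snd ((\<Phi> @ [(A, b)]) ! l))) (m + (\<Sum>j<l. dim_vec (snd ((\<Phi> @ [(A, b)]) ! j))))"
    unfolding * using assms l by (cases "l = length \<Phi>") (auto simp: layers_ok_def nth_append)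
qed

text \<open>The invariant of the layerwise translation is that every function reached so far is a
  combination of at most two coordinates of the accumulated state.\<close>

lemma hidden_of_reach:
  assumes "reach A L w B" "\<And>p. dim_vec (st p) = m" "\<And>f. f \<in> A \<Longrightarrow> two_sparse m st f"
  shows "\<exists>\<Phi>. layers_ok m \<Phi> \<and> length \<Phi> = L \<and> nn_weights \<Phi> \<le> 4 * w \<and>
    (\<forall>p. dim_vec (hid \<Phi> (st p)) = m + (\<Sum>j<length \<Phi>. dim_vec (snd (\<Phi> ! j)))) \<and>
    (\<forall>f\<in>B. two_sparse (m + (\<Sum>j<length \<Phi>. dim_vec (snd (\<Phi> ! j)))) (\<lambda>p. hid \<Phi> (st p)) f)"
  using assms(1)
proof (induction rule: reach.induct)
  case reach_0
  show ?case by (rule exI[of _ "[]"]) (use assms in \<open>auto simp: layers_ok_def nn_weights_def\<close>)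
next
  case (reach_Suc L w B v C)
  then obtain \<Phi> where \<Phi>: "layers_ok m \<Phi>" "length \<Phi> = L" "nn_weights \<Phi> \<le> 4 * w"
    "\<And>p. dim_vec (hid \<Phi> (st p)) = m + (\<Sum>j<length \<Phi>. dim_vec (snd (\<Phi> ! j)))"
    "\<And>f. f\<in>B \<Longrightarrow> two_sparse (m + (\<Sum>j<length \<Phi>. dim_vec (snd (\<Phi> ! j)))) (\<lambda>p. hid \<Phi> (st p)) f"
    by blast
  define M where "M = m + (\<Sum>j<length \<Phi>. dim_vec (snd (\<Phi> ! j)))"
  obtain rs where rs: "rs \<noteq> []" "sum_list (map (row_cost M) rs) \<le> 4 * v"
    "\<And>f. f \<in> C \<Longrightarrow> gates_sparse M (\<lambda>p. hid \<Phi> (st p)) rs f"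
    using rows_of_lstep[OF reach_Suc(2), of M "\<lambda>p. hid \<Phi> (st p)"] \<Phi>(5) unfolding M_def by blast
  obtain A b where Ab: "layer_of M rs = (A, b)" by force
  have dimb: "dim_vec b = length rs" and A: "A \<in> carrier_mat (length rs) M" using Ab by (auto simp: layer_of_def)
  define \<Psi> where "\<Psi> = \<Phi> @ [(A, b)]"
  have sumdim: "m + (\<Sum>j<length \<Psi>. dim_vec (snd (\<Psi> ! j))) = M + length rs"
    by (simp add: \<Psi>_def M_def dimb nth_append)
  have hid: "hid \<Psi> (st p) = hid \<Phi> (st p) @\<^sub>v map_vec relu (A *\<^sub>v hid \<Phi> (st p) + b)" for p
    by (simp add: \<Psi>_def hid_snoc)
  have "layers_ok m \<Psi>" unfolding \<Psi>_def
    by (rule layers_ok_snoc) (use \<Phi>(1) rs(1) dimb A in \<open>auto simp: M_def Suc_le_eq\<close>)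
  moreover have "length \<Psi> = Suc L" by (simp add: \<Psi>_def \<Phi>)
  moreover have "nn_weights \<Psi> \<le> 4 * (w + v)"
    using \<Phi>(3) rs(2) layer_of_weights[of M rs] by (simp add: \<Psi>_def nn_weights_def Ab)
  moreover have "dim_vec (hid \<Psi> (st p)) = m + (\<Sum>j<length \<Psi>. dim_vec (snd (\<Psi> ! j)))" for p
    unfolding sumdim hid using \<Phi>(4) dimb by (simp add: M_def)
  moreover have "two_sparse (m + (\<Sum>j<length \<Psi>. dim_vec (snd (\<Psi> ! j)))) (\<lambda>p. hid \<Psi> (st p)) f" if "f \<in> B \<union> C" for f
    unfolding sumdim hid
  proof (cases "f \<in> B")
    case True
    show "two_sparse (M + length rs) (\<lambda>p. hid \<Phi> (st p) @\<^sub>v map_vec relu (A *\<^sub>v hid \<Phi> (st p) + b)) f"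
      by (rule two_sparse_append) (use \<Phi> True in \<open>auto simp: M_def\<close>)
  next
    case False
    with that have "gates_sparse M (\<lambda>p. hid \<Phi> (st p)) rs f" using rs by auto
    then obtain g where g: "card {i. i < length rs \<and> g i \<noteq> 0} \<le> 2"
     "\<And>p. f p = (\<Sum>i<length rs. g i * relu (row_val M (rs ! i) (hid \<Phi> (st p))))"
      by (auto simp: gates_sparse_def)
    show "two_sparse (M + length rs) (\<lambda>p. hid \<Phi> (st p) @\<^sub>v map_vec relu (A *\<^sub>v hid \<Phi> (st p) + b)) f"
    proof (rule two_sparse_append_new[OF _ _ g(1)])
      show "f p = (\<Sum>i<length rs. g i * vec_index (map_vec relu (A *\<^sub>v hid \<Phi> (st p) + b)) i)" for p
        unfolding g(2)
      proof (rule sum.cong)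
        fix i assume "i \<in> {..<length rs}"
        moreover have "dim_vec (hid \<Phi> (st p)) = M" using \<Phi>(4) by (simp add: M_def)
        ultimately
        show "g i * relu (row_val M (rs ! i) (hid \<Phi> (st p))) = g i * vec_index (map_vec relu (A *\<^sub>v hid \<Phi> (st p) + b)) i"
          using layer_of_val[of "hid \<Phi> (st p)" M i rs] dimb by (simp add: Ab del: index_add_vec(1))
      qed simp
    qed (use \<Phi> dimb in \<open>auto simp: M_def\<close>)
  qed
  ultimately show ?case by (intro exI[of _ \<Psi>]) blast
qed

text \<open>One more layer is spent on the output: it reads the result off at most two neurons,
  which accounts for \<open>Suc L\<close> and for the summand 2.\<close>

theorem nn_of_computes:
  fixes out :: "'a::euclidean_space \<Rightarrow> real"
  assumes "computes {\<lambda>p. inner p e |e. e \<in> Basis} L w {out}"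
  shows "\<exists>\<Phi>. is_nn DIM('a) \<Phi> \<and> nn_out_dim \<Phi> = 1 \<and> nn_layers \<Phi> = Suc L \<and>
    nn_weights \<Phi> \<le> 4 * w + 2 \<and> (\<forall>p. nn_fun \<Phi> p = out p)"
proof -
  obtain B v where B: "reach {\<lambda>p. inner p e |e. e \<in> Basis} L v B" "v \<le> w" "out \<in> B"
    using assms by (auto simp: computes_def)
  have inp: "two_sparse DIM('a) coords f" if "f \<in> {\<lambda>p::'a. inner p e |e. e \<in> Basis}" for f
  proof -
    from that obtain e where e: "e \<in> Basis" "f = (\<lambda>p. inner p e)" by auto
    obtain i where i: "i < length (basis_list :: 'a list)" "basis_list ! i = e"
      using e(1) basis_list(2) by (metis in_set_conv_nth)
    have len: "length (basis_list :: 'a list) = DIM('a)" using basis_list distinct_card by metis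
    have "{j. j < DIM('a) \<and> (if j = i then 1 else (0::real)) \<noteq> 0} = {i}" using i len by auto
    moreover have "f p = (\<Sum>j<DIM('a). (if j = i then 1 else 0) * vec_index (coords p) j)" for p
    proof -
      have "vec_index (coords p) i = inner p e" using i by (simp add: coords_def vec_of_list_index)
      moreover have "(\<Sum>j<DIM('a). (if j = i then 1 else 0) * vec_index (coords p) j) = vec_index (coords p) i"
        using i len by (subst sum.remove[of _ i]) auto
      ultimately show ?thesis by (simp add: e)
    qed
    ultimately show ?thesis unfolding two_sparse_def
      by (intro exI[of _ "\<lambda>j. if j = i then 1 else 0"]) auto
  qed
  obtain \<Phi> where \<Phi>: "layers_ok DIM('a) \<Phi>" "length \<Phi> = L" "nn_weights \<Phi> \<le> 4 * v"
    "\<And>p::'a. dim_vec (hid \<Phi> (coords p)) = DIM('a) + (\<Sum>j<length \<Phi>. dim_vec (snd (\<Phi> ! j)))"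
    "two_sparse (DIM('a) + (\<Sum>j<length \<Phi>. dim_vec (snd (\<Phi> ! j)))) (\<lambda>p. hid \<Phi> (coords p)) out"
    using hidden_of_reach[OF B(1), of coords "DIM('a)"] inp dim_coords B(3) by blast
  define M where "M = DIM('a) + (\<Sum>j<length \<Phi>. dim_vec (snd (\<Phi> ! j)))"
  obtain r where r: "card {j. j < M \<and> r j \<noteq> 0} \<le> 2" "\<And>p. out p = (\<Sum>j<M. r j * vec_index (hid \<Phi> (coords p)) j)"
    using \<Phi>(5) unfolding two_sparse_def M_def by blast
  obtain A b where Ab: "layer_of M [(r, 0)] = (A, b)" by force
  have dimb: "dim_vec b = 1" and A: "A \<in> carrier_mat 1 M" using Ab by (auto simp: layer_of_def)
  have "layers_ok DIM('a) (\<Phi> @ [(A, b)])"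
    by (rule layers_ok_snoc) (use \<Phi>(1) dimb A in \<open>auto simp: M_def\<close>)
  then have "is_nn DIM('a) (\<Phi> @ [(A, b)])" by (simp add: is_nn_def layers_ok_def)
  moreover have "nn_weights (\<Phi> @ [(A, b)]) \<le> 4 * w + 2"
    using \<Phi>(3) B(2) layer_of_weights[of M "[(r,0)]"] r(1) by (simp add: nn_weights_def Ab row_cost_def)
  moreover have "nn_fun (\<Phi> @ [(A, b)]) p = out p" for p
    using layer_of_val[of "hid \<Phi> (coords p)" M 0 "[(r,0)]"] \<Phi>(4)
    by (simp add: nn_fun_def nn_real_snoc Ab M_def[symmetric] row_val_def r(2) del: index_add_vec(1))
  ultimately show ?thesis using \<Phi>(2) dimb
    by (intro exI[of _ "\<Phi> @ [(A, b)]"]) (simp add: nn_out_dim_def nn_layers_def)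
qed

subsection \<open>From networks to circuits\<close>

text \<open>Only nonzero entries become terms, so the circuit inherits exactly the weight count of
  the network.\<close>

lemma row_lc:
  fixes st :: "'x \<Rightarrow> real Matrix.vec"
  assumes "M \<in> carrier_mat (dim_vec b) m" "i < dim_vec b" "\<And>p. dim_vec (st p) = m"
    "\<And>j. j < m \<Longrightarrow> (\<lambda>p. vec_index (st p) j) \<in> A"
  shows "\<exists>ts. length ts = card {j. j < m \<and> index_mat M (i, j) \<noteq> 0} + (if vec_index b i = 0 then 0 else 1) \<and>
    snd ` set ts \<subseteq> insert (\<lambda>_. 1) A \<and> lc ts = (\<lambda>p. vec_index (M *\<^sub>v st p + b) i)"
proof -
  let ?J = "{j. j < m \<and> index_mat M (i, j) \<noteq> 0}"
  have fin: "finite ?J" by simp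
  obtain js where js: "set js = ?J" "distinct js" using finite_distinct_list[OF fin] by blast
  define ts where "ts = map (\<lambda>j. (index_mat M (i, j), \<lambda>p. vec_index (st p) j)) js @
     (if vec_index b i = 0 then [] else [(vec_index b i, \<lambda>_. 1)])"
  have "lc ts p = vec_index (M *\<^sub>v st p + b) i" for p
  proof -
    have "vec_index (M *\<^sub>v st p + b) i = (\<Sum>j<m. index_mat M (i, j) * vec_index (st p) j) + vec_index b i"
      using assms by (auto simp: scalar_prod_def atLeast0LessThan)
    also have "(\<Sum>j<m. index_mat M (i, j) * vec_index (st p) j) = (\<Sum>j\<in>?J. index_mat M (i, j) * vec_index (st p) j)"
      by (rule sum.mono_neutral_right) auto
    also have "\<dots> = (\<Sum>j\<leftarrow>js. index_mat M (i, j) * vec_index (st p) j)"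
      using js by (simp add: sum_list_distinct_conv_sum_set)
    finally show ?thesis by (simp add: ts_def lc_def o_def)
  qed
  moreover have "length ts = card ?J + (if vec_index b i = 0 then 0 else 1)"
    using js distinct_card[OF js(2)] by (simp add: ts_def)
  moreover have "snd ` set ts \<subseteq> insert (\<lambda>_. 1) A"
  proof
    fix f assume "f \<in> snd ` set ts"
    then consider "f = (\<lambda>_. 1)" | j where "j \<in> set js" "f = (\<lambda>p. vec_index (st p) j)"
      by (auto simp: ts_def split: if_splits)
    then show "f \<in> insert (\<lambda>_. 1) A"
    proof cases
      case (2 j)
      then show ?thesis using assms(4)[of j] js by simp
    qed simp
  qed
  ultimately show ?thesis by (intro exI[of _ ts]) (simp add: fun_eq_iff del: index_add_vec(1))
qed

lemma layer_cost_sum: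
  assumes "M \<in> carrier_mat (dim_vec b) m"
  shows "(\<Sum>i<dim_vec b. card {j. j < m \<and> index_mat M (i, j) \<noteq> 0} + (if vec_index b i = 0 then 0 else 1))
    = nnz_mat M + nnz_vec b"
proof -
  define rs where "rs = map (\<lambda>i. (\<lambda>j. index_mat M (i, j), vec_index b i)) [0..<dim_vec b]"
  have "layer_of m rs = (M, b)" using assms
    by (auto simp: layer_of_def rs_def intro!: eq_matI eq_vecI)
  with layer_of_weights[of m rs] show ?thesis
    by (simp add: sum_list_sum_nth atLeast0LessThan rs_def row_cost_def)
qed

text \<open>The input is generalised to an arbitrary vector of available functions, because the
  recursion of \<open>nn_real\<close> passes on an ever longer concatenation.\<close>

lemma computes_nn_real:
  assumes "\<Phi> \<noteq> []" "layers_ok m \<Phi>" "\<And>p. dim_vec (st p) = m" "\<And>j. j < m \<Longrightarrow> (\<lambda>p. vec_index (st p) j) \<in> A"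
  shows "computes A (length \<Phi>) (nn_weights \<Phi>) {\<lambda>p. vec_index (nn_real \<Phi> (st p)) i |i. i < dim_vec (snd (last \<Phi>))}"
  using assms
proof (induction \<Phi> arbitrary: m st A)
  case Nil
  then show ?case by simp
next
  case (Cons l \<Phi>)
  obtain M b where l: "l = (M, b)" by force
  have Mb: "M \<in> carrier_mat (dim_vec b) m" "dim_vec b \<ge> 1"
    using Cons.prems(2) l unfolding layers_ok_def by (force dest: spec[of _ 0])+
  let ?c = "\<lambda>i. card {j. j < m \<and> index_mat M (i, j) \<noteq> 0} + (if vec_index b i = 0 then 0 else 1)"
  have "computes A 1 (?c i) {\<lambda>p. vec_index (M *\<^sub>v st p + b) i} \<and>
      computes A 1 (?c i) {\<lambda>p. relu (vec_index (M *\<^sub>v st p + b) i)}" if i: "i < dim_vec b" for i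
  proof -
    obtain ts where ts: "length ts = ?c i"
      "snd ` set ts \<subseteq> insert (\<lambda>_. 1) A" "lc ts = (\<lambda>p. vec_index (M *\<^sub>v st p + b) i)"
      using row_lc[of M b m i st A] Mb i Cons.prems by blast
    with computes_lc[of ts A] computes_relu_lc[of ts A] show ?thesis by simp
  qed
  then have lin: "computes A 1 (nnz_mat M + nnz_vec b) (\<Union>i<dim_vec b. {\<lambda>p. vec_index (M *\<^sub>v st p + b) i})"
    and rel: "computes A 1 (nnz_mat M + nnz_vec b) (\<Union>i<dim_vec b. {\<lambda>p. relu (vec_index (M *\<^sub>v st p + b) i)})"
    unfolding layer_cost_sum[OF Mb(1), symmetric] by (intro computes_UN; simp)+
  show ?case
  proof (cases "\<Phi> = []")
    case True
    then have "{\<lambda>p. vec_index (nn_real (l # \<Phi>) (st p)) i |i. i < dim_vec (snd (last (l # \<Phi>)))}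
      = (\<Union>i<dim_vec b. {\<lambda>p. vec_index (M *\<^sub>v st p + b) i})" by (auto simp: l simp del: index_add_vec(1))
    with lin True show ?thesis by (simp add: l nn_weights_def)
  next
    case False
    define B where "B = (\<Union>i<dim_vec b. {\<lambda>p. relu (vec_index (M *\<^sub>v st p + b) i)})"
    define st' where "st' p = st p @\<^sub>v map_vec relu (M *\<^sub>v st p + b)" for p
    have nn: "nn_real (l # \<Phi>) (st p) = nn_real \<Phi> (st' p)" for p
      using False by (cases \<Phi>) (auto simp: l st'_def)
    have "computes (A \<union> B) (length \<Phi>) (nn_weights \<Phi>) {\<lambda>p. vec_index (nn_real \<Phi> (st' p)) i |i. i < dim_vec (snd (last \<Phi>))}"
    proof (rule Cons.IH[OF False, of "m + dim_vec b"])
      show "layers_ok (m + dim_vec b) \<Phi>"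
        unfolding layers_ok_def
      proof (intro allI impI)
        fix q assume "q < length \<Phi>"
        then have "Suc q < length (l # \<Phi>)" by simp
        with Cons.prems(2) have "dim_vec (snd ((l # \<Phi>) ! Suc q)) \<ge> 1 \<and>
          fst ((l # \<Phi>) ! Suc q) \<in> carrier_mat (dim_vec (snd ((l # \<Phi>) ! Suc q))) (m + (\<Sum>j<Suc q. dim_vec (snd ((l # \<Phi>) ! j))))"
          unfolding layers_ok_def by blast
        then show "1 \<le> dim_vec (snd (\<Phi> ! q)) \<and>
             fst (\<Phi> ! q) \<in> carrier_mat (dim_vec (snd (\<Phi> ! q))) (m + dim_vec b + (\<Sum>j<q. dim_vec (snd (\<Phi> ! j))))"
          unfolding sum.lessThan_Suc_shift by (simp add: l add.assoc)
      qed
      show "dim_vec (st' p) = m + dim_vec b" for p using Mb Cons.prems(3) by (simp add: st'_def)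
      show "(\<lambda>p. vec_index (st' p) j) \<in> A \<union> B" if j: "j < m + dim_vec b" for j
      proof (cases "j < m")
        case True
        then have "(\<lambda>p. vec_index (st' p) j) = (\<lambda>p. vec_index (st p) j)"
          using Mb Cons.prems(3) by (auto simp: st'_def)
        then show ?thesis using Cons.prems(4)[OF True] by simp
      next
        case F: False
        then have "(\<lambda>p. vec_index (st' p) j) = (\<lambda>p. relu (vec_index (M *\<^sub>v st p + b) (j - m)))"
          using Mb Cons.prems(3) j by (auto simp: st'_def)
        moreover have "j - m < dim_vec b" using F j by auto
        ultimately show ?thesis unfolding B_def by auto
      qed
    qed
    from computes_trans[OF rel[folded B_def] this]
    have "computes A (length (l # \<Phi>)) (nn_weights (l # \<Phi>))
      (A \<union> B \<union> {\<lambda>p. vec_index (nn_real \<Phi> (st' p)) i |i. i < dim_vec (snd (last \<Phi>))})"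
      by (simp add: nn_weights_def l)
    then show ?thesis
      by (rule computes_mono) (use False in \<open>auto simp: nn\<close>)
  qed
qed

text \<open>Plugs a given network into a circuit. In this way the approximation of the initial value
  is evaluated at the computed end point of the polygon, at no cost beyond its own layers and
  weights.\<close>

theorem computes_nn_fun:
  fixes Y :: "'x \<Rightarrow> 'a::euclidean_space"
  assumes "is_nn DIM('a) \<Phi>" "nn_out_dim \<Phi> = 1" "\<And>e. e \<in> Basis \<Longrightarrow> (\<lambda>p. inner (Y p) e) \<in> A"
  shows "computes A (nn_layers \<Phi>) (nn_weights \<Phi>) {\<lambda>p. nn_fun \<Phi> (Y p)}"
proof -
  have len: "length (basis_list :: 'a list) = DIM('a)" using basis_list distinct_card by metis
  have "computes A (length \<Phi>) (nn_weights \<Phi>) {\<lambda>p. vec_index (nn_real \<Phi> (coords (Y p))) i |i. i < dim_vec (snd (last \<Phi>))}"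
  proof (rule computes_nn_real)
    show "layers_ok DIM('a) \<Phi>" "\<Phi> \<noteq> []" using assms(1) by (auto simp: is_nn_def layers_ok_def)
    show "dim_vec (coords (Y p)) = DIM('a)" for p by (rule dim_coords)
    fix j assume j: "j < DIM('a)"
    then have "basis_list ! j \<in> (Basis :: 'a set)" using len basis_list(2) by (metis nth_mem)
    from assms(3)[OF this] show "(\<lambda>p. vec_index (coords (Y p)) j) \<in> A"
      using j len by (simp add: coords_def vec_of_list_index)
  qed
  then show ?thesis
    by (rule computes_mono) (use assms(2) in \<open>auto simp: nn_layers_def nn_fun_def nn_out_dim_def\<close>)
qed

lemma continuous_nn_fun:
  assumes "is_nn DIM('a) \<Phi>" "nn_out_dim \<Phi> = 1"
  shows "continuous_on UNIV (\<lambda>p::'a::euclidean_space. nn_fun \<Phi> p)"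
proof -
  define A where "A = {\<lambda>p :: 'a. inner p e |e. e \<in> Basis}"
  have 1: "computes A (nn_layers \<Phi>) (nn_weights \<Phi>) {\<lambda>p. nn_fun \<Phi> (p :: 'a)}"
    by (rule computes_nn_fun[OF assms, of "\<lambda>p. p"]) (auto simp: A_def)
  have 2: "continuous_on UNIV f" if "f \<in> A" for f
    using that by (auto simp: A_def intro!: continuous_intros)
  show ?thesis using continuous_computes[OF 1 2, of "nn_fun \<Phi>"] by simp
qed

subsection \<open>Multiplication networks of bounded depth\<close>

lemma computes_then:
  assumes "computes A L w B" "computes (A \<union> B) L' v C"
  shows "computes A (L + L') (w + v) C"
  by (rule computes_mono[OF computes_trans[OF assms]]) auto

lemma computes_lin2:
  assumes "f \<in> A" "g \<in> A"
  shows "computes A 1 3 {\<lambda>x. a * f x + b * g x + c}"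
proof -
  have "lc [(a, f), (b, g), (c, \<lambda>_. 1)] = (\<lambda>x. a * f x + b * g x + c)" by (simp add: fun_eq_iff)
  with computes_lc[of "[(a, f), (b, g), (c, \<lambda>_. 1)]" A] assms show ?thesis by (simp add: numeral_3_eq_3)
qed

lemma computes_relu2:
  assumes "f \<in> A" "g \<in> A"
  shows "computes A 1 3 {\<lambda>x. relu (a * f x + b * g x + c)}"
proof -
  have "lc [(a, f), (b, g), (c, \<lambda>_. 1)] = (\<lambda>x. a * f x + b * g x + c)" by (simp add: fun_eq_iff)
  with computes_relu_lc[of "[(a, f), (b, g), (c, \<lambda>_. 1)]" A] assms show ?thesis by (simp add: numeral_3_eq_3)
qed

lemma computes_lin1: "f \<in> A \<Longrightarrow> computes A 1 2 {\<lambda>x. a * f x + c}"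
proof -
  assume f: "f \<in> A"
  have "lc [(a, f), (c, \<lambda>_. 1)] = (\<lambda>x. a * f x + c)" by (simp add: fun_eq_iff)
  with computes_lc[of "[(a, f), (c, \<lambda>_. 1)]" A] f show ?thesis by (simp add: numeral_2_eq_2)
qed

lemma computes_relu1: "f \<in> A \<Longrightarrow> computes A 1 2 {\<lambda>x. relu (a * f x + c)}"
proof -
  assume f: "f \<in> A"
  have "lc [(a, f), (c, \<lambda>_. 1)] = (\<lambda>x. a * f x + c)" by (simp add: fun_eq_iff)
  with computes_relu_lc[of "[(a, f), (c, \<lambda>_. 1)]" A] f show ?thesis by (simp add: numeral_2_eq_2)
qed

text \<open>On [0,1] these are the continuous piecewise linear functions with value 0 at 0 and knots
  j / n: \<open>a 0\<close> is the first slope and \<open>a j\<close> the jump of the slope at j /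
  n. All of them share the same n - 1 ReLU neurons.\<close>

definition pw :: "nat \<Rightarrow> (nat \<Rightarrow> real) \<Rightarrow> real \<Rightarrow> real" where
  "pw n a x = a 0 * x + (\<Sum>j=1..<n. a j * relu (x - real j / real n))"

text \<open>The piecewise linear interpolant of the square at the knots: its slope on cell i is (2 i
  + 1) / n.\<close>

definition interp :: "nat \<Rightarrow> real \<Rightarrow> real" where
  "interp n = pw n (\<lambda>j. if j = 0 then 1 / real n else 2 / real n)"

text \<open>The sawtooth with slopes n and - n in turn, which maps every cell of the grid onto
  [0,1].\<close>

definition tri :: "nat \<Rightarrow> real \<Rightarrow> real" where
  "tri n = pw n (\<lambda>j. if j = 0 then real n else 2 * real n * (-1) ^ j)"

fun sqn :: "nat \<Rightarrow> nat \<Rightarrow> real \<Rightarrow> real" where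
  "sqn n 0 x = x"
| "sqn n (Suc p) x = interp n x - (tri n x - sqn n p (tri n x)) / (real n)\<^sup>2"

lemma pw_cell:
  assumes "n > 0" "i < n" "0 \<le> z" "z \<le> 1"
  shows "pw n a ((real i + z) / real n) = (a 0 * (real i + z) + (\<Sum>j=1..i. a j * (real i + z - real j))) / real n"
proof -
  have "(\<Sum>j=1..<n. a j * relu ((real i + z) / real n - real j / real n))
      = (\<Sum>j=1..i. a j * relu ((real i + z) / real n - real j / real n))"
  proof (rule sum.mono_neutral_right)
    show "\<forall>j\<in>{1..<n} - {1..i}. a j * relu ((real i + z) / real n - real j / real n) = 0"
    proof
      fix j assume "j \<in> {1..<n} - {1..i}"
      then have "real i + z \<le> real j" using assms by auto
      then have "(real i + z) / real n - real j / real n \<le> 0" using assms by (simp add: divide_right_mono)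
      then show "a j * relu ((real i + z) / real n - real j / real n) = 0" by (simp add: relu_def)
    qed
  qed (use assms in auto)
  also have "\<dots> = (\<Sum>j=1..i. a j * (real i + z - real j) / real n)"
  proof (rule sum.cong)
    fix j assume "j \<in> {1..i}"
    then have "0 \<le> (real i + z - real j) / real n" using assms by auto
    then show "a j * relu ((real i + z) / real n - real j / real n) = a j * (real i + z - real j) / real n"
      by (simp add: relu_def diff_divide_distrib[symmetric])
  qed simp
  also have "\<dots> = (\<Sum>j=1..i. a j * (real i + z - real j)) / real n" by (simp add: sum_divide_distrib)
  finally show ?thesis unfolding pw_def by (simp only: add_divide_distrib[of "a 0 * (real i + z)"] times_divide_eq_right)
qed

lemma interp_cell:
  assumes "n > 0" "i < n" "0 \<le> z" "z \<le> 1"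
  shows "interp n ((real i + z) / real n) = (real i ^ 2 + (2 * real i + 1) * z) / (real n)\<^sup>2"
proof -
  \<comment> \<open>A polynomial identity in z, hence free of the restriction to [0,1]: the
    induction on i passes from z to z + 1.\<close>
  have *: "(real i + z) + (\<Sum>j=1..i. 2 * (real i + z - real j)) = real i ^ 2 + (2 * real i + 1) * z" for z
  proof (induction i arbitrary: z)
    case (Suc i)
    have "(\<Sum>j=1..Suc i. 2 * (real (Suc i) + z - real j)) = (\<Sum>j=1..i. 2 * (real i + (z + 1) - real j)) + 2 * z"
      by (simp add: algebra_simps)
    with Suc[of "z + 1"] show ?case by (simp add: algebra_simps power2_eq_square)
  qed simp
  have "interp n ((real i + z) / real n) = ((real i + z) + (\<Sum>j=1..i. 2 * (real i + z - real j))) / real n / real n"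
    unfolding interp_def pw_cell[OF assms]
    by (simp add: add_divide_distrib sum_divide_distrib)
  then show ?thesis unfolding * by (simp add: power2_eq_square)
qed

lemma tri_cell:
  assumes "n > 0" "i < n" "0 \<le> z" "z \<le> 1"
  shows "tri n ((real i + z) / real n) = (if even i then z else 1 - z)"
proof -
  have *: "(real i + z) + (\<Sum>j=1..i. 2 * (-1) ^ j * (real i + z - real j)) = (if even i then z else 1 - z)" for z
  proof (induction i arbitrary: z)
    case (Suc i)
    have "(\<Sum>j=1..Suc i. 2 * (-1) ^ j * (real (Suc i) + z - real j))
      = (\<Sum>j=1..i. 2 * (-1) ^ j * (real i + (z + 1) - real j)) + 2 * (-1) ^ Suc i * z"
      by (simp add: algebra_simps)
    with Suc[of "z + 1"] show ?case by (auto simp: algebra_simps split: if_splits)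
  qed simp
  have "tri n ((real i + z) / real n)
    = (real n * (real i + z) + (\<Sum>j=1..i. 2 * real n * (-1) ^ j * (real i + z - real j))) / real n"
    unfolding tri_def pw_cell[OF assms] by simp
  also have "\<dots> = real n * ((real i + z) + (\<Sum>j=1..i. 2 * (-1) ^ j * (real i + z - real j))) / real n"
    by (simp add: sum_distrib_left algebra_simps)
  finally show ?thesis unfolding * using assms by simp
qed

lemma unit_cell:
  assumes "n > 0" "0 \<le> x" "x \<le> 1"
  obtains i z where "i < n" "0 \<le> z" "z \<le> 1" "x = (real i + z) / real n"
proof (cases "x = 1")
  case True
  show ?thesis by (rule that[of "n - 1" 1]) (use assms True in auto)
next
  case False
  define i where "i = nat \<lfloor>x * real n\<rfloor>"
  have i: "real i \<le> x * real n" "x * real n < real i + 1" using assms unfolding i_def by (simp, linarith)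
  have "real i < real n" using i(1) False assms mult_strict_right_mono[of x 1 "real n"] by linarith
  then show ?thesis by (intro that[of i "x * real n - real i"]) (use i assms in auto)
qed

text \<open>On a cell of the grid of mesh \<open>1/n\<close> one has \<open>x\<^sup>2 = interp n x - (w - w\<^sup>2) / n\<^sup>2\<close> with
  \<open>w = tri n x\<close>, so each recursion step gains a factor \<open>n\<^sup>2\<close>.\<close>

lemma sqn_error:
  assumes "n > 0" "0 \<le> x" "x \<le> 1"
  shows "\<bar>sqn n p x - x\<^sup>2\<bar> \<le> 1 / (4 * real n ^ (2 * p))"
  using assms(2,3)
proof (induction p arbitrary: x)
  case 0
  have "x - x\<^sup>2 \<le> 1 / 4" using zero_le_power2[of "x - 1/2"] by (simp add: power2_eq_square algebra_simps)
  moreover have "x\<^sup>2 \<le> x" using 0 by (simp add: power2_eq_square mult_left_le)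
  ultimately show ?case by simp
next
  case (Suc p)
  obtain i z where iz: "i < n" "0 \<le> z" "z \<le> 1" "x = (real i + z) / real n"
    using unit_cell[OF assms(1) Suc.prems] .
  define w where "w = tri n x"
  have w: "w = (if even i then z else 1 - z)" unfolding w_def iz(4) by (rule tri_cell) (use assms iz in auto)
  have "interp n x = (real i ^ 2 + (2 * real i + 1) * z) / (real n)\<^sup>2"
    unfolding iz(4) by (rule interp_cell) (use assms iz in auto)
  moreover have "w - w\<^sup>2 = z - z\<^sup>2" by (simp add: w power2_eq_square algebra_simps)
  ultimately have "x\<^sup>2 = interp n x - (w - w\<^sup>2) / (real n)\<^sup>2"
    by (simp add: iz(4) power_divide diff_divide_distrib[symmetric] power2_eq_square algebra_simps)
  then have "sqn n (Suc p) x - x\<^sup>2 = (sqn n p w - w\<^sup>2) / (real n)\<^sup>2"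
    by (simp add: w_def[symmetric] diff_divide_distrib)
  moreover have "\<bar>sqn n p w - w\<^sup>2\<bar> \<le> 1 / (4 * real n ^ (2 * p))" using Suc.IH[of w] iz w by auto
  ultimately have "\<bar>sqn n (Suc p) x - x\<^sup>2\<bar> \<le> 1 / (4 * real n ^ (2 * p)) / (real n)\<^sup>2"
    using divide_right_mono[of _ _ "(real n)\<^sup>2"] by (simp del: times_divide_eq_left divide_divide_eq_left)
  also have "\<dots> = 1 / (4 * real n ^ (2 * Suc p))" by (simp add: power2_eq_square)
  finally show ?case .
qed

lemma computes_pw:
  assumes "f \<in> A" "\<And>j. j \<in> {1..<n} \<Longrightarrow> (\<lambda>x. relu (f x - real j / real n)) \<in> A" "n > 0"
  shows "computes A 1 (n + 1) {\<lambda>x. pw n a (f x)}"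
proof -
  let ?g = "\<lambda>j. if j = 0 then f else (\<lambda>x. relu (f x - real j / real n))"
  have "?g j \<in> A" if "j \<in> {0..<n}" for j using assms(1) assms(2)[of j] that by (cases "j = 0") simp_all
  then have "computes A 1 (card {0..<n} + 1) {\<lambda>x. 0 + (\<Sum>j\<in>{0..<n}. a j * ?g j x)}"
    by (intro computes_affine) simp_all
  moreover have "0 + (\<Sum>j\<in>{0..<n}. a j * ?g j x) = pw n a (f x)" for x
    using assms(3) by (simp add: pw_def sum.atLeast_Suc_lessThan)
  ultimately show ?thesis by simp
qed

text \<open>Each recursion step takes three layers: the shifted ReLU neurons, the two piecewise
  linear functions that share them, and the recombination. It uses 4 n + 3 weights. The depth
  depends on p alone, which stays fixed while n grows.\<close>

lemma computes_sqn:
  assumes "f \<in> A" "n > 0"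
  shows "computes A (3 * p) (10 * n * p) {\<lambda>x. sqn n p (f x)}"
  using assms(1)
proof (induction p arbitrary: f A)
  case 0
  then show ?case by (simp add: computes_refl)
next
  case (Suc p)
  define G where "G = (\<Union>j\<in>{1..<n}. {\<lambda>x. relu (1 * f x + (- (real j / real n)))})"
  have G: "computes A 1 (card {1..<n} * 2) G"
    unfolding G_def by (intro computes_UN_const computes_relu1 Suc.prems) simp
  have mem: "(\<lambda>x. relu (f x - real j / real n)) \<in> A \<union> G" if "j \<in> {1..<n}" for j
    using that unfolding G_def by auto
  have "computes (A \<union> G) 1 ((n + 1) + (n + 1)) ({\<lambda>x. interp n (f x)} \<union> {\<lambda>x. tri n (f x)})"
    unfolding interp_def tri_def
    by (intro computes_union computes_pw mem) (use Suc.prems assms(2) in auto)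
  from computes_then[OF G this]
  have 1: "computes A 2 (2 * (n - 1) + 2 * (n + 1)) {\<lambda>x. interp n (f x), \<lambda>x. tri n (f x)}"
    by (simp add: insert_commute mult.commute numeral_2_eq_2)
  define B where "B = A \<union> {\<lambda>x. interp n (f x), \<lambda>x. tri n (f x)}"
  have 2: "computes B (3 * p) (10 * n * p) {\<lambda>x. sqn n p (tri n (f x))}"
    by (rule Suc.IH) (simp add: B_def)
  define C where "C = B \<union> {\<lambda>x. sqn n p (tri n (f x))}"
  have C: "(\<lambda>x. interp n (f x)) \<in> C" "(\<lambda>x. tri n (f x)) \<in> C" "(\<lambda>x. sqn n p (tri n (f x))) \<in> C"
    by (simp_all add: C_def B_def)
  let ?ts = "[(1, \<lambda>x. interp n (f x)), (- 1 / (real n)\<^sup>2, \<lambda>x. tri n (f x)), (1 / (real n)\<^sup>2, \<lambda>x. sqn n p (tri n (f x)))]"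
  have "lc ?ts = (\<lambda>x. sqn n (Suc p) (f x))"
    by (simp add: fun_eq_iff diff_divide_distrib)
  moreover have "snd ` set ?ts \<subseteq> insert (\<lambda>_. 1) C" using C by simp
  ultimately have 3: "computes C 1 3 {\<lambda>x. sqn n (Suc p) (f x)}" using computes_lc[of ?ts C] by (simp add: numeral_3_eq_3)
  have "computes B (3 * p + 1) (10 * n * p + 3) {\<lambda>x. sqn n (Suc p) (f x)}"
    using computes_then[OF 2 3[unfolded C_def]] .
  from computes_then[OF 1 this[unfolded B_def]]
  show ?case by (rule computes_mono) (use assms(2) in \<open>auto simp: algebra_simps\<close>)
qed

text \<open>The polarization identity 4 x y = (x + y)^2 - (x - y)^2. Absolute values and the
  division by 2 B move the arguments into [0,1], where \<open>sqn\<close> is accurate.\<close>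

definition mult_net :: "real \<Rightarrow> nat \<Rightarrow> nat \<Rightarrow> real \<Rightarrow> real \<Rightarrow> real" where
  "mult_net B n p x y = B\<^sup>2 * (sqn n p (\<bar>x + y\<bar> / (2 * B)) - sqn n p (\<bar>x - y\<bar> / (2 * B)))"

lemma mult_net_error:
  assumes "n > 0" "B > 0" "\<bar>x\<bar> \<le> B" "\<bar>y\<bar> \<le> B"
  shows "\<bar>mult_net B n p x y - x * y\<bar> \<le> B\<^sup>2 / real n ^ (2 * p)"
proof -
  let ?a = "\<bar>x + y\<bar> / (2 * B)" and ?b = "\<bar>x - y\<bar> / (2 * B)"
  let ?e = "1 / (4 * real n ^ (2 * p))"
  have ab: "0 \<le> ?a" "?a \<le> 1" "0 \<le> ?b" "?b \<le> 1" using assms by auto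
  have "x * y = B\<^sup>2 * (?a\<^sup>2 - ?b\<^sup>2)"
    using assms(2) by (simp add: power_divide field_simps power2_eq_square)
  then have "mult_net B n p x y - x * y = B\<^sup>2 * ((sqn n p ?a - ?a\<^sup>2) - (sqn n p ?b - ?b\<^sup>2))"
    by (simp add: mult_net_def algebra_simps)
  also have "\<bar>\<dots>\<bar> \<le> B\<^sup>2 * (?e + ?e)"
    unfolding abs_mult using sqn_error[OF assms(1) ab(1,2), of p] sqn_error[OF assms(1) ab(3,4), of p]
    by (intro mult_mono order_trans[OF abs_triangle_ineq4 add_mono]) auto
  also have "\<dots> \<le> B\<^sup>2 / real n ^ (2 * p)" using assms(1) by (simp add: field_simps)
  finally show ?thesis .
qed

lemma computes_abs2:
  assumes "f \<in> A" "g \<in> A" "c \<ge> 0"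
  shows "computes A 2 9 {\<lambda>x. \<bar>f x + s * g x\<bar> * c}"
proof -
  let ?p = "\<lambda>x. relu (c * f x + (c * s) * g x + 0)" and ?m = "\<lambda>x. relu ((- c) * f x + (- (c * s)) * g x + 0)"
  have 1: "computes A 1 (3 + 3) ({?p} \<union> {?m})"
    by (intro computes_union computes_relu2 assms)
  have 2: "computes (A \<union> ({?p} \<union> {?m})) 1 3 {\<lambda>x. 1 * ?p x + 1 * ?m x + 0}"
    by (rule computes_lin2) auto
  have "1 * ?p x + 1 * ?m x + 0 = \<bar>f x + s * g x\<bar> * c" for x
  proof -
    have "relu y + relu (- y) = \<bar>y\<bar>" for y by (simp add: relu_def max_def)
    from this[of "c * (f x + s * g x)"]
    have "relu (c * (f x + s * g x)) + relu (- (c * (f x + s * g x))) = c * \<bar>f x + s * g x\<bar>"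
      using assms(3) by (simp only: abs_mult abs_of_nonneg)
    then show ?thesis by (simp add: algebra_simps)
  qed
  with computes_then[OF 1 2] show ?thesis by (simp add: numeral_2_eq_2)
qed

lemma computes_mult_net:
  assumes "f \<in> A" "g \<in> A" "n > 0" "B > 0"
  shows "computes A (3 * p + 3) (21 + 20 * n * p) {\<lambda>x. mult_net B n p (f x) (g x)}"
proof -
  let ?a = "\<lambda>x. \<bar>f x + 1 * g x\<bar> * (1 / (2 * B))" and ?b = "\<lambda>x. \<bar>f x + (-1) * g x\<bar> * (1 / (2 * B))"
  have 1: "computes A 2 (9 + 9) ({?a} \<union> {?b})"
    by (intro computes_union computes_abs2 assms) (use assms in auto)
  let ?sa = "\<lambda>x. sqn n p (?a x)" and ?sb = "\<lambda>x. sqn n p (?b x)"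
  have 2: "computes (A \<union> ({?a} \<union> {?b})) (3 * p) (10 * n * p + 10 * n * p) ({?sa} \<union> {?sb})"
    by (intro computes_union computes_sqn assms) auto
  have 3: "computes (A \<union> ({?sa} \<union> {?sb})) 1 3 {\<lambda>x. B\<^sup>2 * ?sa x + (- (B\<^sup>2)) * ?sb x + 0}"
    by (rule computes_lin2) auto
  have "(\<lambda>x. B\<^sup>2 * ?sa x + (- (B\<^sup>2)) * ?sb x + 0) = (\<lambda>x. mult_net B n p (f x) (g x))"
    by (simp add: fun_eq_iff mult_net_def algebra_simps)
  with computes_then[OF computes_then[OF 1 2] 3] show ?thesis
    by (auto elim!: computes_mono)
qed

fun prod_net :: "real \<Rightarrow> nat \<Rightarrow> nat \<Rightarrow> real list \<Rightarrow> real" where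
  "prod_net B n p [] = 1"
| "prod_net B n p (x # xs) = mult_net B n p x (prod_net B n p xs)"

lemma abs_prod_list_le:
  assumes "\<And>x. x \<in> set xs \<Longrightarrow> \<bar>x\<bar> \<le> K"
  shows "\<bar>prod_list xs\<bar> \<le> (K::real) ^ length xs"
  using assms
proof (induction xs)
  case (Cons x xs)
  have "0 \<le> K" using Cons.prems[of x] abs_ge_zero[of x] by (meson list.set_intros(1) order_trans)
  with Cons show ?case by (auto simp: abs_mult intro!: mult_mono)
qed simp

text \<open>The accumulated error has to stay below 1, which is what the assumption on
  \<open>n ^ (2 * p)\<close> ensures: then every approximate partial product is bounded by
  \<open>K ^ m + 1\<close>, that is by B, and \<open>mult_net_error\<close> applies to the next
  factor. Each multiplication adds one error of size \<open>B\<^sup>2 / n ^ (2 * p)\<close>, which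
  the remaining factors amplify by at most K each.\<close>

lemma prod_net_error:
  fixes K :: real
  assumes "n > 0" "K \<ge> 1" "m \<ge> 1" "B = K ^ m + 1" "B\<^sup>2 * m * K ^ m \<le> real n ^ (2 * p)"
    and "length xs \<le> m" "\<And>x. x \<in> set xs \<Longrightarrow> \<bar>x\<bar> \<le> K"
  shows "\<bar>prod_net B n p xs - prod_list xs\<bar> \<le> B\<^sup>2 / real n ^ (2 * p) * length xs * K ^ length xs"
  using assms(6,7)
proof (induction xs)
  case (Cons x xs)
  let ?d = "B\<^sup>2 / real n ^ (2 * p)" and ?P = "prod_net B n p xs"
  have d: "?d \<ge> 0" by simp
  have IH: "\<bar>?P - prod_list xs\<bar> \<le> ?d * length xs * K ^ length xs" using Cons by simp
  have KK: "K ^ length xs \<le> K ^ m" using Cons.prems assms(2) by (intro power_increasing) auto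
  have "?d * length xs * K ^ length xs \<le> ?d * m * K ^ m"
    using Cons.prems KK assms(2) by (intro mult_mono) auto
  also have "\<dots> \<le> 1" using assms(1,5) by (simp add: field_simps)
  finally have "\<bar>?P - prod_list xs\<bar> \<le> 1" using IH by linarith
  moreover have "\<bar>prod_list xs\<bar> \<le> K ^ m"
    using abs_prod_list_le[of xs K] Cons.prems KK by force
  ultimately have P: "\<bar>?P\<bar> \<le> B" using assms(4) by linarith
  have x: "\<bar>x\<bar> \<le> K" using Cons.prems by simp
  also have "K \<le> B" using power_increasing[of 1 m K] assms(2,3,4) by simp
  finally have xB: "\<bar>x\<bar> \<le> B" .
  have B0: "B > 0" using \<open>K \<le> B\<close> assms(2) by linarith
  have "prod_net B n p (x # xs) - prod_list (x # xs)
    = (mult_net B n p x ?P - x * ?P) + x * (?P - prod_list xs)" by (simp add: algebra_simps)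
  also have "\<bar>\<dots>\<bar> \<le> ?d + K * (?d * length xs * K ^ length xs)"
  proof (rule order_trans[OF abs_triangle_ineq add_mono])
    show "\<bar>mult_net B n p x ?P - x * ?P\<bar> \<le> ?d" by (rule mult_net_error[OF assms(1) B0 xB P])
    show "\<bar>x * (?P - prod_list xs)\<bar> \<le> K * (?d * length xs * K ^ length xs)"
      unfolding abs_mult using IH x assms(2) by (intro mult_mono) auto
  qed
  also have "\<dots> \<le> ?d * K ^ length (x # xs) + K * (?d * length xs * K ^ length xs)"
    using assms(2) d mult_left_mono[OF one_le_power[of K "length (x # xs)"] d] by auto
  also have "\<dots> = ?d * length (x # xs) * K ^ length (x # xs)"
    by (simp add: algebra_simps add_divide_distrib)
  finally show ?case .
qed simp

lemma computes_prod_net: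
  assumes "set fs \<subseteq> A" "n > 0" "B > 0"
  shows "computes A (length fs * (3 * p + 3) + 1) (length fs * (21 + 20 * n * p) + 1)
    {\<lambda>x. prod_net B n p (map (\<lambda>f. f x) fs)}"
  using assms(1)
proof (induction fs)
  case Nil
  have "lc [(1, \<lambda>_. 1)] = (\<lambda>_ :: 'a. 1)" by (simp add: fun_eq_iff)
  then show ?case using computes_lc[of "[(1, \<lambda>_. 1)]" A] by simp
next
  case (Cons f fs)
  let ?g = "\<lambda>x. prod_net B n p (map (\<lambda>f. f x) fs)"
  have "computes (A \<union> {?g}) (3 * p + 3) (21 + 20 * n * p) {\<lambda>x. mult_net B n p (f x) (?g x)}"
    by (rule computes_mult_net) (use Cons assms in auto)
  from computes_then[OF Cons.IH this] Cons.prems show ?case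
    by (auto simp: algebra_simps elim!: computes_mono)
qed

subsection \<open>Taylor expansion along the coordinate axes\<close>

text \<open>Solidity allows the Taylor expansion to proceed one coordinate at a time without leaving the
  domain.\<close>

definition toward0 :: "'a::euclidean_space \<Rightarrow> 'a \<Rightarrow> bool" where
  "toward0 z y \<longleftrightarrow> (\<forall>b\<in>Basis. 0 \<le> inner z b \<and> inner z b \<le> inner y b \<or> inner y b \<le> inner z b \<and> inner z b \<le> 0)"

definition solid :: "'a::euclidean_space set \<Rightarrow> bool" where
  "solid S \<longleftrightarrow> (\<forall>y\<in>S. \<forall>z. toward0 z y \<longrightarrow> z \<in> S)"

lemma toward0_refl: "toward0 y y"
  unfolding toward0_def by (meson linear order_refl)

text \<open>A translation of the parameter turns the derivative at 0 used in
  \<open>pderiv_within\<close> into a derivative at every point of a line, so that one-dimensional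
  calculus applies on segments within the domain.\<close>

lemma has_derivative_along:
  fixes g :: "'a::euclidean_space \<Rightarrow> real"
  assumes "pdiff_at_within \<Omega> b g (y + t *\<^sub>R b)" "\<And>s. s \<in> X \<Longrightarrow> y + s *\<^sub>R b \<in> \<Omega>"
  shows "((\<lambda>s. g (y + s *\<^sub>R b)) has_field_derivative pderiv_within \<Omega> b g (y + t *\<^sub>R b)) (at t within X)"
proof -
  let ?x = "y + t *\<^sub>R b"
  have "((\<lambda>h. g (?x + h *\<^sub>R b)) has_vector_derivative pderiv_within \<Omega> b g ?x) (at 0 within {h. ?x + h *\<^sub>R b \<in> \<Omega>})"
    using assms(1) unfolding pdiff_at_within_def pderiv_within_def by (rule vector_derivative_works[THEN iffD1])
  moreover have "(\<lambda>s. s - t) ` X \<subseteq> {h. ?x + h *\<^sub>R b \<in> \<Omega>}"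
    using assms(2) by (auto simp: scaleR_left_distrib[symmetric] add.assoc)
  ultimately have "((\<lambda>h. g (?x + h *\<^sub>R b)) has_vector_derivative pderiv_within \<Omega> b g ?x) (at (t - t) within (\<lambda>s. s - t) ` X)"
    using has_vector_derivative_within_subset by fastforce
  moreover have "((\<lambda>s. s - t) has_vector_derivative 1) (at t within X)"
    by (auto intro!: derivative_eq_intros)
  ultimately have "((\<lambda>h. g (?x + h *\<^sub>R b)) \<circ> (\<lambda>s. s - t) has_vector_derivative 1 *\<^sub>R pderiv_within \<Omega> b g ?x) (at t within X)"
    by (intro vector_diff_chain_within) auto
  moreover have "(\<lambda>h. g (?x + h *\<^sub>R b)) \<circ> (\<lambda>s. s - t) = (\<lambda>s. g (y + s *\<^sub>R b))"
    by (simp add: fun_eq_iff scaleR_left_diff_distrib)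
  ultimately show ?thesis by (simp add: has_real_derivative_iff_has_vector_derivative)
qed

lemma Ck_on_mono: "Ck_on m g \<Omega> \<Longrightarrow> j \<le> m \<Longrightarrow> Ck_on j g \<Omega>"
proof (induction j arbitrary: m g)
  case 0
  then show ?case by (cases m) auto
next
  case (Suc j)
  then obtain m' where "m = Suc m'" by (cases m) auto
  with Suc show ?case by auto
qed

lemma Ck_on_iter_pderiv:
  "Ck_on m g \<Omega> \<Longrightarrow> set \<beta> \<subseteq> Basis \<Longrightarrow> length \<beta> \<le> m \<Longrightarrow> Ck_on (m - length \<beta>) (iter_pderiv \<Omega> \<beta> g) \<Omega>"
proof (induction \<beta> arbitrary: m g rule: rev_induct)
  \<comment> \<open>\<open>foldr\<close> differentiates along the last entry of the list first,
    hence the induction from the end.\<close>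
  case (snoc b \<beta>)
  then obtain m' where m: "m = Suc m'" by (cases m) auto
  have "Ck_on (m' - length \<beta>) (iter_pderiv \<Omega> \<beta> (pderiv_within \<Omega> b g)) \<Omega>"
    by (rule snoc.IH) (use snoc.prems in \<open>auto simp: m\<close>)
  then show ?case by (simp add: m iter_pderiv_def)
qed (simp add: iter_pderiv_def)

lemma continuous_iter_pderiv:
  assumes "Ck_on m g \<Omega>" "set \<beta> \<subseteq> Basis" "length \<beta> \<le> m"
  shows "continuous_on \<Omega> (iter_pderiv \<Omega> \<beta> g)"
  using Ck_on_mono[OF Ck_on_iter_pderiv[OF assms], of 0] by simp

lemma iter_pderiv_append: "iter_pderiv \<Omega> (\<alpha> @ \<beta>) g = iter_pderiv \<Omega> \<alpha> (iter_pderiv \<Omega> \<beta> g)"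
  by (simp add: iter_pderiv_def)

definition mono_val :: "'a::euclidean_space list \<Rightarrow> 'a \<Rightarrow> real" where
  "mono_val \<beta> z = prod_list (map (inner z) \<beta>)"

text \<open>Polynomials as lists of monomials with their factors spelled out: each entry later
  becomes one product network, so the length of the list is a cost.\<close>

definition tval :: "(real \<times> 'a::euclidean_space list) list \<Rightarrow> 'a \<Rightarrow> real" where
  "tval ts z = (\<Sum>(c, \<beta>)\<leftarrow>ts. c * mono_val \<beta> z)"

lemma tval_simps [simp]: "tval [] z = 0" "tval ((c, \<beta>) # ts) z = c * mono_val \<beta> z + tval ts z"
  "tval (ss @ ts) z = tval ss z + tval ts z"
  by (simp_all add: tval_def)

lemma tval_concat: "tval (concat tss) z = (\<Sum>ts\<leftarrow>tss. tval ts z)"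
  by (induction tss) auto

text \<open>Moving one coordinate of y back to that of p passes only through points between 0 and y.
  In a solid set the whole segment is therefore available for a Taylor expansion.\<close>

lemma toward0_subst:
  assumes "toward0 p y" "b \<in> Basis" "s \<in> closed_segment 0 (inner (y - p) b)"
  shows "toward0 (y - inner (y - p) b *\<^sub>R b + s *\<^sub>R b) y"
  unfolding toward0_def
proof
  fix e :: 'a assume e: "e \<in> Basis"
  show "0 \<le> inner (y - inner (y - p) b *\<^sub>R b + s *\<^sub>R b) e \<and> inner (y - inner (y - p) b *\<^sub>R b + s *\<^sub>R b) e \<le> inner y e \<or>
    inner y e \<le> inner (y - inner (y - p) b *\<^sub>R b + s *\<^sub>R b) e \<and> inner (y - inner (y - p) b *\<^sub>R b + s *\<^sub>R b) e \<le> 0"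
  proof (cases "e = b")
    case True
    have "0 \<le> inner p b \<and> inner p b \<le> inner y b \<or> inner y b \<le> inner p b \<and> inner p b \<le> 0"
      using assms unfolding toward0_def by blast
    moreover have "inner (y - inner (y - p) b *\<^sub>R b + s *\<^sub>R b) e = inner p b + s"
      using assms(2) True by (simp add: inner_simps)
    ultimately show ?thesis using assms(3) True
      by (auto simp: closed_segment_eq_real_ivl inner_simps split: if_splits)
  next
    case False
    then show ?thesis using e assms(2) by (auto simp: inner_simps inner_Basis)
  qed
qed

text \<open>The function is expanded along the first axis by the one-dimensional Taylor formula, and
  its coefficients, which depend on one coordinate less, are expanded along the other axes. The j-th
  coefficient has only m - j derivatives left, but it is multiplied by a j-th power, so every branch
  leaves an error of order m. With N the constant for the remaining axes, one new remainder and at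
  most s branches give 1 + s N <= (s + 1) N.\<close>

lemma taylor_axes:
  fixes g :: "'a::euclidean_space \<Rightarrow> real"
  assumes "distinct bs" "set bs \<subseteq> Basis" "solid S" "S \<subseteq> \<Omega>" "M \<ge> 0" "m \<le> s" "Ck_on m g \<Omega>"
    and "\<And>\<beta> x. set \<beta> \<subseteq> Basis \<Longrightarrow> length \<beta> \<le> m \<Longrightarrow> x \<in> S \<Longrightarrow> \<bar>iter_pderiv \<Omega> \<beta> g x\<bar> \<le> M"
    and "p \<in> S"
  shows "\<exists>ts. length ts \<le> Suc s ^ length bs \<and>
    (\<forall>(c, \<beta>)\<in>set ts. \<bar>c\<bar> \<le> M \<and> set \<beta> \<subseteq> set bs \<and> length \<beta> < m) \<and>
    (\<forall>y\<in>S. toward0 p y \<longrightarrow> (\<forall>b\<in>Basis - set bs. inner y b = inner p b) \<longrightarrow>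
      \<bar>g y - tval ts (y - p)\<bar> \<le> real (Suc s ^ length bs) * M * (\<Sum>b\<in>Basis. \<bar>inner (y - p) b\<bar>) ^ m)"
  using assms(1,2,6,7,8)
proof (induction bs arbitrary: m g)
  case Nil
  show ?case
  proof (cases "m = 0")
    case True
    show ?thesis by (rule exI[of _ "[]"]) (use True Nil(5)[of "[]"] in \<open>auto simp: iter_pderiv_def\<close>)
  next
    case False
    have "\<bar>g p\<bar> \<le> M" using Nil(5)[of "[]" p] assms(9) by (simp add: iter_pderiv_def)
    moreover have "\<bar>g y - tval [(g p, [])] (y - p)\<bar> \<le> real (Suc s ^ length []) * M * (\<Sum>b\<in>Basis. \<bar>inner (y - p) b\<bar>) ^ m"
      if "\<forall>b\<in>Basis - set []. inner y b = inner p b" for y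
    proof -
      have "y = p" using euclidean_eqI[of y p] that by auto
      then show ?thesis using assms(5) False by (simp add: mono_val_def)
    qed
    ultimately show ?thesis using False by (intro exI[of _ "[(g p, [])]"]) simp
  qed
next
  case (Cons b bs)
  show ?case
  proof (cases m)
    case 0
    show ?thesis
    proof (intro exI[of _ "[]"] conjI ballI impI)
      fix y assume "y \<in> S"
      then have "\<bar>g y\<bar> \<le> M" using Cons.prems(5)[of "[]" y] by (simp add: iter_pderiv_def)
      also have "M \<le> real (Suc s ^ length (b # bs)) * M"
        using mult_right_mono[of 1 "real (Suc s ^ length (b # bs))" M] assms(5) by (simp del: power_Suc)
      finally show "\<bar>g y - tval [] (y - p)\<bar>
         \<le> real (Suc s ^ length (b # bs)) * M * (\<Sum>b\<in>Basis. \<bar>inner (y - p) b\<bar>) ^ m" using 0 by simp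
    qed auto
  next
    case (Suc m')
    have b: "b \<in> Basis" "b \<notin> set bs" using Cons.prems by auto
    define D where "D j = iter_pderiv \<Omega> (replicate j b) g" for j
    define N where "N = real (Suc s ^ length bs)"
    have N1: "N \<ge> 1" by (simp add: N_def)
    have rep: "set (replicate j b) \<subseteq> Basis" for j using b by auto
    define Q where "Q j ts \<longleftrightarrow> length ts \<le> Suc s ^ length bs \<and>
      (\<forall>(c, \<beta>)\<in>set ts. \<bar>c\<bar> \<le> M \<and> set \<beta> \<subseteq> set bs \<and> length \<beta> < m - j) \<and>
      (\<forall>y\<in>S. toward0 p y \<longrightarrow> (\<forall>b\<in>Basis - set bs. inner y b = inner p b) \<longrightarrow>
        \<bar>D j y - tval ts (y - p)\<bar> \<le> real (Suc s ^ length bs) * M * (\<Sum>b\<in>Basis. \<bar>inner (y - p) b\<bar>) ^ (m - j))"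
      for j and ts :: "(real \<times> 'a list) list"
    have "\<exists>ts. Q j ts" if j: "j < m" for j
      unfolding Q_def
    proof (rule Cons.IH)
      show "Ck_on (m - j) (D j) \<Omega>"
        using Ck_on_iter_pderiv[OF Cons.prems(4) rep, of j] j by (auto simp: D_def)
      fix \<beta> :: "'a list" and x assume "set \<beta> \<subseteq> Basis" "length \<beta> \<le> m - j" "x \<in> S"
      then show "\<bar>iter_pderiv \<Omega> \<beta> (D j) x\<bar> \<le> M"
        unfolding D_def iter_pderiv_append[symmetric] using rep[of j] j by (intro Cons.prems(5)) auto
    qed (use Cons.prems in auto)
    then obtain T where QT: "\<And>j. j < m \<Longrightarrow> Q j (T j)" by metis
    have T: "\<And>j. j < m \<Longrightarrow> length (T j) \<le> Suc s ^ length bs"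
      "\<And>j c \<beta>. j < m \<Longrightarrow> (c, \<beta>) \<in> set (T j) \<Longrightarrow> \<bar>c\<bar> \<le> M \<and> set \<beta> \<subseteq> set bs \<and> length \<beta> < m - j"
      "\<And>j y. j < m \<Longrightarrow> y \<in> S \<Longrightarrow> toward0 p y \<Longrightarrow> (\<forall>b\<in>Basis - set bs. inner y b = inner p b) \<Longrightarrow>
        \<bar>D j y - tval (T j) (y - p)\<bar> \<le> N * M * (\<Sum>b\<in>Basis. \<bar>inner (y - p) b\<bar>) ^ (m - j)"
      using QT unfolding Q_def N_def by blast+
    define U where "U j = map (\<lambda>(c, \<beta>). (c / fact j, replicate j b @ \<beta>)) (T j)" for j
    define ts where "ts = concat (map U [0..<m])"
    have Uval: "tval (U j) z = inner z b ^ j / fact j * tval (T j) z" for j z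
    proof -
      have "tval (map (\<lambda>(c, \<beta>). (c / fact j, replicate j b @ \<beta>)) ts) z = inner z b ^ j / fact j * tval ts z" for ts
        by (induction ts) (auto simp: mono_val_def algebra_simps add_divide_distrib prod_list_replicate)
      then show ?thesis by (simp add: U_def)
    qed
    have "length ts = (\<Sum>j<m. length (T j))"
      by (simp add: ts_def U_def length_concat o_def sum_list_distinct_conv_sum_set atLeast0LessThan)
    also have "\<dots> \<le> (\<Sum>j<m. Suc s ^ length bs)" by (rule sum_mono) (use T(1) in auto)
    also have "\<dots> \<le> Suc s ^ length (b # bs)" using Cons.prems(3) by (simp add: trans_le_add2)
    finally have 1: "length ts \<le> Suc s ^ length (b # bs)" .
    have 2: "\<bar>c\<bar> \<le> M \<and> set \<beta> \<subseteq> set (b # bs) \<and> length \<beta> < m" if c: "(c, \<beta>) \<in> set ts" for c \<beta>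
    proof -
      from c obtain j c' \<beta>' where j: "j < m" "(c', \<beta>') \<in> set (T j)" "c = c' / fact j" "\<beta> = replicate j b @ \<beta>'"
        by (auto simp: ts_def U_def)
      have "\<bar>c'\<bar> / fact j \<le> \<bar>c'\<bar> / 1" by (rule divide_left_mono) auto
      then show ?thesis using T(2)[OF j(1,2)] j b by auto
    qed
    have 3: "\<bar>g y - tval ts (y - p)\<bar> \<le> real (Suc s ^ length (b # bs)) * M * (\<Sum>b\<in>Basis. \<bar>inner (y - p) b\<bar>) ^ m"
      if y: "y \<in> S" "toward0 p y" "\<forall>e\<in>Basis - set (b # bs). inner y e = inner p e" for y
    proof -
      define h where "h = inner (y - p) b"
      \<comment> \<open>The point that agrees with p along b and with y along all other axes: the
        base point of the one-dimensional expansion.\<close>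
      define y' where "y' = y - h *\<^sub>R b"
      define \<sigma> where "\<sigma> = (\<Sum>b\<in>Basis. \<bar>inner (y - p) b\<bar>)"
      have \<sigma>0: "\<sigma> \<ge> 0" by (simp add: \<sigma>_def sum_nonneg)
      have h\<sigma>: "\<bar>h\<bar> \<le> \<sigma>" unfolding \<sigma>_def h_def by (rule member_le_sum) (use b in auto)
      have seg: "y' + t *\<^sub>R b \<in> S" if "t \<in> closed_segment 0 h" for t
        using toward0_subst[OF y(2) b(1), of t] that y(1) assms(3) unfolding h_def[symmetric] y'_def solid_def by blast
      have y'p: "inner y' e = (if e = b then inner p b else inner y e)" if "e \<in> Basis" for e
        using that b by (auto simp: y'_def h_def inner_simps inner_Basis)
      have y'S: "y' \<in> S" using seg[of 0] by simp
      have y'0: "toward0 p y'" using y(2) unfolding toward0_def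
        by (metis y'p linear order_refl)
      have y'eq: "\<forall>e\<in>Basis - set bs. inner y' e = inner p e" using y'p y(3) by auto
      have \<sigma>': "(\<Sum>b\<in>Basis. \<bar>inner (y' - p) b\<bar>) \<le> \<sigma>"
        unfolding \<sigma>_def by (rule sum_mono) (auto simp: inner_diff_left y'p)
      \<comment> \<open>The monomials of \<open>T j\<close> involve only the axes in bs, on which y
        and y' agree.\<close>
      have tv: "tval (T j) (y' - p) = tval (T j) (y - p)" if j: "j < m" for j
      proof -
        have "mono_val \<beta> (y' - p) = mono_val \<beta> (y - p)" if "(c, \<beta>) \<in> set (T j)" for c \<beta>
        proof -
          have "set \<beta> \<subseteq> set bs" using T(2)[OF j that] by blast
          then have "inner (y' - p) e = inner (y - p) e" if e: "e \<in> set \<beta>" for e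
          proof -
            have "e \<noteq> b" "e \<in> Basis" using e b Cons.prems(2) \<open>set \<beta> \<subseteq> set bs\<close> by auto
            then show ?thesis by (simp add: inner_diff_left y'p)
          qed
          then show ?thesis unfolding mono_val_def by (metis (mono_tags, lifting) map_eq_conv)
        qed
        then have "map (\<lambda>(c, \<beta>). c * mono_val \<beta> (y' - p)) (T j) = map (\<lambda>(c, \<beta>). c * mono_val \<beta> (y - p)) (T j)"
          by (intro map_cong) auto
        then show ?thesis unfolding tval_def by presburger
      qed
      have "norm (D 0 (y' + h *\<^sub>R b) - (\<Sum>i\<le>m'. D i (y' + 0 *\<^sub>R b) * (h - 0) ^ i / fact i)) \<le> M * norm (h - 0) ^ Suc m' / fact m'"
      proof (rule field_Taylor[where S = "closed_segment 0 h" and f = "\<lambda>i t. D i (y' + t *\<^sub>R b)"])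
        fix i x assume ix: "x \<in> closed_segment 0 h" "i \<le> m'"
        have "Ck_on (m - i) (D i) \<Omega>"
          using Ck_on_iter_pderiv[OF Cons.prems(4) rep, of i] ix Suc by (auto simp: D_def)
        then have "Ck_on (Suc (m' - i)) (D i) \<Omega>" using ix Suc by (simp add: Suc_diff_le)
        then have "pdiff_at_within \<Omega> b (D i) (y' + x *\<^sub>R b)" using b seg[OF ix(1)] assms(4) by auto
        from has_derivative_along[OF this, of "closed_segment 0 h"] seg assms(4)
        show "((\<lambda>t. D i (y' + t *\<^sub>R b)) has_field_derivative D (Suc i) (y' + x *\<^sub>R b)) (at x within closed_segment 0 h)"
          by (auto simp: D_def iter_pderiv_def)
      next
        fix x assume "x \<in> closed_segment 0 h"
        then show "norm (D (Suc m') (y' + x *\<^sub>R b)) \<le> M"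
          using Cons.prems(5)[OF rep, of m "y' + x *\<^sub>R b"] seg Suc by (simp add: D_def)
      qed auto
      then have "\<bar>g y - (\<Sum>i<m. D i y' * h ^ i / fact i)\<bar> \<le> M * \<bar>h\<bar> ^ m / fact m'"
        by (simp add: Suc lessThan_Suc_atMost y'_def D_def iter_pderiv_def)
      also have "\<dots> \<le> M * \<bar>h\<bar> ^ m / 1" using assms(5) by (intro divide_left_mono) auto
      also have "\<dots> \<le> M * \<sigma> ^ m" using assms(5) h\<sigma> by (simp add: mult_left_mono power_mono)
      finally have A: "\<bar>g y - (\<Sum>i<m. D i y' * h ^ i / fact i)\<bar> \<le> M * \<sigma> ^ m" .
      have "tval ts (y - p) = (\<Sum>i<m. h ^ i / fact i * tval (T i) (y - p))"
        by (simp add: ts_def tval_concat o_def Uval h_def sum_list_distinct_conv_sum_set atLeast0LessThan)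
      then have "(\<Sum>i<m. D i y' * h ^ i / fact i) - tval ts (y - p) = (\<Sum>i<m. h ^ i / fact i * (D i y' - tval (T i) (y' - p)))"
        by (simp add: sum_subtractf[symmetric] tv algebra_simps)
      also have "\<bar>\<dots>\<bar> \<le> (\<Sum>i<m. N * M * \<sigma> ^ m)"
      proof (rule order_trans[OF sum_abs sum_mono])
        fix i assume "i \<in> {..<m}"
        then have i: "i < m" by simp
        have "\<bar>h ^ i / fact i\<bar> \<le> \<bar>h\<bar> ^ i / 1"
          unfolding abs_divide power_abs by (simp add: divide_le_eq mult_le_cancel_left1)
        also have "\<dots> \<le> \<sigma> ^ i" using h\<sigma> by (simp add: power_mono)
        finally have a: "\<bar>h ^ i / fact i\<bar> \<le> \<sigma> ^ i" .
        have "\<bar>D i y' - tval (T i) (y' - p)\<bar> \<le> N * M * (\<Sum>b\<in>Basis. \<bar>inner (y' - p) b\<bar>) ^ (m - i)"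
          by (rule T(3)[OF i y'S y'0 y'eq])
        also have "\<dots> \<le> N * M * \<sigma> ^ (m - i)" using \<sigma>' N1 assms(5)
          by (intro mult_left_mono power_mono) (auto intro: sum_nonneg)
        finally have "\<bar>h ^ i / fact i * (D i y' - tval (T i) (y' - p))\<bar> \<le> \<sigma> ^ i * (N * M * \<sigma> ^ (m - i))"
          unfolding abs_mult using a \<sigma>0 by (intro mult_mono) auto
        also have "\<dots> = N * M * \<sigma> ^ m" using i by (simp add: power_add[symmetric])
        finally show "\<bar>h ^ i / fact i * (D i y' - tval (T i) (y' - p))\<bar> \<le> N * M * \<sigma> ^ m" .
      qed
      finally have "\<bar>(\<Sum>i<m. D i y' * h ^ i / fact i) - tval ts (y - p)\<bar> \<le> real m * (N * M * \<sigma> ^ m)" by simp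
      with A have "\<bar>g y - tval ts (y - p)\<bar> \<le> M * \<sigma> ^ m + real m * (N * M * \<sigma> ^ m)" by linarith
      also have "\<dots> \<le> N * (M * \<sigma> ^ m) + real s * (N * M * \<sigma> ^ m)"
        using N1 assms(5) \<sigma>0 Cons.prems(3) mult_right_mono[of 1 N "M * \<sigma> ^ m"]
        by (intro add_mono mult_right_mono) auto
      also have "\<dots> = real (Suc s ^ length (b # bs)) * M * \<sigma> ^ m" by (simp add: N_def algebra_simps)
      finally show ?thesis unfolding \<sigma>_def .
    qed
    show ?thesis
    proof (intro exI[of _ ts] conjI)
      show "\<forall>y\<in>S. toward0 p y \<longrightarrow> (\<forall>e\<in>Basis - set (b # bs). inner y e = inner p e) \<longrightarrow>
         \<bar>g y - tval ts (y - p)\<bar> \<le> real (Suc s ^ length (b # bs)) * M * (\<Sum>b\<in>Basis. \<bar>inner (y - p) b\<bar>) ^ m"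
        using 3 by (intro ballI impI)
      show "\<forall>(c, \<beta>)\<in>set ts. \<bar>c\<bar> \<le> M \<and> set \<beta> \<subseteq> set (b # bs) \<and> length \<beta> < m"
        using 2 by blast
    qed (rule 1)
  qed
qed

section \<open>Uniform derivative bounds, Taylor and Lipschitz estimates on solid sets\<close>

definition l1 :: "'a::euclidean_space \<Rightarrow> real" where
  "l1 z = (\<Sum>b\<in>Basis. \<bar>inner z b\<bar>)"

lemma l1_nonneg: "l1 z \<ge> 0"
  by (simp add: l1_def sum_nonneg)

lemma l1_component: "b \<in> Basis \<Longrightarrow> \<bar>inner z b\<bar> \<le> l1 z"
  unfolding l1_def by (rule member_le_sum) auto

lemma l1_le_norm: "l1 (z :: 'a::euclidean_space) \<le> real DIM('a) * norm z"
proof -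
  have "l1 z \<le> (\<Sum>b\<in>(Basis :: 'a set). norm z)"
    unfolding l1_def by (rule sum_mono) (simp add: Basis_le_norm)
  then show ?thesis by simp
qed

lemma l1_triangle: "l1 (x - z) \<le> l1 (x - y) + l1 (y - z)"
  unfolding l1_def sum.distrib[symmetric]
  by (rule sum_mono) (simp add: inner_diff_left)

lemma norm_le_l1': "norm z \<le> l1 z"
  unfolding l1_def by (rule norm_le_l1)

definition Ck_bound :: "nat \<Rightarrow> real \<Rightarrow> 'a::euclidean_space set \<Rightarrow> 'a set \<Rightarrow> ('a \<Rightarrow> real) \<Rightarrow> bool" where
  "Ck_bound s M \<Omega> S g \<longleftrightarrow> Ck_on s g \<Omega> \<and> S \<subseteq> \<Omega> \<and> M \<ge> 0 \<and>
     (\<forall>\<beta> x. set \<beta> \<subseteq> Basis \<longrightarrow> length \<beta> \<le> s \<longrightarrow> x \<in> S \<longrightarrow> \<bar>iter_pderiv \<Omega> \<beta> g x\<bar> \<le> M)"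

text \<open>Compactness and convexity provide closest points, solidity provides Taylor expansions,
  and R limits the grid as well as the inputs of the product networks.\<close>

definition solid_body :: "real \<Rightarrow> 'a::euclidean_space set \<Rightarrow> bool" where
  "solid_body R S \<longleftrightarrow> compact S \<and> convex S \<and> solid S \<and> S \<noteq> {} \<and> (\<forall>y\<in>S. \<forall>b\<in>Basis. \<bar>inner y b\<bar> \<le> R)"

lemma Ck_bound_mono: "Ck_bound s M \<Omega> S g \<Longrightarrow> j \<le> s \<Longrightarrow> S' \<subseteq> S \<Longrightarrow> Ck_bound j M \<Omega> S' g"
  unfolding Ck_bound_def using Ck_on_mono by (meson order_trans subset_iff)

lemma taylor_solid:
  fixes g :: "'a::euclidean_space \<Rightarrow> real"
  assumes "Ck_bound s M \<Omega> S g" "solid S" "p \<in> S"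
  shows "\<exists>ts. length ts \<le> Suc s ^ DIM('a) \<and>
    (\<forall>(c, \<beta>)\<in>set ts. \<bar>c\<bar> \<le> M \<and> set \<beta> \<subseteq> Basis \<and> length \<beta> < s) \<and>
    (\<forall>y\<in>S. toward0 p y \<longrightarrow> \<bar>g y - tval ts (y - p)\<bar> \<le> real (Suc s ^ DIM('a)) * M * l1 (y - p) ^ s)"
proof -
  obtain bs where bs: "set bs = (Basis :: 'a set)" "distinct bs"
    using finite_distinct_list[OF finite_Basis] by blast
  have len: "length bs = DIM('a)" using bs distinct_card by metis
  obtain ts where ts: "length ts \<le> Suc s ^ length bs"
    "\<forall>(c, \<beta>)\<in>set ts. \<bar>c\<bar> \<le> M \<and> set \<beta> \<subseteq> set bs \<and> length \<beta> < s"
    "\<forall>y\<in>S. toward0 p y \<longrightarrow> (\<forall>b\<in>Basis - set bs. inner y b = inner p b) \<longrightarrow>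
      \<bar>g y - tval ts (y - p)\<bar> \<le> real (Suc s ^ length bs) * M * (\<Sum>b\<in>Basis. \<bar>inner (y - p) b\<bar>) ^ s"
    using taylor_axes[of bs S \<Omega> M s s g p] assms bs unfolding Ck_bound_def by blast
  show ?thesis using ts bs(1) unfolding len l1_def by (intro exI[of _ ts]) simp
qed

text \<open>Two points need not lie toward 0 from one another, but both are comparable with their
  coordinatewise meet m, which a solid set contains. The l1 distance is additive along the detour
  through m, so nothing is lost; each half is a Taylor expansion of order 1 at m.\<close>

lemma lipschitz_solid:
  fixes g :: "'a::euclidean_space \<Rightarrow> real"
  assumes "Ck_bound s M \<Omega> S g" "s \<ge> 1" "solid S" "x \<in> S" "y \<in> S"
  shows "\<bar>g x - g y\<bar> \<le> 2 ^ DIM('a) * M * l1 (x - y)"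
proof -
  have C1: "Ck_bound 1 M \<Omega> S g" using Ck_bound_mono[OF assms(1,2)] by blast
  define m where "m = (\<Sum>b\<in>Basis. (if 0 \<le> inner x b \<and> 0 \<le> inner y b then min (inner x b) (inner y b)
     else if inner x b \<le> 0 \<and> inner y b \<le> 0 then max (inner x b) (inner y b) else 0) *\<^sub>R b)"
  have mb: "inner m b = (if 0 \<le> inner x b \<and> 0 \<le> inner y b then min (inner x b) (inner y b)
     else if inner x b \<le> 0 \<and> inner y b \<le> 0 then max (inner x b) (inner y b) else 0)" if "b \<in> Basis" for b
    unfolding m_def using that by (rule inner_sum_left_Basis)
  have t0: "toward0 m x" "toward0 m y" unfolding toward0_def using mb by auto
  have mS: "m \<in> S" using assms(3,4) t0 unfolding solid_def by blast
  have *: "\<bar>g z - g m\<bar> \<le> 2 ^ DIM('a) * M * l1 (z - m)" if z: "z \<in> S" "toward0 m z" for z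
  proof -
    obtain ts where ts: "\<forall>(c, \<beta>)\<in>set ts. \<bar>c\<bar> \<le> M \<and> set \<beta> \<subseteq> Basis \<and> length \<beta> < 1"
      "\<forall>y\<in>S. toward0 m y \<longrightarrow> \<bar>g y - tval ts (y - m)\<bar> \<le> real (Suc 1 ^ DIM('a)) * M * l1 (y - m) ^ 1"
      using taylor_solid[OF C1 assms(3) mS] by blast
    \<comment> \<open>All monomials have degree less than 1, so the expansion is a constant, and
      evaluating the remainder at m identifies it as g m.\<close>
    have "tval ts w = tval ts 0" for w
      using ts(1) by (induction ts) (auto simp: mono_val_def)
    moreover have "g m = tval ts (m - m)"
      using ts(2)[rule_format, OF mS toward0_refl] by (simp add: l1_def)
    ultimately have "g m = tval ts (z - m)" by metis
    then show ?thesis using ts(2) z by simp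
  qed
  have "l1 (x - m) + l1 (y - m) = l1 (x - y)"
    unfolding l1_def sum.distrib[symmetric] by (rule sum.cong) (auto simp: inner_diff_left mb)
  then have "2 ^ DIM('a) * M * l1 (x - y) = 2 ^ DIM('a) * M * l1 (x - m) + 2 ^ DIM('a) * M * l1 (y - m)"
    by (metis distrib_left)
  with *[OF assms(4) t0(1)] *[OF assms(5) t0(2)] show ?thesis by linarith
qed

lemma mono_val_lipschitz:
  assumes "set \<beta> \<subseteq> Basis" "B \<ge> 1" "\<And>b. b \<in> Basis \<Longrightarrow> \<bar>inner z b\<bar> \<le> B" "\<And>b. b \<in> Basis \<Longrightarrow> \<bar>inner w b\<bar> \<le> B"
  shows "\<bar>mono_val \<beta> z - mono_val \<beta> w\<bar> \<le> real (length \<beta>) * B ^ length \<beta> * l1 (z - w)"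
  using assms(1)
proof (induction \<beta>)
  case (Cons b \<beta>)
  let ?n = "real (length \<beta>)"
  have b: "b \<in> Basis" using Cons by simp
  have IH: "\<bar>mono_val \<beta> z - mono_val \<beta> w\<bar> \<le> ?n * B ^ length \<beta> * l1 (z - w)" using Cons by simp
  have w: "\<bar>mono_val \<beta> w\<bar> \<le> B ^ length \<beta>"
    using abs_prod_list_le[of "map (inner w) \<beta>" B] Cons.prems assms(4) unfolding mono_val_def by fastforce
  have "mono_val (b # \<beta>) z - mono_val (b # \<beta>) w
     = inner z b * (mono_val \<beta> z - mono_val \<beta> w) + inner (z - w) b * mono_val \<beta> w"
    by (simp add: mono_val_def inner_diff_left algebra_simps)
  also have "\<bar>\<dots>\<bar> \<le> B * (?n * B ^ length \<beta> * l1 (z - w)) + l1 (z - w) * B ^ length \<beta>"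
    by (rule order_trans[OF abs_triangle_ineq], unfold abs_mult, intro add_mono mult_mono)
      (use IH w assms(2,3) b l1_component[OF b, of "z - w"] l1_nonneg[of "z - w"] in auto)
  also have "\<dots> \<le> B * (?n * B ^ length \<beta> * l1 (z - w)) + l1 (z - w) * B ^ length (b # \<beta>)"
    using assms(2) l1_nonneg[of "z - w"] by (intro add_left_mono mult_left_mono) auto
  also have "\<dots> = real (length (b # \<beta>)) * B ^ length (b # \<beta>) * l1 (z - w)" by (simp add: algebra_simps)
  finally show ?case .
qed (simp add: mono_val_def)

text \<open>Controls a Taylor polynomial at arguments off the set on which it approximates the
  function.\<close>

lemma tval_lipschitz:
  assumes "\<forall>(c, \<beta>)\<in>set ts. \<bar>c\<bar> \<le> M \<and> set \<beta> \<subseteq> Basis \<and> length \<beta> < s"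
    and "B \<ge> 1" "\<And>b. b \<in> Basis \<Longrightarrow> \<bar>inner z b\<bar> \<le> B" "\<And>b. b \<in> Basis \<Longrightarrow> \<bar>inner w b\<bar> \<le> B" "M \<ge> 0"
  shows "\<bar>tval ts z - tval ts w\<bar> \<le> real (length ts) * (M * (real s * B ^ s)) * l1 (z - w)"
  using assms(1)
proof (induction ts)
  case (Cons t ts)
  obtain c \<beta> where t: "t = (c, \<beta>)" by force
  have c: "\<bar>c\<bar> \<le> M" "set \<beta> \<subseteq> Basis" "length \<beta> < s" using Cons.prems t by auto
  have "\<bar>mono_val \<beta> z - mono_val \<beta> w\<bar> \<le> real (length \<beta>) * B ^ length \<beta> * l1 (z - w)"
    by (rule mono_val_lipschitz) (use c assms in auto)
  also have "\<dots> \<le> real s * B ^ s * l1 (z - w)"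
    using c assms(2) l1_nonneg[of "z - w"] by (intro mult_right_mono mult_mono power_increasing) auto
  finally have "\<bar>c * (mono_val \<beta> z - mono_val \<beta> w)\<bar> \<le> M * (real s * B ^ s * l1 (z - w))"
    unfolding abs_mult using c assms(5) by (intro mult_mono) auto
  moreover have "\<bar>tval ts z - tval ts w\<bar> \<le> real (length ts) * (M * (real s * B ^ s)) * l1 (z - w)"
    using Cons by auto
  moreover have "tval (t # ts) z - tval (t # ts) w = c * (mono_val \<beta> z - mono_val \<beta> w) + (tval ts z - tval ts w)"
    by (simp add: t algebra_simps)
  ultimately have "\<bar>tval (t # ts) z - tval (t # ts) w\<bar> \<le> M * (real s * B ^ s * l1 (z - w)) + real (length ts) * (M * (real s * B ^ s)) * l1 (z - w)"
    by linarith
  then show ?case by (simp add: algebra_simps)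
qed simp

section \<open>Gluing Taylor polynomials by a partition of unity\<close>

definition hat :: "real \<Rightarrow> real" where
  "hat x = max 0 (1 - \<bar>x\<bar>)"

lemma hat_bounds: "0 \<le> hat x" "hat x \<le> 1" "hat x \<noteq> 0 \<Longrightarrow> \<bar>x\<bar> < 1"
  by (auto simp: hat_def)

lemma sum_hat:
  assumes "\<bar>x\<bar> \<le> real_of_int A"
  shows "(\<Sum>i\<in>{-A..A}. hat (x - real_of_int i)) = 1"
proof -
  define k where "k = \<lfloor>x\<rfloor>"
  have k: "real_of_int k \<le> x" "x < real_of_int k + 1" by (simp_all add: k_def)
  have zero: "hat (x - real_of_int i) = 0" if "i \<noteq> k" "i \<noteq> k + 1" for i
  proof -
    have "i \<le> k - 1 \<or> i \<ge> k + 2" using that by linarith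
    then have "real_of_int i \<le> real_of_int k - 1 \<or> real_of_int i \<ge> real_of_int k + 2" by linarith
    then show ?thesis using k by (auto simp: hat_def)
  qed
  have kA: "k \<in> {-A..A}" using assms unfolding k_def by (auto simp: le_floor_iff floor_le_iff)
  show ?thesis
  proof (cases "k = A")
    \<comment> \<open>At the right end of the grid the second hat is missing, but x is then the last
      grid point, where it would vanish.\<close>
    case True
    then have "x = real_of_int k" using k assms by auto
    have "(\<Sum>i\<in>{-A..A}. hat (x - real_of_int i)) = (\<Sum>i\<in>{k}. hat (x - real_of_int i))"
      by (rule sum.mono_neutral_right) (use kA zero True in auto)
    then show ?thesis using \<open>x = _\<close> by (simp add: hat_def)
  next
    case False
    have "(\<Sum>i\<in>{-A..A}. hat (x - real_of_int i)) = (\<Sum>i\<in>{k, k+1}. hat (x - real_of_int i))"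
      by (rule sum.mono_neutral_right) (use kA zero False in auto)
    also have "\<dots> = 1" using k by (simp add: hat_def)
    finally show ?thesis .
  qed
qed

text \<open>Products of hats and linear factors are kept as syntax: a circuit is read off factor by
  factor, and its size is governed by their number. The Boolean selects a hat of mesh 1/a or a
  linear factor of a monomial.\<close>

definition fac :: "nat \<Rightarrow> bool \<times> 'a::euclidean_space \<times> real \<Rightarrow> 'a \<Rightarrow> real" where
  "fac a = (\<lambda>(h, e, v) y. if h then hat (real a * (inner y e - v)) else inner y e - v)"

definition fval :: "nat \<Rightarrow> (real \<times> (bool \<times> 'a::euclidean_space \<times> real) list) list \<Rightarrow> 'a \<Rightarrow> real" where
  "fval a F y = (\<Sum>(c, fs)\<leftarrow>F. c * (\<Prod>f\<leftarrow>fs. fac a f y))"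

definition net_ok :: "nat \<Rightarrow> real \<Rightarrow> real \<Rightarrow> (real \<times> (bool \<times> 'a::euclidean_space \<times> real) list) list \<Rightarrow> bool" where
  "net_ok m M R F \<longleftrightarrow> (\<forall>(c, fs)\<in>set F. \<bar>c\<bar> \<le> M \<and> length fs \<le> m \<and> (\<forall>(h, e, v)\<in>set fs. e \<in> Basis \<and> \<bar>v\<bar> \<le> R))"

lemma net_okI:
  assumes "\<And>c fs. (c, fs) \<in> set F \<Longrightarrow> \<bar>c\<bar> \<le> M \<and> length fs \<le> m"
    "\<And>c fs h e v. (c, fs) \<in> set F \<Longrightarrow> (h, e, v) \<in> set fs \<Longrightarrow> e \<in> Basis \<and> \<bar>v\<bar> \<le> R"
  shows "net_ok m M R F"
  using assms unfolding net_ok_def by blast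

text \<open>An expansion is valid only at points from which its centre lies toward 0, and a grid
  point may not even belong to S. So each grid point is moved by two meshes toward 0 in every
  coordinate. If y lies in the support of a hat and within one mesh of S, then its closest point
  \<pi> in S differs from the grid point by less than two meshes per coordinate; the moved point
  lies toward 0 from \<pi> and, S being solid, belongs to S. If y is farther away from S, the
  admissible error \<open>norm (y - q)\<close> exceeds the mesh, and Lipschitz bounds are good
  enough.\<close>

lemma partition_approximation:
  fixes g :: "'a::euclidean_space \<Rightarrow> real"
  assumes "s \<ge> 1" "R \<ge> 1" "a \<ge> 1" "solid_body R S" "Ck_bound s M \<Omega> S g"
  defines "D \<equiv> real DIM('a)" and "N \<equiv> real (Suc s ^ DIM('a))"
  shows "\<exists>F. real (length F) \<le> N * (2 * R + 3) ^ DIM('a) * real a ^ DIM('a) \<and> net_ok (DIM('a) + s) M (R + 1) F \<and>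
    (\<forall>y. (\<forall>b\<in>Basis. \<bar>inner y b\<bar> \<le> R) \<longrightarrow> (\<forall>q\<in>S. \<bar>fval a F y - g q\<bar> \<le>
       (N * M * (4 * D) ^ s + N * (M * (real s * (2 * R) ^ s)) * (2 * D + 3 * D\<^sup>2) + 2 ^ DIM('a) * M * (D + 3 * D\<^sup>2))
         * (1 / real a ^ s + norm (y - q))))"
proof -
  have S: "compact S" "convex S" "closed S" "S \<noteq> {}" "solid S"
    and SR: "\<And>y b. y \<in> S \<Longrightarrow> b \<in> Basis \<Longrightarrow> \<bar>inner y b\<bar> \<le> R"
    using assms(4) compact_imp_closed unfolding solid_body_def by auto
  have M0: "M \<ge> 0" using assms(5) by (simp add: Ck_bound_def)
  have N1: "N \<ge> 1" by (simp add: N_def)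
  have D1: "D \<ge> 1" by (simp add: D_def Suc_leI)
  have l1D: "l1 v \<le> D * norm v" for v :: 'a unfolding D_def by (rule l1_le_norm)
  \<comment> \<open>Rounding R up makes the ends of the grid multiples of the mesh, so that the hats
    sum to 1 on all of [- R, R].\<close>
  define Rc where "Rc = \<lceil>R\<rceil>"
  have Rc: "R \<le> real_of_int Rc" "real_of_int Rc \<le> R + 1" "Rc \<ge> 1" using assms(2) unfolding Rc_def by linarith+
  define A where "A = int a * Rc"
  have A0: "A \<ge> 1" unfolding A_def using assms(3) Rc(3) by (metis int_one_le_iff_zero_less less_le_trans mult_pos_pos of_nat_0_less_iff zero_less_one le_eq_less_or_eq One_nat_def Suc_le_eq)
  have a0: "real a > 0" using assms(3) by simp
  define Q where "Q = PiE (Basis :: 'a set) (\<lambda>_. {-A..A})"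
  have finQ: "finite Q" unfolding Q_def by (intro finite_PiE) auto
  \<comment> \<open>The grid point moved two meshes toward 0, stopping at 0.\<close>
  define sh where "sh q = (\<Sum>e\<in>(Basis :: 'a set). (sgn (real_of_int (q e)) * max 0 (\<bar>real_of_int (q e)\<bar> - 2) / real a) *\<^sub>R e)" for q :: "'a \<Rightarrow> int"
  have she: "inner (sh q) e = sgn (real_of_int (q e)) * max 0 (\<bar>real_of_int (q e)\<bar> - 2) / real a" if "e \<in> Basis" for q e
    unfolding sh_def using that by (rule inner_sum_left_Basis)
  \<comment> \<open>The projection provides a centre in S for every grid point; it is the identity
    in the case where the accuracy of order s is claimed.\<close>
  define z where "z q = closest_point S (sh q)" for q
  have zS: "z q \<in> S" for q unfolding z_def using S by (intro closest_point_in_set) auto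
  define w where "w q y = (\<Prod>e\<in>Basis. hat (real a * (inner y e - real_of_int (q e) / real a)))" for q and y :: 'a
  define P where "P q ts \<longleftrightarrow> length ts \<le> Suc s ^ DIM('a) \<and>
    (\<forall>(c, \<beta>)\<in>set ts. \<bar>c\<bar> \<le> M \<and> set \<beta> \<subseteq> Basis \<and> length \<beta> < s) \<and>
    (\<forall>y\<in>S. toward0 (z q) y \<longrightarrow> \<bar>g y - tval ts (y - z q)\<bar> \<le> N * M * l1 (y - z q) ^ s)" for q and ts :: "(real \<times> 'a list) list"
  have "\<exists>ts. P q ts" for q
    using taylor_solid[OF assms(5) S(5) zS[of q]] unfolding P_def N_def by blast
  then obtain T where PT: "\<And>q. P q (T q)" by metis
  have Tlen: "real (length (T q)) \<le> N" for q using PT[of q] by (simp add: P_def N_def del: of_nat_Suc of_nat_power)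
  have Tc: "\<forall>(c, \<beta>)\<in>set (T q). \<bar>c\<bar> \<le> M \<and> set \<beta> \<subseteq> Basis \<and> length \<beta> < s" for q using PT[of q] by (simp add: P_def)
  have Tt: "\<bar>g y - tval (T q) (y - z q)\<bar> \<le> N * M * l1 (y - z q) ^ s" if "y \<in> S" "toward0 (z q) y" for q y
    using PT[of q] that by (simp add: P_def)
  define E where "E = M * (real s * (2 * R) ^ s)"
  have E0: "E \<ge> 0" using M0 assms(2) by (simp add: E_def)
  have Tl: "\<bar>tval (T q) u - tval (T q) v\<bar> \<le> N * E * l1 (u - v)"
    if "\<And>b. b \<in> Basis \<Longrightarrow> \<bar>inner u b\<bar> \<le> 2 * R" "\<And>b. b \<in> Basis \<Longrightarrow> \<bar>inner v b\<bar> \<le> 2 * R" for q u v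
  proof -
    have "\<bar>tval (T q) u - tval (T q) v\<bar> \<le> real (length (T q)) * E * l1 (u - v)"
      unfolding E_def by (rule tval_lipschitz) (use Tc that assms(2) M0 in auto)
    also have "\<dots> \<le> N * E * l1 (u - v)" using Tlen E0 l1_nonneg by (intro mult_right_mono) auto
    finally show ?thesis .
  qed
  \<comment> \<open>In turn: the Taylor remainder at l1 distance at most 4 D / a, the variation of a
    Taylor polynomial, and the variation of g between two points of S.\<close>
  define C where "C = N * M * (4 * D) ^ s + N * E * (2 * D + 3 * D\<^sup>2) + 2 ^ DIM('a) * M * (3 * D\<^sup>2)"
  have wsum: "(\<Sum>q\<in>Q. w q y) = 1" if y: "\<forall>b\<in>Basis. \<bar>inner y b\<bar> \<le> R" for y
  proof -
    have "(\<Sum>i\<in>{-A..A}. hat (real a * (inner y e - real_of_int i / real a))) = 1" if e: "e \<in> Basis" for e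
    proof -
      have "\<bar>real a * inner y e\<bar> \<le> real a * real_of_int Rc"
        unfolding abs_mult using y e Rc(1) a0 by (intro mult_mono) auto
      then have "(\<Sum>i\<in>{-A..A}. hat (real a * inner y e - real_of_int i)) = 1"
        by (intro sum_hat) (simp add: A_def)
      then show ?thesis using a0 by (simp add: right_diff_distrib)
    qed
    then have "1 = (\<Prod>e\<in>Basis. \<Sum>i\<in>{-A..A}. hat (real a * (inner y e - real_of_int i / real a)))" by simp
    also have "\<dots> = (\<Sum>q\<in>Q. w q y)" unfolding Q_def w_def by (rule prod_sum_PiE) auto
    finally show ?thesis by simp
  qed
  have w0: "w q y \<ge> 0" for q y unfolding w_def by (intro prod_nonneg) (simp add: hat_bounds)
  have node: "\<bar>tval (T q) (y - z q) - g (closest_point S y)\<bar> \<le> C * (1 / real a ^ s + norm (y - closest_point S y))"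
    if y: "\<forall>b\<in>Basis. \<bar>inner y b\<bar> \<le> R" and wq: "w q y \<noteq> 0" for q y
  proof -
    define \<pi> where "\<pi> = closest_point S y"
    define \<nu> where "\<nu> = norm (y - \<pi>)"
    have \<pi>S: "\<pi> \<in> S" unfolding \<pi>_def using S by (intro closest_point_in_set) auto
    have near: "\<bar>inner y e - real_of_int (q e) / real a\<bar> < 1 / real a" if e: "e \<in> Basis" for e
    proof -
      have "hat (real a * (inner y e - real_of_int (q e) / real a)) \<noteq> 0"
        using wq e unfolding w_def by (simp add: prod_zero_iff)
      then have "\<bar>real a * (inner y e - real_of_int (q e) / real a)\<bar> < 1" by (rule hat_bounds)
      then show ?thesis using a0 by (simp add: abs_mult pos_less_divide_eq mult.commute)
    qed
    have shq: "\<bar>inner (sh q) e - real_of_int (q e) / real a\<bar> \<le> 2 / real a" if e: "e \<in> Basis" for e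
    proof -
      have "\<bar>sgn x * max 0 (\<bar>x\<bar> - 2) - x\<bar> \<le> 2" for x :: real by (auto simp: sgn_if max_def)
      from divide_right_mono[OF this[of "real_of_int (q e)"], of "real a"] show ?thesis
        unfolding she[OF e] using a0 by (simp add: diff_divide_distrib[symmetric] abs_divide)
    qed
    have yz: "\<bar>inner (y - z q) b\<bar> \<le> 2 * R" "\<bar>inner (\<pi> - z q) b\<bar> \<le> 2 * R" if b: "b \<in> Basis" for b
      using y SR[OF zS b, of q] SR[OF \<pi>S b] b unfolding inner_diff_left by (smt (verit, ccfv_SIG))+
    have l1y: "l1 (y - \<pi>) \<le> D * \<nu>" unfolding D_def \<nu>_def by (rule l1_le_norm)
    show ?thesis
    proof (cases "\<nu> \<le> 1 / real a")
      case True
      have \<pi>q: "\<bar>inner \<pi> e - real_of_int (q e) / real a\<bar> < 2 / real a" if e: "e \<in> Basis" for e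
      proof -
        have "\<bar>inner (y - \<pi>) e\<bar> \<le> \<nu>" unfolding \<nu>_def using e by (rule Basis_le_norm)
        then have "\<bar>inner y e - inner \<pi> e\<bar> \<le> 1 / real a" using True by (simp add: inner_diff_left)
        moreover have "2 / real a = 1 / real a + 1 / real a" by simp
        ultimately show ?thesis using near[OF e] by linarith
      qed
      have "toward0 (sh q) \<pi>" unfolding toward0_def
      proof
        fix e :: 'a assume e: "e \<in> Basis"
        let ?x = "real_of_int (q e)"
        have lt: "\<bar>real a * inner \<pi> e - ?x\<bar> < 2" using \<pi>q[OF e] a0 by (simp add: field_simps abs_less_iff)
        have eq: "real a * inner (sh q) e = sgn ?x * max 0 (\<bar>?x\<bar> - 2)" using she[OF e] a0 by simp
        have "0 \<le> real a * inner (sh q) e \<and> real a * inner (sh q) e \<le> real a * inner \<pi> e \<or>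
            real a * inner \<pi> e \<le> real a * inner (sh q) e \<and> real a * inner (sh q) e \<le> 0"
          unfolding eq using lt by (auto simp: sgn_if max_def)
        then show "0 \<le> inner (sh q) e \<and> inner (sh q) e \<le> inner \<pi> e \<or> inner \<pi> e \<le> inner (sh q) e \<and> inner (sh q) e \<le> 0"
          using a0 by (simp add: zero_le_mult_iff mult_le_0_iff)
      qed
      then have shS: "sh q \<in> S" "toward0 (sh q) \<pi>" using S(5) \<pi>S unfolding solid_def by blast+
      then have zsh: "z q = sh q" unfolding z_def by (simp add: closest_point_self)
      have "l1 (\<pi> - z q) \<le> (\<Sum>b\<in>(Basis :: 'a set). 4 / real a)"
        unfolding l1_def
      proof (rule sum_mono)
        fix e :: 'a assume e: "e \<in> Basis"
        have "4 / real a = 2 / real a + 2 / real a" by simp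
        then show "\<bar>inner (\<pi> - z q) e\<bar> \<le> 4 / real a"
          using \<pi>q[OF e] shq[OF e] unfolding zsh inner_diff_left by linarith
      qed
      then have "l1 (\<pi> - z q) \<le> 4 * D / real a" by (simp add: D_def mult.commute)
      then have "l1 (\<pi> - z q) ^ s \<le> (4 * D / real a) ^ s" by (intro power_mono l1_nonneg)
      then have "N * M * l1 (\<pi> - z q) ^ s \<le> N * M * (4 * D) ^ s * (1 / real a ^ s)"
        using N1 M0 mult_left_mono[of "l1 (\<pi> - z q) ^ s" "(4 * D / real a) ^ s" "N * M"] by (simp add: power_divide)
      then have 1: "\<bar>g \<pi> - tval (T q) (\<pi> - z q)\<bar> \<le> N * M * (4 * D) ^ s * (1 / real a ^ s)"
        using Tt[OF \<pi>S, of q] shS(2) zsh by simp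
      have "\<bar>tval (T q) (y - z q) - tval (T q) (\<pi> - z q)\<bar> \<le> N * E * l1 ((y - z q) - (\<pi> - z q))"
        by (rule Tl) (use yz in auto)
      also have "\<dots> \<le> N * E * (D * \<nu>)" using l1y N1 E0 by (intro mult_left_mono) auto
      finally have 2: "\<bar>tval (T q) (y - z q) - tval (T q) (\<pi> - z q)\<bar> \<le> N * E * D * \<nu>" by simp
      have "\<nu> \<ge> 0" by (simp add: \<nu>_def)
      then have "N * M * (4 * D) ^ s * (1 / real a ^ s) \<le> C * (1 / real a ^ s)" "N * E * D * \<nu> \<le> C * \<nu>"
        using N1 M0 E0 D1 unfolding C_def
        by (intro mult_right_mono; simp add: algebra_simps)+
      with 1 2 show ?thesis unfolding \<pi>_def[symmetric] \<nu>_def[symmetric] distrib_left by linarith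
    next
      case False
      then have \<nu>a: "1 / real a < \<nu>" by simp
      then have \<nu>0: "\<nu> \<ge> 0" by (simp add: \<nu>_def)
      \<comment> \<open>Both points are projections onto the convex set S, and projecting does not
        increase distances.\<close>
      have "norm (\<pi> - z q) \<le> norm (y - sh q)"
        using closest_point_lipschitz[OF S(2,3,4), of y "sh q"] by (simp add: \<pi>_def z_def dist_norm)
      also have "\<dots> \<le> l1 (y - sh q)" by (rule norm_le_l1')
      also have "\<dots> \<le> (\<Sum>b\<in>(Basis :: 'a set). 3 / real a)"
        unfolding l1_def
      proof (rule sum_mono)
        fix e :: 'a assume e: "e \<in> Basis"
        have "3 / real a = 1 / real a + 2 / real a" by (simp add: add_divide_distrib[symmetric])
        then show "\<bar>inner (y - sh q) e\<bar> \<le> 3 / real a"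
          using near[OF e] shq[OF e] unfolding inner_diff_left by linarith
      qed
      also have "\<dots> = 3 * D * (1 / real a)" by (simp add: D_def)
      also have "\<dots> \<le> 3 * D * \<nu>" using \<nu>a D1 by (intro mult_left_mono) auto
      finally have nz: "norm (\<pi> - z q) \<le> 3 * D * \<nu>" .
      have lz: "l1 (\<pi> - z q) \<le> 3 * D\<^sup>2 * \<nu>"
        using order_trans[OF l1D[of "\<pi> - z q"] mult_left_mono[OF nz, of D]] D1
        by (simp add: power2_eq_square algebra_simps)
      have lyz: "l1 (y - z q) \<le> D * \<nu> + 3 * D\<^sup>2 * \<nu>" using l1_triangle[of y "z q" \<pi>] l1y lz by linarith
      have "\<bar>tval (T q) (y - z q) - tval (T q) 0\<bar> \<le> N * E * l1 (y - z q - 0)"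
        by (rule Tl) (use yz assms(2) in auto)
      also have "\<dots> \<le> N * E * (D * \<nu> + 3 * D\<^sup>2 * \<nu>)" using lyz N1 E0 by (intro mult_left_mono) auto
      finally have 1: "\<bar>tval (T q) (y - z q) - tval (T q) 0\<bar> \<le> N * E * (D + 3 * D\<^sup>2) * \<nu>" by (simp add: algebra_simps)
      \<comment> \<open>The Taylor estimate at the centre itself, where the remainder is 0 because s
        is at least 1.\<close>
      have 2: "tval (T q) 0 = g (z q)"
        using Tt[OF zS toward0_refl, of q] assms(1) by (simp add: l1_def power_0_left)
      have "\<bar>g (z q) - g \<pi>\<bar> \<le> 2 ^ DIM('a) * M * l1 (z q - \<pi>)"
        by (rule lipschitz_solid[OF assms(5,1) S(5) zS \<pi>S])
      also have "l1 (z q - \<pi>) = l1 (\<pi> - z q)" unfolding l1_def by (simp add: inner_diff_left abs_minus_commute)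
      also have "2 ^ DIM('a) * M * l1 (\<pi> - z q) \<le> 2 ^ DIM('a) * M * (3 * D\<^sup>2 * \<nu>)"
        using lz M0 by (intro mult_left_mono) auto
      finally have 3: "\<bar>g (z q) - g \<pi>\<bar> \<le> 2 ^ DIM('a) * M * (3 * D\<^sup>2) * \<nu>" by (simp add: algebra_simps)
      have "N * E * (D + 3 * D\<^sup>2) * \<nu> + 2 ^ DIM('a) * M * (3 * D\<^sup>2) * \<nu> \<le> C * \<nu>"
        unfolding C_def distrib_right[symmetric] using N1 M0 E0 D1 \<nu>0
        by (intro mult_right_mono) (auto simp: algebra_simps)
      moreover have "C * \<nu> \<le> C * (1 / real a ^ s + \<nu>)"
        using N1 M0 E0 D1 a0 unfolding C_def by (intro mult_left_mono) auto
      ultimately show ?thesis using 1 2 3 unfolding \<pi>_def[symmetric] \<nu>_def[symmetric] by linarith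
    qed
  qed
  obtain qs where qs: "set qs = Q" "distinct qs" using finite_distinct_list[OF finQ] by blast
  define U where "U q = map (\<lambda>(c, \<beta>). (c, map (\<lambda>e. (True, e, real_of_int (q e) / real a)) basis_list @ map (\<lambda>b. (False, b, inner (z q) b)) \<beta>)) (T q)" for q
  define F where "F = concat (map U qs)"
  have blen: "length (basis_list :: 'a list) = DIM('a)" using basis_list distinct_card by metis
  have Uval: "fval a (U q) y = w q y * tval (T q) (y - z q)" for q y
  proof -
    have "prod_list (map (\<lambda>e. hat (real a * (inner y e - real_of_int (q e) / real a))) basis_list) = w q y"
      unfolding w_def basis_list(2)[symmetric] by (rule prod.distinct_set_conv_list[symmetric]) (rule basis_list)
    then have w: "prod_list (map ((\<lambda>f. fac a f y) \<circ> (\<lambda>e. (True, e, real_of_int (q e) / real a))) basis_list) = w q y"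
      by (simp add: fac_def o_def)
    have m: "prod_list (map ((\<lambda>f. fac a f y) \<circ> (\<lambda>b. (False, b, inner (z q) b))) \<beta>) = mono_val \<beta> (y - z q)" for \<beta>
      by (simp add: fac_def o_def mono_val_def inner_diff_left cong: map_cong)
    have "fval a (map (\<lambda>(c, \<beta>). (c, map (\<lambda>e. (True, e, real_of_int (q e) / real a)) basis_list @ map (\<lambda>b. (False, b, inner (z q) b)) \<beta>)) ts) y
      = w q y * tval ts (y - z q)" for ts
      by (induction ts) (auto simp: fval_def w m algebra_simps)
    then show ?thesis by (simp add: U_def)
  qed
  have fvalF: "fval a F y = (\<Sum>q\<in>Q. w q y * tval (T q) (y - z q))" for y
  proof -
    have "fval a F y = (\<Sum>q\<leftarrow>qs. fval a (U q) y)"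
      unfolding F_def by (induction qs) (auto simp: fval_def)
    then show ?thesis using qs by (simp add: Uval sum_list_distinct_conv_sum_set)
  qed
  have cardQ: "real (card Q) \<le> ((2 * R + 3) * real a) ^ DIM('a)"
  proof -
    have "card Q = (nat (2 * A + 1)) ^ DIM('a)"
      unfolding Q_def using A0 by (simp add: card_PiE)
    then have "real (card Q) = real (nat (2 * A + 1)) ^ DIM('a)" by simp
    also have "\<dots> \<le> ((2 * R + 3) * real a) ^ DIM('a)"
    proof (rule power_mono)
      have "real (nat (2 * A + 1)) = 2 * (real a * real_of_int Rc) + 1" using A0 by (simp add: A_def)
      also have "\<dots> \<le> 2 * (real a * (R + 1)) + real a" using Rc(2) a0 assms(3) by (intro add_mono mult_left_mono) auto
      finally show "real (nat (2 * A + 1)) \<le> (2 * R + 3) * real a" by (simp add: algebra_simps)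
    qed simp
    finally show ?thesis .
  qed
  have "real (length F) = (\<Sum>q\<in>Q. real (length (T q)))"
    unfolding F_def using qs by (simp add: U_def length_concat o_def sum_list_distinct_conv_sum_set)
  also have "\<dots> \<le> real (card Q) * N" using sum_mono[of Q "\<lambda>q. real (length (T q))" "\<lambda>_. N"] Tlen by simp
  also have "\<dots> \<le> ((2 * R + 3) * real a) ^ DIM('a) * N" using cardQ N1 by (intro mult_right_mono) auto
  finally have lenF: "real (length F) \<le> N * (2 * R + 3) ^ DIM('a) * real a ^ DIM('a)" by (simp add: power_mult_distrib mult_ac)
  have okF: "net_ok (DIM('a) + s) M (R + 1) F"
  proof (rule net_okI)
    fix c fs assume "(c, fs) \<in> set F"
    then obtain q \<beta> where q: "q \<in> Q" "(c, \<beta>) \<in> set (T q)"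
      "fs = map (\<lambda>e. (True, e, real_of_int (q e) / real a)) basis_list @ map (\<lambda>b. (False, b, inner (z q) b)) \<beta>"
      by (auto simp: F_def U_def qs)
    have c: "\<bar>c\<bar> \<le> M" "set \<beta> \<subseteq> Basis" "length \<beta> < s" using Tc[of q] q(2) by fast+
    then show "\<bar>c\<bar> \<le> M \<and> length fs \<le> DIM('a) + s" by (simp add: q(3) blen)
    fix h e v assume "(h, e, v) \<in> set fs"
    then consider "e \<in> Basis" "v = real_of_int (q e) / real a" | "e \<in> Basis" "v = inner (z q) e"
      using c(2) basis_list(2) by (auto simp: q(3))
    then show "e \<in> Basis \<and> \<bar>v\<bar> \<le> R + 1"
    proof cases
      case 1
      have "\<bar>q e\<bar> \<le> A" using q(1) 1(1) unfolding Q_def by (auto simp: PiE_iff abs_le_iff)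
      then have "\<bar>real_of_int (q e)\<bar> \<le> real a * real_of_int Rc" unfolding A_def
        by (metis of_int_abs of_int_le_iff of_int_mult of_int_of_nat_eq)
      also have "\<dots> \<le> real a * (R + 1)" using Rc a0 by (intro mult_left_mono) auto
      finally show ?thesis using 1 a0 by (simp add: abs_divide pos_divide_le_eq mult.commute)
    next
      case 2
      then show ?thesis using SR[OF zS, of e q] by simp
    qed
  qed
  have est: "\<bar>fval a F y - g q0\<bar> \<le> (N * M * (4 * D) ^ s + N * (M * (real s * (2 * R) ^ s)) * (2 * D + 3 * D\<^sup>2) + 2 ^ DIM('a) * M * (D + 3 * D\<^sup>2))
         * (1 / real a ^ s + norm (y - q0))"
    if y: "\<forall>b\<in>Basis. \<bar>inner y b\<bar> \<le> R" and q0: "q0 \<in> S" for y q0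
  proof -
    define \<pi> where "\<pi> = closest_point S y"
    have \<pi>S: "\<pi> \<in> S" unfolding \<pi>_def using S by (intro closest_point_in_set) auto
    let ?X = "1 / real a ^ s + norm (y - \<pi>)"
    have C0: "C \<ge> 0" unfolding C_def using N1 M0 E0 D1 by auto
    have "fval a F y - g \<pi> = (\<Sum>q\<in>Q. w q y * (tval (T q) (y - z q) - g \<pi>))"
      using wsum[OF y] by (simp add: fvalF right_diff_distrib sum_subtractf sum_distrib_right[symmetric])
    also have "\<bar>\<dots>\<bar> \<le> (\<Sum>q\<in>Q. w q y * (C * ?X))"
    proof (rule order_trans[OF sum_abs sum_mono])
      fix q assume "q \<in> Q"
      show "\<bar>w q y * (tval (T q) (y - z q) - g \<pi>)\<bar> \<le> w q y * (C * ?X)"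
        using node[OF y, of q] w0[of q y] unfolding \<pi>_def[symmetric]
        by (cases "w q y = 0") (auto simp: abs_mult intro!: mult_left_mono)
    qed
    also have "\<dots> = C * ?X" using wsum[OF y] by (simp add: sum_distrib_right[symmetric])
    finally have 1: "\<bar>fval a F y - g \<pi>\<bar> \<le> C * ?X" .
    \<comment> \<open>The estimate so far concerns the closest point of y. Any other point of S is
      at least as far from y, and by nonexpansiveness \<pi> is no farther from it than y is.\<close>
    have ny: "norm (y - \<pi>) \<le> norm (y - q0)"
      using closest_point_le[OF S(3) q0, of y] by (simp add: \<pi>_def dist_norm)
    have n\<pi>: "norm (\<pi> - q0) \<le> norm (y - q0)"
      using closest_point_lipschitz[OF S(2,3,4), of y q0] closest_point_self[OF q0] by (simp add: \<pi>_def dist_norm)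
    have "\<bar>g \<pi> - g q0\<bar> \<le> 2 ^ DIM('a) * M * l1 (\<pi> - q0)"
      by (rule lipschitz_solid[OF assms(5,1) S(5) \<pi>S q0])
    also have "\<dots> \<le> 2 ^ DIM('a) * M * (D * norm (y - q0))"
      using order_trans[OF l1D[of "\<pi> - q0"] mult_left_mono[OF n\<pi>, of D]] D1 M0
      by (intro mult_left_mono) auto
    also have "\<dots> \<le> 2 ^ DIM('a) * M * D * (1 / real a ^ s + norm (y - q0))"
      using M0 D1 by (simp add: algebra_simps)
    finally have 2: "\<bar>g \<pi> - g q0\<bar> \<le> 2 ^ DIM('a) * M * D * (1 / real a ^ s + norm (y - q0))" .
    have "C * ?X \<le> C * (1 / real a ^ s + norm (y - q0))" using ny C0 by (intro mult_left_mono) auto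
    with 1 2 have "\<bar>fval a F y - g q0\<bar> \<le> (C + 2 ^ DIM('a) * M * D) * (1 / real a ^ s + norm (y - q0))"
      unfolding distrib_right by linarith
    then show ?thesis by (simp add: C_def E_def algebra_simps)
  qed
  show ?thesis using lenF okF est by (intro exI[of _ F]) blast
qed

section \<open>Circuits for the glued Taylor polynomials\<close>

definition clip :: "real \<Rightarrow> real \<Rightarrow> real" where
  "clip R x = relu (x + R) - relu (x - R) - R"

lemma clip_eq: "R \<ge> 0 \<Longrightarrow> clip R x = max (- R) (min R x)"
  by (auto simp: clip_def relu_def max_def min_def)

text \<open>The error estimate has to hold for every argument, but product networks are accurate
  only for bounded factors. Clipping to the cube with coordinates in [- R, R] reconciles the two,
  since it brings y no farther from any point of that cube.\<close>

definition clipv :: "real \<Rightarrow> 'a::euclidean_space \<Rightarrow> 'a" where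
  "clipv R y = (\<Sum>e\<in>Basis. clip R (inner y e) *\<^sub>R e)"

lemma clipv_inner: "e \<in> Basis \<Longrightarrow> inner (clipv R y) e = clip R (inner y e)"
  unfolding clipv_def by (rule inner_sum_left_Basis)

lemma clipv_bound: "R \<ge> 0 \<Longrightarrow> e \<in> Basis \<Longrightarrow> \<bar>inner (clipv R y) e\<bar> \<le> R"
  by (auto simp: clipv_inner clip_eq max_def min_def)

lemma clipv_norm:
  assumes "R \<ge> 0" "\<And>b. b \<in> Basis \<Longrightarrow> \<bar>inner q b\<bar> \<le> R"
  shows "norm (clipv R y - q) \<le> norm (y - q)"
proof (rule norm_le_componentwise)
  fix b :: 'a assume b: "b \<in> Basis"
  show "\<bar>inner (clipv R y - q) b\<bar> \<le> \<bar>inner (y - q) b\<bar>"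
    using assms(2)[OF b] assms(1) by (auto simp: inner_diff_left clipv_inner[OF b] clip_eq max_def min_def)
qed

lemma computes_clipv:
  fixes Y :: "'x \<Rightarrow> 'a::euclidean_space"
  assumes "\<And>e. e \<in> Basis \<Longrightarrow> (\<lambda>x. inner (Y x) e) \<in> A"
  shows "computes A 2 (DIM('a) * 7) (\<Union>e\<in>Basis. {\<lambda>x. inner (clipv R (Y x)) e})"
proof -
  have "computes A 2 7 {\<lambda>x. inner (clipv R (Y x)) e}" if e: "e \<in> Basis" for e
  proof -
    let ?p = "\<lambda>x. relu (1 * inner (Y x) e + R)" and ?m = "\<lambda>x. relu (1 * inner (Y x) e + (- R))"
    have 1: "computes A 1 (2 + 2) ({?p} \<union> {?m})"
      by (intro computes_union computes_relu1 assms[OF e])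
    have 2: "computes (A \<union> ({?p} \<union> {?m})) 1 3 {\<lambda>x. 1 * ?p x + (- 1) * ?m x + (- R)}"
      by (rule computes_lin2) (simp_all only: Un_iff insert_iff simp_thms)
    have "(\<lambda>x. 1 * ?p x + (- 1) * ?m x + (- R)) = (\<lambda>x. inner (clipv R (Y x)) e)"
      by (simp add: clipv_inner[OF e] clip_def)
    with computes_then[OF 1 2] show ?thesis by (simp add: numeral_2_eq_2)
  qed
  then show ?thesis by (intro computes_UN_const) auto
qed

lemma hat_relu: "hat x = relu (x + 1) - 2 * relu x + relu (x - 1)"
  by (auto simp: hat_def relu_def max_def)

lemma computes_fac:
  fixes Z :: "'x \<Rightarrow> 'a::euclidean_space"
  assumes "\<And>e. e \<in> Basis \<Longrightarrow> (\<lambda>x. inner (Z x) e) \<in> A" "fst (snd f) \<in> Basis"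
  shows "computes A 2 9 {\<lambda>x. fac a f (Z x)}"
proof -
  obtain h e v where f: "f = (h, e, v)" by (cases f)
  have e: "(\<lambda>x. inner (Z x) e) \<in> A" using assms f by simp
  show ?thesis
  proof (cases h)
    case False
    have "computes A 1 2 {\<lambda>x. 1 * inner (Z x) e + (- v)}" by (rule computes_lin1[OF e])
    then show ?thesis using False f by (auto simp: fac_def elim!: computes_mono)
  next
    case True
    let ?r = "\<lambda>c x. relu (real a * inner (Z x) e + (c - real a * v))"
    have 1: "computes A 1 (2 + (2 + 2)) ({?r 1} \<union> ({?r 0} \<union> {?r (- 1)}))"
      by (intro computes_union computes_relu1 e)
    let ?ts = "[(1 :: real, ?r 1), (- 2, ?r 0), (1, ?r (- 1))]"
    have "computes (A \<union> ({?r 1} \<union> ({?r 0} \<union> {?r (- 1)}))) 1 (length ?ts) {lc ?ts}"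
      by (rule computes_lc) auto
    moreover have "lc ?ts = (\<lambda>x. fac a f (Z x))"
      using True f by (simp add: fun_eq_iff fac_def hat_relu algebra_simps)
    ultimately have "computes (A \<union> ({?r 1} \<union> ({?r 0} \<union> {?r (- 1)}))) 1 3 {\<lambda>x. fac a f (Z x)}" by (simp add: numeral_3_eq_3)
    from computes_then[OF 1 this] show ?thesis by (simp add: numeral_2_eq_2)
  qed
qed

lemma sum_list_prod_net_error:
  assumes "\<And>c fs. (c, fs) \<in> set F \<Longrightarrow> \<bar>c\<bar> \<le> M \<and> \<bar>P fs - Q fs\<bar> \<le> (d::real)" "M \<ge> 0"
  shows "\<bar>(\<Sum>(c, fs)\<leftarrow>F. c * P fs) - (\<Sum>(c, fs)\<leftarrow>F. c * Q fs)\<bar> \<le> real (length F) * (M * d)"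
  using assms(1)
proof (induction F)
  case (Cons t F)
  obtain c fs where t: "t = (c, fs)" by force
  have "\<bar>c\<bar> \<le> M" "\<bar>P fs - Q fs\<bar> \<le> d" using Cons.prems[of c fs] by (auto simp: t)
  then have "\<bar>c * (P fs - Q fs)\<bar> \<le> M * d" unfolding abs_mult using assms(2) by (intro mult_mono) auto
  moreover have "\<bar>(\<Sum>(c, fs)\<leftarrow>F. c * P fs) - (\<Sum>(c, fs)\<leftarrow>F. c * Q fs)\<bar> \<le> real (length F) * (M * d)"
    by (rule Cons.IH) (use Cons.prems in auto)
  ultimately show ?case by (simp add: t algebra_simps)
qed simp

text \<open>The scalar \<tau> enters each product as one more factor, hence the + 1 in
  \<open>m\<close>; it will be the time t, which scales the steps of the polygon. The mesh 1/a and
  the number n of teeth are independent: n determines the cost of a product, while the number p of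
  squaring steps pushes its error below any prescribed power of 1/n at the price of a constant
  factor.\<close>

lemma net_approximation:
  fixes s p :: nat and R M :: real
  assumes "s \<ge> 1" "R \<ge> 1" "M \<ge> 0" "p \<ge> 1"
  shows "\<exists>(C::nat) L. C \<ge> 1 \<and> (\<forall>(\<Omega> :: 'a::euclidean_space set) S g a n.
    a \<ge> 1 \<longrightarrow> n \<ge> C \<longrightarrow> solid_body R S \<longrightarrow> Ck_bound s M \<Omega> S g \<longrightarrow>
    (\<exists>H :: real \<Rightarrow> 'a \<Rightarrow> real.
      (\<forall>\<tau> y. \<forall>q\<in>S. \<bar>\<tau>\<bar> \<le> R \<longrightarrow>
        \<bar>H \<tau> y - \<tau> * g q\<bar> \<le> real C * (1 / real a ^ s + real a ^ DIM('a) / real n ^ (2 * p) + norm (y - q))) \<and>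
      (\<forall>A (Y :: 'x \<Rightarrow> 'a) \<tau>. \<tau> \<in> A \<longrightarrow> (\<forall>e\<in>Basis. (\<lambda>x. inner (Y x) e) \<in> A) \<longrightarrow>
        computes A L (C * n * a ^ DIM('a)) {\<lambda>x. H (\<tau> x) (Y x)})))"
proof -
  define D where "D = real DIM('a)"
  define N where "N = real (Suc s ^ DIM('a))"
  define C1 where "C1 = nat \<lceil>N * (2 * R + 3) ^ DIM('a)\<rceil>"
  define C2 where "C2 = N * M * (4 * D) ^ s + N * (M * (real s * (2 * R) ^ s)) * (2 * D + 3 * D\<^sup>2) + 2 ^ DIM('a) * M * (D + 3 * D\<^sup>2)"
  define m where "m = DIM('a) + s + 1"
  \<comment> \<open>A linear factor is the difference of a clipped coordinate, at most R, and a
    centre, at most R + 1; hats and \<tau> are smaller.\<close>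
  define K where "K = 2 * R + 1"
  define B where "B = K ^ m + 1"
  define C3 where "C3 = B\<^sup>2 * real m * K ^ m"
  define C4 where "C4 = 7 * DIM('a) + C1 * (52 * m * p + 1) + 1"
  define C where "C = nat \<lceil>C3\<rceil> + nat \<lceil>real C1 * M * C3\<rceil> + nat \<lceil>R * C2\<rceil> + C4"
  \<comment> \<open>Two layers for clipping, two for the factors, then the products of up to m
    factors, and one for the sum over all terms.\<close>
  define L where "L = 2 + (2 + (m * (3 * p + 3) + 1) + 1)"
  have K1: "K \<ge> 1" using assms(2) by (simp add: K_def)
  have B0: "B > 0" using K1 unfolding B_def by (simp add: add_nonneg_pos)
  have C3p: "C3 \<ge> 0" using K1 by (simp add: C3_def)
  have CC: "real C \<ge> C3" "real C \<ge> real C1 * M * C3" "real C \<ge> R * C2" "C \<ge> C4"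
    unfolding C_def by (linarith, linarith, linarith, simp)
  have "\<exists>H :: real \<Rightarrow> 'a \<Rightarrow> real.
      (\<forall>\<tau> y. \<forall>q\<in>S. \<bar>\<tau>\<bar> \<le> R \<longrightarrow>
        \<bar>H \<tau> y - \<tau> * g q\<bar> \<le> real C * (1 / real a ^ s + real a ^ DIM('a) / real n ^ (2 * p) + norm (y - q))) \<and>
      (\<forall>A (Y :: 'x \<Rightarrow> 'a) \<tau>. \<tau> \<in> A \<longrightarrow> (\<forall>e\<in>Basis. (\<lambda>x. inner (Y x) e) \<in> A) \<longrightarrow>
        computes A L (C * n * a ^ DIM('a)) {\<lambda>x. H (\<tau> x) (Y x)})"
    if a: "a \<ge> 1" and n: "n \<ge> C" and S: "solid_body R S" and g: "Ck_bound s M \<Omega> S g" for \<Omega> S :: "'a set" and g a n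
  proof -
    have n0: "n > 0" using n CC(4) by (simp add: C4_def)
    obtain F where F: "real (length F) \<le> N * (2 * R + 3) ^ DIM('a) * real a ^ DIM('a)" "net_ok (DIM('a) + s) M (R + 1) F"
      and Fe: "\<And>y q. \<forall>b\<in>Basis. \<bar>inner y b\<bar> \<le> R \<Longrightarrow> q \<in> S \<Longrightarrow> \<bar>fval a F y - g q\<bar> \<le> C2 * (1 / real a ^ s + norm (y - q))"
      using partition_approximation[OF assms(1,2) a S g] unfolding C2_def D_def N_def by blast
    have lenF: "length F \<le> C1 * a ^ DIM('a)"
    proof -
      have "real (length F) \<le> real C1 * real a ^ DIM('a)"
        using F(1) mult_right_mono[of "N * (2 * R + 3) ^ DIM('a)" "real C1" "real a ^ DIM('a)"]
        unfolding C1_def by (smt (verit, best) real_nat_ceiling_ge zero_le_power of_nat_0_le_iff)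
      then have "real (length F) \<le> real (C1 * a ^ DIM('a))" by simp
      then show ?thesis by (simp only: of_nat_le_iff)
    qed
    define T where "T fs \<tau> z = prod_net B n p (\<tau> # map (\<lambda>f. fac a f z) fs)" for fs \<tau> and z :: 'a
    define H where "H \<tau> y = (\<Sum>(c, fs)\<leftarrow>F. c * T fs \<tau> (clipv R y))" for \<tau> y
    have R0: "R \<ge> 0" using assms(2) by simp
    have err: "\<bar>H \<tau> y - \<tau> * g q\<bar> \<le> real C * (1 / real a ^ s + real a ^ DIM('a) / real n ^ (2 * p) + norm (y - q))"
      if q: "q \<in> S" and \<tau>: "\<bar>\<tau>\<bar> \<le> R" for \<tau> y q
    proof -
      let ?z = "clipv R y" and ?e = "C3 / real n ^ (2 * p)"
      have zb: "\<bar>inner ?z b\<bar> \<le> R" if "b \<in> Basis" for b using clipv_bound[OF R0 that] .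
      have "\<bar>(\<Sum>(c, fs)\<leftarrow>F. c * T fs \<tau> ?z) - (\<Sum>(c, fs)\<leftarrow>F. c * (\<tau> * (\<Prod>f\<leftarrow>fs. fac a f ?z)))\<bar> \<le> real (length F) * (M * ?e)"
      proof (rule sum_list_prod_net_error)
        fix c fs assume cf: "(c, fs) \<in> set F"
        then have ok: "\<bar>c\<bar> \<le> M" "length fs \<le> DIM('a) + s" "\<And>h e v. (h, e, v) \<in> set fs \<Longrightarrow> e \<in> Basis \<and> \<bar>v\<bar> \<le> R + 1"
          using F(2) unfolding net_ok_def by fast+
        let ?xs = "\<tau> # map (\<lambda>f. fac a f ?z) fs"
        have xs: "\<bar>x\<bar> \<le> K" if "x \<in> set ?xs" for x
        proof (cases "x = \<tau>")
          case True
          then show ?thesis using \<tau> assms(2) by (simp add: K_def)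
        next
          case False
          with that obtain h e v where f: "(h, e, v) \<in> set fs" "x = fac a (h, e, v) ?z" by auto
          have "\<bar>inner ?z e - v\<bar> \<le> K" using zb[of e] ok(3)[OF f(1)] by (auto simp: K_def)
          moreover have "\<bar>hat u\<bar> \<le> K" for u using hat_bounds(1,2)[of u] K1 by auto
          ultimately show ?thesis using f(2) by (auto simp: fac_def)
        qed
        have lx: "length ?xs \<le> m" using ok(2) by (simp add: m_def)
        \<comment> \<open>The lower bound on n serves here: it yields the smallness condition of
          \<open>prod_net_error\<close>.\<close>
        have "C3 \<le> real n" using n CC(1) by linarith
        also have "real n \<le> real n ^ (2 * p)" using n0 assms(4) self_le_power[of "real n" "2 * p"] by simp
        finally have C3n: "C3 \<le> real n ^ (2 * p)" .
        have "\<bar>prod_net B n p ?xs - prod_list ?xs\<bar> \<le> B\<^sup>2 / real n ^ (2 * p) * length ?xs * K ^ length ?xs"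
          by (rule prod_net_error[OF n0 K1 _ B_def _ lx xs]) (use C3n in \<open>auto simp: C3_def m_def\<close>)
        also have "\<dots> \<le> B\<^sup>2 / real n ^ (2 * p) * real m * K ^ m"
          using lx K1 by (intro mult_mono power_increasing) auto
        also have "\<dots> = ?e" by (simp add: C3_def)
        finally show "\<bar>c\<bar> \<le> M \<and> \<bar>T fs \<tau> ?z - \<tau> * (\<Prod>f\<leftarrow>fs. fac a f ?z)\<bar> \<le> ?e"
          using ok(1) by (simp add: T_def)
      qed (rule assms(3))
      moreover have "(\<Sum>(c, fs)\<leftarrow>F. c * (\<tau> * (\<Prod>f\<leftarrow>fs. fac a f ?z))) = \<tau> * fval a F ?z"
        unfolding fval_def by (induction F) (auto simp: algebra_simps)
      ultimately have "\<bar>H \<tau> y - \<tau> * fval a F ?z\<bar> \<le> real (length F) * (M * ?e)" by (simp add: H_def)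
      also have "\<dots> \<le> real (C1 * a ^ DIM('a)) * (M * ?e)"
        using lenF assms(3) C3p by (intro mult_right_mono) (simp_all only: of_nat_le_iff, simp)
      also have "\<dots> = (real C1 * M * C3) * (real a ^ DIM('a) / real n ^ (2 * p))" by simp
      also have "\<dots> \<le> real C * (real a ^ DIM('a) / real n ^ (2 * p))" using CC(2) by (intro mult_right_mono) auto
      finally have 1: "\<bar>H \<tau> y - \<tau> * fval a F ?z\<bar> \<le> real C * (real a ^ DIM('a) / real n ^ (2 * p))" .
      have qR: "\<And>b. b \<in> Basis \<Longrightarrow> \<bar>inner q b\<bar> \<le> R" using S q by (auto simp: solid_body_def)
      have C2p: "C2 \<ge> 0" using assms(2,3) by (simp add: C2_def N_def D_def)
      have "\<bar>\<tau> * fval a F ?z - \<tau> * g q\<bar> = \<bar>\<tau>\<bar> * \<bar>fval a F ?z - g q\<bar>" by (simp add: abs_mult[symmetric] right_diff_distrib)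
      also have "\<dots> \<le> R * (C2 * (1 / real a ^ s + norm (?z - q)))"
        using \<tau> R0 Fe[OF _ q, of ?z] zb by (intro mult_mono) auto
      also have "\<dots> \<le> R * (C2 * (1 / real a ^ s + norm (y - q)))"
        using clipv_norm[OF R0 qR, of y] R0 C2p by (intro mult_left_mono add_left_mono) auto
      also have "\<dots> \<le> real C * (1 / real a ^ s + norm (y - q))"
        using CC(3) by (simp add: mult.assoc[symmetric] mult_right_mono)
      finally have "\<bar>\<tau> * fval a F ?z - \<tau> * g q\<bar> \<le> real C * (1 / real a ^ s + norm (y - q))" .
      with 1 show ?thesis by (simp add: algebra_simps)
    qed
    have comp: "computes A L (C * n * a ^ DIM('a)) {\<lambda>x. H (\<tau> x) (Y x)}"
      if \<tau>: "\<tau> \<in> A" and Y: "\<forall>e\<in>Basis. (\<lambda>x. inner (Y x) e) \<in> A" for A and Y :: "'x \<Rightarrow> 'a" and \<tau>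
    proof -
      define Z where "Z = (\<Union>e\<in>Basis. {\<lambda>x. inner (clipv R (Y x)) e})"
      have cZ: "computes A 2 (DIM('a) * 7) Z" unfolding Z_def by (rule computes_clipv) (use Y in blast)
      have Zin: "(\<lambda>x. inner (clipv R (Y x)) e) \<in> A \<union> Z" if "e \<in> Basis" for e using that unfolding Z_def by blast
      define t where "t j = (\<lambda>x. T (snd (F ! j)) (\<tau> x) (clipv R (Y x)))" for j
      have term1: "computes (A \<union> Z) (2 + (m * (3 * p + 3) + 1)) (52 * m * p * n) {t j}" if j: "j < length F" for j
      proof -
        obtain c fs where cf: "F ! j = (c, fs)" by force
        then have "(c, fs) \<in> set F" using j by (metis nth_mem)
        then have ok: "length fs \<le> DIM('a) + s" "\<And>h e v. (h, e, v) \<in> set fs \<Longrightarrow> e \<in> Basis"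
          using F(2) unfolding net_ok_def by fast+
        have lm: "length fs + 1 \<le> m" using ok by (simp add: m_def)
        let ?G = "\<lambda>i. {\<lambda>x. fac a (fs ! i) (clipv R (Y x))}"
        have "computes (A \<union> Z) 2 (card {..<length fs} * 9) (\<Union>i\<in>{..<length fs}. ?G i)"
        proof (rule computes_UN_const)
          fix i assume i: "i \<in> {..<length fs}"
          then have "fs ! i \<in> set fs" by simp
          then have "fst (snd (fs ! i)) \<in> Basis" using ok(2) by (metis prod.collapse)
          then show "computes (A \<union> Z) 2 9 (?G i)" by (intro computes_fac Zin)
        qed simp
        then have c1: "computes (A \<union> Z) 2 (length fs * 9) (\<Union>i\<in>{..<length fs}. ?G i)" by simp
        let ?fs = "\<tau> # map (\<lambda>f x. fac a f (clipv R (Y x))) fs"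
        have "set ?fs \<subseteq> (A \<union> Z) \<union> (\<Union>i\<in>{..<length fs}. ?G i)"
        proof
          fix h assume "h \<in> set ?fs"
          then consider "h = \<tau>" | f where "f \<in> set fs" "h = (\<lambda>x. fac a f (clipv R (Y x)))" by auto
          then show "h \<in> (A \<union> Z) \<union> (\<Union>i\<in>{..<length fs}. ?G i)"
          proof cases
            case (2 f)
            then obtain i where "i < length fs" "fs ! i = f" by (meson in_set_conv_nth)
            then show ?thesis using 2(2) by blast
          qed (use \<tau> in simp)
        qed
        from computes_prod_net[OF this n0 B0, of p]
        have "computes ((A \<union> Z) \<union> (\<Union>i\<in>{..<length fs}. ?G i)) (length ?fs * (3 * p + 3) + 1) (length ?fs * (21 + 20 * n * p) + 1) {t j}"
          by (simp add: t_def T_def cf o_def)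
        from computes_then[OF c1 this] show ?thesis
        proof (rule computes_mono)
          have "length ?fs \<le> m" using lm by simp
          then have "length ?fs * (3 * p + 3) \<le> m * (3 * p + 3)" by (rule mult_right_mono) simp
          then show "2 + (length ?fs * (3 * p + 3) + 1) \<le> 2 + (m * (3 * p + 3) + 1)" by simp
          have np: "1 \<le> n * p" using n0 assms(4) by (simp add: Suc_le_eq)
          then have "21 \<le> 21 * (n * p)" by linarith
          then have "length ?fs * (21 + 20 * n * p) \<le> m * (41 * (n * p))"
            using lm by (intro mult_mono) auto
          moreover have "length fs * 9 + 1 \<le> m * (10 * (n * p))"
          proof -
            have "length fs * 9 + 1 \<le> m * (10 * 1)" using lm by linarith
            also have "\<dots> \<le> m * (10 * (n * p))" using np by (intro mult_left_mono) auto
            finally show ?thesis .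
          qed
          ultimately show "length fs * 9 + (length ?fs * (21 + 20 * n * p) + 1) \<le> 52 * m * p * n"
            by (simp add: algebra_simps)
        qed auto
      qed
      define G where "G = (\<Union>j\<in>{..<length F}. {t j})"
      have "computes (A \<union> Z) (2 + (m * (3 * p + 3) + 1)) (card {..<length F} * (52 * m * p * n)) G"
        unfolding G_def by (rule computes_UN_const) (use term1 in auto)
      then have cG: "computes (A \<union> Z) (2 + (m * (3 * p + 3) + 1)) (length F * (52 * m * p * n)) G" by simp
      have "computes (A \<union> Z \<union> G) 1 (card {..<length F} + 1) {\<lambda>x. 0 + (\<Sum>j\<in>{..<length F}. fst (F ! j) * t j x)}"
        by (rule computes_affine) (auto simp: G_def)
      moreover have "(\<lambda>x. 0 + (\<Sum>j\<in>{..<length F}. fst (F ! j) * t j x)) = (\<lambda>x. H (\<tau> x) (Y x))"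
        by (simp add: fun_eq_iff H_def t_def sum_list_sum_nth atLeast0LessThan case_prod_beta)
      ultimately have cH: "computes (A \<union> Z \<union> G) 1 (length F + 1) {\<lambda>x. H (\<tau> x) (Y x)}" by simp
      have "computes A L (DIM('a) * 7 + (length F * (52 * m * p * n) + (length F + 1))) {\<lambda>x. H (\<tau> x) (Y x)}"
        unfolding L_def by (rule computes_then[OF cZ computes_then[OF cG cH]])
      then show ?thesis
      proof (rule computes_mono)
        have an: "1 \<le> n * a ^ DIM('a)" using n0 a by (simp add: Suc_le_eq)
        have nn: "a ^ DIM('a) \<le> n * a ^ DIM('a)" using n0 by simp
        have "DIM('a) * 7 + 1 \<le> (DIM('a) * 7 + 1) * (n * a ^ DIM('a))" using an by (metis mult.right_neutral mult_le_mono2)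
        moreover have "length F * (52 * m * p * n) \<le> (C1 * a ^ DIM('a)) * (52 * m * p * n)" using lenF by (rule mult_le_mono1)
        moreover have "length F \<le> C1 * (n * a ^ DIM('a))" using lenF mult_le_mono2[OF nn, of C1] by linarith
        moreover have "C4 * (n * a ^ DIM('a)) = (DIM('a) * 7 + 1) * (n * a ^ DIM('a)) + (C1 * a ^ DIM('a)) * (52 * m * p * n) + C1 * (n * a ^ DIM('a))"
          by (simp add: C4_def algebra_simps)
        ultimately have "DIM('a) * 7 + (length F * (52 * m * p * n) + (length F + 1)) \<le> C4 * (n * a ^ DIM('a))"
          by linarith
        also have "\<dots> \<le> C * (n * a ^ DIM('a))" using CC(4) by (rule mult_le_mono1)
        finally show "DIM('a) * 7 + (length F * (52 * m * p * n) + (length F + 1)) \<le> C * n * a ^ DIM('a)" by (simp add: mult.assoc)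
      qed auto
    qed
    show ?thesis using err comp by (intro exI[of _ H]) blast
  qed
  note main = this
  have "C \<ge> 1" using CC(4) by (simp add: C4_def)
  then show ?thesis by (intro exI[of _ C] exI[of _ L] conjI allI impI main)
qed

subsection \<open>Partial derivatives within a domain\<close>

lemma has_vector_derivative_cong_on:
  fixes g g' :: "real \<Rightarrow> 'b::real_normed_vector"
  assumes "t \<in> X" "\<And>h. h \<in> X \<Longrightarrow> g h = g' h"
  shows "(g has_vector_derivative d) (at t within X) \<longleftrightarrow> (g' has_vector_derivative d) (at t within X)"
  unfolding has_vector_derivative_def
  using has_derivative_transform[OF assms(1), of g' g] has_derivative_transform[OF assms(1), of g g'] assms(2)
  by (metis (no_types, lifting))

text \<open>A partial derivative depends only on the values along one line. Admitting two different
  spaces covers both the replacement of a function by an equal one and the passage from (t, x,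
  \<eta>) to (t, x).\<close>

lemma pderiv_within_eq_on:
  fixes g :: "'a::euclidean_space \<Rightarrow> 'b::real_normed_vector" and g' :: "'c::euclidean_space \<Rightarrow> 'b"
  assumes "x \<in> \<Omega>" "\<And>h. x + h *\<^sub>R b \<in> \<Omega> \<longleftrightarrow> x' + h *\<^sub>R b' \<in> \<Omega>'"
    "\<And>h. x + h *\<^sub>R b \<in> \<Omega> \<Longrightarrow> g (x + h *\<^sub>R b) = g' (x' + h *\<^sub>R b')"
  shows "pderiv_within \<Omega> b g x = pderiv_within \<Omega>' b' g' x'"
    "pdiff_at_within \<Omega> b g x \<longleftrightarrow> pdiff_at_within \<Omega>' b' g' x'"
proof -
  let ?X = "{h. x + h *\<^sub>R b \<in> \<Omega>}"
  have X: "{h. x' + h *\<^sub>R b' \<in> \<Omega>'} = ?X" using assms(2) by auto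
  have cong: "((\<lambda>h. g (x + h *\<^sub>R b)) has_vector_derivative d) (at 0 within ?X) \<longleftrightarrow>
      ((\<lambda>h. g' (x' + h *\<^sub>R b')) has_vector_derivative d) (at 0 within ?X)" for d
  proof (rule has_vector_derivative_cong_on)
    show "0 \<in> ?X" using assms(1) by simp
    show "g (x + h *\<^sub>R b) = g' (x' + h *\<^sub>R b')" if "h \<in> ?X" for h using that assms(3) by blast
  qed
  show "pderiv_within \<Omega> b g x = pderiv_within \<Omega>' b' g' x'"
    unfolding pderiv_within_def vector_derivative_def X cong ..
  have "(\<lambda>h. g (x + h *\<^sub>R b)) differentiable at 0 within ?X \<longleftrightarrow>
     (\<exists>d. ((\<lambda>h. g (x + h *\<^sub>R b)) has_vector_derivative d) (at 0 within ?X))" for g :: "'a \<Rightarrow> 'b"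
    using vector_derivative_works differentiableI_vector by blast
  moreover have "(\<lambda>h. g' (x' + h *\<^sub>R b')) differentiable at 0 within ?X \<longleftrightarrow>
     (\<exists>d. ((\<lambda>h. g' (x' + h *\<^sub>R b')) has_vector_derivative d) (at 0 within ?X))"
    using vector_derivative_works differentiableI_vector by blast
  ultimately show "pdiff_at_within \<Omega> b g x \<longleftrightarrow> pdiff_at_within \<Omega>' b' g' x'"
    unfolding pdiff_at_within_def X by (simp add: cong)
qed

lemma Ck_on_cong:
  assumes "\<And>x. x \<in> \<Omega> \<Longrightarrow> g x = g' x"
  shows "Ck_on k g \<Omega> \<longleftrightarrow> Ck_on k g' \<Omega>"
  using assms
proof (induction k arbitrary: g g')
  case 0
  then show ?case by (simp cong: continuous_on_cong)
next
  case (Suc k)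
  have eq: "pderiv_within \<Omega> b g x = pderiv_within \<Omega> b g' x" "pdiff_at_within \<Omega> b g x \<longleftrightarrow> pdiff_at_within \<Omega> b g' x"
    if "x \<in> \<Omega>" for b x
    using pderiv_within_eq_on[of x \<Omega> b x b \<Omega> g g'] that Suc.prems by auto
  have "Ck_on k (pderiv_within \<Omega> b g) \<Omega> \<longleftrightarrow> Ck_on k (pderiv_within \<Omega> b g') \<Omega>" for b
    by (rule Suc.IH) (rule eq)
  then show ?case using Suc.prems eq by (simp cong: continuous_on_cong)
qed

text \<open>Where the filter is trivial every vector is a derivative and
  \<open>pderiv_within\<close> is an arbitrary choice. Thickness makes derivatives unique, so that
  they commute with linear maps such as taking components.\<close>

definition thick :: "'a::euclidean_space set \<Rightarrow> bool" where
  "thick \<Omega> \<longleftrightarrow> (\<forall>x\<in>\<Omega>. \<forall>b\<in>Basis. at 0 within {h. x + h *\<^sub>R b \<in> \<Omega>} \<noteq> bot)"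

lemma pderiv_within_inner:
  assumes "thick \<Omega>" "x \<in> \<Omega>" "e \<in> Basis" "pdiff_at_within \<Omega> e V x"
  shows "pderiv_within \<Omega> e (\<lambda>y. inner (V y) b) x = inner (pderiv_within \<Omega> e V x) b"
    "pdiff_at_within \<Omega> e (\<lambda>y. inner (V y) b) x"
proof -
  let ?X = "{h. x + h *\<^sub>R e \<in> \<Omega>}"
  have "((\<lambda>h. V (x + h *\<^sub>R e)) has_vector_derivative pderiv_within \<Omega> e V x) (at 0 within ?X)"
    using assms(4) unfolding pdiff_at_within_def pderiv_within_def by (rule vector_derivative_works[THEN iffD1])
  from bounded_linear.has_vector_derivative[OF bounded_linear_inner_left this]
  have *: "((\<lambda>h. inner (V (x + h *\<^sub>R e)) b) has_vector_derivative inner (pderiv_within \<Omega> e V x) b) (at 0 within ?X)" .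
  have "at 0 within ?X \<noteq> bot" using assms(1,2,3) by (simp add: thick_def)
  from vector_derivative_within[OF this *]
  show "pderiv_within \<Omega> e (\<lambda>y. inner (V y) b) x = inner (pderiv_within \<Omega> e V x) b"
    unfolding pderiv_within_def .
  show "pdiff_at_within \<Omega> e (\<lambda>y. inner (V y) b) x"
    unfolding pdiff_at_within_def using * by (rule differentiableI_vector)
qed

lemma Ck_on_inner: "thick \<Omega> \<Longrightarrow> Ck_on k V \<Omega> \<Longrightarrow> Ck_on k (\<lambda>x. inner (V x) b) \<Omega>"
proof (induction k arbitrary: V)
  case 0
  then show ?case by (auto intro: continuous_on_inner continuous_on_const)
next
  case (Suc k)
  have "Ck_on k (pderiv_within \<Omega> e (\<lambda>x. inner (V x) b)) \<Omega>" if e: "e \<in> Basis" for e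
  proof -
    have C: "Ck_on k (\<lambda>x. inner (pderiv_within \<Omega> e V x) b) \<Omega>" using Suc e by auto
    have eq: "pderiv_within \<Omega> e (\<lambda>x. inner (V x) b) x = inner (pderiv_within \<Omega> e V x) b" if "x \<in> \<Omega>" for x
    proof (rule pderiv_within_inner(1)[OF Suc.prems(1) that e])
      show "pdiff_at_within \<Omega> e V x" using Suc.prems(2) e that by simp
    qed
    show ?thesis by (rule iffD2[OF Ck_on_cong C]) (rule eq)
  qed
  moreover have "pdiff_at_within \<Omega> e (\<lambda>x. inner (V x) b) x" if "e \<in> Basis" "x \<in> \<Omega>" for e x
  proof (rule pderiv_within_inner(2)[OF Suc.prems(1) that(2,1)])
    show "pdiff_at_within \<Omega> e V x" using Suc.prems(2) that by simp
  qed
  ultimately show ?case using Suc.prems(2) by (auto intro: continuous_on_inner continuous_on_const)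
qed

lemma iter_pderiv_Cons: "iter_pderiv \<Omega> (e # \<beta>) g = pderiv_within \<Omega> e (iter_pderiv \<Omega> \<beta> g)"
  by (simp add: iter_pderiv_def)

lemma iter_pderiv_inner:
  assumes "thick \<Omega>" "Ck_on k V \<Omega>" "set \<beta> \<subseteq> Basis" "length \<beta> \<le> k" "x \<in> \<Omega>"
  shows "iter_pderiv \<Omega> \<beta> (\<lambda>x. inner (V x) b) x = inner (iter_pderiv \<Omega> \<beta> V x) b"
  using assms(3-5)
proof (induction \<beta> arbitrary: x)
  case Nil
  show ?case by (simp add: iter_pderiv_def)
next
  case (Cons e \<beta>)
  have e: "e \<in> Basis" using Cons.prems by simp
  have "iter_pderiv \<Omega> (e # \<beta>) (\<lambda>x. inner (V x) b) x = pderiv_within \<Omega> e (\<lambda>x. inner (iter_pderiv \<Omega> \<beta> V x) b) x"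
    unfolding iter_pderiv_Cons by (rule pderiv_within_eq_on) (use Cons in auto)
  also have "\<dots> = inner (pderiv_within \<Omega> e (iter_pderiv \<Omega> \<beta> V) x) b"
  proof (rule pderiv_within_inner(1)[OF assms(1) Cons.prems(3) e])
    have "Ck_on (k - length \<beta>) (iter_pderiv \<Omega> \<beta> V) \<Omega>"
      by (rule Ck_on_iter_pderiv[OF assms(2)]) (use Cons.prems in auto)
    moreover obtain j where "k - length \<beta> = Suc j" using Cons.prems(2) by (metis Suc_diff_Suc Suc_le_lessD length_Cons)
    ultimately show "pdiff_at_within \<Omega> e (iter_pderiv \<Omega> \<beta> V) x" using e Cons.prems(3) by simp
  qed
  finally show ?case by (simp add: iter_pderiv_Cons)
qed

section \<open>From norms to bounds on all derivatives\<close>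

lemma iter_pderiv_le_Ck_norm:
  fixes g :: "'a::euclidean_space \<Rightarrow> 'b::real_normed_vector"
  assumes "set \<beta> \<subseteq> Basis" "length \<beta> \<le> k" "x \<in> S" "bdd_above ((\<lambda>x. norm (iter_pderiv \<Omega> \<beta> g x)) ` S)"
  shows "norm (iter_pderiv \<Omega> \<beta> g x) \<le> Ck_norm k \<Omega> S g"
proof -
  have "norm (iter_pderiv \<Omega> \<beta> g x) \<le> (SUP x\<in>S. norm (iter_pderiv \<Omega> \<beta> g x))"
    using assms(3,4) by (rule cSUP_upper)
  also have "\<dots> \<le> Ck_norm k \<Omega> S g"
    unfolding Ck_norm_def
    by (rule Max_ge) (use assms finite_lists_length_le[OF finite_Basis, of k] in auto)
  finally show ?thesis .
qed

lemma bdd_above_norm_image: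
  fixes g :: "'a::euclidean_space \<Rightarrow> 'b::real_normed_vector"
  assumes "continuous_on S g" "compact S"
  shows "bdd_above ((\<lambda>x. norm (g x)) ` S)"
  by (intro bounded_imp_bdd_above compact_imp_bounded compact_continuous_image continuous_on_norm assms)

text \<open>Networks are scalar, so V is approximated one component at a time; by the Cauchy-Schwarz
  inequality each component inherits the norm of V.\<close>

lemma Ck_bound_Ck_norm_inner:
  fixes V :: "'a::euclidean_space \<Rightarrow> 'b::euclidean_space"
  assumes "thick \<Omega>" "Ck_on k V \<Omega>" "compact S" "S \<subseteq> \<Omega>" "S \<noteq> {}" "norm b = 1"
  shows "Ck_bound k (Ck_norm k \<Omega> S V) \<Omega> S (\<lambda>x. inner (V x) b)"
  unfolding Ck_bound_def
proof (intro conjI allI impI)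
  have le: "norm (iter_pderiv \<Omega> \<beta> V x) \<le> Ck_norm k \<Omega> S V" if "set \<beta> \<subseteq> Basis" "length \<beta> \<le> k" "x \<in> S" for \<beta> x
    by (intro iter_pderiv_le_Ck_norm[OF that] bdd_above_norm_image assms(3)
      continuous_on_subset[OF continuous_iter_pderiv[OF assms(2) that(1,2)] assms(4)])
  obtain x0 where "x0 \<in> S" using assms(5) by blast
  then show "0 \<le> Ck_norm k \<Omega> S V" using le[of "[]" x0] by (simp add: order_trans[OF norm_ge_zero])
  fix \<beta> :: "'a list" and x assume \<beta>: "set \<beta> \<subseteq> Basis" "length \<beta> \<le> k" "x \<in> S"
  have "iter_pderiv \<Omega> \<beta> (\<lambda>x. inner (V x) b) x = inner (iter_pderiv \<Omega> \<beta> V x) b"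
    by (rule iter_pderiv_inner[OF assms(1,2)]) (use \<beta> assms in auto)
  also have "\<bar>\<dots>\<bar> \<le> norm (iter_pderiv \<Omega> \<beta> V x)"
    using Cauchy_Schwarz_ineq2[of "iter_pderiv \<Omega> \<beta> V x" b] assms(6) by simp
  also have "\<dots> \<le> Ck_norm k \<Omega> S V" by (rule le[OF \<beta>])
  finally show "\<bar>iter_pderiv \<Omega> \<beta> (\<lambda>x. inner (V x) b) x\<bar> \<le> Ck_norm k \<Omega> S V" .
qed (use assms(4) Ck_on_inner[OF assms(1,2)] in simp_all)

lemma Ck_bound_Ck_norm:
  fixes f :: "'a::euclidean_space \<Rightarrow> real"
  assumes "Ck_on k f \<Omega>" "compact S" "S \<subseteq> \<Omega>" "S \<noteq> {}"
  shows "Ck_bound k (Ck_norm k \<Omega> S f) \<Omega> S f"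
  unfolding Ck_bound_def
proof (intro conjI allI impI)
  have le: "norm (iter_pderiv \<Omega> \<beta> f x) \<le> Ck_norm k \<Omega> S f" if "set \<beta> \<subseteq> Basis" "length \<beta> \<le> k" "x \<in> S" for \<beta> x
    by (intro iter_pderiv_le_Ck_norm[OF that] bdd_above_norm_image assms(2)
      continuous_on_subset[OF continuous_iter_pderiv[OF assms(1) that(1,2)] assms(3)])
  obtain x0 where "x0 \<in> S" using assms(4) by blast
  then show "0 \<le> Ck_norm k \<Omega> S f" using le[of "[]" x0] by (simp add: order_trans[OF norm_ge_zero])
  show "\<bar>iter_pderiv \<Omega> \<beta> f x\<bar> \<le> Ck_norm k \<Omega> S f" if "set \<beta> \<subseteq> Basis" "length \<beta> \<le> k" "x \<in> S" for \<beta> x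
    using le[OF that] by simp
qed (use assms in auto)

lemma thick_I:
  fixes \<Omega> :: "'a::euclidean_space set"
  assumes "\<And>x b. x \<in> \<Omega> \<Longrightarrow> b \<in> Basis \<Longrightarrow> \<exists>\<delta>. \<delta> \<noteq> 0 \<and> (\<forall>s\<in>{0..1}. x + (s * \<delta>) *\<^sub>R b \<in> \<Omega>)"
  shows "thick \<Omega>"
  unfolding thick_def
proof (intro ballI)
  fix x b :: 'a assume xb: "x \<in> \<Omega>" "b \<in> Basis"
  then obtain \<delta> where \<delta>: "\<delta> \<noteq> 0" "\<And>s. s \<in> {0..1} \<Longrightarrow> x + (s * \<delta>) *\<^sub>R b \<in> \<Omega>" using assms by blast
  have "0 islimpt {h. x + h *\<^sub>R b \<in> \<Omega>}"
    unfolding islimpt_approachable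
  proof (intro allI impI)
    fix e :: real assume e: "e > 0"
    let ?s = "min 1 (e / (2 * \<bar>\<delta>\<bar>))"
    have s: "?s \<in> {0..1}" "?s > 0" using e \<delta>(1) by auto
    have "?s * \<bar>\<delta>\<bar> \<le> e / (2 * \<bar>\<delta>\<bar>) * \<bar>\<delta>\<bar>" by (intro mult_right_mono) auto
    also have "\<dots> < e" using e \<delta>(1) by simp
    finally have "dist (?s * \<delta>) 0 < e" using s by (simp add: abs_mult)
    moreover have "?s * \<delta> \<noteq> 0" using s(2) \<delta>(1) by (metis less_irrefl mult_eq_0_iff)
    ultimately show "\<exists>x'\<in>{h. x + h *\<^sub>R b \<in> \<Omega>}. x' \<noteq> 0 \<and> dist x' 0 < e"
      using \<delta>(2)[OF s(1)] by blast
  qed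
  then show "at 0 within {h. x + h *\<^sub>R b \<in> \<Omega>} \<noteq> bot" by (simp add: trivial_limit_within)
qed

lemma interval_direction:
  fixes v lo hi :: real
  assumes "lo < hi" "v \<in> {lo..hi}"
  obtains \<delta> where "\<delta> \<noteq> 0" "\<And>s. s \<in> {0..1} \<Longrightarrow> v + s * \<delta> \<in> {lo..hi}"
proof (cases "v < hi")
  case True
  show ?thesis
  proof (rule that[of "hi - v"])
    fix s :: real assume s: "s \<in> {0..1}"
    have "s * (hi - v) \<le> 1 * (hi - v)" using s True by (intro mult_right_mono) auto
    moreover have "0 \<le> s * (hi - v)" using s True by auto
    ultimately show "v + s * (hi - v) \<in> {lo..hi}" using assms by auto
  qed (use True in simp)
next
  case False
  then have v: "v = hi" using assms by auto
  show ?thesis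
  proof (rule that[of "lo - hi"])
    fix s :: real assume s: "s \<in> {0..1}"
    have "s * (hi - lo) \<le> 1 * (hi - lo)" using s assms by (intro mult_right_mono) auto
    moreover have "0 \<le> s * (hi - lo)" using s assms by auto
    ultimately show "v + s * (lo - hi) \<in> {lo..hi}" using v by (auto simp: algebra_simps)
  qed (use assms in simp)
qed

lemma thick_tx_dom:
  assumes "T > 0"
  shows "thick (tx_dom T (UNIV :: (real ^ 'n) set) :: (real \<times> (real ^ 'n) \<times> (real ^ 'D)) set)"
proof (rule thick_I)
  fix p b :: "real \<times> (real ^ 'n) \<times> (real ^ 'D)"
  assume p: "p \<in> tx_dom T UNIV" and b: "b \<in> Basis"
  obtain t x \<eta> where tx: "p = (t, x, \<eta>)" "t \<in> {0..T}" "\<eta> \<in> cbox 0 One" using p by (auto simp: tx_dom_def)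
  consider "b = (1, 0, 0)" | e where "b = (0, e, 0)" | e where "e \<in> Basis" "b = (0, 0, e)"
    using b by (auto simp: Basis_prod_def zero_prod_def)
  then show "\<exists>\<delta>. \<delta> \<noteq> 0 \<and> (\<forall>s\<in>{0..1}. p + (s * \<delta>) *\<^sub>R b \<in> tx_dom T UNIV)"
  proof cases
    case 1
    obtain \<delta> where "\<delta> \<noteq> 0" "\<And>s. s \<in> {0..1} \<Longrightarrow> t + s * \<delta> \<in> {0..T}"
      using interval_direction[OF assms tx(2)] by blast
    then show ?thesis using tx 1 by (intro exI[of _ \<delta>]) (auto simp: tx_dom_def)
  next
    case (2 e)
    then show ?thesis using tx by (intro exI[of _ 1]) (auto simp: tx_dom_def)
  next
    case (3 e)
    have "inner \<eta> e \<in> {0..1}" using tx(3) 3(1) by (auto simp: mem_box)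
    then obtain \<delta> where \<delta>: "\<delta> \<noteq> 0" "\<And>s. s \<in> {0..1} \<Longrightarrow> inner \<eta> e + s * \<delta> \<in> {0..1}"
      using interval_direction[of 0 1 "inner \<eta> e"] by auto
    have "\<eta> + (s * \<delta>) *\<^sub>R e \<in> cbox 0 One" if s: "s \<in> {0..1}" for s
      unfolding mem_box
    proof
      fix i :: "real ^ 'D" assume i: "i \<in> Basis"
      show "inner 0 i \<le> inner (\<eta> + (s * \<delta>) *\<^sub>R e) i \<and> inner (\<eta> + (s * \<delta>) *\<^sub>R e) i \<le> inner One i"
      proof (cases "i = e")
        case True
        then show ?thesis using \<delta>(2)[OF s] i by (simp add: inner_simps)
      next
        case False
        then show ?thesis using tx(3) i 3(1) by (auto simp: mem_box inner_simps inner_Basis)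
      qed
    qed
    then show ?thesis using \<delta>(1) tx 3 by (intro exI[of _ \<delta>]) (auto simp: tx_dom_def)
  qed
qed

lemma iter_pderiv_drop_parameter:
  fixes f :: "real \<times> (real ^ 'n) \<times> (real ^ 'D) \<Rightarrow> real"
  assumes "\<And>t x \<eta>. (t, x, \<eta>) \<in> tx_dom T UNIV \<Longrightarrow> f (t, x, \<eta>) = f\<^sub>1 (t, x)" "(t, x, \<eta>) \<in> tx_dom T UNIV"
  shows "iter_pderiv (tx_dom T UNIV) (map (\<lambda>(a, b). (a, b, 0)) \<beta>) f (t, x, \<eta>) = iter_pderiv ({0..T} \<times> UNIV) \<beta> f\<^sub>1 (t, x)"
  using assms(2)
proof (induction \<beta> arbitrary: t x \<eta>)
  case Nil
  then show ?case using assms(1) by (simp add: iter_pderiv_def)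
next
  case (Cons e \<beta>)
  obtain a b where e: "e = (a, b)" by force
  let ?g = "iter_pderiv (tx_dom T UNIV) (map (\<lambda>(a, b). (a, b, 0)) \<beta>) f"
  have "pderiv_within (tx_dom T UNIV) (a, b, 0) ?g (t, x, \<eta>) = pderiv_within ({0..T} \<times> UNIV) (a, b) (iter_pderiv ({0..T} \<times> UNIV) \<beta> f\<^sub>1) (t, x)"
    by (rule pderiv_within_eq_on) (use Cons in \<open>auto simp: tx_dom_def\<close>)
  then show ?case by (simp add: e iter_pderiv_Cons)
qed

text \<open>In case (a) the norm is that of f in all d variables, while the Taylor expansion is
  applied to \<open>f\<^sub>1\<close>. Differentiating f in t and x only yields the derivatives of
  \<open>f\<^sub>1\<close>; their boundedness, without which the supremum in \<open>Ck_norm\<close>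
  would say nothing, is taken over from \<open>f\<^sub>1\<close> as well.\<close>

lemma Ck_bound_drop_parameter:
  fixes f :: "real \<times> (real ^ 'n) \<times> (real ^ 'D) \<Rightarrow> real"
  assumes f: "\<And>t x \<eta>. (t, x, \<eta>) \<in> tx_dom T UNIV \<Longrightarrow> f (t, x, \<eta>) = f\<^sub>1 (t, x)"
    and "Ck_on s f\<^sub>1 ({0..T} \<times> UNIV)" "compact X" "X \<noteq> {}" "T \<ge> 0"
  shows "Ck_bound s (Ck_norm s (tx_dom T UNIV) (tx_dom T X) f) ({0..T} \<times> UNIV) ({0..T} \<times> X) f\<^sub>1"
  unfolding Ck_bound_def
proof (intro conjI allI impI)
  have le: "\<bar>iter_pderiv ({0..T} \<times> UNIV) \<beta> f\<^sub>1 p\<bar> \<le> Ck_norm s (tx_dom T UNIV) (tx_dom T X) f"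
    if \<beta>: "set \<beta> \<subseteq> Basis" "length \<beta> \<le> s" and p: "p \<in> {0..T} \<times> X" for \<beta> p
  proof -
    obtain t x where tx: "p = (t, x)" "t \<in> {0..T}" "x \<in> X" using p by auto
    let ?\<beta> = "map (\<lambda>(a, b). (a, b, 0 :: real ^ 'D)) \<beta>"
    have eq: "iter_pderiv (tx_dom T UNIV) ?\<beta> f (t, x, \<eta>) = iter_pderiv ({0..T} \<times> UNIV) \<beta> f\<^sub>1 (t, x)"
      if "(t, x, \<eta>) \<in> tx_dom T X" for t x \<eta>
      by (rule iter_pderiv_drop_parameter) (use that f in \<open>auto simp: tx_dom_def\<close>)
    have "bdd_above ((\<lambda>p. norm (iter_pderiv ({0..T} \<times> UNIV) \<beta> f\<^sub>1 p)) ` ({0..T} \<times> X))"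
      by (intro bdd_above_norm_image compact_Times assms)
        (use continuous_iter_pderiv[OF assms(2) \<beta>] in \<open>auto elim: continuous_on_subset\<close>)
    moreover have "(\<lambda>p. norm (iter_pderiv (tx_dom T UNIV) ?\<beta> f p)) ` tx_dom T X \<subseteq> (\<lambda>p. norm (iter_pderiv ({0..T} \<times> UNIV) \<beta> f\<^sub>1 p)) ` ({0..T} \<times> X)"
    proof
      fix v assume "v \<in> (\<lambda>p. norm (iter_pderiv (tx_dom T UNIV) ?\<beta> f p)) ` tx_dom T X"
      then obtain t x \<eta> where q: "(t, x, \<eta>) \<in> tx_dom T X" "v = norm (iter_pderiv (tx_dom T UNIV) ?\<beta> f (t, x, \<eta>))" by auto
      then have "v = norm (iter_pderiv ({0..T} \<times> UNIV) \<beta> f\<^sub>1 (t, x))" "(t, x) \<in> {0..T} \<times> X"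
        using eq[OF q(1)] by (auto simp: tx_dom_def)
      then show "v \<in> (\<lambda>p. norm (iter_pderiv ({0..T} \<times> UNIV) \<beta> f\<^sub>1 p)) ` ({0..T} \<times> X)" by (rule image_eqI)
    qed
    ultimately have bdd: "bdd_above ((\<lambda>p. norm (iter_pderiv (tx_dom T UNIV) ?\<beta> f p)) ` tx_dom T X)"
      by (rule bdd_above_mono)
    have "(a, b, 0 :: real ^ 'D) \<in> Basis" if "(a, b) \<in> Basis" for a :: real and b :: "real ^ 'n"
      using that by (auto simp: Basis_prod_def zero_prod_def)
    then have "set ?\<beta> \<subseteq> Basis" using \<beta>(1) by auto
    \<comment> \<open>Any parameter of the cube would do, as these derivatives do not depend on
      it.\<close>
    moreover have m: "(t, x, 0) \<in> tx_dom T X" using tx by (auto simp: tx_dom_def mem_box)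
    ultimately have "norm (iter_pderiv (tx_dom T UNIV) ?\<beta> f (t, x, 0)) \<le> Ck_norm s (tx_dom T UNIV) (tx_dom T X) f"
      using \<beta>(2) bdd by (intro iter_pderiv_le_Ck_norm) auto
    then show ?thesis unfolding eq[OF m] tx(1) by simp
  qed
  obtain x0 where "x0 \<in> X" using assms(4) by blast
  then show "0 \<le> Ck_norm s (tx_dom T UNIV) (tx_dom T X) f" using le[of "[]" "(0, x0)"] assms(5) by force
  show "\<bar>iter_pderiv ({0..T} \<times> UNIV) \<beta> f\<^sub>1 p\<bar> \<le> Ck_norm s (tx_dom T UNIV) (tx_dom T X) f"
    if "set \<beta> \<subseteq> Basis" "length \<beta> \<le> s" "p \<in> {0..T} \<times> X" for \<beta> p using le[OF that] .
qed (use assms in auto)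

section \<open>Solidity of the domains\<close>

lemma solid_cball: "solid (cball 0 G)"
  unfolding solid_def toward0_def
proof (intro ballI allI impI)
  fix y z :: 'a assume y: "y \<in> cball 0 G"
    and z: "\<forall>b\<in>Basis. 0 \<le> inner z b \<and> inner z b \<le> inner y b \<or> inner y b \<le> inner z b \<and> inner z b \<le> 0"
  have "norm z \<le> norm y" by (rule norm_le_componentwise) (use z in fastforce)
  then show "z \<in> cball 0 G" using y by simp
qed

lemma solid_Times:
  assumes "solid A" "solid B"
  shows "solid (A \<times> B)"
  unfolding solid_def
proof (intro ballI allI impI)
  fix y z :: "'a \<times> 'b" assume y: "y \<in> A \<times> B" and z: "toward0 z y"
  have "toward0 (fst z) (fst y)" "toward0 (snd z) (snd y)"
    using z unfolding toward0_def by (auto simp: Basis_prod_def inner_prod_def ball_Un)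
  then show "z \<in> A \<times> B" using y assms unfolding solid_def by (cases y, cases z) auto
qed

lemma solid_interval: "solid {0..T::real}"
  unfolding solid_def toward0_def by auto

lemma solid_unit_cube: "solid (cbox 0 (One :: 'a::euclidean_space))"
  unfolding solid_def toward0_def mem_box
proof (intro ballI allI impI)
  fix y z e :: 'a
  assume "y \<in> cbox 0 One" and z: "\<forall>b\<in>Basis. 0 \<le> inner z b \<and> inner z b \<le> inner y b \<or> inner y b \<le> inner z b \<and> inner z b \<le> 0"
    and e: "e \<in> Basis"
  then have "0 \<le> inner y e" "inner y e \<le> 1" by (auto simp: mem_box)
  then show "inner 0 e \<le> inner z e \<and> inner z e \<le> inner One e" using bspec[OF z e] e by auto
qed

subsection \<open>The backward Euler polygon\<close>

text \<open>With \<open>W s y = V (t - s, y, \<eta>)\<close> this follows the characteristic through \<open>(t, x)\<close> backwards in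
  time.\<close>

primrec eul :: "(real \<Rightarrow> 'a \<Rightarrow> 'a) \<Rightarrow> real \<Rightarrow> 'a::real_normed_vector \<Rightarrow> nat \<Rightarrow> 'a" where
  "eul W \<sigma> x 0 = x"
| "eul W \<sigma> x (Suc i) = eul W \<sigma> x i - \<sigma> *\<^sub>R W (real i * \<sigma>) (eul W \<sigma> x i)"

text \<open>Converts the Gronwall bound (\<rho> + 1) exp (C T) - 1 for the polygon into the radius
  (\<rho> + C T) exp (C T) of the ball on which the norms are taken.\<close>

lemma exp_le_growth: "exp a - 1 \<le> a * exp (a::real)"
proof -
  have "1 - a \<le> exp (- a)" using exp_ge_add_one_self[of "- a"] by simp
  then have "(1 - a) * exp a \<le> exp (- a) * exp a" by (intro mult_right_mono) auto
  then show ?thesis by (simp add: exp_minus algebra_simps)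
qed

text \<open>The first bound is a discrete Gronwall argument and keeps the polygon in the ball on
  which M bounds W. Only then is the second available, which adds up steps of speed at most M. Its
  value lies in being independent of C.\<close>

lemma eul_bound:
  fixes W :: "real \<Rightarrow> 'a::real_normed_vector \<Rightarrow> 'a"
  assumes "\<sigma> \<ge> 0" "real N * \<sigma> \<le> t" "t \<le> T" "C > 0" "M \<ge> 0" "norm x \<le> \<rho>"
    and growth: "\<And>s y. 0 \<le> s \<Longrightarrow> s \<le> t \<Longrightarrow> norm (W s y) \<le> C * (1 + norm y)"
    and bound: "\<And>s y. 0 \<le> s \<Longrightarrow> s \<le> t \<Longrightarrow> norm y \<le> (\<rho> + C * T) * exp (C * T) \<Longrightarrow> norm (W s y) \<le> M"
    and "i \<le> N"
  shows "norm (eul W \<sigma> x i) \<le> (\<rho> + C * T) * exp (C * T)" "norm (eul W \<sigma> x i) \<le> \<rho> + T * M"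
proof -
  have time: "real j * \<sigma> \<le> t" if "j \<le> N" for j
    using mult_right_mono[of "real j" "real N" \<sigma>] that assms(1,2) by simp
  have \<rho>0: "\<rho> \<ge> 0" using assms(6) norm_ge_zero[of x] by linarith
  \<comment> \<open>Adding 1 to the norm makes the growth condition homogeneous, so one step
    multiplies by 1 + C \<sigma>.\<close>
  have a: "norm (eul W \<sigma> x i) + 1 \<le> (1 + C * \<sigma>) ^ i * (\<rho> + 1)" if "i \<le> N" for i
    using that
  proof (induction i)
    case (Suc i)
    let ?y = "eul W \<sigma> x i"
    have "norm (eul W \<sigma> x (Suc i)) \<le> norm ?y + \<sigma> * norm (W (real i * \<sigma>) ?y)"
      using norm_triangle_ineq4[of ?y "\<sigma> *\<^sub>R W (real i * \<sigma>) ?y"] assms(1) by simp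
    also have "\<dots> \<le> norm ?y + \<sigma> * (C * (1 + norm ?y))"
      using growth[of "real i * \<sigma>" ?y] time[of i] Suc.prems assms(1) by (intro add_left_mono mult_left_mono) auto
    finally have "norm (eul W \<sigma> x (Suc i)) + 1 \<le> (1 + C * \<sigma>) * (norm ?y + 1)" by (simp add: algebra_simps)
    also have "\<dots> \<le> (1 + C * \<sigma>) * ((1 + C * \<sigma>) ^ i * (\<rho> + 1))"
      using Suc assms(1,4) by (intro mult_left_mono) auto
    finally show ?case by simp
  qed (use assms(6) in simp)
  have b: "norm (eul W \<sigma> x i) \<le> (\<rho> + C * T) * exp (C * T)" if "i \<le> N" for i
  proof -
    have "(1 + C * \<sigma>) ^ i \<le> exp (C * \<sigma>) ^ i" using assms(1,4) by (intro power_mono) (auto simp: add_nonneg_nonneg)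
    also have "\<dots> = exp (C * (real i * \<sigma>))" by (simp add: exp_of_nat_mult[symmetric] algebra_simps)
    also have "\<dots> \<le> exp (C * T)" using time[OF that] assms(3,4) by simp
    finally have "(1 + C * \<sigma>) ^ i * (\<rho> + 1) \<le> exp (C * T) * (\<rho> + 1)" using \<rho>0 by (intro mult_right_mono) auto
    then have "norm (eul W \<sigma> x i) \<le> exp (C * T) * (\<rho> + 1) - 1" using a[OF that] by linarith
    also have "\<dots> = exp (C * T) * \<rho> + (exp (C * T) - 1)" by (simp add: algebra_simps)
    also have "\<dots> \<le> (\<rho> + C * T) * exp (C * T)" using exp_le_growth[of "C * T"] by (simp add: algebra_simps)
    finally show ?thesis .
  qed
  have c: "norm (eul W \<sigma> x i) \<le> \<rho> + real i * \<sigma> * M" if "i \<le> N" for i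
    using that
  proof (induction i)
    case (Suc i)
    let ?y = "eul W \<sigma> x i"
    have "norm (eul W \<sigma> x (Suc i)) \<le> norm ?y + \<sigma> * norm (W (real i * \<sigma>) ?y)"
      using norm_triangle_ineq4[of ?y "\<sigma> *\<^sub>R W (real i * \<sigma>) ?y"] assms(1) by simp
    also have "\<dots> \<le> (\<rho> + real i * \<sigma> * M) + \<sigma> * M"
      using bound[of "real i * \<sigma>" ?y] time[of i] b[of i] Suc assms(1) by (intro add_mono mult_left_mono) auto
    finally show ?case by (simp add: algebra_simps)
  qed (use assms(6) in simp)
  show "norm (eul W \<sigma> x i) \<le> (\<rho> + C * T) * exp (C * T)" using b[OF assms(9)] .
  have "real i * \<sigma> * M \<le> T * M" using time[OF assms(9)] assms(3,5) by (intro mult_right_mono) auto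
  then show "norm (eul W \<sigma> x i) \<le> \<rho> + T * M" using c[OF assms(9)] by linarith
qed

lemma eul_add:
  "eul W \<sigma> x (i + l) = eul W \<sigma> x i - (\<Sum>r<l. \<sigma> *\<^sub>R W (real (i + r) * \<sigma>) (eul W \<sigma> x (i + r)))"
  by (induction l) (auto simp: algebra_simps)

lemma power_one_plus_le_exp:
  assumes "\<tau> * \<Lambda> \<ge> 0" "real j * \<tau> \<le> T" "\<Lambda> \<ge> (0::real)"
  shows "(1 + \<tau> * \<Lambda>) ^ j \<le> exp (T * \<Lambda>)"
proof -
  have "(1 + \<tau> * \<Lambda>) ^ j \<le> exp (\<tau> * \<Lambda>) ^ j" using assms(1) by (intro power_mono) auto
  also have "\<dots> = exp (real j * \<tau> * \<Lambda>)" by (simp add: exp_of_nat_mult[symmetric] algebra_simps)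
  also have "\<dots> \<le> exp (T * \<Lambda>)" using mult_right_mono[OF assms(2,3)] by simp
  finally show ?thesis .
qed

section \<open>Comparison of a polygon with a refinement of it\<close>

context
  fixes W :: "real \<Rightarrow> 'a::real_normed_vector \<Rightarrow> 'a" and B :: "'a set" and l N :: nat and \<sigma> \<tau> t \<Lambda> M :: real and x :: 'a
  assumes l: "l \<ge> 1" and \<sigma>: "\<sigma> \<ge> 0" and \<tau>: "\<tau> = real l * \<sigma>" and N: "real N * \<tau> \<le> t"
    and \<Lambda>: "\<Lambda> \<ge> 0" and M: "M \<ge> 0"
    and coarse: "\<And>j. j \<le> N \<Longrightarrow> eul W \<tau> x j \<in> B"
    and fine: "\<And>i. i \<le> N * l \<Longrightarrow> eul W \<sigma> x i \<in> B"
    and bound: "\<And>s y. 0 \<le> s \<Longrightarrow> s \<le> t \<Longrightarrow> y \<in> B \<Longrightarrow> norm (W s y) \<le> M"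
    and lip: "\<And>s s' y y'. 0 \<le> s \<Longrightarrow> s \<le> t \<Longrightarrow> 0 \<le> s' \<Longrightarrow> s' \<le> t \<Longrightarrow> y \<in> B \<Longrightarrow> y' \<in> B \<Longrightarrow>
       norm (W s y - W s' y') \<le> \<Lambda> * (\<bar>s - s'\<bar> + norm (y - y'))"
begin

text \<open>A discrete Gronwall argument for two polygons from the same point with steps \<tau> and
  \<sigma> = \<tau> / l. The bounds do not depend on l, so the fine polygon can stand in for the
  exact characteristic. The elementary facts on times and indices are included because the estimate
  of the source term needs them again.\<close>

lemma eul_refine:
  shows "j \<le> N \<Longrightarrow> norm (eul W \<sigma> x (j * l) - eul W \<tau> x j) \<le> \<tau> * (1 + M) * ((1 + \<tau> * \<Lambda>) ^ j - 1)"
    and "j < N \<Longrightarrow> r < l \<Longrightarrow> \<bar>real (j * l + r) * \<sigma> - real j * \<tau>\<bar> + norm (eul W \<sigma> x (j * l + r) - eul W \<tau> x j)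
       \<le> \<tau> * (1 + M) * (1 + \<tau> * \<Lambda>) ^ j"
    and "j < N \<Longrightarrow> r < l \<Longrightarrow> real (j * l + r) * \<sigma> \<le> t"
    and "j \<le> N \<Longrightarrow> real j * \<tau> \<le> t"
    and "j < N \<Longrightarrow> r < l \<Longrightarrow> j * l + r \<le> N * l"
proof -
  note assms = l \<sigma> \<tau> N \<Lambda> M
  have \<tau>0: "\<tau> \<ge> 0" using assms(2,3) by simp
  have time: "real j * \<tau> \<le> t" if "j \<le> N" for j
    using mult_right_mono[of "real j" "real N" \<tau>] that \<tau>0 assms(4) by simp
  have time2: "real i * \<sigma> \<le> t" if "i \<le> N * l" for i
  proof -
    have "real i * \<sigma> \<le> real (N * l) * \<sigma>" using that assms(2) by (intro mult_right_mono) (simp_all only: of_nat_le_iff)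
    then show ?thesis using assms(3,4) by simp
  qed
  have idx: "j * l + r \<le> N * l" if "j < N" "r \<le> l" for j r
  proof -
    have "j * l + l \<le> N * l" using mult_le_mono1[of "Suc j" N l] that(1) by (simp add: add.commute)
    then show ?thesis using that(2) by linarith
  qed
  have drift: "norm (eul W \<sigma> x (j * l + r) - eul W \<sigma> x (j * l)) \<le> \<tau> * M" if j: "j < N" and r: "r < l" for j r
  proof -
    have "norm (eul W \<sigma> x (j * l + r) - eul W \<sigma> x (j * l))
      = norm (\<Sum>q<r. \<sigma> *\<^sub>R W (real (j * l + q) * \<sigma>) (eul W \<sigma> x (j * l + q)))" by (simp add: eul_add[of W \<sigma> x "j * l" r])
    also have "\<dots> \<le> (\<Sum>q<r. \<sigma> * M)"
    proof (rule sum_norm_le)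
      fix q assume "q \<in> {..<r}"
      then have "j * l + q \<le> N * l" using idx[OF j, of q] r by auto
      then have "norm (W (real (j * l + q) * \<sigma>) (eul W \<sigma> x (j * l + q))) \<le> M"
        using assms(2) by (intro bound time2 fine mult_nonneg_nonneg) auto
      then show "norm (\<sigma> *\<^sub>R W (real (j * l + q) * \<sigma>) (eul W \<sigma> x (j * l + q))) \<le> \<sigma> * M"
        using assms(2) by (simp add: mult_left_mono)
    qed
    also have "\<dots> = real r * \<sigma> * M" by simp
    also have "\<dots> \<le> real l * \<sigma> * M" using r assms(2,6) by (intro mult_right_mono) auto
    finally show ?thesis using assms(3) by simp
  qed
  have near: "\<bar>real (j * l + r) * \<sigma> - real j * \<tau>\<bar> + norm (eul W \<sigma> x (j * l + r) - eul W \<tau> x j)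
       \<le> \<tau> * (1 + M) + norm (eul W \<sigma> x (j * l) - eul W \<tau> x j)" if j: "j < N" and r: "r < l" for j r
  proof -
    have "real (j * l + r) * \<sigma> - real j * \<tau> = real r * \<sigma>" using assms(3) by (simp add: algebra_simps)
    moreover have "real r * \<sigma> \<le> \<tau>" using r assms(2,3) by (simp add: mult_right_mono)
    ultimately have 1: "\<bar>real (j * l + r) * \<sigma> - real j * \<tau>\<bar> \<le> \<tau>" using assms(2) by simp
    have "norm (eul W \<sigma> x (j * l + r) - eul W \<tau> x j)
      \<le> norm (eul W \<sigma> x (j * l + r) - eul W \<sigma> x (j * l)) + norm (eul W \<sigma> x (j * l) - eul W \<tau> x j)"
      using norm_triangle_ineq[of "eul W \<sigma> x (j * l + r) - eul W \<sigma> x (j * l)" "eul W \<sigma> x (j * l) - eul W \<tau> x j"] by simp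
    with 1 drift[OF j r] show ?thesis by (simp add: algebra_simps)
  qed
  \<comment> \<open>The right-hand side solves e(j + 1) = (1 + \<tau> \<Lambda>) e(j) + \<tau>
    \<Lambda> \<tau> (1 + M) with e(0) = 0, where \<tau> (1 + M) bounds the drift in time and space
    within one coarse step.\<close>
  have main: "norm (eul W \<sigma> x (j * l) - eul W \<tau> x j) \<le> \<tau> * (1 + M) * ((1 + \<tau> * \<Lambda>) ^ j - 1)" if "j \<le> N" for j
    using that
  proof (induction j)
    case (Suc j)
    define e where "e = norm (eul W \<sigma> x (j * l) - eul W \<tau> x j)"
    have jN: "j < N" using Suc.prems by simp
    let ?Wc = "W (real j * \<tau>) (eul W \<tau> x j)"
    let ?Wf = "\<lambda>r. W (real (j * l + r) * \<sigma>) (eul W \<sigma> x (j * l + r))"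
    have 1: "(\<Sum>r<l. \<sigma> *\<^sub>R ?Wc) = \<tau> *\<^sub>R ?Wc" unfolding assms(3) by (simp add: sum_constant_scaleR)
    have 2: "eul W \<sigma> x (Suc j * l) = eul W \<sigma> x (j * l) - (\<Sum>r<l. \<sigma> *\<^sub>R ?Wf r)"
      unfolding mult_Suc add.commute[of l] by (rule eul_add)
    have 3: "(\<Sum>r<l. \<sigma> *\<^sub>R (?Wf r - ?Wc)) = (\<Sum>r<l. \<sigma> *\<^sub>R ?Wf r) - \<tau> *\<^sub>R ?Wc"
      unfolding scaleR_right_diff_distrib sum_subtractf 1 ..
    have "eul W \<sigma> x (Suc j * l) - eul W \<tau> x (Suc j)
       = (eul W \<sigma> x (j * l) - eul W \<tau> x j) - (\<Sum>r<l. \<sigma> *\<^sub>R (?Wf r - ?Wc))"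
      unfolding 2 3 eul.simps by simp
    then have "norm (eul W \<sigma> x (Suc j * l) - eul W \<tau> x (Suc j)) \<le> e + norm (\<Sum>r<l. \<sigma> *\<^sub>R (?Wf r - ?Wc))"
      unfolding e_def by (simp only: norm_triangle_ineq4)
    also have "norm (\<Sum>r<l. \<sigma> *\<^sub>R (?Wf r - ?Wc)) \<le> (\<Sum>r<l. \<sigma> * (\<Lambda> * (\<tau> * (1 + M) + e)))"
    proof (rule sum_norm_le)
      fix r assume "r \<in> {..<l}"
      then have r: "r < l" by simp
      have "norm (?Wf r - ?Wc) \<le> \<Lambda> * (\<bar>real (j * l + r) * \<sigma> - real j * \<tau>\<bar> + norm (eul W \<sigma> x (j * l + r) - eul W \<tau> x j))"
        using idx[OF jN, of r] r jN \<tau>0 assms(2) by (intro lip fine coarse time time2 mult_nonneg_nonneg) auto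
      also have "\<dots> \<le> \<Lambda> * (\<tau> * (1 + M) + e)" unfolding e_def using near[OF jN r] assms(5) by (rule mult_left_mono)
      finally show "norm (\<sigma> *\<^sub>R (?Wf r - ?Wc)) \<le> \<sigma> * (\<Lambda> * (\<tau> * (1 + M) + e))"
        using assms(2) by (simp add: mult_left_mono)
    qed
    also have "\<dots> = \<tau> * \<Lambda> * (\<tau> * (1 + M) + e)" using assms(3) by simp
    finally have "norm (eul W \<sigma> x (Suc j * l) - eul W \<tau> x (Suc j)) \<le> (1 + \<tau> * \<Lambda>) * e + \<tau> * \<Lambda> * (\<tau> * (1 + M))"
      by (simp add: algebra_simps)
    also have "\<dots> \<le> (1 + \<tau> * \<Lambda>) * (\<tau> * (1 + M) * ((1 + \<tau> * \<Lambda>) ^ j - 1)) + \<tau> * \<Lambda> * (\<tau> * (1 + M))"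
      using Suc \<tau>0 assms(5) unfolding e_def by (intro add_right_mono mult_left_mono) auto
    also have "\<dots> = \<tau> * (1 + M) * ((1 + \<tau> * \<Lambda>) ^ Suc j - 1)" by (simp add: algebra_simps)
    finally show ?case .
  qed simp
  show "j \<le> N \<Longrightarrow> norm (eul W \<sigma> x (j * l) - eul W \<tau> x j) \<le> \<tau> * (1 + M) * ((1 + \<tau> * \<Lambda>) ^ j - 1)"
    by (rule main)
  show "j < N \<Longrightarrow> r < l \<Longrightarrow> \<bar>real (j * l + r) * \<sigma> - real j * \<tau>\<bar> + norm (eul W \<sigma> x (j * l + r) - eul W \<tau> x j)
       \<le> \<tau> * (1 + M) * (1 + \<tau> * \<Lambda>) ^ j"
    using near[of j r] main[of j] by (simp add: algebra_simps)
  show "j < N \<Longrightarrow> r < l \<Longrightarrow> real (j * l + r) * \<sigma> \<le> t" by (rule time2[OF idx]) auto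
  show "j \<le> N \<Longrightarrow> real j * \<tau> \<le> t" by (rule time)
  show "j < N \<Longrightarrow> r < l \<Longrightarrow> j * l + r \<le> N * l" by (rule idx) auto
qed

text \<open>Blocks of l fine steps are compared with one coarse step: within a block the arguments
  of F differ by O(\<tau>), and the blocks together have length at most T.\<close>

lemma eul_refine_sum:
  fixes F :: "real \<Rightarrow> 'a \<Rightarrow> real"
  assumes "t \<le> T" "\<Lambda>' \<ge> 0"
    and lipF: "\<And>s s' y y'. 0 \<le> s \<Longrightarrow> s \<le> t \<Longrightarrow> 0 \<le> s' \<Longrightarrow> s' \<le> t \<Longrightarrow> y \<in> B \<Longrightarrow> y' \<in> B \<Longrightarrow>
       \<bar>F s y - F s' y'\<bar> \<le> \<Lambda>' * (\<bar>s - s'\<bar> + norm (y - y'))"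
  shows "\<bar>\<sigma> * (\<Sum>i<N * l. F (real i * \<sigma>) (eul W \<sigma> x i)) - \<tau> * (\<Sum>j<N. F (real j * \<tau>) (eul W \<tau> x j))\<bar>
     \<le> T * \<Lambda>' * (\<tau> * (1 + M) * exp (T * \<Lambda>))"
proof -
  have \<tau>0: "\<tau> \<ge> 0" using \<sigma> \<tau> by simp
  let ?f = "\<lambda>i. F (real i * \<sigma>) (eul W \<sigma> x i)" and ?c = "\<lambda>j. F (real j * \<tau>) (eul W \<tau> x j)"
  let ?K = "\<Lambda>' * (\<tau> * (1 + M) * exp (T * \<Lambda>))"
  have blk: "sum ?f {j * l ..< j * l + l} = (\<Sum>r<l. ?f (j * l + r))" for j
    using sum.shift_bounds_nat_ivl[of ?f 0 "j * l" l] by (simp add: atLeast0LessThan add.commute)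
  have grp: "(\<Sum>i<N * l. ?f i) = (\<Sum>j<N. \<Sum>r<l. ?f (j * l + r))"
    using sum.nat_group[of ?f l N] unfolding blk by (rule sym)
  have "\<sigma> * (\<Sum>i<N * l. ?f i) - \<tau> * (\<Sum>j<N. ?c j) = (\<Sum>j<N. \<Sum>r<l. \<sigma> * (?f (j * l + r) - ?c j))"
    unfolding grp \<tau> by (simp add: sum_distrib_left sum_subtractf right_diff_distrib mult_ac)
  also have "\<bar>\<dots>\<bar> \<le> (\<Sum>j<N. \<bar>\<Sum>r<l. \<sigma> * (?f (j * l + r) - ?c j)\<bar>)" by (rule sum_abs)
  also have "\<dots> \<le> (\<Sum>j<N. \<Sum>r<l. \<sigma> * ?K)"
  proof (rule sum_mono, rule order_trans[OF sum_abs sum_mono])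
    fix j r assume "j \<in> {..<N}" "r \<in> {..<l}"
    then have j: "j < N" and r: "r < l" by auto
    have "\<bar>?f (j * l + r) - ?c j\<bar> \<le> \<Lambda>' * (\<bar>real (j * l + r) * \<sigma> - real j * \<tau>\<bar> + norm (eul W \<sigma> x (j * l + r) - eul W \<tau> x j))"
      by (rule lipF[OF _ eul_refine(3)[OF j r] _ eul_refine(4) fine[OF eul_refine(5)[OF j r]] coarse])
        (use j \<tau>0 \<sigma> in \<open>simp_all del: of_nat_add of_nat_mult\<close>)
    also have "\<dots> \<le> \<Lambda>' * (\<tau> * (1 + M) * (1 + \<tau> * \<Lambda>) ^ j)"
      using eul_refine(2)[OF j r] assms(2) by (rule mult_left_mono)
    also have "\<dots> \<le> ?K"
      using power_one_plus_le_exp[of \<tau> \<Lambda> j T] eul_refine(4)[of j] j \<tau>0 assms(1,2) \<Lambda> M by (intro mult_left_mono) auto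
    finally show "\<bar>\<sigma> * (?f (j * l + r) - ?c j)\<bar> \<le> \<sigma> * ?K"
      using \<sigma> by (simp only: abs_mult abs_of_nonneg mult_left_mono)
  qed
  also have "\<dots> = (real N * \<tau>) * ?K" using \<tau> by simp
  also have "\<dots> \<le> T * ?K" using N assms(1,2) M \<tau>0 by (intro mult_right_mono) auto
  finally show ?thesis by (simp add: mult.assoc)
qed

end

section \<open>Increments of a C^1 function on a box\<close>

lemma increment_along:
  fixes u :: "'a::euclidean_space \<Rightarrow> real"
  assumes "\<And>s. s \<in> closed_segment 0 h \<Longrightarrow> y + s *\<^sub>R b \<in> \<Omega>"
    and "\<And>s. s \<in> closed_segment 0 h \<Longrightarrow> pdiff_at_within \<Omega> b u (y + s *\<^sub>R b)"
    and "\<And>s. s \<in> closed_segment 0 h \<Longrightarrow> \<bar>pderiv_within \<Omega> b u (y + s *\<^sub>R b) - c\<bar> \<le> \<omega>"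
  shows "\<bar>u (y + h *\<^sub>R b) - u y - c * h\<bar> \<le> \<omega> * \<bar>h\<bar>"
proof -
  let ?S = "closed_segment 0 h"
  have "((\<lambda>s. u (y + s *\<^sub>R b) - c * s) has_field_derivative pderiv_within \<Omega> b u (y + s *\<^sub>R b) - c * 1) (at s within ?S)"
    if "s \<in> ?S" for s
    by (rule DERIV_diff[OF has_derivative_along[OF assms(2)[OF that] assms(1)] DERIV_cmult[OF DERIV_ident]])
  then have "norm ((u (y + h *\<^sub>R b) - c * h) - (u (y + 0 *\<^sub>R b) - c * 0)) \<le> \<omega> * norm (h - 0)"
    by (rule field_differentiable_bound[OF convex_closed_segment]) (use assms(3) in simp_all)
  then show ?thesis by simp
qed

text \<open>The stops of the axis-parallel path from p to p'.\<close>

definition mix :: "'a::euclidean_space \<Rightarrow> 'a \<Rightarrow> 'a set \<Rightarrow> 'a" where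
  "mix p p' X = (\<Sum>b\<in>Basis. (if b \<in> X then inner p' b else inner p b) *\<^sub>R b)"

lemma mix_inner: "e \<in> Basis \<Longrightarrow> inner (mix p p' X) e = (if e \<in> X then inner p' e else inner p e)"
  unfolding mix_def by (rule inner_sum_left_Basis)

lemma mix_insert:
  assumes "b \<in> Basis" "b \<notin> X"
  shows "mix p p' (insert b X) = mix p p' X + inner (p' - p) b *\<^sub>R b"
proof (rule euclidean_eqI)
  fix e :: 'a assume e: "e \<in> Basis"
  show "inner (mix p p' (insert b X)) e = inner (mix p p' X + inner (p' - p) b *\<^sub>R b) e"
    unfolding inner_add_left mix_inner[OF e] using assms e
    by (cases "e = b") (simp_all add: inner_diff_left inner_Basis)
qed

lemma mix_segment:
  assumes "b \<in> Basis" "b \<notin> X" "s \<in> closed_segment 0 (inner (p' - p) b)" "p \<in> cbox a c" "p' \<in> cbox a c"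
  shows "mix p p' X + s *\<^sub>R b \<in> cbox a c" "norm (mix p p' X + s *\<^sub>R b - p) \<le> norm (p' - p)"
proof -
  have sb: "0 \<le> s \<and> s \<le> inner p' b - inner p b \<or> inner p' b - inner p b \<le> s \<and> s \<le> 0"
    using assms(3) by (auto simp: closed_segment_eq_real_ivl inner_diff_left split: if_splits)
  have val: "inner (mix p p' X + s *\<^sub>R b) e = (if e = b then inner p b + s else if e \<in> X then inner p' e else inner p e)"
    if e: "e \<in> Basis" for e
    unfolding inner_add_left mix_inner[OF e] using assms e
    by (cases "e = b") (simp_all add: inner_Basis)
  show "mix p p' X + s *\<^sub>R b \<in> cbox a c" unfolding mem_box
  proof
    fix e :: 'a assume e: "e \<in> Basis"
    have "inner a e \<le> inner p e" "inner p e \<le> inner c e" "inner a e \<le> inner p' e" "inner p' e \<le> inner c e"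
      using assms(4,5) e by (auto simp: mem_box)
    then show "inner a e \<le> inner (mix p p' X + s *\<^sub>R b) e \<and> inner (mix p p' X + s *\<^sub>R b) e \<le> inner c e"
      unfolding val[OF e] using sb by auto
  qed
  show "norm (mix p p' X + s *\<^sub>R b - p) \<le> norm (p' - p)"
  proof (rule norm_le_componentwise)
    fix e :: 'a assume e: "e \<in> Basis"
    show "\<bar>inner (mix p p' X + s *\<^sub>R b - p) e\<bar> \<le> \<bar>inner (p' - p) e\<bar>"
      unfolding inner_diff_left val[OF e] using sb by auto
  qed
qed

lemma mix_increment:
  fixes u :: "'a::euclidean_space \<Rightarrow> real"
  assumes "Ck_on 1 u \<Omega>" "cbox a c \<subseteq> \<Omega>" "p \<in> cbox a c" "p' \<in> cbox a c" "finite X" "X \<subseteq> Basis"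
    and close: "\<And>b q. b \<in> Basis \<Longrightarrow> q \<in> cbox a c \<Longrightarrow> norm (q - p) \<le> norm (p' - p) \<Longrightarrow>
      \<bar>pderiv_within \<Omega> b u q - pderiv_within \<Omega> b u p\<bar> \<le> \<omega>"
  shows "\<bar>u (mix p p' X) - u p - (\<Sum>b\<in>X. pderiv_within \<Omega> b u p * inner (p' - p) b)\<bar> \<le> \<omega> * (\<Sum>b\<in>X. \<bar>inner (p' - p) b\<bar>)"
  using assms(5,6)
proof (induction X rule: finite_induct)
  case empty
  have "mix p p' {} = p" unfolding mix_def by (simp add: euclidean_representation)
  then show ?case by simp
next
  case (insert b X)
  define h where "h = inner (p' - p) b"
  define D where "D = pderiv_within \<Omega> b u p"
  have b: "b \<in> Basis" using insert.prems by simp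
  have seg: "mix p p' X + s *\<^sub>R b \<in> cbox a c" "norm (mix p p' X + s *\<^sub>R b - p) \<le> norm (p' - p)"
    if "s \<in> closed_segment 0 h" for s
    using mix_segment[OF b insert.hyps(2) that[unfolded h_def] assms(3,4)] by auto
  have "\<bar>u (mix p p' X + h *\<^sub>R b) - u (mix p p' X) - D * h\<bar> \<le> \<omega> * \<bar>h\<bar>"
  proof (rule increment_along)
    fix s assume s: "s \<in> closed_segment 0 h"
    show \<Omega>: "mix p p' X + s *\<^sub>R b \<in> \<Omega>" using seg(1)[OF s] assms(2) by blast
    show "pdiff_at_within \<Omega> b u (mix p p' X + s *\<^sub>R b)" using assms(1) b \<Omega> by simp
    show "\<bar>pderiv_within \<Omega> b u (mix p p' X + s *\<^sub>R b) - D\<bar> \<le> \<omega>"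
      unfolding D_def by (rule close[OF b seg[OF s]])
  qed
  then have "\<bar>u (mix p p' (insert b X)) - u (mix p p' X) - D * h\<bar> \<le> \<omega> * \<bar>h\<bar>"
    unfolding mix_insert[OF b insert.hyps(2)] h_def .
  moreover have "\<bar>u (mix p p' X) - u p - (\<Sum>b\<in>X. pderiv_within \<Omega> b u p * inner (p' - p) b)\<bar> \<le> \<omega> * (\<Sum>b\<in>X. \<bar>inner (p' - p) b\<bar>)"
    using insert.IH insert.prems by blast
  moreover have "(\<Sum>b\<in>insert b X. pderiv_within \<Omega> b u p * inner (p' - p) b) = D * h + (\<Sum>b\<in>X. pderiv_within \<Omega> b u p * inner (p' - p) b)"
    using insert.hyps by (simp add: D_def h_def)
  moreover have "\<omega> * (\<Sum>b\<in>insert b X. \<bar>inner (p' - p) b\<bar>) = \<omega> * \<bar>h\<bar> + \<omega> * (\<Sum>b\<in>X. \<bar>inner (p' - p) b\<bar>)"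
    using insert.hyps by (simp add: h_def distrib_left)
  ultimately show ?case by linarith
qed

text \<open>\<open>Ck_on 1\<close> speaks of partial derivatives within the domain only.
  Differentiability, uniformly on a box, follows from their uniform continuity by changing one
  coordinate at a time; the axis-parallel path stays in the box and never farther from p than p'
  is.\<close>

lemma C1_increment:
  fixes u :: "'a::euclidean_space \<Rightarrow> real"
  assumes "Ck_on 1 u \<Omega>" "cbox a c \<subseteq> \<Omega>" "\<omega> > 0"
  shows "\<exists>\<delta>>0. \<forall>p\<in>cbox a c. \<forall>p'\<in>cbox a c. norm (p' - p) < \<delta> \<longrightarrow>
    \<bar>u p' - u p - (\<Sum>b\<in>Basis. pderiv_within \<Omega> b u p * inner (p' - p) b)\<bar> \<le> \<omega> * l1 (p' - p)"
proof -
  define Q where "Q b \<delta> \<longleftrightarrow> \<delta> > 0 \<and> (\<forall>p\<in>cbox a c. \<forall>q\<in>cbox a c. dist q p < \<delta> \<longrightarrow>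
      dist (pderiv_within \<Omega> b u q) (pderiv_within \<Omega> b u p) < \<omega>)" for b \<delta>
  have "\<exists>\<delta>. Q b \<delta>" if b: "b \<in> Basis" for b
  proof -
    have "continuous_on \<Omega> (pderiv_within \<Omega> b u)" using assms(1) b by simp
    then have "continuous_on (cbox a c) (pderiv_within \<Omega> b u)" using assms(2) by (rule continuous_on_subset)
    then have "uniformly_continuous_on (cbox a c) (pderiv_within \<Omega> b u)"
      by (rule compact_uniformly_continuous) (rule compact_cbox)
    then show ?thesis using assms(3) unfolding uniformly_continuous_on_def Q_def by presburger
  qed
  then obtain d where d: "\<And>b. b \<in> Basis \<Longrightarrow> Q b (d b)" by metis
  define \<delta> where "\<delta> = Min (d ` Basis)"
  have \<delta>: "\<delta> > 0" "\<And>b. b \<in> Basis \<Longrightarrow> \<delta> \<le> d b" using d unfolding Q_def \<delta>_def by auto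
  show ?thesis
  proof (intro exI[of _ \<delta>] conjI ballI impI)
    fix p p' assume p: "p \<in> cbox a c" and p': "p' \<in> cbox a c" and near: "norm (p' - p) < \<delta>"
    have "\<bar>u (mix p p' Basis) - u p - (\<Sum>b\<in>Basis. pderiv_within \<Omega> b u p * inner (p' - p) b)\<bar> \<le> \<omega> * (\<Sum>b\<in>Basis. \<bar>inner (p' - p) b\<bar>)"
    proof (rule mix_increment[OF assms(1,2) p p' finite_Basis order_refl])
      fix b q :: 'a assume b: "b \<in> Basis" and q: "q \<in> cbox a c" "norm (q - p) \<le> norm (p' - p)"
      have "dist q p < d b" using q(2) near \<delta>(2)[OF b] by (simp add: dist_norm)
      then have "dist (pderiv_within \<Omega> b u q) (pderiv_within \<Omega> b u p) < \<omega>" using d[OF b] p q(1) unfolding Q_def by blast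
      then show "\<bar>pderiv_within \<Omega> b u q - pderiv_within \<Omega> b u p\<bar> \<le> \<omega>" by (simp add: dist_real_def)
    qed
    moreover have "mix p p' Basis = p'" unfolding mix_def by (simp add: euclidean_representation)
    ultimately show "\<bar>u p' - u p - (\<Sum>b\<in>Basis. pderiv_within \<Omega> b u p * inner (p' - p) b)\<bar> \<le> \<omega> * l1 (p' - p)"
      by (simp add: l1_def)
  qed (rule \<delta>(1))
qed

lemma sum_Basis_prod:
  "(\<Sum>b\<in>(Basis :: ('a::euclidean_space \<times> 'b::euclidean_space) set). g b)
    = (\<Sum>b\<in>Basis. g (b, 0)) + (\<Sum>b\<in>Basis. g (0, b))"
proof -
  have "(\<Sum>b\<in>(Basis :: ('a \<times> 'b) set). g b) = sum g ((\<lambda>u. (u, 0)) ` Basis) + sum g ((\<lambda>v. (0, v)) ` Basis)"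
    unfolding Basis_prod_def by (rule sum.union_disjoint) auto
  then show ?thesis by (simp add: sum.reindex inj_on_def)
qed

text \<open>Along a step of length \<sigma> in the direction (- 1, - V, 0) the differential of u is
  - \<sigma> f by the equation, so with \<sigma> = \<tau> / l the total defect falls below any e > 0
  for large l. The comparison of the two polygons then carries the result over to the step \<tau>
  with a bound independent of l, and e is arbitrary. The choice of B makes all data accessible: it
  lies in the ball where M bounds V.\<close>

lemma euler_solution:
  fixes V :: "real \<times> (real ^ 'n) \<times> (real ^ 'D) \<Rightarrow> real ^ 'n" and f u :: "real \<times> (real ^ 'n) \<times> (real ^ 'D) \<Rightarrow> real"
  assumes sol: "cauchy_solution T V f u\<^sub>0 u"
    and tT: "t \<in> {0..T}" and \<eta>: "\<eta> \<in> cbox 0 One" and x: "norm x \<le> \<rho>" and C: "C > 0"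
    and growth: "\<And>s y. s \<in> {0..T} \<Longrightarrow> norm (V (s, y, \<eta>)) \<le> C * (1 + norm y)"
    and bound: "\<And>s y. s \<in> {0..T} \<Longrightarrow> norm y \<le> (\<rho> + C * T) * exp (C * T) \<Longrightarrow> norm (V (s, y, \<eta>)) \<le> M"
    and pos: "M \<ge> 0" "\<Lambda> \<ge> 0" "\<Lambda>' \<ge> 0" "L \<ge> 0" and N: "N \<ge> 1"
    and B: "B = cball 0 (min ((\<rho> + C * T) * exp (C * T)) (\<rho> + T * M))"
    and lipV: "\<And>s s' y y'. s \<in> {0..T} \<Longrightarrow> s' \<in> {0..T} \<Longrightarrow> y \<in> B \<Longrightarrow> y' \<in> B \<Longrightarrow>
      norm (V (s, y, \<eta>) - V (s', y', \<eta>)) \<le> \<Lambda> * (\<bar>s - s'\<bar> + norm (y - y'))"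
    and lipf: "\<And>s s' y y'. s \<in> {0..T} \<Longrightarrow> s' \<in> {0..T} \<Longrightarrow> y \<in> B \<Longrightarrow> y' \<in> B \<Longrightarrow>
      \<bar>f (s, y, \<eta>) - f (s', y', \<eta>)\<bar> \<le> \<Lambda>' * (\<bar>s - s'\<bar> + norm (y - y'))"
    and lipu: "\<And>y y'. y \<in> B \<Longrightarrow> y' \<in> B \<Longrightarrow> \<bar>u\<^sub>0 y - u\<^sub>0 y'\<bar> \<le> L * norm (y - y')"
  defines "W \<equiv> \<lambda>s y. V (t - s, y, \<eta>)" and "\<tau> \<equiv> t / real N"
  shows "\<And>j. j \<le> N \<Longrightarrow> eul W \<tau> x j \<in> B"
    and "\<bar>u (t, x, \<eta>) - (u\<^sub>0 (eul W \<tau> x N) + \<tau> * (\<Sum>j<N. f (t - real j * \<tau>, eul W \<tau> x j, \<eta>)))\<bar>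
      \<le> (L + T * \<Lambda>') * (\<tau> * (1 + M) * exp (T * \<Lambda>))"
proof -
  have T0: "T \<ge> 0" and t0: "0 \<le> t" "t \<le> T" using tT by auto
  \<comment> \<open>Stated for an arbitrary step, since both the coarse and the fine polygon must
    remain in B.\<close>
  have inB: "eul W \<sigma> x i \<in> B" if "\<sigma> \<ge> 0" "real N' * \<sigma> \<le> t" "i \<le> N'" for \<sigma> N' i
  proof -
    have g: "norm (W s y) \<le> C * (1 + norm y)" if "0 \<le> s" "s \<le> t" for s y
      unfolding W_def using that t0 by (intro growth) auto
    have b: "norm (W s y) \<le> M" if "0 \<le> s" "s \<le> t" "norm y \<le> (\<rho> + C * T) * exp (C * T)" for s y
      unfolding W_def using that t0 by (intro bound) auto
    show ?thesis using eul_bound[OF that(1,2) t0(2) C pos(1) x g b that(3)] by (simp add: B)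
  qed
  have \<tau>0: "\<tau> \<ge> 0" and N\<tau>: "real N * \<tau> = t" using t0 N by (auto simp: \<tau>_def)
  show coarse: "eul W \<tau> x j \<in> B" if "j \<le> N" for j by (rule inB[OF \<tau>0 _ that]) (simp add: N\<tau>)
  have BM: "norm (V (s, y, \<eta>)) \<le> M" if "s \<in> {0..T}" "y \<in> B" for s y using that by (intro bound) (auto simp: B)
  define R where "R = \<rho> + T * M"
  have BR: "norm y \<le> R" if "y \<in> B" for y using that by (simp add: B R_def)
  let ?\<Omega> = "tx_dom T (UNIV :: (real ^ 'n) set) :: (real \<times> (real ^ 'n) \<times> (real ^ 'D)) set"
  let ?lo = "(0, - (R *\<^sub>R One), 0) :: real \<times> (real ^ 'n) \<times> (real ^ 'D)"
  let ?hi = "(T, R *\<^sub>R One, One) :: real \<times> (real ^ 'n) \<times> (real ^ 'D)"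
  have box: "(s, y, \<eta>) \<in> cbox ?lo ?hi" if "s \<in> {0..T}" "y \<in> B" for s y
  proof -
    have "\<bar>inner y e\<bar> \<le> R" if "e \<in> Basis" for e using Basis_le_norm[OF that, of y] BR[OF \<open>y \<in> B\<close>] by linarith
    then have "y \<in> cbox (- (R *\<^sub>R One)) (R *\<^sub>R One)"
      unfolding mem_box by (auto simp: abs_le_iff minus_le_iff)
    then show ?thesis using that \<eta> by (simp add: cbox_Pair_eq)
  qed
  have box\<Omega>: "cbox ?lo ?hi \<subseteq> ?\<Omega>" by (auto simp: cbox_Pair_eq tx_dom_def)
  have u1: "Ck_on 1 u ?\<Omega>" using sol by (simp add: cauchy_solution_def)
  define D where "D = real DIM(real \<times> (real ^ 'n) \<times> (real ^ 'D))"
  have D1: "D \<ge> 1" by (simp add: D_def)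
  show "\<bar>u (t, x, \<eta>) - (u\<^sub>0 (eul W \<tau> x N) + \<tau> * (\<Sum>j<N. f (t - real j * \<tau>, eul W \<tau> x j, \<eta>)))\<bar>
      \<le> (L + T * \<Lambda>') * (\<tau> * (1 + M) * exp (T * \<Lambda>))"
  proof (rule field_le_epsilon)
    fix e :: real assume e: "e > 0"
    \<comment> \<open>Each of the N l steps has a defect of at most \<omega> D \<sigma> (1 + M); as
      N l \<sigma> = t, these add up to at most e.\<close>
    define \<omega> where "\<omega> = e / (D * (1 + M) * (T + 1))"
    have den: "D * (1 + M) * (T + 1) > 0" using D1 pos(1) T0 by auto
    have \<omega>0: "\<omega> > 0" using e den by (simp add: \<omega>_def)
    obtain \<delta> where \<delta>: "\<delta> > 0" and inc: "\<forall>p\<in>cbox ?lo ?hi. \<forall>p'\<in>cbox ?lo ?hi. norm (p' - p) < \<delta> \<longrightarrow>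
      \<bar>u p' - u p - (\<Sum>b\<in>Basis. pderiv_within ?\<Omega> b u p * inner (p' - p) b)\<bar> \<le> \<omega> * l1 (p' - p)"
      using C1_increment[OF u1 box\<Omega> \<omega>0] by blast
    \<comment> \<open>A fine step moves the point by at most \<sigma> (1 + M), which this choice of
      l makes smaller than \<delta>.\<close>
    obtain l :: nat where l: "real l > T * (1 + M) / \<delta>" using reals_Archimedean2 by blast
    have "T * (1 + M) / \<delta> \<ge> 0" using T0 pos(1) \<delta> by simp
    then have l1: "l \<ge> 1" using l by (cases l) auto
    define \<sigma> where "\<sigma> = t / (real N * real l)"
    have \<sigma>0: "\<sigma> \<ge> 0" using t0 by (simp add: \<sigma>_def)
    have \<tau>\<sigma>: "\<tau> = real l * \<sigma>" using l1 by (simp add: \<tau>_def \<sigma>_def)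
    have Nl: "real (N * l) * \<sigma> = t" using N l1 by (simp add: \<sigma>_def)
    have "\<sigma> \<le> t / (1 * real l)" unfolding \<sigma>_def using N l1 t0 by (intro divide_left_mono mult_right_mono) auto
    also have "\<dots> \<le> T / real l" using t0 by (simp add: divide_right_mono)
    finally have "\<sigma> * (1 + M) \<le> T / real l * (1 + M)" using pos(1) by (intro mult_right_mono) auto
    also have "\<dots> < \<delta>" using l l1 \<delta> by (simp add: field_simps)
    finally have small: "\<sigma> * (1 + M) < \<delta>" .
    let ?z = "eul W \<sigma> x"
    have fine: "?z i \<in> B" if "i \<le> N * l" for i by (rule inB[OF \<sigma>0 _ that]) (simp add: Nl del: of_nat_mult)
    have time: "t - real i * \<sigma> \<in> {0..T}" if "i \<le> N * l" for i
    proof -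
      have "real i * \<sigma> \<le> real (N * l) * \<sigma>" using that \<sigma>0 by (intro mult_right_mono) (simp_all only: of_nat_le_iff)
      then have "real i * \<sigma> \<le> t" by (simp only: Nl)
      moreover have "0 \<le> real i * \<sigma>" using \<sigma>0 by simp
      ultimately show ?thesis using t0 by simp
    qed
    have tele: "\<bar>u (t - real i * \<sigma>, ?z i, \<eta>) + \<sigma> * (\<Sum>q<i. f (t - real q * \<sigma>, ?z q, \<eta>)) - u (t, x, \<eta>)\<bar>
        \<le> real i * (\<omega> * (D * (\<sigma> * (1 + M))))" if "i \<le> N * l" for i
      using that
    proof (induction i)
      case (Suc i)
      define p where "p = (t - real i * \<sigma>, ?z i, \<eta>)"
      define p' where "p' = (t - real (Suc i) * \<sigma>, ?z (Suc i), \<eta>)"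
      have pbox: "p \<in> cbox ?lo ?hi" "p' \<in> cbox ?lo ?hi"
        unfolding p_def p'_def using Suc.prems by (intro box time fine; simp)+
      have pp: "p' - p = (- \<sigma>, - (\<sigma> *\<^sub>R V p), 0)" by (simp add: p_def p'_def W_def algebra_simps)
      have "norm (V p) \<le> M" unfolding p_def using Suc.prems by (intro BM time fine) auto
      then have VM: "\<sigma> * norm (V p) \<le> \<sigma> * M" using \<sigma>0 by (rule mult_left_mono)
      have "norm (p' - p) \<le> norm (- \<sigma>) + norm (- (\<sigma> *\<^sub>R V p), 0 :: real ^ 'D)" unfolding pp by (rule norm_Pair_le)
      also have "\<dots> \<le> \<sigma> * (1 + M)" using VM \<sigma>0 by (simp add: distrib_left)
      finally have np: "norm (p' - p) \<le> \<sigma> * (1 + M)" .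
      have "l1 (p' - p) \<le> D * norm (p' - p)" unfolding D_def by (rule l1_le_norm)
      also have "\<dots> \<le> D * (\<sigma> * (1 + M))" using np D1 by (intro mult_left_mono) auto
      finally have lp: "l1 (p' - p) \<le> D * (\<sigma> * (1 + M))" .
      \<comment> \<open>The increment has no \<eta> component, so the sum over the basis is -
        \<sigma> times the left-hand side of the transport equation.\<close>
      have "(\<Sum>b\<in>Basis. pderiv_within ?\<Omega> b u p * inner (p' - p) b)
        = - \<sigma> * (pderiv_within ?\<Omega> (1, 0, 0) u p + (\<Sum>b\<in>Basis. inner (V p) b * pderiv_within ?\<Omega> (0, b, 0) u p))"
        unfolding pp by (simp add: sum_Basis_prod zero_prod_def sum_negf sum_distrib_left algebra_simps)
      also have "\<dots> = - \<sigma> * f p"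
      proof -
        have "p \<in> ?\<Omega>" using pbox box\<Omega> by blast
        then show ?thesis using sol by (simp add: cauchy_solution_def)
      qed
      finally have "\<bar>u p' - u p + \<sigma> * f p\<bar> \<le> \<omega> * l1 (p' - p)"
        using inc pbox np small by fastforce
      also have "\<dots> \<le> \<omega> * (D * (\<sigma> * (1 + M)))" using lp \<omega>0 by (intro mult_left_mono) auto
      finally have step: "\<bar>u p' - u p + \<sigma> * f p\<bar> \<le> \<omega> * (D * (\<sigma> * (1 + M)))" .
      have IH: "\<bar>u p + \<sigma> * (\<Sum>q<i. f (t - real q * \<sigma>, ?z q, \<eta>)) - u (t, x, \<eta>)\<bar> \<le> real i * (\<omega> * (D * (\<sigma> * (1 + M))))"
        using Suc unfolding p_def by simp
      have "u p' + \<sigma> * (\<Sum>q<Suc i. f (t - real q * \<sigma>, ?z q, \<eta>)) - u (t, x, \<eta>)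
        = (u p' - u p + \<sigma> * f p) + (u p + \<sigma> * (\<Sum>q<i. f (t - real q * \<sigma>, ?z q, \<eta>)) - u (t, x, \<eta>))"
        by (simp add: p_def algebra_simps)
      then have "\<bar>u p' + \<sigma> * (\<Sum>q<Suc i. f (t - real q * \<sigma>, ?z q, \<eta>)) - u (t, x, \<eta>)\<bar>
         \<le> \<omega> * (D * (\<sigma> * (1 + M))) + real i * (\<omega> * (D * (\<sigma> * (1 + M))))"
        using step IH by linarith
      also have "\<dots> = real (Suc i) * (\<omega> * (D * (\<sigma> * (1 + M))))" by (simp add: algebra_simps)
      finally show ?case unfolding p'_def .
    qed simp
    have "real (N * l) * (\<omega> * (D * (\<sigma> * (1 + M)))) = \<omega> * (D * (1 + M)) * (real (N * l) * \<sigma>)" by simp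
    also have "\<dots> = \<omega> * (D * (1 + M)) * t" unfolding Nl ..
    also have "\<dots> \<le> \<omega> * (D * (1 + M)) * (T + 1)" using \<omega>0 D1 pos(1) t0 by (intro mult_left_mono) auto
    also have "\<dots> = e"
    proof -
      have "T + 1 > 0" "1 + M > 0" "D > 0" using D1 pos(1) T0 by auto
      then show ?thesis by (simp add: \<omega>_def)
    qed
    finally have le_e: "real (N * l) * (\<omega> * (D * (\<sigma> * (1 + M)))) \<le> e" .
    have u0: "u (t - real (N * l) * \<sigma>, ?z (N * l), \<eta>) = u\<^sub>0 (?z (N * l))"
      unfolding Nl using sol \<eta> by (simp add: cauchy_solution_def)
    have 1: "\<bar>u\<^sub>0 (?z (N * l)) + \<sigma> * (\<Sum>q<N * l. f (t - real q * \<sigma>, ?z q, \<eta>)) - u (t, x, \<eta>)\<bar> \<le> e"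
      using order_trans[OF tele[OF order_refl] le_e] unfolding u0 .
    have Wb: "norm (W s y) \<le> M" if "0 \<le> s" "s \<le> t" "y \<in> B" for s y
      unfolding W_def using that t0 by (intro BM) auto
    have Wl: "norm (W s y - W s' y') \<le> \<Lambda> * (\<bar>s - s'\<bar> + norm (y - y'))"
      if "0 \<le> s" "s \<le> t" "0 \<le> s'" "s' \<le> t" "y \<in> B" "y' \<in> B" for s s' y y'
      using lipV[of "t - s" "t - s'" y y'] that t0 by (simp add: W_def abs_minus_commute)
    have Fl: "\<bar>f (t - s, y, \<eta>) - f (t - s', y', \<eta>)\<bar> \<le> \<Lambda>' * (\<bar>s - s'\<bar> + norm (y - y'))"
      if "0 \<le> s" "s \<le> t" "0 \<le> s'" "s' \<le> t" "y \<in> B" "y' \<in> B" for s s' y y'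
      using lipf[of "t - s" "t - s'" y y'] that t0 by (simp add: abs_minus_commute)
    have N\<tau>': "real N * \<tau> \<le> t" by (simp add: N\<tau>)
    have 2: "\<bar>\<sigma> * (\<Sum>i<N * l. f (t - real i * \<sigma>, ?z i, \<eta>)) - \<tau> * (\<Sum>j<N. f (t - real j * \<tau>, eul W \<tau> x j, \<eta>))\<bar>
       \<le> T * \<Lambda>' * (\<tau> * (1 + M) * exp (T * \<Lambda>))"
      by (rule eul_refine_sum[where F = "\<lambda>s y. f (t - s, y, \<eta>)" and B = B and t = t, OF l1 \<sigma>0 \<tau>\<sigma> N\<tau>' pos(2,1) _ _ _ _ t0(2) pos(3)])
        (rule coarse fine Wb Wl Fl; assumption)+
    have 3: "\<bar>u\<^sub>0 (?z (N * l)) - u\<^sub>0 (eul W \<tau> x N)\<bar> \<le> L * (\<tau> * (1 + M) * exp (T * \<Lambda>))"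
    proof -
      have "norm (?z (N * l) - eul W \<tau> x N) \<le> \<tau> * (1 + M) * ((1 + \<tau> * \<Lambda>) ^ N - 1)"
        by (rule eul_refine(1)[where B = B and t = t and N = N, OF l1 \<sigma>0 \<tau>\<sigma> N\<tau>' pos(2,1)])
          (rule coarse fine Wb Wl order_refl; assumption?)+
      also have "\<dots> \<le> \<tau> * (1 + M) * exp (T * \<Lambda>)"
        using power_one_plus_le_exp[of \<tau> \<Lambda> N T] N\<tau> t0 \<tau>0 pos by (intro mult_left_mono) auto
      finally have d: "norm (?z (N * l) - eul W \<tau> x N) \<le> \<tau> * (1 + M) * exp (T * \<Lambda>)" .
      have "\<bar>u\<^sub>0 (?z (N * l)) - u\<^sub>0 (eul W \<tau> x N)\<bar> \<le> L * norm (?z (N * l) - eul W \<tau> x N)"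
        by (rule lipu[OF fine coarse]) auto
      also have "\<dots> \<le> L * (\<tau> * (1 + M) * exp (T * \<Lambda>))" using d pos(4) by (rule mult_left_mono)
      finally show ?thesis .
    qed
    show "\<bar>u (t, x, \<eta>) - (u\<^sub>0 (eul W \<tau> x N) + \<tau> * (\<Sum>j<N. f (t - real j * \<tau>, eul W \<tau> x j, \<eta>)))\<bar>
      \<le> (L + T * \<Lambda>') * (\<tau> * (1 + M) * exp (T * \<Lambda>)) + e"
      using 1 2 3 unfolding distrib_right by linarith
  qed
qed

subsection \<open>Waveform relaxation by a network of logarithmic depth\<close>

text \<open>Splitting into \<open>b\<close> blocks \<open>k\<close> times keeps both the depth and the number of summands per
  neuron small; summing each prefix directly would cost \<open>b\<^bsup>2k\<^esup>\<close> weights.\<close>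

lemma computes_prefix_sums:
  assumes "b \<ge> 1" "\<And>i. i < b ^ k \<Longrightarrow> f i \<in> A"
  shows "computes A k (k * b ^ k * (b + 1)) (\<Union>j\<in>{1..b ^ k}. {\<lambda>x. \<Sum>i<j. f i x})"
  using assms(2)
proof (induction k arbitrary: f)
  case 0
  then show ?case by (intro computes_refl) simp
next
  case (Suc k)
  let ?n = "b ^ k"
  have n1: "?n \<ge> 1" using assms(1) by simp
  define P where "P q j = (\<lambda>x. \<Sum>i<j. f (q * ?n + i) x)" for q j
  define B where "B = (\<Union>q\<in>{..<b}. \<Union>j\<in>{1..?n}. {P q j})"
  have "computes A k (card {..<b} * (k * ?n * (b + 1))) B"
    unfolding B_def P_def
  proof (rule computes_UN_const, simp, rule Suc.IH)
    fix q i assume q: "q \<in> {..<b}" and i: "i < ?n"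
    then have "q * ?n + i < (q + 1) * ?n" by simp
    also have "\<dots> \<le> b ^ Suc k" using q mult_le_mono1[of "q + 1" b ?n] by simp
    finally show "f (q * ?n + i) \<in> A" by (rule Suc.prems)
  qed
  then have cB: "computes A k (b * (k * ?n * (b + 1))) B" by simp
  have pre: "computes (A \<union> B) 1 (b + 1) {\<lambda>x. \<Sum>i<j. f i x}" if j: "j \<in> {1..b ^ Suc k}" for j
  proof -
    \<comment> \<open>Remainders are counted from 1 to \<open>?n\<close>: a prefix is q full blocks
      followed by a nonempty piece, because B contains no empty sums. Each prefix thus has at most b
      summands.\<close>
    define q where "q = (j - 1) div ?n"
    define r where "r = (j - 1) mod ?n + 1"
    have "j - 1 < b * ?n" using j by auto
    then have qb: "q < b" unfolding q_def using n1 by (simp add: less_mult_imp_div_less)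
    have r: "r \<in> {1..?n}" 
    proof -
      have "(j - 1) mod ?n < ?n" using n1 by (intro mod_less_divisor) linarith
      then show ?thesis unfolding r_def by simp
    qed
    have "q * ?n + (j - 1) mod ?n = j - 1" unfolding q_def by (rule div_mult_mod_eq)
    then have jqr: "j = q * ?n + r" unfolding r_def using j by auto
    let ?g = "\<lambda>q'. if q' < q then P q' ?n else P q r"
    have "?g q' \<in> A \<union> B" if "q' \<in> {..q}" for q'
    proof (cases "q' < q")
      case True
      have "P q' ?n \<in> B" unfolding B_def using True qb n1 by (intro UN_I[of q'] UN_I[of ?n]) auto
      then show ?thesis using True by simp
    next
      case False
      have "P q r \<in> B" unfolding B_def using qb r by (intro UN_I[of q] UN_I[of r]) auto
      then show ?thesis using False by simp
    qed
    then have "computes (A \<union> B) 1 (card {..q} + 1) {\<lambda>x. 0 + (\<Sum>q'\<in>{..q}. 1 * ?g q' x)}"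
      by (intro computes_affine) auto
    moreover have "0 + (\<Sum>q'\<in>{..q}. 1 * ?g q' x) = (\<Sum>i<j. f i x)" for x
    proof -
      have "(\<Sum>q'\<in>{..q}. 1 * ?g q' x) = (\<Sum>q'<q. P q' ?n x) + P q r x"
        by (simp add: lessThan_Suc_atMost[symmetric])
      also have "(\<Sum>q'<q. P q' ?n x) = (\<Sum>i<q * ?n. f i x)"
      proof (induction q)
        case (Suc q)
        have "Suc q * ?n = q * ?n + ?n" by simp
        then show ?case using Suc by (simp only: sum.lessThan_Suc sum_lessThan_add P_def)
      qed simp
      also have "(\<Sum>i<q * ?n. f i x) + P q r x = (\<Sum>i<j. f i x)"
        unfolding jqr sum_lessThan_add by (simp add: P_def)
      finally show ?thesis by simp
    qed
    ultimately have "computes (A \<union> B) 1 (card {..q} + 1) {\<lambda>x. \<Sum>i<j. f i x}" by simp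
    then show ?thesis by (rule computes_mono) (use qb in auto)
  qed
  have "computes (A \<union> B) 1 (card {1..b ^ Suc k} * (b + 1)) (\<Union>j\<in>{1..b ^ Suc k}. {\<lambda>x. \<Sum>i<j. f i x})"
    by (rule computes_UN_const) (use pre in auto)
  from computes_then[OF cB this] show ?case
    by (rule computes_mono) (auto simp: algebra_simps)
qed

text \<open>Node i belongs to the time t - i t / N, a fixed multiple of t, so an affine neuron
  computes it although the step t / N depends on the input.\<close>

definition node_at :: "nat \<Rightarrow> (nat \<Rightarrow> real \<times> 'y \<times> 'z \<Rightarrow> 'y::euclidean_space) \<Rightarrow> nat \<Rightarrow> real \<times> 'y \<times> 'z \<Rightarrow> real \<times> 'y \<times> 'z" where
  "node_at N Y i p = ((1 - real i / real N) * fst p, Y i p, snd (snd p))"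

text \<open>The nodes of the Euler polygon solve \<open>Y j = x - (\<Sum>i<j. (t / N) *\<^sub>R V (node i))\<close>; this is the
  Picard iteration for all nodes at once. \<open>H e s\<close> approximates \<open>s\<close> times the coordinate \<open>e\<close> of \<open>V\<close>.\<close>

primrec relax :: "('y \<Rightarrow> real \<Rightarrow> real \<times> 'y \<times> 'z \<Rightarrow> real) \<Rightarrow> nat \<Rightarrow> nat \<Rightarrow> nat \<Rightarrow> real \<times> 'y \<times> 'z \<Rightarrow> 'y::euclidean_space" where
  "relax H N 0 j p = fst (snd p)"
| "relax H N (Suc m) j p = fst (snd p) - (1 / real N) *\<^sub>R
     (\<Sum>e\<in>Basis. (\<Sum>i<j. H e (fst p) (node_at N (relax H N m) i p)) *\<^sub>R e)"

lemma relax_inner: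
  assumes "e \<in> Basis"
  shows "inner (relax H N (Suc m) j p) e
    = inner (fst (snd p)) e - (1 / real N) * (\<Sum>i<j. H e (fst p) (node_at N (relax H N m) i p))"
proof -
  have "inner (\<Sum>e\<in>Basis. (\<Sum>i<j. H e (fst p) (node_at N (relax H N m) i p)) *\<^sub>R e) e
    = (\<Sum>i<j. H e (fst p) (node_at N (relax H N m) i p))" using assms by (rule inner_sum_left_Basis)
  then show ?thesis by (simp add: inner_diff_left)
qed

text \<open>A change at one node affects each component at the later nodes by a factor C / N, which
  gives the constant \<kappa> = n C / N. With weight (1 + 2 \<kappa>)^j at node j, summing the
  weights of all earlier nodes and multiplying by \<kappa> gives at most half the weight at j, so a
  sweep halves the weighted error whatever N is. The weights stay below exp (2 n C), hence removing
  them costs only a constant.\<close>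

lemma relax_error:
  fixes V :: "real \<times> 'y \<times> 'z::euclidean_space \<Rightarrow> 'y::euclidean_space" and H :: "'y \<Rightarrow> real \<Rightarrow> real \<times> 'y \<times> 'z \<Rightarrow> real"
  defines "n \<equiv> real DIM('y)"
  assumes N: "N \<ge> 1" and pos: "C \<ge> 0" "\<epsilon> \<ge> 0" "A0 \<ge> 0"
    and H: "\<And>e i y. e \<in> Basis \<Longrightarrow> i < N \<Longrightarrow>
       \<bar>H e t ((1 - real i / real N) * t, y, \<eta>) - t * inner (V (t - real i * (t / real N), eul (\<lambda>s y. V (t - s, y, \<eta>)) (t / real N) x i, \<eta>)) e\<bar>
       \<le> C * (\<epsilon> + norm (y - eul (\<lambda>s y. V (t - s, y, \<eta>)) (t / real N) x i))"
    and A0: "\<And>j. j \<le> N \<Longrightarrow> norm (x - eul (\<lambda>s y. V (t - s, y, \<eta>)) (t / real N) x j) \<le> A0"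
    and "j \<le> N"
  shows "norm (relax H N m j (t, x, \<eta>) - eul (\<lambda>s y. V (t - s, y, \<eta>)) (t / real N) x j) \<le> (2 * (n * C) * \<epsilon> + A0 / 2 ^ m) * exp (2 * (n * C))"
proof -
  define W where "W = (\<lambda>s y. V (t - s, y, \<eta>))"
  define y where "y = eul W (t / real N) x"
  define \<kappa> where "\<kappa> = n * C / real N"
  have \<kappa>0: "\<kappa> \<ge> 0" using pos by (simp add: \<kappa>_def n_def)
  have \<kappa>N: "\<kappa> * real N = n * C" using N by (simp add: \<kappa>_def)
  let ?Y = "\<lambda>m j. relax H N m j (t, x, \<eta>)"
  define q where "q i = (t - real i * (t / real N), y i, \<eta>)" for i
  have yj: "y j = x - (1 / real N) *\<^sub>R (\<Sum>i<j. t *\<^sub>R V (q i))" for j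
    unfolding y_def q_def by (induction j) (auto simp: W_def scaleR_right_diff_distrib scaleR_add_right)
  \<comment> \<open>Solves A (m + 1) = n C \<epsilon> + A m / 2: the network error made in every
    sweep accumulates to a multiple of itself only.\<close>
  define A where "A m = 2 * (n * C) * \<epsilon> + A0 / 2 ^ m" for m
  have Apos: "A m \<ge> 0" for m using pos by (simp add: A_def n_def)
  have step: "norm (?Y (Suc m) j - y j) \<le> \<kappa> * (\<Sum>i<j. \<epsilon> + norm (?Y m i - y i))" if "j \<le> N" for m j
  proof -
    have comp: "\<bar>inner (?Y (Suc m) j - y j) e\<bar> \<le> (1 / real N) * (\<Sum>i<j. C * (\<epsilon> + norm (?Y m i - y i)))" if e: "e \<in> Basis" for e
    proof -
      have "inner (?Y (Suc m) j - y j) e = - (1 / real N) * (\<Sum>i<j. H e t (node_at N (relax H N m) i (t, x, \<eta>)) - t * inner (V (q i)) e)"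
        unfolding inner_diff_left relax_inner[OF e] yj by (simp add: inner_diff_left inner_sum_left sum_subtractf right_diff_distrib)
      then have "\<bar>inner (?Y (Suc m) j - y j) e\<bar> = (1 / real N) * \<bar>\<Sum>i<j. H e t (node_at N (relax H N m) i (t, x, \<eta>)) - t * inner (V (q i)) e\<bar>"
        by (simp add: abs_mult)
      also have "\<dots> \<le> (1 / real N) * (\<Sum>i<j. C * (\<epsilon> + norm (?Y m i - y i)))"
      proof (rule mult_left_mono[OF order_trans[OF sum_abs sum_mono]])
        fix i assume "i \<in> {..<j}"
        then have "i < N" using \<open>j \<le> N\<close> by simp
        from H[OF e this, of "?Y m i"] show "\<bar>H e t (node_at N (relax H N m) i (t, x, \<eta>)) - t * inner (V (q i)) e\<bar> \<le> C * (\<epsilon> + norm (?Y m i - y i))"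
          by (simp add: node_at_def q_def y_def W_def)
      qed simp
      finally show ?thesis .
    qed
    have "norm (?Y (Suc m) j - y j) \<le> l1 (?Y (Suc m) j - y j)" by (rule norm_le_l1')
    also have "\<dots> \<le> (\<Sum>e\<in>(Basis :: 'y set). (1 / real N) * (\<Sum>i<j. C * (\<epsilon> + norm (?Y m i - y i))))"
      unfolding l1_def by (rule sum_mono) (rule comp)
    also have "\<dots> = \<kappa> * (\<Sum>i<j. \<epsilon> + norm (?Y m i - y i))"
      by (simp add: \<kappa>_def n_def sum_distrib_left[symmetric])
    finally show ?thesis .
  qed
  have geo: "2 * \<kappa> * (\<Sum>i<j. (1 + 2 * \<kappa>) ^ i) = (1 + 2 * \<kappa>) ^ j - 1" for j
    by (induction j) (auto simp: algebra_simps)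
  have pw1: "(1 + 2 * \<kappa>) ^ j \<ge> 1" for j using \<kappa>0 by (simp add: one_le_power)
  have main: "norm (?Y m j - y j) \<le> A m * (1 + 2 * \<kappa>) ^ j" if "j \<le> N" for m j
    using that
  proof (induction m arbitrary: j)
    case 0
    have "norm (?Y 0 j - y j) \<le> A0" using A0[OF 0] by (simp add: y_def W_def)
    also have "\<dots> \<le> A 0 * 1" using pos by (simp add: A_def n_def)
    also have "\<dots> \<le> A 0 * (1 + 2 * \<kappa>) ^ j" using pw1 Apos by (intro mult_left_mono) auto
    finally show ?case .
  next
    case (Suc m)
    have "norm (?Y (Suc m) j - y j) \<le> \<kappa> * (\<Sum>i<j. \<epsilon> + norm (?Y m i - y i))" by (rule step[OF Suc.prems])
    also have "\<dots> \<le> \<kappa> * (\<Sum>i<j. \<epsilon> + A m * (1 + 2 * \<kappa>) ^ i)"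
      using Suc \<kappa>0 by (intro mult_left_mono sum_mono add_left_mono) auto
    also have "\<dots> = (\<kappa> * real j) * \<epsilon> + A m / 2 * (2 * \<kappa> * (\<Sum>i<j. (1 + 2 * \<kappa>) ^ i))"
      by (simp add: sum.distrib sum_distrib_left algebra_simps)
    also have "\<dots> = (\<kappa> * real j) * \<epsilon> + A m / 2 * ((1 + 2 * \<kappa>) ^ j - 1)" unfolding geo ..
    also have "\<dots> \<le> (n * C * \<epsilon>) * (1 + 2 * \<kappa>) ^ j + A m / 2 * (1 + 2 * \<kappa>) ^ j"
    proof (rule add_mono)
      have "\<kappa> * real j \<le> n * C" unfolding \<kappa>N[symmetric] using Suc.prems \<kappa>0 by (intro mult_left_mono) auto
      then have "(\<kappa> * real j) * \<epsilon> \<le> (n * C * \<epsilon>) * 1" using pos by (simp add: mult_right_mono)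
      also have "\<dots> \<le> (n * C * \<epsilon>) * (1 + 2 * \<kappa>) ^ j" using pos pw1 by (intro mult_left_mono) (auto simp: n_def)
      finally show "(\<kappa> * real j) * \<epsilon> \<le> (n * C * \<epsilon>) * (1 + 2 * \<kappa>) ^ j" .
      show "A m / 2 * ((1 + 2 * \<kappa>) ^ j - 1) \<le> A m / 2 * (1 + 2 * \<kappa>) ^ j" using Apos[of m] by (intro mult_left_mono) auto
    qed
    also have "\<dots> = A (Suc m) * (1 + 2 * \<kappa>) ^ j" by (simp add: A_def field_simps)
    finally show ?case .
  qed
  have "(1 + 2 * \<kappa>) ^ j \<le> exp (1 * (2 * (n * C)))"
  proof -
    have "(1 + (1 / real N) * (2 * (n * C))) ^ j \<le> exp (1 * (2 * (n * C)))"
      by (rule power_one_plus_le_exp) (use N pos \<open>j \<le> N\<close> in \<open>auto simp: n_def\<close>)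
    then show ?thesis by (simp add: \<kappa>_def)
  qed
  then have "A m * (1 + 2 * \<kappa>) ^ j \<le> A m * exp (2 * (n * C))" using Apos by (simp add: mult_left_mono)
  with main[OF assms(8), of m] show ?thesis by (simp add: A_def y_def W_def)
qed

definition coord_funs :: "(real \<times> 'y::euclidean_space \<times> 'z::euclidean_space \<Rightarrow> real) set" where
  "coord_funs = {\<lambda>p. inner p e |e. e \<in> Basis}"

lemma coord_funs_mem:
  "fst \<in> (coord_funs :: (real \<times> 'y::euclidean_space \<times> 'z::euclidean_space \<Rightarrow> real) set)"
  "e \<in> Basis \<Longrightarrow> (\<lambda>p. inner (fst (snd p)) e) \<in> (coord_funs :: (real \<times> 'y \<times> 'z \<Rightarrow> real) set)"
  "e' \<in> Basis \<Longrightarrow> (\<lambda>p. inner (snd (snd p)) e') \<in> (coord_funs :: (real \<times> 'y \<times> 'z \<Rightarrow> real) set)"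
proof -
  have "(\<lambda>p :: real \<times> 'y \<times> 'z. inner p (1, 0)) \<in> coord_funs"
    unfolding coord_funs_def by (rule CollectI, rule exI[of _ "(1, 0)"]) (simp add: Basis_prod_def)
  moreover have "(\<lambda>p :: real \<times> 'y \<times> 'z. inner p (1, 0)) = fst" by (auto simp: fun_eq_iff)
  ultimately show "fst \<in> (coord_funs :: (real \<times> 'y \<times> 'z \<Rightarrow> real) set)" by simp
  assume e: "e \<in> Basis"
  have "(\<lambda>p :: real \<times> 'y \<times> 'z. inner p (0, e, 0)) \<in> coord_funs"
    unfolding coord_funs_def by (rule CollectI, rule exI[of _ "(0, e, 0)"]) (simp add: Basis_prod_def e)
  moreover have "(\<lambda>p :: real \<times> 'y \<times> 'z. inner p (0, e, 0)) = (\<lambda>p. inner (fst (snd p)) e)" by (auto simp: fun_eq_iff)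
  ultimately show "(\<lambda>p. inner (fst (snd p)) e) \<in> (coord_funs :: (real \<times> 'y \<times> 'z \<Rightarrow> real) set)" by simp
next
  assume e: "e' \<in> Basis"
  have "(\<lambda>p :: real \<times> 'y \<times> 'z. inner p (0, 0, e')) \<in> coord_funs"
    unfolding coord_funs_def by (rule CollectI, rule exI[of _ "(0, 0, e')"]) (simp add: Basis_prod_def e)
  moreover have "(\<lambda>p :: real \<times> 'y \<times> 'z. inner p (0, 0, e')) = (\<lambda>p. inner (snd (snd p)) e')" by (auto simp: fun_eq_iff)
  ultimately show "(\<lambda>p. inner (snd (snd p)) e') \<in> (coord_funs :: (real \<times> 'y \<times> 'z \<Rightarrow> real) set)" by simp
qed

definition time_funs :: "nat \<Rightarrow> (real \<times> 'y \<times> 'z \<Rightarrow> real) set" where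
  "time_funs N = (\<Union>i\<in>{..<N}. {\<lambda>p. (1 - real i / real N) * fst p})"

definition relax_funs :: "('y \<Rightarrow> real \<Rightarrow> real \<times> 'y \<times> 'z \<Rightarrow> real) \<Rightarrow> nat \<Rightarrow> nat \<Rightarrow> (real \<times> 'y::euclidean_space \<times> 'z \<Rightarrow> real) set" where
  "relax_funs H N m = (\<Union>j\<in>{..N}. \<Union>e\<in>Basis. {\<lambda>p. inner (relax H N m j p) e})"

lemma node_at_available:
  fixes H :: "'y::euclidean_space \<Rightarrow> real \<Rightarrow> real \<times> 'y \<times> 'z::euclidean_space \<Rightarrow> real"
  assumes "i < N" "coord_funs \<union> time_funs N \<union> relax_funs H N m \<subseteq> A" "b \<in> Basis"
  shows "(\<lambda>p. inner (node_at N (relax H N m) i p) b) \<in> A"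
proof -
  from assms(3) consider "b = (1, 0)" | e where "e \<in> Basis" "b = (0, e, 0)" | e where "e \<in> Basis" "b = (0, 0, e)"
    by (auto simp: Basis_prod_def)
  then show ?thesis
  proof cases
    case 1
    have "(\<lambda>p. (1 - real i / real N) * fst p) \<in> (time_funs N :: (real \<times> 'y \<times> 'z \<Rightarrow> real) set)"
      unfolding time_funs_def using assms(1) by blast
    moreover have "(\<lambda>p. inner (node_at N (relax H N m) i p) b) = (\<lambda>p. (1 - real i / real N) * fst p)"
      by (simp add: 1 node_at_def inner_prod_def)
    ultimately show ?thesis using assms(2) by auto
  next
    case (2 e)
    have "(\<lambda>p. inner (relax H N m i p) e) \<in> relax_funs H N m"
      unfolding relax_funs_def by (rule UN_I[of i], use assms(1) in simp, rule UN_I[of e], use 2 in simp_all)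
    moreover have "(\<lambda>p. inner (node_at N (relax H N m) i p) b) = (\<lambda>p. inner (relax H N m i p) e)"
      by (simp add: 2 node_at_def inner_prod_def)
    ultimately show ?thesis using assms(2) by auto
  next
    case (3 e)
    have "(\<lambda>p. inner (node_at N (relax H N m) i p) b) = (\<lambda>p. inner (snd (snd p)) e)"
      by (simp add: 3 node_at_def inner_prod_def)
    then show ?thesis using assms(2) coord_funs_mem(3)[OF 3(1)] by auto
  qed
qed

text \<open>A sweep evaluates the field at all nodes in parallel (depth L), forms all prefix sums
  (depth k) and updates the nodes (depth 1). Only depth and weights add up over the sweeps; the
  functions kept are those of the last one.\<close>

lemma computes_relax:
  fixes H :: "'y::euclidean_space \<Rightarrow> real \<Rightarrow> real \<times> 'y \<times> 'z::euclidean_space \<Rightarrow> real"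
  assumes b: "b \<ge> 1" and N: "N = b ^ k"
    and H: "\<And>e A (Z :: real \<times> 'y \<times> 'z \<Rightarrow> real \<times> 'y \<times> 'z). e \<in> Basis \<Longrightarrow> fst \<in> A \<Longrightarrow> (\<forall>c\<in>Basis. (\<lambda>p. inner (Z p) c) \<in> A) \<Longrightarrow>
      computes A L w {\<lambda>p. H e (fst p) (Z p)}"
  shows "computes coord_funs (1 + m * (L + k + 1)) (2 * N + m * (DIM('y) * N * (w + k * (b + 1) + 3)))
    (coord_funs \<union> time_funs N \<union> relax_funs H N m)"
proof (induction m)
  case 0
  have "computes (coord_funs :: (real \<times> 'y \<times> 'z \<Rightarrow> real) set) 1 (card {..<N} * 2) (time_funs N)"
    unfolding time_funs_def
  proof (rule computes_UN_const)
    fix i assume "i \<in> {..<N}"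
    have "computes coord_funs 1 2 {\<lambda>p :: real \<times> 'y \<times> 'z. (1 - real i / real N) * fst p + 0}"
      by (rule computes_lin1[OF coord_funs_mem(1)])
    then show "computes coord_funs 1 2 {\<lambda>p :: real \<times> 'y \<times> 'z. (1 - real i / real N) * fst p}" by simp
  qed simp
  from computes_union[OF this computes_refl[OF order_refl, of _ 1 0]]
  have "computes (coord_funs :: (real \<times> 'y \<times> 'z \<Rightarrow> real) set) 1 (2 * N) (time_funs N \<union> coord_funs)" by (simp add: mult.commute[of N 2])
  moreover have "relax_funs H N 0 \<subseteq> coord_funs"
    unfolding relax_funs_def by (auto intro: coord_funs_mem(2))
  ultimately show ?case by (simp, elim computes_mono) auto
next
  case (Suc m)
  define A where "A = coord_funs \<union> time_funs N \<union> relax_funs H N m"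
  define h where "h e i = (\<lambda>p. H e (fst p) (node_at N (relax H N m) i p))" for e i
  define B where "B = (\<Union>e\<in>Basis. \<Union>i\<in>{..<N}. {h e i})"
  have N1: "N \<ge> 1" using b N by simp
  have "computes A L (card (Basis :: 'y set) * (card {..<N} * w)) B"
    unfolding B_def
  proof (intro computes_UN_const)
    fix e :: 'y and i assume e: "e \<in> Basis" and i: "i \<in> {..<N}"
    show "computes A L w {h e i}" unfolding h_def
    proof (rule H[OF e])
      show "fst \<in> A" using coord_funs_mem(1) by (auto simp: A_def)
      show "\<forall>c\<in>Basis. (\<lambda>p. inner (node_at N (relax H N m) i p) c) \<in> A"
        using i by (intro ballI node_at_available) (auto simp: A_def)
    qed
  qed auto
  then have cB: "computes A L (DIM('y) * (N * w)) B" by simp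
  define P where "P e j = (\<lambda>p. \<Sum>i<j. h e i p)" for e j
  define C where "C = (\<Union>e\<in>Basis. \<Union>j\<in>{1..N}. {P e j})"
  have "computes (A \<union> B) k (card (Basis :: 'y set) * (k * b ^ k * (b + 1))) C"
    unfolding C_def P_def N
  proof (rule computes_UN_const[OF finite_Basis], rule computes_prefix_sums[OF b])
    fix e :: 'y and i assume "e \<in> Basis" "i < b ^ k"
    then have "h e i \<in> B" unfolding B_def N by blast
    then show "h e i \<in> A \<union> B" by simp
  qed
  then have cC: "computes (A \<union> B) k (DIM('y) * (k * N * (b + 1))) C" by (simp add: N)
  from computes_then[OF cB this] have cC': "computes A (L + k) (DIM('y) * (N * w) + DIM('y) * (k * N * (b + 1))) C" .
  have "computes (A \<union> C) 1 (card {1..N} * (card (Basis :: 'y set) * 3)) (\<Union>j\<in>{1..N}. \<Union>e\<in>Basis. {\<lambda>p. inner (relax H N (Suc m) j p) e})"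
  proof (intro computes_UN_const)
    fix e :: 'y and j assume e: "e \<in> Basis" and j: "j \<in> {1..N}"
    have x: "(\<lambda>p. inner (fst (snd p)) e) \<in> A \<union> C" using coord_funs_mem(2)[OF e] unfolding A_def by blast
    have P: "P e j \<in> A \<union> C" unfolding C_def using e j by blast
    from computes_lin2[OF x P, of 1 "- (1 / real N)" 0]
    show "computes (A \<union> C) 1 3 {\<lambda>p. inner (relax H N (Suc m) j p) e}"
      unfolding relax_inner[OF e] by (simp add: P_def h_def)
  qed auto
  then have cY: "computes (A \<union> C) 1 (N * (DIM('y) * 3)) (\<Union>j\<in>{1..N}. \<Union>e\<in>Basis. {\<lambda>p. inner (relax H N (Suc m) j p) e})"
    by simp
  \<comment> \<open>Node 0 is the starting point in every sweep, hence an input and not a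
    neuron.\<close>
  have "relax H N (Suc m) 0 p = fst (snd p)" for p by simp
  then have "(\<Union>e\<in>Basis. {\<lambda>p. inner (relax H N (Suc m) 0 p) e}) \<subseteq> coord_funs"
    by (auto intro: coord_funs_mem(2))
  moreover have "{..N} = insert 0 {1..N}" by auto
  ultimately have sub: "coord_funs \<union> time_funs N \<union> relax_funs H N (Suc m) \<subseteq> A \<union> (\<Union>j\<in>{1..N}. \<Union>e\<in>Basis. {\<lambda>p. inner (relax H N (Suc m) j p) e})"
    unfolding relax_funs_def A_def by auto
  have "computes A (L + k + 1) (DIM('y) * (N * w) + DIM('y) * (k * N * (b + 1)) + N * (DIM('y) * 3))
     (\<Union>j\<in>{1..N}. \<Union>e\<in>Basis. {\<lambda>p. inner (relax H N (Suc m) j p) e})"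
    by (rule computes_then[OF cC' cY])
  then have "computes (coord_funs \<union> A) (L + k + 1) (DIM('y) * (N * w) + DIM('y) * (k * N * (b + 1)) + N * (DIM('y) * 3))
     (\<Union>j\<in>{1..N}. \<Union>e\<in>Basis. {\<lambda>p. inner (relax H N (Suc m) j p) e})"
    by (rule computes_mono) auto
  from computes_trans[OF Suc.IH[folded A_def] this]
  show ?case
    by (rule computes_mono) (use sub in \<open>auto simp: algebra_simps\<close>)
qed

subsection \<open>Networks for the coefficient functions\<close>

text \<open>The argument \<open>y\<close> of \<open>H\<close> is only an approximation of a point \<open>q\<close> of \<open>S\<close> and need not lie in
  \<open>S\<close>.\<close>

definition net_for :: "nat \<Rightarrow> nat \<Rightarrow> real \<Rightarrow> nat \<Rightarrow> nat \<Rightarrow> nat \<Rightarrow> 'a::euclidean_space set \<Rightarrow> ('a \<Rightarrow> real) \<Rightarrow> (real \<Rightarrow> 'a \<Rightarrow> real) \<Rightarrow> bool" where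
  "net_for k d R C L b S g H \<longleftrightarrow>
     (\<forall>\<tau> y. \<forall>q\<in>S. \<bar>\<tau>\<bar> \<le> R \<longrightarrow> \<bar>H \<tau> y - \<tau> * g q\<bar> \<le> real C * (1 / real b ^ k + norm (y - q))) \<and>
     (\<forall>A (Z :: 'a \<Rightarrow> 'a) \<tau>. \<tau> \<in> A \<longrightarrow> (\<forall>c\<in>Basis. (\<lambda>p. inner (Z p) c) \<in> A) \<longrightarrow>
        computes A L (C * b ^ (d + 1)) {\<lambda>p. H (\<tau> p) (Z p)})"

lemma net_for_error:
  assumes "net_for k d R C L b S g H" "q \<in> S" "\<bar>\<tau>\<bar> \<le> R"
  shows "\<bar>H \<tau> y - \<tau> * g q\<bar> \<le> real C * (1 / real b ^ k + norm (y - q))"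
  using assms by (simp add: net_for_def)

lemma net_for_computes:
  fixes Z :: "'a::euclidean_space \<Rightarrow> 'a"
  assumes "net_for k d R C L b S g H" "\<tau> \<in> A" "\<forall>c\<in>Basis. (\<lambda>p. inner (Z p) c) \<in> A"
  shows "computes A L (C * b ^ (d + 1)) {\<lambda>p. H (\<tau> p) (Z p)}"
  by (rule assms(1)[unfolded net_for_def, THEN conjunct2, THEN spec, THEN spec, THEN spec, THEN mp, OF assms(2), THEN mp, OF assms(3)])

lemma net_for_mono:
  assumes "net_for k d R C L b S g H" "C \<le> C'" "L \<le> L'"
  shows "net_for k d R C' L' b S g H"
  unfolding net_for_def
proof (intro conjI allI ballI impI)
  fix \<tau> y q assume "q \<in> S" "\<bar>\<tau>\<bar> \<le> R"
  then have "\<bar>H \<tau> y - \<tau> * g q\<bar> \<le> real C * (1 / real b ^ k + norm (y - q))" using assms(1) by (simp add: net_for_def)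
  also have "\<dots> \<le> real C' * (1 / real b ^ k + norm (y - q))" using assms(2) by (intro mult_right_mono) auto
  finally show "\<bar>H \<tau> y - \<tau> * g q\<bar> \<le> real C' * (1 / real b ^ k + norm (y - q))" .
next
  fix A and Z :: "'a \<Rightarrow> 'a" and \<tau> assume "\<tau> \<in> A" "\<forall>c\<in>Basis. (\<lambda>p. inner (Z p) c) \<in> A"
  from net_for_computes[OF assms(1) this] show "computes A L' (C' * b ^ (d + 1)) {\<lambda>p. H (\<tau> p) (Z p)}"
    by (rule computes_mono) (use assms in auto)
qed

lemma net_for_smooth:
  fixes R M :: real
  assumes "k \<ge> 1" "R \<ge> 1" "M \<ge> 0"
  shows "\<exists>C L. C \<ge> 1 \<and> (\<forall>(\<Omega> :: 'a::euclidean_space set) S g b. b \<ge> C \<longrightarrow> solid_body R S \<longrightarrow> Ck_bound k M \<Omega> S g \<longrightarrow>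
    (\<exists>H. net_for k DIM('a) R C L b S g H))"
proof -
  \<comment> \<open>With mesh 1/b and b teeth, the errors of order b^(- 2 p) in the products of some
    b^DIM terms must add up to at most b^(- k).\<close>
  define p where "p = DIM('a) + k"
  have p1: "p \<ge> 1" using assms(1) by (simp add: p_def)
  obtain C L where C: "C \<ge> 1" and *: "\<forall>(\<Omega> :: 'a set) S g a n.
    a \<ge> 1 \<longrightarrow> n \<ge> C \<longrightarrow> solid_body R S \<longrightarrow> Ck_bound k M \<Omega> S g \<longrightarrow>
    (\<exists>H :: real \<Rightarrow> 'a \<Rightarrow> real.
      (\<forall>\<tau> y. \<forall>q\<in>S. \<bar>\<tau>\<bar> \<le> R \<longrightarrow>
        \<bar>H \<tau> y - \<tau> * g q\<bar> \<le> real C * (1 / real a ^ k + real a ^ DIM('a) / real n ^ (2 * p) + norm (y - q))) \<and>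
      (\<forall>A (Y :: 'a \<Rightarrow> 'a) \<tau>. \<tau> \<in> A \<longrightarrow> (\<forall>e\<in>Basis. (\<lambda>x. inner (Y x) e) \<in> A) \<longrightarrow>
        computes A L (C * n * a ^ DIM('a)) {\<lambda>x. H (\<tau> x) (Y x)}))"
    using net_approximation[OF assms p1, where 'a = 'a and 'x = 'a] by (elim exE conjE) (rule that, assumption+)
  have "\<exists>H. net_for k DIM('a) R (2 * C) L b S g H"
    if b: "b \<ge> 2 * C" and S: "solid_body R S" and g: "Ck_bound k M \<Omega> S g" for \<Omega> S :: "'a set" and g b
  proof -
    have b1: "b \<ge> 1" "b \<ge> C" using b C by auto
    obtain H where H1: "\<forall>\<tau> y. \<forall>q\<in>S. \<bar>\<tau>\<bar> \<le> R \<longrightarrow>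
        \<bar>H \<tau> y - \<tau> * g q\<bar> \<le> real C * (1 / real b ^ k + real b ^ DIM('a) / real b ^ (2 * p) + norm (y - q))"
      and H2: "\<forall>A (Y :: 'a \<Rightarrow> 'a) \<tau>. \<tau> \<in> A \<longrightarrow> (\<forall>e\<in>Basis. (\<lambda>x. inner (Y x) e) \<in> A) \<longrightarrow>
        computes A L (C * b * b ^ DIM('a)) {\<lambda>x. H (\<tau> x) (Y x)}"
      using *[rule_format, OF b1 S g] by (elim exE conjE) (rule that, assumption+)
    have b0: "real b \<ge> 1" using b1 by simp
    have "real b ^ DIM('a) * real b ^ k \<le> real b ^ (2 * p)"
      unfolding power_add[symmetric] p_def using b0 by (intro power_increasing) auto
    then have pb: "real b ^ DIM('a) / real b ^ (2 * p) \<le> 1 / real b ^ k"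
      using b0 by (simp add: field_simps)
    have "net_for k DIM('a) R (2 * C) L b S g H"
      unfolding net_for_def
    proof (intro conjI allI ballI impI)
      fix \<tau> y q assume "q \<in> S" "\<bar>\<tau>\<bar> \<le> R"
      then have "\<bar>H \<tau> y - \<tau> * g q\<bar> \<le> real C * (1 / real b ^ k + real b ^ DIM('a) / real b ^ (2 * p) + norm (y - q))" using H1 by blast
      also have "\<dots> \<le> real C * (2 * (1 / real b ^ k + norm (y - q)))"
      proof (rule mult_left_mono)
        show "1 / real b ^ k + real b ^ DIM('a) / real b ^ (2 * p) + norm (y - q) \<le> 2 * (1 / real b ^ k + norm (y - q))"
          using pb norm_ge_zero[of "y - q"] unfolding distrib_left by linarith
      qed simp
      also have "\<dots> = real (2 * C) * (1 / real b ^ k + norm (y - q))" by (simp add: algebra_simps)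
      finally show "\<bar>H \<tau> y - \<tau> * g q\<bar> \<le> real (2 * C) * (1 / real b ^ k + norm (y - q))" .
    next
      fix A and Z :: "'a \<Rightarrow> 'a" and \<tau> assume \<tau>A: "\<tau> \<in> A" and ZA: "\<forall>c\<in>Basis. (\<lambda>p. inner (Z p) c) \<in> A"
      from H2[THEN spec, THEN spec, THEN spec, THEN mp, OF \<tau>A, THEN mp, OF ZA]
      show "computes A L (2 * C * b ^ (DIM('a) + 1)) {\<lambda>p. H (\<tau> p) (Z p)}"
        by (rule computes_mono) auto
    qed
    then show ?thesis by blast
  qed
  note main = this
  have "2 * C \<ge> 1" using C by simp
  then show ?thesis by (intro exI[of _ "2 * C"] exI[of _ L] conjI allI impI main)
qed

text \<open>A function of \<open>(t, x)\<close> alone may use a finer grid: mesh \<open>1/a\<close> with \<open>a \<approx> b\<^bsup>k/s\<^esup>\<close> in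
  dimension \<open>n + 1\<close> costs no more than mesh \<open>1/b\<close> in dimension \<open>d\<close>, since
  \<open>(n + 1) k / s \<le> d\<close>.\<close>

lemma net_for_parameter_free:
  fixes R M :: real and k s d :: nat
  defines "d \<equiv> DIM(real \<times> 'y::euclidean_space \<times> 'z::euclidean_space)"
    and "s \<equiv> nat \<lceil>real (DIM(real \<times> 'y) * k) / real d\<rceil>"
  assumes "k \<ge> 1" "R \<ge> 1" "M \<ge> 0"
  shows "\<exists>C L. C \<ge> 1 \<and> (\<forall>(\<Omega>\<^sub>1 :: (real \<times> 'y) set) S\<^sub>1 f\<^sub>1 (S :: (real \<times> 'y \<times> 'z) set) f b.
    b \<ge> C \<longrightarrow> solid_body R S\<^sub>1 \<longrightarrow> Ck_bound s M \<Omega>\<^sub>1 S\<^sub>1 f\<^sub>1 \<longrightarrow>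
    (\<forall>(t, x, \<eta>)\<in>S. (t, x) \<in> S\<^sub>1 \<and> f (t, x, \<eta>) = f\<^sub>1 (t, x)) \<longrightarrow>
    (\<exists>H. net_for k d R C L b S f H))"
proof -
  define n where "n = DIM(real \<times> 'y)"
  define p where "p = d + k"
  have p1: "p \<ge> 1" using assms(3) by (simp add: p_def)
  have d1: "d \<ge> 1" by (simp add: d_def)
  have n1: "n \<ge> 1" by (simp add: n_def)
  have "real (n * k) / real d > 0" using d1 n1 assms(3) by simp
  then have s1: "s \<ge> 1" unfolding s_def n_def[symmetric] by linarith
  have "real (n * k) / real d \<le> real s" unfolding s_def n_def[symmetric] by (rule real_nat_ceiling_ge)
  then have sd: "real n * (real k / real s) \<le> real d" using d1 s1 by (simp add: field_simps)
  obtain C L where C: "C \<ge> 1" and *: "\<forall>(\<Omega> :: (real \<times> 'y) set) S g a m.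
    a \<ge> 1 \<longrightarrow> m \<ge> C \<longrightarrow> solid_body R S \<longrightarrow> Ck_bound s M \<Omega> S g \<longrightarrow>
    (\<exists>H :: real \<Rightarrow> (real \<times> 'y) \<Rightarrow> real.
      (\<forall>\<tau> y. \<forall>q\<in>S. \<bar>\<tau>\<bar> \<le> R \<longrightarrow>
        \<bar>H \<tau> y - \<tau> * g q\<bar> \<le> real C * (1 / real a ^ s + real a ^ DIM(real \<times> 'y) / real m ^ (2 * p) + norm (y - q))) \<and>
      (\<forall>A (Y :: real \<times> 'y \<times> 'z \<Rightarrow> real \<times> 'y) \<tau>. \<tau> \<in> A \<longrightarrow> (\<forall>e\<in>Basis. (\<lambda>x. inner (Y x) e) \<in> A) \<longrightarrow>
        computes A L (C * m * a ^ DIM(real \<times> 'y)) {\<lambda>x. H (\<tau> x) (Y x)}))"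
    using net_approximation[OF s1 assms(4,5) p1, where 'a = "real \<times> 'y" and 'x = "real \<times> 'y \<times> 'z"]
    by (elim exE conjE) (rule that, assumption+)
  \<comment> \<open>Rounding the grid parameter up to an integer at most doubles it, which costs 2^n
    in dimension n; the further factor 2 absorbs 1 + 2^n in the error.\<close>
  define C' where "C' = 2 ^ (n + 1) * C"
  have C'C: "C \<le> C'" by (simp add: C'_def)
  have "\<exists>H. net_for k d R C' L b S f H"
    if b: "b \<ge> C'" and S1: "solid_body R S\<^sub>1" and f1: "Ck_bound s M \<Omega>\<^sub>1 S\<^sub>1 f\<^sub>1"
      and f: "\<forall>(t, x, \<eta>)\<in>S. (t, x) \<in> S\<^sub>1 \<and> f (t, x, \<eta>) = f\<^sub>1 (t, x)"
    for \<Omega>\<^sub>1 S\<^sub>1 f\<^sub>1 and S :: "(real \<times> 'y \<times> 'z) set" and f b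
  proof -
    have bC: "b \<ge> C" and b1: "b \<ge> 1" using b C'C C by auto
    have b0: "real b \<ge> 1" using b1 by simp
    define \<beta> where "\<beta> = real b powr (real k / real s)"
    have \<beta>1: "\<beta> \<ge> 1" unfolding \<beta>_def using b0 by (simp add: ge_one_powr_ge_zero)
    define a where "a = nat \<lceil>\<beta>\<rceil>"
    have a\<beta>: "\<beta> \<le> real a" "real a \<le> 2 * \<beta>" unfolding a_def using \<beta>1 by linarith+
    have a1: "a \<ge> 1" using a\<beta>(1) \<beta>1 by linarith
    have "\<beta> ^ s = real b ^ k"
      using b0 s1 unfolding \<beta>_def by (simp add: powr_realpow[symmetric] powr_powr)
    then have "real b ^ k \<le> real a ^ s" using power_mono[OF a\<beta>(1), of s] \<beta>1 by simp
    then have as: "1 / real a ^ s \<le> 1 / real b ^ k" using b0 by (simp add: frac_le)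
    have "\<beta> ^ n = real b powr (real n * (real k / real s))"
      using b0 unfolding \<beta>_def by (simp add: powr_realpow[symmetric] powr_powr mult.commute)
    also have "\<dots> \<le> real b powr real d" using sd b0 by (intro powr_mono) auto
    also have "\<dots> = real b ^ d" using b0 by (simp add: powr_realpow)
    finally have \<beta>n: "\<beta> ^ n \<le> real b ^ d" .
    have "real a ^ n \<le> (2 * \<beta>) ^ n" using a\<beta>(2) by (intro power_mono) auto
    also have "\<dots> \<le> 2 ^ n * real b ^ d" using \<beta>n by (simp add: power_mult_distrib)
    finally have an: "real a ^ n \<le> 2 ^ n * real b ^ d" .
    then have "real (a ^ n) \<le> real (2 ^ n * b ^ d)" by simp
    then have an': "a ^ n \<le> 2 ^ n * b ^ d" by (simp only: of_nat_le_iff)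
    obtain H where H1: "\<forall>\<tau> y. \<forall>q\<in>S\<^sub>1. \<bar>\<tau>\<bar> \<le> R \<longrightarrow>
        \<bar>H \<tau> y - \<tau> * f\<^sub>1 q\<bar> \<le> real C * (1 / real a ^ s + real a ^ DIM(real \<times> 'y) / real b ^ (2 * p) + norm (y - q))"
      and H2: "\<forall>A (Y :: real \<times> 'y \<times> 'z \<Rightarrow> real \<times> 'y) \<tau>. \<tau> \<in> A \<longrightarrow> (\<forall>e\<in>Basis. (\<lambda>x. inner (Y x) e) \<in> A) \<longrightarrow>
        computes A L (C * b * a ^ DIM(real \<times> 'y)) {\<lambda>x. H (\<tau> x) (Y x)}"
      using *[rule_format, OF a1 bC S1 f1] by (elim exE conjE) (rule that, assumption+)
    have "real b ^ d * real b ^ k \<le> real b ^ (2 * p)"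
      unfolding power_add[symmetric] p_def using b0 by (intro power_increasing) auto
    then have "real b ^ d / real b ^ (2 * p) \<le> 1 / real b ^ k"
      using b0 by (simp add: field_simps)
    then have "2 ^ n * (real b ^ d / real b ^ (2 * p)) \<le> 2 ^ n * (1 / real b ^ k)" by (rule mult_left_mono) simp
    moreover have "real a ^ n / real b ^ (2 * p) \<le> 2 ^ n * real b ^ d / real b ^ (2 * p)"
      using an by (rule divide_right_mono) simp
    ultimately have pb: "real a ^ n / real b ^ (2 * p) \<le> 2 ^ n * (1 / real b ^ k)" by simp
    define H' where "H' \<tau> y = H \<tau> (fst y, fst (snd y))" for \<tau> and y :: "real \<times> 'y \<times> 'z"
    have "net_for k d R C' L b S f H'"
      unfolding net_for_def
    proof (intro conjI allI ballI impI)
      fix \<tau> and y q :: "real \<times> 'y \<times> 'z" assume q: "q \<in> S" and \<tau>: "\<bar>\<tau>\<bar> \<le> R"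
      obtain t x \<eta> where q3: "q = (t, x, \<eta>)" by (cases q)
      obtain t' x' \<eta>' where y3: "y = (t', x', \<eta>')" by (cases y)
      have q1: "(t, x) \<in> S\<^sub>1" "f q = f\<^sub>1 (t, x)" using f q q3 by auto
      have "norm ((t', x') - (t, x)) \<le> norm (y - q)"
        unfolding q3 y3 by (simp add: norm_Pair)
      then have nn: "norm ((fst y, fst (snd y)) - (t, x)) \<le> norm (y - q)" by (simp add: y3)
      have "\<bar>H' \<tau> y - \<tau> * f q\<bar> \<le> real C * (1 / real a ^ s + real a ^ n / real b ^ (2 * p) + norm ((fst y, fst (snd y)) - (t, x)))"
        unfolding H'_def q1(2) n_def using H1 q1(1) \<tau> by blast
      also have "\<dots> \<le> real C * (1 / real b ^ k + 2 ^ n * (1 / real b ^ k) + norm (y - q))"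
        using as pb nn by (intro mult_left_mono add_mono) auto
      also have "\<dots> \<le> real C * (2 ^ (n + 1) * (1 / real b ^ k + norm (y - q)))"
      proof (rule mult_left_mono)
        let ?u = "1 / real b ^ k" and ?w = "norm (y - q)"
        have "1 * ?u \<le> 2 ^ n * ?u" by (rule mult_right_mono) simp_all
        moreover have "1 * ?w \<le> 2 ^ (n + 1) * ?w" by (rule mult_right_mono) (rule one_le_power, simp_all)
        moreover have "2 ^ (n + 1) * (?u + ?w) = 2 ^ n * ?u + 2 ^ n * ?u + 2 ^ (n + 1) * ?w" by (simp add: algebra_simps)
        ultimately show "?u + 2 ^ n * ?u + ?w \<le> 2 ^ (n + 1) * (?u + ?w)" by linarith
      qed simp
      finally show "\<bar>H' \<tau> y - \<tau> * f q\<bar> \<le> real C' * (1 / real b ^ k + norm (y - q))" by (simp add: C'_def mult_ac)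
    next
      fix A and Z :: "real \<times> 'y \<times> 'z \<Rightarrow> real \<times> 'y \<times> 'z" and \<tau>
      assume \<tau>: "\<tau> \<in> A" and Z: "\<forall>c\<in>Basis. (\<lambda>p. inner (Z p) c) \<in> A"
      have "\<forall>e\<in>Basis. (\<lambda>p. inner (fst (Z p), fst (snd (Z p))) e) \<in> A"
      proof
        fix e :: "real \<times> 'y" assume e: "e \<in> Basis"
        obtain e1 e2 where e12: "e = (e1, e2)" by force
        have "(e1, e2, 0 :: 'z) \<in> Basis" using e unfolding e12 by (auto simp: Basis_prod_def zero_prod_def)
        then have "(\<lambda>p. inner (Z p) (e1, e2, 0)) \<in> A" using Z by blast
        moreover have "(\<lambda>p. inner (Z p) (e1, e2, 0)) = (\<lambda>p. inner (fst (Z p), fst (snd (Z p))) e)"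
          by (simp add: fun_eq_iff e12 inner_prod_def)
        ultimately show "(\<lambda>p. inner (fst (Z p), fst (snd (Z p))) e) \<in> A" by simp
      qed
      note ZA = this
      from H2[THEN spec, THEN spec, THEN spec, THEN mp, OF \<tau>, THEN mp, OF ZA, folded n_def]
      show "computes A L (C' * b ^ (d + 1)) {\<lambda>p. H' (\<tau> p) (Z p)}"
        unfolding H'_def
      proof (rule computes_mono)
        have "C * b * a ^ n \<le> C * b * (2 ^ n * b ^ d)" using an' by (rule mult_le_mono2)
        also have "\<dots> \<le> C' * b ^ (d + 1)" by (simp add: C'_def mult_ac)
        finally show "C * b * a ^ n \<le> C' * b ^ (d + 1)" .
      qed auto
    qed
    then show ?thesis by blast
  qed
  note main = this
  have "C' \<ge> 1" using C C'C by linarith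
  then show ?thesis by (intro exI[of _ C'] exI[of _ L] conjI allI impI main)
qed

subsection \<open>The approximating network\<close>

lemma C1_lipschitz_ball:
  fixes g :: "'a::euclidean_space \<Rightarrow> real"
  assumes "Ck_on 1 g UNIV" "R \<ge> 0"
  shows "\<exists>L\<ge>0. \<forall>y\<in>cball 0 R. \<forall>y'\<in>cball 0 R. \<bar>g y - g y'\<bar> \<le> L * norm (y - y')"
proof -
  define M where "M = Ck_norm 1 UNIV (cball 0 R) g"
  have b: "Ck_bound 1 M UNIV (cball 0 R) g"
    unfolding M_def by (rule Ck_bound_Ck_norm[OF assms(1)]) (use assms(2) in auto)
  have M0: "M \<ge> 0" using b by (simp add: Ck_bound_def)
  have "\<bar>g y - g y'\<bar> \<le> 2 ^ DIM('a) * M * real DIM('a) * norm (y - y')" if "y \<in> cball 0 R" "y' \<in> cball 0 R" for y y'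
  proof -
    have "\<bar>g y - g y'\<bar> \<le> 2 ^ DIM('a) * M * l1 (y - y')"
      by (rule lipschitz_solid[OF b _ solid_cball that]) simp
    also have "\<dots> \<le> 2 ^ DIM('a) * M * (real DIM('a) * norm (y - y'))"
      using M0 l1_le_norm by (intro mult_left_mono) auto
    finally show ?thesis by simp
  qed
  then show ?thesis using M0 by (intro exI[of _ "2 ^ DIM('a) * M * real DIM('a)"]) simp
qed

section \<open>Essential bounds and pointwise bounds\<close>

lemma Linf_norm_le_pointwise:
  fixes g :: "'a::euclidean_space \<Rightarrow> real"
  assumes "Linf_norm (cball 0 R) g \<le> ereal e" "continuous_on UNIV g" "y \<in> ball 0 R"
  shows "\<bar>g y\<bar> \<le> e"
proof (rule ccontr)
  assume "\<not> \<bar>g y\<bar> \<le> e"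
  then have y: "\<bar>g y\<bar> > e" by simp
  \<comment> \<open>A strict excess at one point of the open ball persists on a nonempty open set,
    which is not negligible.\<close>
  define U where "U = ball 0 R \<inter> {z. \<bar>g z\<bar> > e}"
  have "open {z. e < \<bar>g z\<bar>}"
    by (intro open_Collect_less continuous_intros continuous_on_rabs assms(2))
  then have "open U" by (simp add: U_def open_Int)
  moreover have "U \<noteq> {}" using y assms(3) by (auto simp: U_def)
  ultimately have nneg: "\<not> negligible U" by (rule open_not_negligible)
  have ess: "esssup (lebesgue_on (cball 0 R)) (\<lambda>x. ereal \<bar>g x\<bar>) \<le> ereal e"
    using assms(1) by (simp add: Linf_norm_def)
  have "AE x in lebesgue_on (cball 0 R). ereal \<bar>g x\<bar> \<le> ereal e"
    by (rule eventually_mono[OF esssup_AE[where f = "\<lambda>x. ereal \<bar>g x\<bar>"]]) (rule order_trans[OF _ ess])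
  then have "AE x in lebesgue. x \<in> cball 0 R \<longrightarrow> ereal \<bar>g x\<bar> \<le> ereal e"
    by (subst (asm) AE_restrict_space_iff) simp_all
  then obtain N where N: "N \<in> null_sets lebesgue" "{x. \<not> (x \<in> cball 0 R \<longrightarrow> ereal \<bar>g x\<bar> \<le> ereal e)} \<subseteq> N"
    by (auto simp: eventually_ae_filter)
  have "negligible N" using N(1) by (simp add: negligible_iff_null_sets)
  moreover have "U \<subseteq> N" using N(2) by (force simp: U_def)
  ultimately show False using nneg negligible_subset[of N U] by simp
qed

lemma Linf_norm_le:
  fixes g :: "'a::euclidean_space \<Rightarrow> real"
  assumes "compact S" "continuous_on S g" "\<And>x. x \<in> S \<Longrightarrow> \<bar>g x\<bar> \<le> e" "e \<ge> 0"
  shows "Linf_norm S g \<le> ereal e"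
proof -
  have S: "S \<in> sets lebesgue" using assms(1) by (simp add: fmeasurableD lmeasurable_compact)
  have "g \<in> borel_measurable (lebesgue_on S)"
    by (rule continuous_imp_measurable_on_sets_lebesgue[OF assms(2) S])
  then have m: "(\<lambda>x. ereal \<bar>g x\<bar>) \<in> borel_measurable (lebesgue_on S)" by measurable
  have "esssup (lebesgue_on S) (\<lambda>x. ereal \<bar>g x\<bar>) \<le> ereal e"
    by (rule esssup_I[OF m]) (use assms(3) in \<open>auto intro!: AE_I2 simp: space_restrict_space\<close>)
  then show ?thesis using assms(4) by (simp add: Linf_norm_def)
qed

text \<open>Approximability is a statement almost everywhere, but the initial network is evaluated
  at computed end points, so it has to be accurate at every point. Continuity of both functions
  gives this in the open ball.\<close>

lemma approximable_on_ball:
  fixes g :: "'a::euclidean_space \<Rightarrow> real"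
  assumes "r_approximable r g" "continuous_on UNIV g"
  shows "\<exists>c>0. \<forall>\<epsilon>. 0 < \<epsilon> \<and> \<epsilon> < 1 \<longrightarrow> (\<exists>\<Phi>. is_nn DIM('a) \<Phi> \<and> nn_out_dim \<Phi> = 1 \<and>
     real (nn_layers \<Phi>) \<le> c * (ln (1 / \<epsilon>) + 1) \<and> real (nn_weights \<Phi>) \<le> c * \<epsilon> powr (- (1 / r)) \<and>
     (\<forall>y\<in>ball 0 R. \<bar>g y - nn_fun \<Phi> y\<bar> \<le> \<epsilon>))"
proof -
  obtain c where c: "c > 0" and *: "\<forall>\<epsilon>. 0 < \<epsilon> \<and> \<epsilon> < 1 \<longrightarrow> (\<exists>\<Phi>. is_nn DIM('a) \<Phi> \<and> nn_out_dim \<Phi> = 1 \<and>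
     real (nn_layers \<Phi>) \<le> c * (ln (1 / \<epsilon>) + 1) \<and> real (nn_weights \<Phi>) \<le> c * \<epsilon> powr (- (1 / r)) \<and>
     Linf_norm (cball 0 R) (\<lambda>x. g x - nn_fun \<Phi> x) \<le> ereal \<epsilon>)"
    using assms(1)[unfolded r_approximable_def, THEN conjunct2, THEN conjunct2, THEN spec, THEN mp, OF compact_cball[of 0 R]]
    by (elim exE conjE) (rule that, assumption+)
  show ?thesis
  proof (intro exI[of _ c] conjI allI impI)
    fix \<epsilon> :: real assume \<epsilon>: "0 < \<epsilon> \<and> \<epsilon> < 1"
    obtain \<Phi> where \<Phi>: "is_nn DIM('a) \<Phi>" "nn_out_dim \<Phi> = 1"
     "real (nn_layers \<Phi>) \<le> c * (ln (1 / \<epsilon>) + 1)" "real (nn_weights \<Phi>) \<le> c * \<epsilon> powr (- (1 / r))"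
     "Linf_norm (cball 0 R) (\<lambda>x. g x - nn_fun \<Phi> x) \<le> ereal \<epsilon>"
      using *[THEN spec, THEN mp, OF \<epsilon>] by (elim exE conjE) (rule that, assumption+)
    have "continuous_on UNIV (\<lambda>x. g x - nn_fun \<Phi> x)"
      by (intro continuous_on_diff assms(2) continuous_nn_fun \<Phi>)
    from Linf_norm_le_pointwise[OF \<Phi>(5) this] have ptw: "\<forall>y\<in>ball 0 R. \<bar>g y - nn_fun \<Phi> y\<bar> \<le> \<epsilon>"
      by (rule ballI)
    show "\<exists>\<Phi>. is_nn DIM('a) \<Phi> \<and> nn_out_dim \<Phi> = 1 \<and>
     real (nn_layers \<Phi>) \<le> c * (ln (1 / \<epsilon>) + 1) \<and> real (nn_weights \<Phi>) \<le> c * \<epsilon> powr (- (1 / r)) \<and>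
     (\<forall>y\<in>ball 0 R. \<bar>g y - nn_fun \<Phi> y\<bar> \<le> \<epsilon>)" by (intro exI[of _ \<Phi>] conjI \<Phi> ptw)
  qed (rule c)
qed

text \<open>The initial network acts once, after the last sweep and beside the evaluation of the
  source at the nodes. Its layers and weights therefore enter additively and are not multiplied by
  the number of nodes or sweeps.\<close>

lemma relax_computes:
  fixes H :: "real ^ 'n \<Rightarrow> real \<Rightarrow> real \<times> (real ^ 'n) \<times> (real ^ 'D) \<Rightarrow> real" and k b m :: nat
    and Hf :: "real \<Rightarrow> real \<times> (real ^ 'n) \<times> (real ^ 'D) \<Rightarrow> real" and \<Phi> :: nn
  defines "N \<equiv> b ^ k"
  defines "out \<equiv> \<lambda>p. nn_fun \<Phi> (relax H N m N p) + (1 / real N) * (\<Sum>i<N. Hf (fst p) (node_at N (relax H N m) i p))"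
  assumes b: "b \<ge> 1"
    and H: "\<And>e. e \<in> Basis \<Longrightarrow> net_for k d R C L b S (V e) (H e)"
    and Hf: "net_for k d R C L b S f Hf"
    and \<Phi>: "is_nn CARD('n) \<Phi>" "nn_out_dim \<Phi> = 1"
  shows "computes coord_funs ((2 * L + k + 3) * (m + 1) + nn_layers \<Phi>)
    ((CARD('n) * (C + 2 * k + 3) + C + 5) * (m + 1) * b ^ (k + d + 1) + nn_weights \<Phi>) {out}"
proof -
  let ?w = "C * b ^ (d + 1)"
  have N1: "N \<ge> 1" using b by (simp add: N_def)
  define A where "A = (coord_funs :: (real \<times> (real ^ 'n) \<times> (real ^ 'D) \<Rightarrow> real) set) \<union> time_funs N \<union> relax_funs H N m"
  have "computes coord_funs (1 + m * (L + k + 1)) (2 * N + m * (DIM(real ^ 'n) * N * (?w + k * (b + 1) + 3))) A"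
    unfolding A_def
  proof (rule computes_relax[OF b])
    show "N = b ^ k" by (simp add: N_def)
    fix e :: "real ^ 'n" and A and Z :: "real \<times> (real ^ 'n) \<times> (real ^ 'D) \<Rightarrow> real \<times> (real ^ 'n) \<times> (real ^ 'D)"
    assume e: "e \<in> Basis" and A: "fst \<in> A" "\<forall>c\<in>Basis. (\<lambda>p. inner (Z p) c) \<in> A"
    show "computes A L ?w {\<lambda>p. H e (fst p) (Z p)}" by (rule net_for_computes[OF H[OF e] A])
  qed
  then have c1: "computes coord_funs (1 + m * (L + k + 1)) (2 * N + m * (CARD('n) * N * (?w + k * (b + 1) + 3))) A"
    by simp
  define h where "h i = (\<lambda>p. Hf (fst p) (node_at N (relax H N m) i p))" for i
  have "computes A L (card {..<N} * ?w) (\<Union>i\<in>{..<N}. {h i})"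
  proof (rule computes_UN_const)
    fix i assume i: "i \<in> {..<N}"
    show "computes A L ?w {h i}" unfolding h_def
    proof (rule net_for_computes[OF Hf])
      show "fst \<in> A" using coord_funs_mem(1) by (auto simp: A_def)
      show "\<forall>c\<in>Basis. (\<lambda>p. inner (node_at N (relax H N m) i p) c) \<in> A"
        using i by (intro ballI node_at_available) (auto simp: A_def)
    qed
  qed simp
  then have c2: "computes A (L + nn_layers \<Phi>) (N * ?w) (\<Union>i\<in>{..<N}. {h i})"
    by (rule computes_mono) auto
  define g where "g = (\<lambda>p. nn_fun \<Phi> (relax H N m N p))"
  have "computes A (nn_layers \<Phi>) (nn_weights \<Phi>) {g}"
    unfolding g_def
  proof (rule computes_nn_fun)
    show "is_nn DIM(real ^ 'n) \<Phi>" "nn_out_dim \<Phi> = 1" using \<Phi> by auto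
    fix e :: "real ^ 'n" assume e: "e \<in> Basis"
    have "(\<lambda>p. inner (relax H N m N p) e) \<in> relax_funs H N m"
      unfolding relax_funs_def by (rule UN_I[of N], simp, rule UN_I[OF e], simp)
    then show "(\<lambda>p. inner (relax H N m N p) e) \<in> A" by (simp add: A_def)
  qed
  then have c3: "computes A (L + nn_layers \<Phi>) (nn_weights \<Phi>) {g}" by (rule computes_mono) auto
  let ?F = "\<lambda>i. if i < N then h i else g"
  let ?B = "(\<Union>i\<in>{..<N}. {h i}) \<union> {g}"
  have "computes (A \<union> ?B) 1 (card {..N} + 1) {\<lambda>p. 0 + (\<Sum>i\<in>{..N}. (if i < N then 1 / real N else 1) * ?F i p)}"
    by (rule computes_affine) auto
  moreover have "0 + (\<Sum>i\<in>{..N}. (if i < N then 1 / real N else 1) * ?F i p) = out p" for p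
    by (simp add: lessThan_Suc_atMost[symmetric] out_def g_def h_def sum_distrib_left)
  ultimately have c4: "computes (A \<union> ?B) 1 (N + 2) {out}" by simp
  have c5: "computes A (L + nn_layers \<Phi> + 1) (N * ?w + nn_weights \<Phi> + (N + 2)) {out}"
    by (rule computes_then[OF computes_union[OF c2 c3] c4])
  have "computes (coord_funs \<union> A) (L + nn_layers \<Phi> + 1) (N * ?w + nn_weights \<Phi> + (N + 2)) {out}"
    by (rule computes_mono[OF c5]) auto
  from computes_then[OF c1 this] show ?thesis
  proof (rule computes_mono)
    show "1 + m * (L + k + 1) + (L + nn_layers \<Phi> + 1) \<le> (2 * L + k + 3) * (m + 1) + nn_layers \<Phi>"
      by (simp add: algebra_simps)
    define X where "X = b ^ (k + d + 1)"
    have NX: "N * b ^ (d + 1) = X" by (simp add: N_def X_def power_add)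
    have bd: "1 \<le> b ^ (d + 1)" using b by simp
    have N_X: "N \<le> X" using mult_le_mono2[OF bd, of N] unfolding NX mult_1_right .
    have "1 \<le> b ^ d" using b by simp
    from mult_le_mono2[OF this, of b] have "b \<le> b ^ (d + 1)" by simp
    then have "b + 1 \<le> 2 * b ^ (d + 1)" using bd by linarith
    then have "N * (?w + k * (b + 1) + 3) \<le> N * (C * b ^ (d + 1) + k * (2 * b ^ (d + 1)) + 3 * b ^ (d + 1))"
      using bd by (intro mult_le_mono2 add_mono) auto
    also have "\<dots> = (C + 2 * k + 3) * X" unfolding NX[symmetric] by (simp add: algebra_simps)
    finally have 1: "CARD('n) * (N * (?w + k * (b + 1) + 3)) \<le> CARD('n) * ((C + 2 * k + 3) * X)" by (rule mult_le_mono2)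
    have X1: "X \<ge> 1" using N1 N_X by linarith
    have 2: "2 * N + N * ?w + (N + 2) \<le> (C + 5) * X"
    proof -
      have "N * ?w = C * X" unfolding NX[symmetric] by simp
      then show ?thesis using N_X X1 unfolding add_mult_distrib by linarith
    qed
    have "m * (CARD('n) * N * (?w + k * (b + 1) + 3)) \<le> m * (CARD('n) * ((C + 2 * k + 3) * X))"
      using 1 by (intro mult_le_mono2) (simp add: mult.assoc)
    moreover have "(CARD('n) * (C + 2 * k + 3) + C + 5) * (m + 1) * X
      = m * (CARD('n) * ((C + 2 * k + 3) * X)) + CARD('n) * ((C + 2 * k + 3) * X) + (C + 5) * X + m * ((C + 5) * X)"
      by (simp add: algebra_simps)
    ultimately show "2 * N + m * (CARD('n) * N * (?w + k * (b + 1) + 3)) + (N * ?w + nn_weights \<Phi> + (N + 2))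
      \<le> (CARD('n) * (C + 2 * k + 3) + C + 5) * (m + 1) * b ^ (k + d + 1) + nn_weights \<Phi>"
      using 2 unfolding X_def[symmetric] by linarith
  qed auto
qed

text \<open>Four errors are added: the discretization, the effect on the initial value of ending at
  the last iterate instead of the polygon, the initial network, and the evaluation of the source.
  The last iterate may miss the polygon by up to \<delta> and so leave B; hence the initial value is
  used on an enlarged ball, with 1 to spare so that the open ball suffices.\<close>

lemma relax_approximates:
  fixes V :: "real \<times> (real ^ 'n) \<times> (real ^ 'D) \<Rightarrow> real ^ 'n" and f u :: "real \<times> (real ^ 'n) \<times> (real ^ 'D) \<Rightarrow> real"
    and k b m Cn :: nat and \<rho> T M :: real
    and H :: "real ^ 'n \<Rightarrow> real \<Rightarrow> real \<times> (real ^ 'n) \<times> (real ^ 'D) \<Rightarrow> real"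
    and Hf :: "real \<Rightarrow> real \<times> (real ^ 'n) \<times> (real ^ 'D) \<Rightarrow> real" and \<Phi> :: nn
  defines "N \<equiv> b ^ k" and "\<Gamma> \<equiv> real CARD('n) * real Cn"
  defines "\<delta> \<equiv> (2 * \<Gamma> + 2 * (\<rho> + T * M)) * exp (2 * \<Gamma>)"
  defines "out \<equiv> \<lambda>p. nn_fun \<Phi> (relax H N m N p) + (1 / real N) * (\<Sum>i<N. Hf (fst p) (node_at N (relax H N m) i p))"
  assumes sol: "cauchy_solution T V f u\<^sub>0 u"
    and b: "b \<ge> 1" and m: "real b ^ k \<le> 2 ^ m" and TR: "T \<le> R"
    and tT: "t \<in> {0..T}" and \<eta>: "\<eta> \<in> cbox 0 One" and x: "norm x \<le> \<rho>" and C: "C > 0"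
    and growth: "\<And>s y. s \<in> {0..T} \<Longrightarrow> norm (V (s, y, \<eta>)) \<le> C * (1 + norm y)"
    and bound: "\<And>s y. s \<in> {0..T} \<Longrightarrow> norm y \<le> (\<rho> + C * T) * exp (C * T) \<Longrightarrow> norm (V (s, y, \<eta>)) \<le> M"
    and pos: "M \<ge> 0" "\<Lambda> \<ge> 0" "\<Lambda>' \<ge> 0" "L \<ge> 0"
    and B: "B = cball 0 (min ((\<rho> + C * T) * exp (C * T)) (\<rho> + T * M))"
    and lipV: "\<And>s s' y y'. s \<in> {0..T} \<Longrightarrow> s' \<in> {0..T} \<Longrightarrow> y \<in> B \<Longrightarrow> y' \<in> B \<Longrightarrow>
      norm (V (s, y, \<eta>) - V (s', y', \<eta>)) \<le> \<Lambda> * (\<bar>s - s'\<bar> + norm (y - y'))"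
    and lipf: "\<And>s s' y y'. s \<in> {0..T} \<Longrightarrow> s' \<in> {0..T} \<Longrightarrow> y \<in> B \<Longrightarrow> y' \<in> B \<Longrightarrow>
      \<bar>f (s, y, \<eta>) - f (s', y', \<eta>)\<bar> \<le> \<Lambda>' * (\<bar>s - s'\<bar> + norm (y - y'))"
    and lipu: "\<And>y y'. y \<in> cball 0 (\<rho> + T * M + \<delta> + 1) \<Longrightarrow> y' \<in> cball 0 (\<rho> + T * M + \<delta> + 1) \<Longrightarrow> \<bar>u\<^sub>0 y - u\<^sub>0 y'\<bar> \<le> L * norm (y - y')"
    and H: "\<And>e. e \<in> Basis \<Longrightarrow> net_for k d R Cn Lc b (tx_dom T B) (\<lambda>p. inner (V p) e) (H e)"
    and Hf: "net_for k d R Cn Lc b (tx_dom T B) f Hf"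
    and \<Phi>: "\<And>y. y \<in> ball 0 (\<rho> + T * M + \<delta> + 1) \<Longrightarrow> \<bar>u\<^sub>0 y - nn_fun \<Phi> y\<bar> \<le> \<epsilon>"
  shows "\<bar>u (t, x, \<eta>) - out (t, x, \<eta>)\<bar>
     \<le> ((L + T * \<Lambda>') * (T * (1 + M) * exp (T * \<Lambda>)) + L * \<delta> + real Cn * (1 + \<delta>)) / real b ^ k + \<epsilon>"
proof -
  have T0: "T \<ge> 0" and t0: "0 \<le> t" "t \<le> T" using tT by auto
  have \<rho>0: "\<rho> \<ge> 0" using x norm_ge_zero[of x] by linarith
  have \<Gamma>0: "\<Gamma> \<ge> 0" by (simp add: \<Gamma>_def)
  have \<delta>0: "\<delta> \<ge> 0" unfolding \<delta>_def using \<Gamma>0 \<rho>0 T0 pos(1) by auto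
  have N1: "N \<ge> 1" using b by (simp add: N_def)
  have NR: "real N = real b ^ k" by (simp add: N_def)
  define W where "W = (\<lambda>s y. V (t - s, y, \<eta>))"
  define \<tau> where "\<tau> = t / real N"
  define y where "y = eul W \<tau> x"
  let ?R1 = "\<rho> + T * M + \<delta> + 1"
  have Bsub: "B \<subseteq> cball 0 ?R1" unfolding B using \<delta>0 by auto
  have lipuB: "\<bar>u\<^sub>0 z - u\<^sub>0 z'\<bar> \<le> L * norm (z - z')" if "z \<in> B" "z' \<in> B" for z z'
    using lipu that Bsub by blast
  have yB: "y j \<in> B" if "j \<le> N" for j
    unfolding y_def W_def \<tau>_def
    by (rule euler_solution(1)[OF sol tT \<eta> x C growth bound pos N1 B lipV lipf lipuB that]; assumption)
  have "\<bar>u (t, x, \<eta>) - (u\<^sub>0 (y N) + \<tau> * (\<Sum>j<N. f (t - real j * \<tau>, y j, \<eta>)))\<bar>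
      \<le> (L + T * \<Lambda>') * (\<tau> * (1 + M) * exp (T * \<Lambda>))"
    unfolding y_def W_def \<tau>_def
    by (rule euler_solution(2)[OF sol tT \<eta> x C growth bound pos N1 B lipV lipf lipuB]; assumption)
  also have "\<dots> \<le> (L + T * \<Lambda>') * (T / real b ^ k * (1 + M) * exp (T * \<Lambda>))"
    unfolding \<tau>_def NR using t0 T0 pos b by (intro mult_left_mono mult_right_mono divide_right_mono) auto
  finally have 1: "\<bar>u (t, x, \<eta>) - (u\<^sub>0 (y N) + \<tau> * (\<Sum>j<N. f (t - real j * \<tau>, y j, \<eta>)))\<bar>
      \<le> (L + T * \<Lambda>') * (T * (1 + M) * exp (T * \<Lambda>)) / real b ^ k" by simp
  have q: "(t - real i * \<tau>, y i, \<eta>) \<in> tx_dom T B" if "i < N" for i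
  proof -
    have "real i * \<tau> \<le> real N * \<tau>" using that t0 by (intro mult_right_mono) (auto simp: \<tau>_def)
    also have "\<dots> = t" using N1 by (simp add: \<tau>_def)
    finally have "real i * \<tau> \<le> t" .
    moreover have "0 \<le> real i * \<tau>" using t0 by (simp add: \<tau>_def)
    ultimately show ?thesis using yB[of i] that t0 \<eta> by (simp add: tx_dom_def)
  qed
  have st: "(1 - real i / real N) * t = t - real i * \<tau>" for i by (simp add: \<tau>_def algebra_simps)
  have tR: "\<bar>t\<bar> \<le> R" using t0 TR by simp
  have nrm: "norm ((s, z, \<eta>) - (s, z', \<eta>)) = norm (z - z')" for s :: real and z z' :: "real ^ 'n" by (simp add: norm_Pair)
  have yn: "norm (y j) \<le> \<rho> + T * M" if "j \<le> N" for j using yB[OF that] by (simp add: B)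
  have rel: "norm (relax H N m j (t, x, \<eta>) - y j) \<le> \<delta> / real b ^ k" if j: "j \<le> N" for j
  proof -
    have "norm (relax H N m j (t, x, \<eta>) - y j) \<le> (2 * \<Gamma> * (1 / real b ^ k) + 2 * (\<rho> + T * M) / 2 ^ m) * exp (2 * \<Gamma>)"
      unfolding y_def \<tau>_def W_def \<Gamma>_def
    proof (rule order_trans[OF relax_error[where C = "real Cn" and \<epsilon> = "1 / real b ^ k" and ?A0.0 = "2 * (\<rho> + T * M)", OF N1]])
      fix e :: "real ^ 'n" and i z assume e: "e \<in> Basis" and i: "i < N"
      show "\<bar>H e t ((1 - real i / real N) * t, z, \<eta>) - t * inner (V (t - real i * (t / real N), eul (\<lambda>s y. V (t - s, y, \<eta>)) (t / real N) x i, \<eta>)) e\<bar>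
        \<le> real Cn * (1 / real b ^ k + norm (z - eul (\<lambda>s y. V (t - s, y, \<eta>)) (t / real N) x i))"
        using net_for_error[OF H[OF e] q[OF i] tR, of "((1 - real i / real N) * t, z, \<eta>)"]
        unfolding st nrm y_def W_def \<tau>_def by simp
    next
      fix j assume jN: "j \<le> N"
      show "norm (x - eul (\<lambda>s y. V (t - s, y, \<eta>)) (t / real N) x j) \<le> 2 * (\<rho> + T * M)"
      proof -
        have "norm (x - y j) \<le> norm x + norm (y j)" by (rule norm_triangle_ineq4)
        also have "\<dots> \<le> \<rho> + (\<rho> + T * M)" using x yn[OF jN] by (rule add_mono)
        also have "\<dots> \<le> 2 * (\<rho> + T * M)" using mult_nonneg_nonneg[OF T0 pos(1)] by (simp add: algebra_simps)
        finally show ?thesis unfolding y_def W_def \<tau>_def .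
      qed
    qed (use \<rho>0 T0 pos j in auto)
    also have "\<dots> \<le> (2 * \<Gamma> * (1 / real b ^ k) + 2 * (\<rho> + T * M) / real b ^ k) * exp (2 * \<Gamma>)"
      using m b \<rho>0 T0 pos(1) by (intro mult_right_mono add_left_mono divide_left_mono) auto
    also have "\<dots> = \<delta> / real b ^ k" by (simp add: \<delta>_def algebra_simps add_divide_distrib)
    finally show ?thesis .
  qed
  let ?Y = "\<lambda>j. relax H N m j (t, x, \<eta>)"
  have bk: "real b ^ k \<ge> 1" using b by simp
  have "\<delta> / real b ^ k \<le> \<delta> / 1" using bk \<delta>0 b by (intro divide_left_mono) auto
  then have rel1: "norm (?Y N - y N) \<le> \<delta>" using rel[of N] by simp
  have "norm (?Y N) \<le> norm (y N) + norm (?Y N - y N)" using norm_triangle_ineq[of "y N" "?Y N - y N"] by simp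
  then have YN: "norm (?Y N) < ?R1" using yn[of N] rel1 by simp
  have "\<bar>u\<^sub>0 (y N) - u\<^sub>0 (?Y N)\<bar> \<le> L * norm (y N - ?Y N)"
    using YN yn[of N] \<delta>0 by (intro lipu) auto
  also have "\<dots> \<le> L * (\<delta> / real b ^ k)" using rel[of N] pos(4) by (intro mult_left_mono) (auto simp: norm_minus_commute)
  finally have 2: "\<bar>u\<^sub>0 (y N) - u\<^sub>0 (?Y N)\<bar> \<le> L * \<delta> / real b ^ k" by simp
  have 3: "\<bar>u\<^sub>0 (?Y N) - nn_fun \<Phi> (?Y N)\<bar> \<le> \<epsilon>" using YN by (intro \<Phi>) simp
  let ?h = "\<lambda>i. Hf t (node_at N (relax H N m) i (t, x, \<eta>))"
  have hi: "\<bar>t * f (t - real i * \<tau>, y i, \<eta>) - ?h i\<bar> \<le> real Cn * (1 + \<delta>) / real b ^ k" if i: "i < N" for i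
  proof -
    have "\<bar>?h i - t * f (t - real i * \<tau>, y i, \<eta>)\<bar> \<le> real Cn * (1 / real b ^ k + norm (?Y i - y i))"
      using net_for_error[OF Hf q[OF i] tR, of "node_at N (relax H N m) i (t, x, \<eta>)"]
      by (simp add: node_at_def st norm_Pair)
    also have "\<dots> \<le> real Cn * (1 / real b ^ k + \<delta> / real b ^ k)"
      using rel[of i] i by (intro mult_left_mono add_left_mono) auto
    also have "\<dots> = real Cn * (1 + \<delta>) / real b ^ k" by (simp add: add_divide_distrib[symmetric])
    finally show ?thesis by (simp add: abs_minus_commute)
  qed
  have "\<tau> * (\<Sum>j<N. f (t - real j * \<tau>, y j, \<eta>)) - (1 / real N) * (\<Sum>i<N. ?h i)
    = (1 / real N) * (\<Sum>i<N. t * f (t - real i * \<tau>, y i, \<eta>) - ?h i)"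
    by (simp add: \<tau>_def sum_subtractf sum_distrib_left[symmetric] right_diff_distrib)
  also have "\<bar>\<dots>\<bar> = (1 / real N) * \<bar>\<Sum>i<N. t * f (t - real i * \<tau>, y i, \<eta>) - ?h i\<bar>" by (simp add: abs_mult)
  also have "\<dots> \<le> (1 / real N) * (\<Sum>i<N. real Cn * (1 + \<delta>) / real b ^ k)"
    by (rule mult_left_mono[OF order_trans[OF sum_abs sum_mono]]) (use hi in auto)
  also have "\<dots> = real Cn * (1 + \<delta>) / real b ^ k" using N1 by simp
  finally have 4: "\<bar>\<tau> * (\<Sum>j<N. f (t - real j * \<tau>, y j, \<eta>)) - (1 / real N) * (\<Sum>i<N. ?h i)\<bar> \<le> real Cn * (1 + \<delta>) / real b ^ k" .
  have "out (t, x, \<eta>) = nn_fun \<Phi> (?Y N) + (1 / real N) * (\<Sum>i<N. ?h i)" by (simp add: out_def)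
  with 1 2 3 4 show ?thesis unfolding add_divide_distrib by linarith
qed

subsection \<open>The main estimate\<close>

lemma Ck_bound_lipschitz_norm:
  fixes g :: "'a::euclidean_space \<Rightarrow> real"
  assumes "Ck_bound s M \<Omega> S g" "s \<ge> 1" "solid S" "x \<in> S" "y \<in> S"
  shows "\<bar>g x - g y\<bar> \<le> 2 ^ DIM('a) * M * real DIM('a) * norm (x - y)"
proof -
  have M: "M \<ge> 0" using assms(1) by (simp add: Ck_bound_def)
  have "\<bar>g x - g y\<bar> \<le> 2 ^ DIM('a) * M * l1 (x - y)" by (rule lipschitz_solid[OF assms])
  also have "\<dots> \<le> 2 ^ DIM('a) * M * (real DIM('a) * norm (x - y))"
    using M l1_le_norm by (intro mult_left_mono) auto
  finally show ?thesis by simp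
qed

lemma norm_Pair3_diff_le: "norm ((s, y, \<eta>) - (s', y', \<eta>)) \<le> \<bar>s - s'\<bar> + norm (y - y')"
  for s s' :: real and y y' :: "'y::euclidean_space" and \<eta> :: "'z::euclidean_space"
proof -
  have "norm ((s, y, \<eta>) - (s', y', \<eta>)) = norm (s - s', y - y', 0 :: 'z)" by simp
  also have "\<dots> \<le> norm (s - s') + norm (y - y', 0 :: 'z)" by (rule norm_Pair_le)
  also have "norm (y - y', 0 :: 'z) = norm (y - y')" by simp
  finally show ?thesis by simp
qed

definition source_ok :: "nat \<Rightarrow> real \<Rightarrow> nat \<Rightarrow> (real \<times> (real ^ 'n) \<times> (real ^ 'D) \<Rightarrow> real) \<Rightarrow> bool" where
  "source_ok k T s' f \<longleftrightarrow>
     (s' = nat \<lceil>real ((CARD('n) + 1) * k) / real (1 + CARD('n) + CARD('D))\<rceil> \<and>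
         (\<exists>f\<^sub>1. Ck_on s' f\<^sub>1 ({0..T} \<times> UNIV) \<and> (\<forall>(t, x, \<eta>)\<in>tx_dom T UNIV. f (t, x, \<eta>) = f\<^sub>1 (t, x)))) \<or>
     (s' = k \<and> Ck_on s' f (tx_dom T UNIV))"

text \<open>The constants are fixed before f is known, hence before it is known which of the cases
  (a) and (b) applies; the constants of both networks are added to serve either.\<close>

lemma source_net:
  fixes \<phi> R :: real and k :: nat
  defines "d \<equiv> 1 + CARD('n) + CARD('D)"
  assumes "k \<ge> 1" "R \<ge> 1" "\<phi> \<ge> 0"
  shows "\<exists>C L. C \<ge> 1 \<and> (\<forall>(f :: real \<times> (real ^ 'n) \<times> (real ^ 'D) \<Rightarrow> real) s' T G B b.
    b \<ge> C \<longrightarrow> solid_body R (tx_dom T B :: (real \<times> (real ^ 'n) \<times> (real ^ 'D)) set) \<longrightarrow> solid_body R ({0..T} \<times> B) \<longrightarrow> T \<ge> 0 \<longrightarrow> G \<ge> 0 \<longrightarrow> B \<subseteq> cball 0 G \<longrightarrow>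
    source_ok k T s' f \<longrightarrow> Ck_norm s' (tx_dom T UNIV) (tx_dom T (cball 0 G)) f = \<phi> \<longrightarrow>
    (\<exists>Hf. net_for k d R C L b (tx_dom T B) f Hf) \<and>
    (\<forall>s s' y y' \<eta>. (s, y, \<eta>) \<in> tx_dom T B \<longrightarrow> (s', y', \<eta>) \<in> tx_dom T B \<longrightarrow>
       \<bar>f (s, y, \<eta>) - f (s', y', \<eta>)\<bar> \<le> 2 ^ d * \<phi> * real d * (\<bar>s - s'\<bar> + norm (y - y'))))"
proof -
  have dP: "DIM(real \<times> (real ^ 'n) \<times> (real ^ 'D)) = d" by (simp add: d_def)
  have dn: "DIM(real \<times> (real ^ 'n)) = CARD('n) + 1" by simp
  obtain CF LF where CF: "CF \<ge> 1" and nF: "\<forall>(\<Omega> :: (real \<times> (real ^ 'n) \<times> (real ^ 'D)) set) S g b. b \<ge> CF \<longrightarrow> solid_body R S \<longrightarrow> Ck_bound k \<phi> \<Omega> S g \<longrightarrow>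
    (\<exists>H. net_for k DIM(real \<times> (real ^ 'n) \<times> (real ^ 'D)) R CF LF b S g H)"
    using net_for_smooth[OF assms(2-4), where 'a = "real \<times> (real ^ 'n) \<times> (real ^ 'D)"] by (elim exE conjE) (rule that, assumption+)
  obtain CA LA where CA: "CA \<ge> 1" and nA: "\<forall>(\<Omega>\<^sub>1 :: (real \<times> (real ^ 'n)) set) S\<^sub>1 f\<^sub>1 (S :: (real \<times> (real ^ 'n) \<times> (real ^ 'D)) set) f b.
    b \<ge> CA \<longrightarrow> solid_body R S\<^sub>1 \<longrightarrow> Ck_bound (nat \<lceil>real (DIM(real \<times> (real ^ 'n)) * k) / real DIM(real \<times> (real ^ 'n) \<times> (real ^ 'D))\<rceil>) \<phi> \<Omega>\<^sub>1 S\<^sub>1 f\<^sub>1 \<longrightarrow>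
    (\<forall>(t, x, \<eta>)\<in>S. (t, x) \<in> S\<^sub>1 \<and> f (t, x, \<eta>) = f\<^sub>1 (t, x)) \<longrightarrow>
    (\<exists>H. net_for k DIM(real \<times> (real ^ 'n) \<times> (real ^ 'D)) R CA LA b S f H)"
    using net_for_parameter_free[OF assms(2-4), where 'y = "real ^ 'n" and 'z = "real ^ 'D"] by (elim exE conjE) (rule that, assumption+)
  have main: "(\<exists>Hf. net_for k d R (CF + CA) (LF + LA) b (tx_dom T B) f Hf) \<and>
    (\<forall>s s' y y' \<eta>. (s, y, \<eta>) \<in> tx_dom T B \<longrightarrow> (s', y', \<eta>) \<in> tx_dom T B \<longrightarrow>
       \<bar>f (s, y, \<eta>) - f (s', y', \<eta>)\<bar> \<le> 2 ^ d * \<phi> * real d * (\<bar>s - s'\<bar> + norm (y - y')))"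
    if b: "b \<ge> CF + CA" and S: "solid_body R (tx_dom T B :: (real \<times> (real ^ 'n) \<times> (real ^ 'D)) set)"
      and S1: "solid_body R ({0..T} \<times> B)" and T: "T \<ge> 0" and G: "G \<ge> 0" and BG: "B \<subseteq> cball 0 G"
      and ok: "source_ok k T s' f" and nrm: "Ck_norm s' (tx_dom T UNIV) (tx_dom T (cball 0 G)) f = \<phi>"
    for f :: "real \<times> (real ^ 'n) \<times> (real ^ 'D) \<Rightarrow> real" and s' T G B b
  proof -
    have bF: "b \<ge> CF" and bA: "b \<ge> CA" using b by auto
    have sub: "(tx_dom T B :: (real \<times> (real ^ 'n) \<times> (real ^ 'D)) set) \<subseteq> tx_dom T (cball 0 G)"
      using BG unfolding tx_dom_def by blast
    have so: "solid (tx_dom T B :: (real \<times> (real ^ 'n) \<times> (real ^ 'D)) set)" "solid ({0..T} \<times> B)"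
      using S S1 by (auto simp: solid_body_def)
    from ok consider (a) f\<^sub>1 where "s' = nat \<lceil>real ((CARD('n) + 1) * k) / real d\<rceil>" "Ck_on s' f\<^sub>1 ({0..T} \<times> UNIV)"
        "\<forall>(t, x, \<eta>)\<in>tx_dom T UNIV. f (t, x, \<eta>) = f\<^sub>1 (t, x)"
      | (b) "s' = k" "Ck_on s' f (tx_dom T UNIV)"
      unfolding source_ok_def d_def by (elim disjE conjE exE) (assumption | rule that)+
    then show ?thesis
    proof cases
      case (a f\<^sub>1)
      \<comment> \<open>The ceiling of a positive number: however few derivatives the case leaves,
        one remains to make \<open>f\<^sub>1\<close> Lipschitz.\<close>
      have s1: "s' \<ge> 1"
      proof -
        have "real ((CARD('n) + 1) * k) / real d > 0" using assms(2)
          by (intro divide_pos_pos iffD2[OF of_nat_0_less_iff] mult_pos_pos) (simp_all add: d_def)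
        then have "\<lceil>real ((CARD('n) + 1) * k) / real d\<rceil> > 0" by (simp only: zero_less_ceiling)
        then show ?thesis unfolding a(1) by linarith
      qed
      have feq: "f (t, x, \<eta>) = f\<^sub>1 (t, x)" if "(t, x, \<eta>) \<in> tx_dom T UNIV" for t x and \<eta> :: "real ^ 'D"
        using bspec[OF a(3) that] by simp
      have "Ck_bound s' \<phi> ({0..T} \<times> UNIV) ({0..T} \<times> cball 0 G) f\<^sub>1"
        unfolding nrm[symmetric] by (rule Ck_bound_drop_parameter[OF feq a(2) compact_cball _ T]) (use G in auto)
      from Ck_bound_mono[OF this order_refl, of "{0..T} \<times> B"] BG
      have f1: "Ck_bound s' \<phi> ({0..T} \<times> UNIV) ({0..T} \<times> B) f\<^sub>1" by auto
      have fS: "\<forall>(t, x, \<eta>)\<in>(tx_dom T B :: (real \<times> (real ^ 'n) \<times> (real ^ 'D)) set). (t, x) \<in> {0..T} \<times> B \<and> f (t, x, \<eta>) = f\<^sub>1 (t, x)"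
      proof (rule ballI)
        fix p :: "real \<times> (real ^ 'n) \<times> (real ^ 'D)" assume p: "p \<in> tx_dom T B"
        obtain t x \<eta> where pt: "p = (t, x, \<eta>)" by (cases p)
        have "(t, x) \<in> {0..T} \<times> B" "(t, x, \<eta>) \<in> tx_dom T UNIV" using p by (auto simp: pt tx_dom_def)
        then show "case p of (t, x, \<eta>) \<Rightarrow> (t, x) \<in> {0..T} \<times> B \<and> f (t, x, \<eta>) = f\<^sub>1 (t, x)"
          using feq by (simp add: pt)
      qed
      obtain H where H: "net_for k d R CA LA b (tx_dom T B) f H"
        using nA[unfolded dP dn, THEN spec, THEN spec, THEN spec[of _ f\<^sub>1], THEN spec, THEN spec[of _ f], THEN spec,
          THEN mp, OF bA, THEN mp, OF S1, THEN mp, OF f1[unfolded a(1)], THEN mp, OF fS] by (elim exE) (rule that)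
      have lip: "\<bar>f (s, y, \<eta>) - f (t, z, \<eta>)\<bar> \<le> 2 ^ d * \<phi> * real d * (\<bar>s - t\<bar> + norm (y - z))"
        if p: "(s, y, \<eta>) \<in> tx_dom T B" and q: "(t, z, \<eta>) \<in> tx_dom T B" for s t y z \<eta>
      proof -
        have fp: "f (s, y, \<eta>) = f\<^sub>1 (s, y)" "f (t, z, \<eta>) = f\<^sub>1 (t, z)" "(s, y) \<in> {0..T} \<times> B" "(t, z) \<in> {0..T} \<times> B"
          using bspec[OF fS p] bspec[OF fS q] by auto
        have "\<bar>f\<^sub>1 (s, y) - f\<^sub>1 (t, z)\<bar> \<le> 2 ^ (CARD('n) + 1) * \<phi> * real (CARD('n) + 1) * norm ((s, y) - (t, z))"
          using Ck_bound_lipschitz_norm[OF f1 s1 so(2) fp(3,4)] unfolding dn .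
        also have "\<dots> \<le> 2 ^ d * \<phi> * real d * (\<bar>s - t\<bar> + norm (y - z))"
        proof (intro mult_mono)
          show "(2::real) ^ (CARD('n) + 1) \<le> 2 ^ d" by (rule power_increasing) (simp_all add: d_def)
          have "norm (s - t, y - z) \<le> norm (s - t) + norm (y - z)" by (rule norm_Pair_le)
          then show "norm ((s, y) - (t, z)) \<le> \<bar>s - t\<bar> + norm (y - z)" by simp
        qed (use assms(4) in \<open>auto simp: d_def\<close>)
        finally show ?thesis unfolding fp .
      qed
      show ?thesis using net_for_mono[OF H, of "CF + CA" "LF + LA"] lip by auto
    next
      case b
      have ne: "(tx_dom T (cball 0 G) :: (real \<times> (real ^ 'n) \<times> (real ^ 'D)) set) \<noteq> {}"
      proof -
        have "(0, 0, 0) \<in> (tx_dom T (cball 0 G) :: (real \<times> (real ^ 'n) \<times> (real ^ 'D)) set)" using T G by (simp add: tx_dom_def mem_box)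
        then show ?thesis by blast
      qed
      have "Ck_bound s' \<phi> (tx_dom T UNIV) (tx_dom T (cball 0 G)) f"
        unfolding nrm[symmetric] by (rule Ck_bound_Ck_norm[OF b(2) _ _ ne])
          (auto simp: tx_dom_def intro!: compact_Times)
      from Ck_bound_mono[OF this order_refl sub]
      have fB: "Ck_bound k \<phi> (tx_dom T UNIV) (tx_dom T B) f" unfolding b(1) .
      obtain H where H: "net_for k d R CF LF b (tx_dom T B) f H"
        using nF[rule_format, unfolded dP, OF bF S fB] by (elim exE) (rule that)
      have lip: "\<bar>f (s, y, \<eta>) - f (t, z, \<eta>)\<bar> \<le> 2 ^ d * \<phi> * real d * (\<bar>s - t\<bar> + norm (y - z))"
        if p: "(s, y, \<eta>) \<in> tx_dom T B" and q: "(t, z, \<eta>) \<in> tx_dom T B" for s t y z \<eta>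
      proof -
        have "\<bar>f (s, y, \<eta>) - f (t, z, \<eta>)\<bar> \<le> 2 ^ d * \<phi> * real d * norm ((s, y, \<eta>) - (t, z, \<eta>))"
          using Ck_bound_lipschitz_norm[OF fB assms(2) so(1) p q] unfolding dP .
        also have "\<dots> \<le> 2 ^ d * \<phi> * real d * (\<bar>s - t\<bar> + norm (y - z))"
          by (intro mult_left_mono norm_Pair3_diff_le) (use assms(4) in auto)
        finally show ?thesis .
      qed
      show ?thesis using net_for_mono[OF H, of "CF + CA" "LF + LA"] lip by auto
    qed
  qed
  have "CF + CA \<ge> 1" using CF by simp
  then show ?thesis by (intro exI[of _ "CF + CA"] exI[of _ "LF + LA"] conjI[of "1 \<le> CF + CA"] allI impI main)
qed

lemma solid_body_tx:
  fixes B :: "(real ^ 'n) set"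
  assumes "B = cball 0 r" "r \<ge> 0" "T \<ge> 0" "T \<le> R" "r \<le> R" "1 \<le> R"
  shows "solid_body R (tx_dom T B :: (real \<times> (real ^ 'n) \<times> (real ^ 'D)) set)" "solid_body R ({0..T} \<times> B)"
proof -
  have x: "\<bar>inner x e\<bar> \<le> R" if "x \<in> B" "e \<in> Basis" for x e
    using Basis_le_norm[OF that(2), of x] that(1) assms by simp
  have \<eta>: "\<bar>inner \<eta> e\<bar> \<le> R" if "\<eta> \<in> cbox 0 One" "e \<in> Basis" for \<eta> e :: "real ^ 'D"
  proof -
    have "0 \<le> inner \<eta> e" "inner \<eta> e \<le> 1" using that by (auto simp: mem_box)
    then show ?thesis using assms by simp
  qed
  have ne: "0 \<in> B" "0 \<in> {0..T}" "0 \<in> cbox 0 (One :: real ^ 'D)" using assms by (auto simp: mem_box)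
  show "solid_body R (tx_dom T B :: (real \<times> (real ^ 'n) \<times> (real ^ 'D)) set)"
    unfolding solid_body_def
  proof (intro conjI ballI)
    show "compact (tx_dom T B :: (real \<times> (real ^ 'n) \<times> (real ^ 'D)) set)" unfolding tx_dom_def assms(1) by (intro compact_Times) auto
    show "convex (tx_dom T B :: (real \<times> (real ^ 'n) \<times> (real ^ 'D)) set)" unfolding tx_dom_def assms(1) by (intro convex_Times) auto
    show "solid (tx_dom T B :: (real \<times> (real ^ 'n) \<times> (real ^ 'D)) set)" unfolding tx_dom_def assms(1)
      by (intro solid_Times solid_interval solid_cball solid_unit_cube)
    show "(tx_dom T B :: (real \<times> (real ^ 'n) \<times> (real ^ 'D)) set) \<noteq> {}" using ne unfolding tx_dom_def by auto
    fix p e :: "real \<times> (real ^ 'n) \<times> (real ^ 'D)" assume p: "p \<in> tx_dom T B" and e: "e \<in> Basis"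
    obtain s y \<eta> where py: "p = (s, y, \<eta>)" by (cases p)
    from e consider "e = (1, 0, 0)" | e' where "e' \<in> Basis" "e = (0, e', 0)" | e' where "e' \<in> Basis" "e = (0, 0, e')"
      by (auto simp: Basis_prod_def zero_prod_def)
    then show "\<bar>inner p e\<bar> \<le> R"
      by cases (use p x \<eta> assms in \<open>auto simp: py tx_dom_def\<close>)
  qed
  show "solid_body R ({0..T} \<times> B)"
    unfolding solid_body_def
  proof (intro conjI ballI)
    show "compact ({0..T} \<times> B)" unfolding assms(1) by (intro compact_Times) auto
    show "convex ({0..T} \<times> B)" unfolding assms(1) by (intro convex_Times) auto
    show "solid ({0..T} \<times> B)" unfolding assms(1) by (intro solid_Times solid_interval solid_cball)
    show "{0..T} \<times> B \<noteq> {}" using ne by auto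
    fix p e :: "real \<times> (real ^ 'n)" assume p: "p \<in> {0..T} \<times> B" and e: "e \<in> Basis"
    obtain s y where py: "p = (s, y)" by (cases p)
    from e consider "e = (1, 0)" | e' where "e' \<in> Basis" "e = (0, e')"
      by (auto simp: Basis_prod_def)
    then show "\<bar>inner p e\<bar> \<le> R"
      by cases (use p x assms in \<open>auto simp: py\<close>)
  qed
qed

text \<open>All constants are extracted while only the numbers \<rho>, v and \<phi> are known,
  before V, C, f and K enter. For this reason the domain is bounded through \<rho> + T v and not
  through the growth radius.\<close>

lemma core_estimate:
  fixes u\<^sub>0 :: "real ^ 'n \<Rightarrow> real" and T \<rho> v \<phi> :: real and k :: nat
  defines "d \<equiv> 1 + CARD('n) + CARD('D)"
  assumes k: "k \<ge> 1" and T: "T > 0" and u0: "Ck_on 1 u\<^sub>0 UNIV" and nonneg: "\<rho> \<ge> 0" "v \<ge> 0" "\<phi> \<ge> 0"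
  shows "\<exists>E R1 (Cw :: nat) L1 b0. E \<ge> 0 \<and> (\<forall>(V :: real \<times> (real ^ 'n) \<times> (real ^ 'D) \<Rightarrow> real ^ 'n) C
      (f :: real \<times> (real ^ 'n) \<times> (real ^ 'D) \<Rightarrow> real) s' u K b m \<Phi> \<epsilon>.
    Ck_on k V (tx_dom T UNIV) \<longrightarrow> C > 0 \<longrightarrow>
    (\<forall>(t, x, \<eta>)\<in>tx_dom T UNIV. norm (V (t, x, \<eta>)) \<le> C * (1 + norm x)) \<longrightarrow>
    source_ok k T s' f \<longrightarrow> cauchy_solution T V f u\<^sub>0 u \<longrightarrow> compact K \<longrightarrow> K \<noteq> {} \<longrightarrow> set_size K = \<rho> \<longrightarrow>
    Ck_norm k (tx_dom T UNIV) (tx_dom T (cball 0 (growth_radius K C T))) V = v \<longrightarrow>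
    Ck_norm s' (tx_dom T UNIV) (tx_dom T (cball 0 (growth_radius K C T))) f = \<phi> \<longrightarrow>
    b \<ge> b0 \<longrightarrow> b \<ge> 1 \<longrightarrow> real b ^ k \<le> 2 ^ m \<longrightarrow> is_nn CARD('n) \<Phi> \<longrightarrow> nn_out_dim \<Phi> = 1 \<longrightarrow>
    (\<forall>y\<in>ball 0 R1. \<bar>u\<^sub>0 y - nn_fun \<Phi> y\<bar> \<le> \<epsilon>) \<longrightarrow>
    (\<exists>out. computes coord_funs (L1 * (m + 1) + nn_layers \<Phi>) (Cw * (m + 1) * b ^ (k + d + 1) + nn_weights \<Phi>) {out} \<and>
       (\<forall>p\<in>tx_dom T K. \<bar>u p - out p\<bar> \<le> E / real b ^ k + \<epsilon>)))"
proof -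
  have dP: "DIM(real \<times> (real ^ 'n) \<times> (real ^ 'D)) = d" by (simp add: d_def)
  \<comment> \<open>Dominates the coordinates of every node: times up to T, parameters up to 1 and
    positions up to \<rho> + T v.\<close>
  define R where "R = 1 + T + \<rho> + T * v"
  have Tv: "T * v \<ge> 0" using T nonneg by simp
  have R1: "R \<ge> 1" "T \<le> R" using T nonneg Tv by (auto simp: R_def)
  obtain CV LV where CV: "CV \<ge> 1" and nV: "\<forall>(\<Omega> :: (real \<times> (real ^ 'n) \<times> (real ^ 'D)) set) S g b. b \<ge> CV \<longrightarrow> solid_body R S \<longrightarrow> Ck_bound k v \<Omega> S g \<longrightarrow>
    (\<exists>H. net_for k DIM(real \<times> (real ^ 'n) \<times> (real ^ 'D)) R CV LV b S g H)"
    using net_for_smooth[OF k R1(1) nonneg(2), where 'a = "real \<times> (real ^ 'n) \<times> (real ^ 'D)"] by (elim exE conjE) (rule that, assumption+)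
  obtain CF LF where CF: "CF \<ge> 1" and nF: "\<forall>(f :: real \<times> (real ^ 'n) \<times> (real ^ 'D) \<Rightarrow> real) s' T G B b.
    b \<ge> CF \<longrightarrow> solid_body R (tx_dom T B :: (real \<times> (real ^ 'n) \<times> (real ^ 'D)) set) \<longrightarrow> solid_body R ({0..T} \<times> B) \<longrightarrow> T \<ge> 0 \<longrightarrow> G \<ge> 0 \<longrightarrow> B \<subseteq> cball 0 G \<longrightarrow>
    source_ok k T s' f \<longrightarrow> Ck_norm s' (tx_dom T UNIV) (tx_dom T (cball 0 G)) f = \<phi> \<longrightarrow>
    (\<exists>Hf. net_for k d R CF LF b (tx_dom T B) f Hf) \<and>
    (\<forall>s s' y y' \<eta>. (s, y, \<eta>) \<in> tx_dom T B \<longrightarrow> (s', y', \<eta>) \<in> tx_dom T B \<longrightarrow>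
       \<bar>f (s, y, \<eta>) - f (s', y', \<eta>)\<bar> \<le> 2 ^ d * \<phi> * real d * (\<bar>s - s'\<bar> + norm (y - y')))"
    using source_net[OF k R1(1) nonneg(3), where 'n = 'n and 'D = 'D, folded d_def] by (elim exE conjE) (rule that, assumption+)
  define Cn where "Cn = CV + CF"
  define Lc where "Lc = LV + LF"
  define \<Gamma> where "\<Gamma> = real CARD('n) * real Cn"
  define \<delta> where "\<delta> = (2 * \<Gamma> + 2 * (\<rho> + T * v)) * exp (2 * \<Gamma>)"
  have \<Gamma>0: "\<Gamma> \<ge> 0" by (simp add: \<Gamma>_def)
  have \<delta>0: "\<delta> \<ge> 0" unfolding \<delta>_def using \<Gamma>0 nonneg Tv by auto
  define R2 where "R2 = \<rho> + T * v + \<delta> + 1"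
  have R20: "R2 \<ge> 0" using nonneg Tv \<delta>0 by (simp add: R2_def)
  obtain L where L: "L \<ge> 0" "\<forall>y\<in>cball 0 R2. \<forall>y'\<in>cball 0 R2. \<bar>u\<^sub>0 y - u\<^sub>0 y'\<bar> \<le> L * norm (y - y')"
    using C1_lipschitz_ball[OF u0 R20] by (elim exE conjE) (rule that, assumption+)
  define \<Lambda> where "\<Lambda> = real CARD('n) * (2 ^ d * v * real d)"
  define \<Lambda>' where "\<Lambda>' = 2 ^ d * \<phi> * real d"
  have \<Lambda>0: "\<Lambda> \<ge> 0" "\<Lambda>' \<ge> 0" using nonneg by (auto simp: \<Lambda>_def \<Lambda>'_def)
  define E where "E = (L + T * \<Lambda>') * (T * (1 + v) * exp (T * \<Lambda>)) + L * \<delta> + real Cn * (1 + \<delta>)"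
  have E0: "E \<ge> 0" unfolding E_def using L(1) T \<Lambda>0 nonneg \<delta>0 by (intro add_nonneg_nonneg mult_nonneg_nonneg) auto
  have main: "\<exists>out. computes coord_funs ((2 * Lc + k + 3) * (m + 1) + nn_layers \<Phi>)
       ((CARD('n) * (Cn + 2 * k + 3) + Cn + 5) * (m + 1) * b ^ (k + d + 1) + nn_weights \<Phi>) {out} \<and>
       (\<forall>p\<in>tx_dom T K. \<bar>u p - out p\<bar> \<le> E / real b ^ k + \<epsilon>)"
    if V: "Ck_on k V (tx_dom T UNIV)" and C: "C > 0"
      and gr: "\<forall>(t, x, \<eta>)\<in>tx_dom T UNIV. norm (V (t, x, \<eta>)) \<le> C * (1 + norm x)"
      and ok: "source_ok k T s' f" and sol: "cauchy_solution T V f u\<^sub>0 u"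
      and K: "compact K" "K \<noteq> {}" "set_size K = \<rho>"
      and nv: "Ck_norm k (tx_dom T UNIV) (tx_dom T (cball 0 (growth_radius K C T))) V = v"
      and nf: "Ck_norm s' (tx_dom T UNIV) (tx_dom T (cball 0 (growth_radius K C T))) f = \<phi>"
      and b: "b \<ge> Cn" "b \<ge> 1" and m: "real b ^ k \<le> 2 ^ m"
      and \<Phi>: "is_nn CARD('n) \<Phi>" "nn_out_dim \<Phi> = 1" "\<forall>y\<in>ball 0 R2. \<bar>u\<^sub>0 y - nn_fun \<Phi> y\<bar> \<le> \<epsilon>"
    for V :: "real \<times> (real ^ 'n) \<times> (real ^ 'D) \<Rightarrow> real ^ 'n" and C
      and f u :: "real \<times> (real ^ 'n) \<times> (real ^ 'D) \<Rightarrow> real" and s' K b m \<Phi> \<epsilon>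
  proof -
    define G where "G = (\<rho> + C * T) * exp (C * T)"
    have GG: "growth_radius K C T = G" using K(3) by (simp add: growth_radius_def G_def)
    have G0: "G \<ge> 0" using C T nonneg by (simp add: G_def)
    \<comment> \<open>Below G, so that the given norms apply, and below R, so that the constants
      chosen above apply.\<close>
    define r where "r = min G (\<rho> + T * v)"
    have r0: "r \<ge> 0" "r \<le> R" "r \<le> G" using G0 nonneg Tv T by (auto simp: r_def R_def)
    define B where "B = cball (0 :: real ^ 'n) r"
    have BG: "B \<subseteq> cball 0 G" using r0 by (auto simp: B_def)
    note bodies = solid_body_tx(1)[OF B_def r0(1) less_imp_le[OF T] R1(2) r0(2) R1(1), where 'D = 'D]
      solid_body_tx(2)[OF B_def r0(1) less_imp_le[OF T] R1(2) r0(2) R1(1)]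
    let ?\<Omega> = "tx_dom T UNIV :: (real \<times> (real ^ 'n) \<times> (real ^ 'D)) set"
    let ?S' = "tx_dom T (cball 0 G) :: (real \<times> (real ^ 'n) \<times> (real ^ 'D)) set"
    let ?S = "tx_dom T B :: (real \<times> (real ^ 'n) \<times> (real ^ 'D)) set"
    have S'c: "compact ?S'" unfolding tx_dom_def by (intro compact_Times) auto
    have S'\<Omega>: "?S' \<subseteq> ?\<Omega>" unfolding tx_dom_def by auto
    have SS': "?S \<subseteq> ?S'" unfolding tx_dom_def using BG by blast
    have "(0, 0, 0) \<in> ?S'" using T G0 by (simp add: tx_dom_def mem_box)
    then have S'ne: "?S' \<noteq> {}" by blast
    have nvG: "Ck_norm k ?\<Omega> ?S' V = v" using nv unfolding GG .
    have Vb: "Ck_bound k v ?\<Omega> ?S (\<lambda>p. inner (V p) e)" if e: "e \<in> Basis" for e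
    proof -
      have "Ck_bound k v ?\<Omega> ?S' (\<lambda>p. inner (V p) e)"
        using Ck_bound_Ck_norm_inner[OF thick_tx_dom[OF T] V S'c S'\<Omega> S'ne norm_Basis[OF e]] unfolding nvG .
      from Ck_bound_mono[OF this order_refl SS'] show ?thesis .
    qed
    have Vn: "norm (V p) \<le> v" if p: "p \<in> ?S'" for p
    proof -
      have "continuous_on ?S' V" using Ck_on_mono[OF V, of 0] S'\<Omega> by (auto elim: continuous_on_subset)
      from bdd_above_norm_image[OF this S'c] iter_pderiv_le_Ck_norm[of "[]" k p ?S' ?\<Omega> V] p
      show ?thesis unfolding nvG by (simp add: iter_pderiv_def)
    qed
    have "\<forall>e\<in>Basis. \<exists>H. net_for k d R Cn Lc b ?S (\<lambda>p. inner (V p) e) H"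
    proof
      fix e :: "real ^ 'n" assume e: "e \<in> Basis"
      have bV: "b \<ge> CV" using b by (simp add: Cn_def)
      obtain H where "net_for k d R CV LV b ?S (\<lambda>p. inner (V p) e) H"
        using nV[rule_format, unfolded dP, OF bV bodies(1) Vb[OF e]] by (elim exE) (rule that)
      then have "net_for k d R Cn Lc b ?S (\<lambda>p. inner (V p) e) H"
        by (rule net_for_mono) (simp_all add: Cn_def Lc_def)
      then show "\<exists>H. net_for k d R Cn Lc b ?S (\<lambda>p. inner (V p) e) H" by (rule exI[of _ H])
    qed
    from bchoice[OF this] obtain H where H: "\<forall>e\<in>Basis. net_for k d R Cn Lc b ?S (\<lambda>p. inner (V p) e) (H e)"
      by (elim exE) (rule that)
    have bF: "b \<ge> CF" using b by (simp add: Cn_def)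
    have ex: "(\<exists>Hf. net_for k d R CF LF b ?S f Hf) \<and>
      (\<forall>s s' y y' \<eta>. (s, y, \<eta>) \<in> ?S \<longrightarrow> (s', y', \<eta>) \<in> ?S \<longrightarrow>
       \<bar>f (s, y, \<eta>) - f (s', y', \<eta>)\<bar> \<le> 2 ^ d * \<phi> * real d * (\<bar>s - s'\<bar> + norm (y - y')))"
      using nF[rule_format, OF bF bodies less_imp_le[OF T] G0 BG ok nf[unfolded GG]] .
    obtain Hf0 where "net_for k d R CF LF b ?S f Hf0" using conjunct1[OF ex] by (elim exE) (rule that)
    then have Hf: "net_for k d R Cn Lc b ?S f Hf0" by (rule net_for_mono) (simp_all add: Cn_def Lc_def)
    have lipf: "\<bar>f (s, y, \<eta>) - f (s', y', \<eta>)\<bar> \<le> \<Lambda>' * (\<bar>s - s'\<bar> + norm (y - y'))"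
      if "(s, y, \<eta>) \<in> ?S" "(s', y', \<eta>) \<in> ?S" for s s' y y' \<eta>
      unfolding \<Lambda>'_def by (rule conjunct2[OF ex, rule_format, OF that])
    have lipV: "norm (V (s, y, \<eta>) - V (s', y', \<eta>)) \<le> \<Lambda> * (\<bar>s - s'\<bar> + norm (y - y'))"
      if p: "(s, y, \<eta>) \<in> ?S" "(s', y', \<eta>) \<in> ?S" for s s' y y' \<eta>
    proof -
      have so: "solid ?S" using bodies(1) by (simp add: solid_body_def)
      have "norm (V (s, y, \<eta>) - V (s', y', \<eta>)) \<le> l1 (V (s, y, \<eta>) - V (s', y', \<eta>))" by (rule norm_le_l1')
      also have "\<dots> \<le> (\<Sum>e\<in>(Basis :: (real ^ 'n) set). 2 ^ d * v * real d * (\<bar>s - s'\<bar> + norm (y - y')))"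
        unfolding l1_def
      proof (rule sum_mono)
        fix e :: "real ^ 'n" assume e: "e \<in> Basis"
        have "\<bar>inner (V (s, y, \<eta>)) e - inner (V (s', y', \<eta>)) e\<bar> \<le> 2 ^ d * v * real d * norm ((s, y, \<eta>) - (s', y', \<eta>))"
          using Ck_bound_lipschitz_norm[OF Vb[OF e] k so p] unfolding dP .
        also have "\<dots> \<le> 2 ^ d * v * real d * (\<bar>s - s'\<bar> + norm (y - y'))"
          by (intro mult_left_mono norm_Pair3_diff_le) (use nonneg in auto)
        finally show "\<bar>inner (V (s, y, \<eta>) - V (s', y', \<eta>)) e\<bar> \<le> 2 ^ d * v * real d * (\<bar>s - s'\<bar> + norm (y - y'))"
          by (simp add: inner_diff_left)
      qed
      also have "\<dots> = \<Lambda> * (\<bar>s - s'\<bar> + norm (y - y'))" by (simp add: \<Lambda>_def)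
      finally show ?thesis .
    qed
    let ?N = "b ^ k"
    define out where "out = (\<lambda>p. nn_fun \<Phi> (relax H ?N m ?N p) + (1 / real ?N) * (\<Sum>i<?N. Hf0 (fst p) (node_at ?N (relax H ?N m) i p)))"
    have c: "computes coord_funs ((2 * Lc + k + 3) * (m + 1) + nn_layers \<Phi>)
       ((CARD('n) * (Cn + 2 * k + 3) + Cn + 5) * (m + 1) * b ^ (k + d + 1) + nn_weights \<Phi>) {out}"
      unfolding out_def
      by (rule relax_computes[where V = "\<lambda>e p. inner (V p) e", OF b(2) bspec[OF H] Hf \<Phi>(1,2)])
    have e: "\<bar>u p - out p\<bar> \<le> E / real b ^ k + \<epsilon>" if p: "p \<in> tx_dom T K" for p
    proof -
      obtain t x \<eta> where pt: "p = (t, x, \<eta>)" "t \<in> {0..T}" "x \<in> K" "\<eta> \<in> cbox 0 One" using p by (auto simp: tx_dom_def)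
      have "bdd_above (norm ` K)" using bdd_above_norm_image[OF continuous_on_id K(1)] by simp
      then have x\<rho>: "norm x \<le> \<rho>" unfolding K(3)[symmetric] set_size_def using pt(3) by (intro cSUP_upper)
      have B': "B = cball 0 (min ((\<rho> + C * T) * exp (C * T)) (\<rho> + T * v))" by (simp add: B_def r_def G_def)
      show ?thesis unfolding pt(1) out_def E_def \<delta>_def \<Gamma>_def
      proof (rule relax_approximates[where R = R and B = B and d = d and Lc = Lc and C = C, OF sol b(2) m R1(2) pt(2,4) x\<rho> C _ _ nonneg(2) \<Lambda>0 L(1) B'])
        fix s y assume "s \<in> {0..T}"
        then have "(s, y, \<eta>) \<in> ?\<Omega>" using pt(4) by (simp add: tx_dom_def)
        from bspec[OF gr this] show "norm (V (s, y, \<eta>)) \<le> C * (1 + norm y)" by simp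
      next
        fix s and y :: "real ^ 'n" assume "s \<in> {0..T}" "norm y \<le> (\<rho> + C * T) * exp (C * T)"
        then show "norm (V (s, y, \<eta>)) \<le> v" using pt(4) by (intro Vn) (simp add: tx_dom_def G_def)
      next
        fix s s' y y' assume "s \<in> {0..T}" "s' \<in> {0..T}" "y \<in> B" "y' \<in> B"
        then have "(s, y, \<eta>) \<in> ?S" "(s', y', \<eta>) \<in> ?S" using pt(4) by (auto simp: tx_dom_def)
        then show "norm (V (s, y, \<eta>) - V (s', y', \<eta>)) \<le> \<Lambda> * (\<bar>s - s'\<bar> + norm (y - y'))"
          "\<bar>f (s, y, \<eta>) - f (s', y', \<eta>)\<bar> \<le> \<Lambda>' * (\<bar>s - s'\<bar> + norm (y - y'))" by (rule lipV, rule lipf)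
      next
        fix y y' :: "real ^ 'n"
        assume "y \<in> cball 0 (\<rho> + T * v + (2 * (real CARD('n) * real Cn) + 2 * (\<rho> + T * v)) * exp (2 * (real CARD('n) * real Cn)) + 1)"
          "y' \<in> cball 0 (\<rho> + T * v + (2 * (real CARD('n) * real Cn) + 2 * (\<rho> + T * v)) * exp (2 * (real CARD('n) * real Cn)) + 1)"
        then show "\<bar>u\<^sub>0 y - u\<^sub>0 y'\<bar> \<le> L * norm (y - y')"
          by (rule bspec[OF bspec[OF L(2)[unfolded R2_def \<delta>_def \<Gamma>_def]]])
      next
        fix e :: "real ^ 'n" assume "e \<in> Basis"
        then show "net_for k d R Cn Lc b ?S (\<lambda>p. inner (V p) e) (H e)" by (rule bspec[OF H])
      next
        show "net_for k d R Cn Lc b ?S f Hf0" by (rule Hf)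
      next
        fix y :: "real ^ 'n"
        assume "y \<in> ball 0 (\<rho> + T * v + (2 * (real CARD('n) * real Cn) + 2 * (\<rho> + T * v)) * exp (2 * (real CARD('n) * real Cn)) + 1)"
        then show "\<bar>u\<^sub>0 y - nn_fun \<Phi> y\<bar> \<le> \<epsilon>" by (rule bspec[OF \<Phi>(3)[unfolded R2_def \<delta>_def \<Gamma>_def]])
      qed
    qed
    show ?thesis using c e by (intro exI[of _ out] conjI ballI)
  qed
  show ?thesis
    by (intro exI[of _ E] exI[of _ R2] exI[of _ "CARD('n) * (Cn + 2 * k + 3) + Cn + 5"] exI[of _ "2 * Lc + k + 3"] exI[of _ Cn]
        conjI[OF E0] allI impI main)
qed

section \<open>Choice of the grid and of the number of sweeps for a given accuracy\<close>

lemma base_for_accuracy: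
  fixes A \<epsilon> :: real and k b0 :: nat
  assumes k: "k \<ge> 1" and \<epsilon>: "0 < \<epsilon>" "\<epsilon> < 1" and A: "A \<ge> 1" "A \<ge> real b0 ^ k"
  shows "\<exists>b m. b \<ge> 1 \<and> b \<ge> b0 \<and> A / \<epsilon> \<le> real b ^ k \<and> real b \<le> 2 * (A / \<epsilon>) powr (1 / real k) \<and>
    real b ^ k \<le> 2 ^ m \<and> real (m + 1) \<le> (2 * real k + 3 + 2 * ln A) * (ln (1 / \<epsilon>) + 1)"
proof -
  define z where "z = (A / \<epsilon>) powr (1 / real k)"
  have A\<epsilon>: "A / \<epsilon> \<ge> A" using A \<epsilon> by (simp add: field_simps)
  then have A1: "A / \<epsilon> \<ge> 1" using A by linarith
  have z1: "z \<ge> 1" unfolding z_def using A1 k by (intro ge_one_powr_ge_zero) auto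
  have zk: "z ^ k = A / \<epsilon>"
  proof -
    have "z ^ k = z powr real k" using z1 by (simp add: powr_realpow)
    also have "\<dots> = A / \<epsilon>" unfolding z_def powr_powr using k A \<epsilon> by simp
    finally show ?thesis .
  qed
  \<comment> \<open>Rounding up at most doubles z, as z is at least 1.\<close>
  define b where "b = nat \<lceil>z\<rceil>"
  have bz: "z \<le> real b" "real b \<le> z + 1" using z1 unfolding b_def by linarith+
  have b1: "b \<ge> 1" using bz z1 by linarith
  have b2: "real b \<le> 2 * z" using bz z1 by linarith
  have bk: "A / \<epsilon> \<le> real b ^ k" using power_mono[OF bz(1), of k] z1 by (simp add: zk)
  have "real b0 ^ k \<le> real b ^ k" using bk A\<epsilon> A(2) by linarith
  then have "b0 \<le> b" using k by (simp add: power_mono_iff)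
  \<comment> \<open>The number of sweeps: with b^k <= 2^m the error of the starting guess, halved in
    each sweep, falls to the order b^(- k) of the discretization error.\<close>
  define m where "m = k * nat \<lceil>log 2 (real b)\<rceil>"
  have lb: "log 2 (real b) \<ge> 0" using b1 by (simp add: zero_le_log_cancel_iff)
  have "real b = 2 powr (log 2 (real b))" using b1 by simp
  also have "\<dots> \<le> 2 powr (real (nat \<lceil>log 2 (real b)\<rceil>))" using lb by (intro powr_mono) auto
  also have "\<dots> = 2 ^ nat \<lceil>log 2 (real b)\<rceil>" by (simp add: powr_realpow)
  finally have "real b ^ k \<le> (2 ^ nat \<lceil>log 2 (real b)\<rceil>) ^ k" by (intro power_mono) auto
  then have bm: "real b ^ k \<le> 2 ^ m" by (simp add: m_def power_mult[symmetric] mult.commute)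
  \<comment> \<open>This bound trades the division by ln 2 for a factor 2.\<close>
  have l2: "ln 2 \<ge> (1/2 :: real)" using ln2_ge_two_thirds by linarith
  have "ln (real b) \<le> ln (2 * z)" using b1 b2 by (subst ln_le_cancel_iff) auto
  also have "\<dots> = ln 2 + ln (A / \<epsilon>) / real k" using z1 A \<epsilon> by (simp add: ln_mult z_def ln_powr)
  finally have "real k * ln (real b) \<le> real k * (ln 2 + ln (A / \<epsilon>) / real k)" using k by (intro mult_left_mono) auto
  also have "\<dots> = real k * ln 2 + ln (A / \<epsilon>)" using k by (simp add: field_simps)
  finally have kb: "real k * ln (real b) \<le> real k * ln 2 + ln (A / \<epsilon>)" .
  have "real (nat \<lceil>log 2 (real b)\<rceil>) \<le> log 2 (real b) + 1" using lb by linarith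
  then have "real m \<le> real k * (log 2 (real b) + 1)" unfolding m_def of_nat_mult by (intro mult_left_mono) auto
  also have "\<dots> = (real k * ln (real b)) / ln 2 + real k" by (simp add: log_def algebra_simps)
  also have "\<dots> \<le> (real k * ln 2 + ln (A / \<epsilon>)) / ln 2 + real k" using kb l2 by (intro add_right_mono divide_right_mono) auto
  also have "\<dots> = 2 * real k + ln (A / \<epsilon>) / ln 2" using l2 by (simp add: field_simps)
  also have "ln (A / \<epsilon>) / ln 2 \<le> 2 * ln (A / \<epsilon>)"
  proof -
    have "ln (A / \<epsilon>) * (1 / 2) \<le> ln (A / \<epsilon>) * ln 2" using A1 l2 by (intro mult_left_mono) auto
    then show ?thesis using l2 by (simp add: field_simps)
  qed
  also have "ln (A / \<epsilon>) = ln A + ln (1 / \<epsilon>)" using A \<epsilon> by (simp add: ln_div)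
  finally have m: "real (m + 1) \<le> 2 * real k + 1 + 2 * ln A + 2 * ln (1 / \<epsilon>)" by simp
  have lA: "ln A \<ge> 0" and l\<epsilon>: "ln (1 / \<epsilon>) \<ge> 0" using A \<epsilon> by (auto simp: ln_div)
  have "real (m + 1) \<le> (2 * real k + 3 + 2 * ln A) * (ln (1 / \<epsilon>) + 1)"
  proof -
    have "(2 * real k + 3 + 2 * ln A) * (ln (1 / \<epsilon>) + 1)
      = 2 * real k + 3 + 2 * ln A + (2 * real k + 2 * ln A) * ln (1 / \<epsilon>) + 3 * ln (1 / \<epsilon>)" by (simp add: algebra_simps)
    moreover have "(2 * real k + 2 * ln A) * ln (1 / \<epsilon>) \<ge> 0" using lA l\<epsilon> by simp
    ultimately show ?thesis using m l\<epsilon> by linarith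
  qed
  then show ?thesis
    using b1 \<open>b0 \<le> b\<close> bk b2 bm unfolding z_def by (intro exI[of _ b] exI[of _ m] conjI)
qed

text \<open>Here the exponent of the weight bound arises: b^k nodes at a cost of b^(d + 1) each,
  with b of order \<epsilon>^(- 1/k).\<close>

lemma base_power_le:
  fixes A \<epsilon> :: real and b k d :: nat
  assumes k: "k \<ge> 1" and \<epsilon>: "0 < \<epsilon>" and A: "A > 0" and b: "real b \<le> 2 * (A / \<epsilon>) powr (1 / real k)"
  shows "real b ^ (k + d + 1) \<le> (2 * A powr (1 / real k)) ^ (k + d + 1) * \<epsilon> powr (- (real (d + 1) / real k) - 1)"
proof -
  have "real b ^ (k + d + 1) \<le> (2 * (A / \<epsilon>) powr (1 / real k)) ^ (k + d + 1)" by (rule power_mono[OF b]) simp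
  also have "2 * (A / \<epsilon>) powr (1 / real k) = 2 * A powr (1 / real k) * \<epsilon> powr (- (1 / real k))"
    using A \<epsilon> by (simp add: powr_divide powr_minus_divide)
  also have "(\<dots>) ^ (k + d + 1) = (2 * A powr (1 / real k)) ^ (k + d + 1) * (\<epsilon> powr (- (1 / real k))) ^ (k + d + 1)"
    by (simp add: power_mult_distrib)
  also have "(\<epsilon> powr (- (1 / real k))) ^ (k + d + 1) = \<epsilon> powr (- (1 / real k) * real (k + d + 1))"
    using \<epsilon> by (simp only: powr_realpow[symmetric] powr_gt_zero powr_powr simp_thms not_less less_imp_neq[symmetric])
  also have "- (1 / real k) * real (k + d + 1) = - (real (d + 1) / real k) - 1" using k by (simp add: field_simps)
  finally show ?thesis .
qed

lemma source_ok_continuous: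
  assumes "source_ok k T s' f"
  shows "continuous_on (tx_dom T UNIV) f"
  using assms unfolding source_ok_def
proof (elim disjE conjE exE)
  fix f\<^sub>1 assume f1: "Ck_on s' f\<^sub>1 ({0..T} \<times> UNIV)" and eq: "\<forall>(t, x, \<eta>)\<in>tx_dom T UNIV. f (t, x, \<eta>) = f\<^sub>1 (t, x)"
  have "continuous_on ({0..T} \<times> UNIV) f\<^sub>1" using Ck_on_mono[OF f1, of 0] by simp
  then have "continuous_on (tx_dom T UNIV) (\<lambda>p. f\<^sub>1 (fst p, fst (snd p)))"
    by (rule continuous_on_compose2) (auto intro!: continuous_intros simp: tx_dom_def)
  then show ?thesis by (rule continuous_on_eq) (use eq in auto)
next
  assume "Ck_on s' f (tx_dom T UNIV)"
  from Ck_on_mono[OF this, of 0] show ?thesis by simp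
qed

lemma Ck_norm_nonneg:
  assumes "continuous_on \<Omega> g" "compact S" "S \<subseteq> \<Omega>" "S \<noteq> {}"
  shows "Ck_norm k \<Omega> S g \<ge> 0"
proof -
  obtain p where p: "p \<in> S" using assms(4) by blast
  have "continuous_on S g" using assms(1,3) by (rule continuous_on_subset)
  from bdd_above_norm_image[OF this assms(2)] iter_pderiv_le_Ck_norm[of "[]" k p S \<Omega> g] p
  have "norm (g p) \<le> Ck_norm k \<Omega> S g" by (simp add: iter_pderiv_def)
  then show ?thesis using norm_ge_zero[of "g p"] by linarith
qed

lemma set_size_nonneg: "compact K \<Longrightarrow> K \<noteq> {} \<Longrightarrow> set_size K \<ge> 0"
  for K :: "'a::euclidean_space set"
proof -
  assume K: "compact K" "K \<noteq> {}"
  obtain x where x: "x \<in> K" using K(2) by blast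
  have "bdd_above (norm ` K)" using bdd_above_norm_image[OF continuous_on_id K(1)] by simp
  then have "norm x \<le> set_size K" unfolding set_size_def using x by (intro cSUP_upper)
  then show ?thesis using norm_ge_zero[of x] by linarith
qed

text \<open>Serves an empty K, for which \<open>set_size\<close> is a supremum over the empty set
  and carries no information.\<close>

lemma zero_network:
  assumes "d \<ge> 1"
  shows "is_nn d [(0\<^sub>m 1 d, 0\<^sub>v 1)]" "nn_out_dim [(0\<^sub>m 1 d, 0\<^sub>v 1)] = 1"
    "nn_layers [(0\<^sub>m 1 d, 0\<^sub>v 1)] = 1" "nn_weights [(0\<^sub>m 1 d, 0\<^sub>v 1)] = 0"
proof -
  have "{(i, j). i < 1 \<and> j < d \<and> 0\<^sub>m 1 d $$ (i, j) \<noteq> (0::real)} = {}" by (auto simp del: less_one less_Suc0 One_nat_def)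
  then have m: "nnz_mat (0\<^sub>m 1 d) = 0" unfolding nnz_mat_def by (simp only: index_zero_mat card.empty)
  have "{i. i < 1 \<and> vec_index (0\<^sub>v 1) i \<noteq> (0::real)} = {}" by (auto simp del: less_one less_Suc0 One_nat_def)
  then have v: "nnz_vec (0\<^sub>v 1) = 0" unfolding nnz_vec_def by (simp only: index_zero_vec card.empty)
  show "is_nn d [(0\<^sub>m 1 d, 0\<^sub>v 1)]" "nn_out_dim [(0\<^sub>m 1 d, 0\<^sub>v 1)] = 1"
    "nn_layers [(0\<^sub>m 1 d, 0\<^sub>v 1)] = 1" using assms by (auto simp: is_nn_def nn_out_dim_def nn_layers_def)
  show "nn_weights [(0\<^sub>m 1 d, 0\<^sub>v 1)] = 0" using m v by (simp add: nn_weights_def)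
qed

definition approximable_at :: "nat \<Rightarrow> real \<Rightarrow> nat \<Rightarrow> real \<Rightarrow> (real \<times> (real ^ 'n) \<times> (real ^ 'D)) set \<Rightarrow>
    (real \<times> (real ^ 'n) \<times> (real ^ 'D) \<Rightarrow> real) \<Rightarrow> real \<Rightarrow> bool" where
  "approximable_at d r k c S u \<epsilon> \<longleftrightarrow> (\<exists>\<Phi>. is_nn d \<Phi> \<and> nn_out_dim \<Phi> = 1 \<and>
     real (nn_layers \<Phi>) \<le> c * (ln (1 / \<epsilon>) + 1) \<and>
     real (nn_weights \<Phi>) \<le> c * (\<epsilon> powr (- (1 / r)) + \<epsilon> powr (- (real (d + 1) / real k) - 1)) * (ln (1 / \<epsilon>) + 1) \<and>
     Linf_norm S (\<lambda>p. u p - nn_fun \<Phi> p) < ereal \<epsilon>)"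

lemma approximable_at_empty:
  assumes "d \<ge> 1" "c \<ge> 1" "0 < \<epsilon>" "\<epsilon> < 1"
  shows "approximable_at d r k c {} u \<epsilon>"
proof -
  let ?\<Phi> = "[(0\<^sub>m 1 d, 0\<^sub>v 1)] :: nn"
  have l: "ln (1 / \<epsilon>) \<ge> 0" using assms by (simp add: ln_div)
  have "1 * 1 \<le> c * (ln (1 / \<epsilon>) + 1)" using assms l by (intro mult_mono) auto
  moreover have "Linf_norm {} (\<lambda>p. u p - nn_fun ?\<Phi> p) < ereal \<epsilon>"
    by (rule le_less_trans[OF Linf_norm_le[of _ _ 0]]) (use assms in auto)
  ultimately show ?thesis
    unfolding approximable_at_def using zero_network[OF assms(1)] assms l by (intro exI[of _ ?\<Phi>]) (auto simp: zero_ereal_def)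
qed

lemma transport_rate:
  fixes u\<^sub>0 :: "real ^ 'n \<Rightarrow> real" and T r \<rho> v \<phi> :: real and k :: nat
  defines "d \<equiv> 1 + CARD('n) + CARD('D)"
  assumes k: "k \<ge> 1" and T: "T > 0" and r: "r > 0" and u0: "Ck_on 1 u\<^sub>0 UNIV" "r_approximable r u\<^sub>0"
    and nonneg: "\<rho> \<ge> 0" "v \<ge> 0" "\<phi> \<ge> 0"
  shows "\<exists>c\<ge>1. \<forall>(V :: real \<times> (real ^ 'n) \<times> (real ^ 'D) \<Rightarrow> real ^ 'n) C
      (f :: real \<times> (real ^ 'n) \<times> (real ^ 'D) \<Rightarrow> real) s' u K \<epsilon>.
    Ck_on k V (tx_dom T UNIV) \<longrightarrow> C > 0 \<longrightarrow>
    (\<forall>(t, x, \<eta>)\<in>tx_dom T UNIV. norm (V (t, x, \<eta>)) \<le> C * (1 + norm x)) \<longrightarrow>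
    source_ok k T s' f \<longrightarrow> cauchy_solution T V f u\<^sub>0 u \<longrightarrow> compact K \<longrightarrow> K \<noteq> {} \<longrightarrow> set_size K = \<rho> \<longrightarrow>
    Ck_norm k (tx_dom T UNIV) (tx_dom T (cball 0 (growth_radius K C T))) V = v \<longrightarrow>
    Ck_norm s' (tx_dom T UNIV) (tx_dom T (cball 0 (growth_radius K C T))) f = \<phi> \<longrightarrow>
    0 < \<epsilon> \<longrightarrow> \<epsilon> < 1 \<longrightarrow> approximable_at d r k c (tx_dom T K) u \<epsilon>"
proof -
  have dP: "DIM(real \<times> (real ^ 'n) \<times> (real ^ 'D)) = d" by (simp add: d_def)
  obtain E R1 and Cw L1 b0 :: nat where E: "E \<ge> 0" and core: "\<forall>(V :: real \<times> (real ^ 'n) \<times> (real ^ 'D) \<Rightarrow> real ^ 'n) C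
      (f :: real \<times> (real ^ 'n) \<times> (real ^ 'D) \<Rightarrow> real) s' u K b m \<Phi> \<epsilon>.
    Ck_on k V (tx_dom T UNIV) \<longrightarrow> C > 0 \<longrightarrow>
    (\<forall>(t, x, \<eta>)\<in>tx_dom T UNIV. norm (V (t, x, \<eta>)) \<le> C * (1 + norm x)) \<longrightarrow>
    source_ok k T s' f \<longrightarrow> cauchy_solution T V f u\<^sub>0 u \<longrightarrow> compact K \<longrightarrow> K \<noteq> {} \<longrightarrow> set_size K = \<rho> \<longrightarrow>
    Ck_norm k (tx_dom T UNIV) (tx_dom T (cball 0 (growth_radius K C T))) V = v \<longrightarrow>
    Ck_norm s' (tx_dom T UNIV) (tx_dom T (cball 0 (growth_radius K C T))) f = \<phi> \<longrightarrow>
    b \<ge> b0 \<longrightarrow> b \<ge> 1 \<longrightarrow> real b ^ k \<le> 2 ^ m \<longrightarrow> is_nn CARD('n) \<Phi> \<longrightarrow> nn_out_dim \<Phi> = 1 \<longrightarrow>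
    (\<forall>y\<in>ball 0 R1. \<bar>u\<^sub>0 y - nn_fun \<Phi> y\<bar> \<le> \<epsilon>) \<longrightarrow>
    (\<exists>out. computes coord_funs (L1 * (m + 1) + nn_layers \<Phi>) (Cw * (m + 1) * b ^ (k + d + 1) + nn_weights \<Phi>) {out} \<and>
       (\<forall>p\<in>tx_dom T K. \<bar>u p - out p\<bar> \<le> E / real b ^ k + \<epsilon>))"
    using core_estimate[OF k T u0(1) nonneg, where 'D = 'D, folded d_def] by (elim exE conjE) (rule that, assumption+)
  have u0c: "continuous_on UNIV u\<^sub>0" using Ck_on_mono[OF u0(1), of 0] by simp
  obtain c0 where c0: "c0 > 0" and init: "\<forall>\<epsilon>. 0 < \<epsilon> \<and> \<epsilon> < 1 \<longrightarrow> (\<exists>\<Phi>. is_nn DIM(real ^ 'n) \<Phi> \<and> nn_out_dim \<Phi> = 1 \<and>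
     real (nn_layers \<Phi>) \<le> c0 * (ln (1 / \<epsilon>) + 1) \<and> real (nn_weights \<Phi>) \<le> c0 * \<epsilon> powr (- (1 / r)) \<and>
     (\<forall>y\<in>ball 0 R1. \<bar>u\<^sub>0 y - nn_fun \<Phi> y\<bar> \<le> \<epsilon>))"
    using approximable_on_ball[OF u0(2) u0c, of R1] by (elim exE conjE) (rule that, assumption+)
  \<comment> \<open>The first entry makes E / b^k at most \<epsilon> / 2, the second forces b to be
    at least b0.\<close>
  define A where "A = max (2 * E) (max (real b0 ^ k) 1)"
  have A: "A \<ge> 1" "A \<ge> real b0 ^ k" "A \<ge> 2 * E" by (auto simp: A_def)
  define C1 where "C1 = 2 * real k + 3 + 2 * ln A"
  define Q where "Q = (2 * A powr (1 / real k)) ^ (k + d + 1)"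
  have C1: "C1 \<ge> 0" and Q: "Q \<ge> 0" using A by (auto simp: C1_def Q_def)
  \<comment> \<open>In turn: the output layer, the sweeps, and the initial network at accuracy
    \<epsilon> / 4, whence ln 4.\<close>
  define cL where "cL = 1 + real L1 * C1 + c0 * (ln 4 + 1)"
  define cW where "cW = 4 * real Cw * C1 * Q + 4 * (c0 * 4 powr (1 / r)) + 2"
  define c where "c = cL + cW"
  have cL: "cL \<ge> 1" unfolding cL_def using c0 C1 by simp
  have cW: "cW \<ge> 2" unfolding cW_def using c0 C1 Q by simp
  have main: "approximable_at d r k c (tx_dom T K) u \<epsilon>"
    if V: "Ck_on k V (tx_dom T UNIV)" "C > 0"
      "\<forall>(t, x, \<eta>)\<in>tx_dom T UNIV. norm (V (t, x, \<eta>)) \<le> C * (1 + norm x)"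
      and ok: "source_ok k T s' f" and sol: "cauchy_solution T V f u\<^sub>0 u"
      and K: "compact K" "K \<noteq> {}" "set_size K = \<rho>"
      "Ck_norm k (tx_dom T UNIV) (tx_dom T (cball 0 (growth_radius K C T))) V = v"
      "Ck_norm s' (tx_dom T UNIV) (tx_dom T (cball 0 (growth_radius K C T))) f = \<phi>"
      and \<epsilon>: "0 < \<epsilon>" "\<epsilon> < 1"
    for V :: "real \<times> (real ^ 'n) \<times> (real ^ 'D) \<Rightarrow> real ^ 'n" and C
      and f u :: "real \<times> (real ^ 'n) \<times> (real ^ 'D) \<Rightarrow> real" and s' K \<epsilon>
  proof -
    define l where "l = ln (1 / \<epsilon>) + 1"
    define X where "X = \<epsilon> powr (- (1 / r))"
    define Y where "Y = \<epsilon> powr (- (real (d + 1) / real k) - 1)"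
    have l: "l \<ge> 1" using \<epsilon> by (simp add: l_def ln_div)
    have X: "X \<ge> 1" unfolding X_def using \<epsilon> r by (simp add: powr_minus one_le_inverse_iff powr_le1)
    have Y: "Y \<ge> 0" by (simp add: Y_def)
    obtain b m where b: "b \<ge> 1" "b \<ge> b0" "A / \<epsilon> \<le> real b ^ k" "real b \<le> 2 * (A / \<epsilon>) powr (1 / real k)"
      and m: "real b ^ k \<le> 2 ^ m" "real (m + 1) \<le> C1 * l"
      using base_for_accuracy[OF k \<epsilon> A(1,2), folded C1_def l_def] by (elim exE conjE) (rule that, assumption+)
    have bY: "real b ^ (k + d + 1) \<le> Q * Y"
      unfolding Q_def Y_def by (rule base_power_le[OF k \<epsilon>(1) _ b(4)]) (use A in linarith)
    \<comment> \<open>A quarter of \<epsilon> for the initial network and half of it for everything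
      else leave room for the strict inequality.\<close>
    have \<epsilon>4: "0 < \<epsilon> / 4 \<and> \<epsilon> / 4 < 1" using \<epsilon> by simp
    obtain \<Phi>\<^sub>0 where \<Phi>0: "is_nn CARD('n) \<Phi>\<^sub>0" "nn_out_dim \<Phi>\<^sub>0 = 1"
     "real (nn_layers \<Phi>\<^sub>0) \<le> c0 * (ln (1 / (\<epsilon> / 4)) + 1)" "real (nn_weights \<Phi>\<^sub>0) \<le> c0 * (\<epsilon> / 4) powr (- (1 / r))"
     "\<forall>y\<in>ball 0 R1. \<bar>u\<^sub>0 y - nn_fun \<Phi>\<^sub>0 y\<bar> \<le> \<epsilon> / 4"
      using init[THEN spec, THEN mp, OF \<epsilon>4] unfolding DIM_cart DIM_real mult_1_right by (elim exE conjE) (rule that, assumption+)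
    obtain out where cp: "computes coord_funs (L1 * (m + 1) + nn_layers \<Phi>\<^sub>0) (Cw * (m + 1) * b ^ (k + d + 1) + nn_weights \<Phi>\<^sub>0) {out}"
      and err: "\<forall>p\<in>tx_dom T K. \<bar>u p - out p\<bar> \<le> E / real b ^ k + \<epsilon> / 4"
      using core[THEN spec[of _ V], THEN spec[of _ C], THEN spec[of _ f], THEN spec[of _ s'], THEN spec[of _ u], THEN spec[of _ K],
          THEN spec[of _ b], THEN spec[of _ m], THEN spec[of _ \<Phi>\<^sub>0], THEN spec[of _ "\<epsilon> / 4"],
          THEN mp, OF V(1), THEN mp, OF V(2), THEN mp, OF V(3), THEN mp, OF ok, THEN mp, OF sol, THEN mp, OF K(1), THEN mp, OF K(2),
          THEN mp, OF K(3), THEN mp, OF K(4), THEN mp, OF K(5), THEN mp, OF b(2), THEN mp, OF b(1), THEN mp, OF m(1),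
          THEN mp, OF \<Phi>0(1), THEN mp, OF \<Phi>0(2), THEN mp, OF \<Phi>0(5)]
      by (elim exE conjE) (rule that, assumption+)
    obtain \<Phi> where \<Phi>: "is_nn d \<Phi>" "nn_out_dim \<Phi> = 1"
      "nn_layers \<Phi> = Suc (L1 * (m + 1) + nn_layers \<Phi>\<^sub>0)"
      "nn_weights \<Phi> \<le> 4 * (Cw * (m + 1) * b ^ (k + d + 1) + nn_weights \<Phi>\<^sub>0) + 2" "\<forall>p. nn_fun \<Phi> p = out p"
      using nn_of_computes[OF cp[unfolded coord_funs_def], unfolded dP] by (elim exE conjE) (rule that, assumption+)
    have ln4: "ln (1 / (\<epsilon> / 4)) + 1 \<le> (ln 4 + 1) * l"
    proof -
      have "ln (1 / (\<epsilon> / 4)) = ln 4 + ln (1 / \<epsilon>)" using \<epsilon> by (simp add: ln_div)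
      moreover have "ln 4 * 1 \<le> ln 4 * l" using l by (intro mult_left_mono) auto
      moreover have "(ln 4 + 1) * l = ln 4 * l + ln (1 / \<epsilon>) + 1" by (simp add: l_def algebra_simps)
      ultimately show ?thesis by linarith
    qed
    have "real (nn_layers \<Phi>) = 1 + real L1 * real (m + 1) + real (nn_layers \<Phi>\<^sub>0)" unfolding \<Phi>(3) by (simp add: algebra_simps)
    also have "\<dots> \<le> 1 * l + real L1 * (C1 * l) + c0 * ((ln 4 + 1) * l)"
    proof (intro add_mono mult_left_mono m(2))
      show "real (nn_layers \<Phi>\<^sub>0) \<le> c0 * ((ln 4 + 1) * l)"
        using \<Phi>0(3) mult_left_mono[OF ln4, of c0] c0 by linarith
    qed (use l in auto)
    also have "\<dots> = cL * l" by (simp add: cL_def algebra_simps)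
    also have "\<dots> \<le> c * l" using cW l by (intro mult_right_mono) (auto simp: c_def)
    finally have layers: "real (nn_layers \<Phi>) \<le> c * l" .
    have X4: "(\<epsilon> / 4) powr (- (1 / r)) = 4 powr (1 / r) * X"
      unfolding X_def using \<epsilon> by (simp add: powr_divide powr_minus field_simps)
    have "real (nn_weights \<Phi>) \<le> real (4 * (Cw * (m + 1) * b ^ (k + d + 1) + nn_weights \<Phi>\<^sub>0) + 2)"
      using \<Phi>(4) by (rule of_nat_mono)
    also have "\<dots> = 4 * real Cw * (real (m + 1) * real b ^ (k + d + 1)) + 4 * real (nn_weights \<Phi>\<^sub>0) + 2" by (simp add: algebra_simps)
    also have "\<dots> \<le> 4 * real Cw * ((C1 * l) * (Q * Y)) + 4 * (c0 * (4 powr (1 / r) * X)) + 2"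
      using \<Phi>0(4)[unfolded X4] m(2) bY C1 l by (intro add_mono mult_left_mono mult_mono order_refl) auto
    also have "\<dots> \<le> cW * (X + Y) * l"
    proof -
      \<comment> \<open>These absorb the additive constant of the weight count and the missing
        logarithmic factor at the initial network into X l.\<close>
      have Xl: "1 * 1 \<le> X * l" "X * 1 \<le> X * l" using X l by (intro mult_mono; simp)+
      have "cW * (X + Y) * l = 4 * real Cw * ((C1 * l) * (Q * Y)) + 4 * (c0 * 4 powr (1 / r)) * (X * l) + 2 * (X * l)
          + (4 * real Cw * C1 * Q * X * l + 4 * (c0 * 4 powr (1 / r)) * Y * l + 2 * Y * l)"
        by (simp add: cW_def algebra_simps)
      moreover have "4 * (c0 * 4 powr (1 / r)) * X \<le> 4 * (c0 * 4 powr (1 / r)) * (X * l)"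
        using Xl(2) c0 by (intro mult_left_mono) auto
      moreover have "4 * real Cw * C1 * Q * X * l + 4 * (c0 * 4 powr (1 / r)) * Y * l + 2 * Y * l \<ge> 0"
        using c0 C1 Q X Y l by (intro add_nonneg_nonneg mult_nonneg_nonneg) auto
      ultimately show ?thesis using Xl(1) by (simp add: mult.assoc)
    qed
    also have "\<dots> \<le> c * (X + Y) * l" using cL X Y l by (intro mult_right_mono) (auto simp: c_def)
    finally have weights: "real (nn_weights \<Phi>) \<le> c * (X + Y) * l" .
    have "E / real b ^ k \<le> \<epsilon> / 2"
    proof -
      have "2 * E / \<epsilon> \<le> A / \<epsilon>" using A(3) \<epsilon> by (intro divide_right_mono) auto
      then have "2 * E / \<epsilon> \<le> real b ^ k" using b(3) by linarith
      then show ?thesis using \<epsilon> b(1) by (simp add: field_simps)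
    qed
    then have ptw: "\<bar>u p - nn_fun \<Phi> p\<bar> \<le> 3 / 4 * \<epsilon>" if "p \<in> tx_dom T K" for p
      using bspec[OF err that] \<Phi>(5)[THEN spec, of p] by linarith
    have "Ck_on 1 u (tx_dom T UNIV)" using sol by (simp add: cauchy_solution_def)
    from Ck_on_mono[OF this, of 0] have "continuous_on (tx_dom T UNIV) u" by simp
    then have uc: "continuous_on (tx_dom T K) u" by (rule continuous_on_subset) (auto simp: tx_dom_def)
    have \<Phi>c: "continuous_on (tx_dom T K :: (real \<times> (real ^ 'n) \<times> (real ^ 'D)) set) (\<lambda>p. nn_fun \<Phi> p)"
      by (rule continuous_on_subset[OF continuous_nn_fun[where 'a = "real \<times> (real ^ 'n) \<times> (real ^ 'D)", unfolded dP, OF \<Phi>(1,2)] subset_UNIV])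
    have "compact (tx_dom T K :: (real \<times> (real ^ 'n) \<times> (real ^ 'D)) set)"
      unfolding tx_dom_def using K(1) by (intro compact_Times) auto
    then have "Linf_norm (tx_dom T K) (\<lambda>p. u p - nn_fun \<Phi> p) \<le> ereal (3 / 4 * \<epsilon>)"
      by (rule Linf_norm_le[OF _ continuous_on_diff[OF uc \<Phi>c] ptw]) (use \<epsilon> in simp_all)
    also have "\<dots> < ereal \<epsilon>" using \<epsilon> by simp
    finally have "Linf_norm (tx_dom T K) (\<lambda>p. u p - nn_fun \<Phi> p) < ereal \<epsilon>" .
    then show ?thesis unfolding approximable_at_def
      using \<Phi>(1,2) layers weights unfolding l_def X_def Y_def by (intro exI[of _ \<Phi>] conjI)
  qed
  have "c \<ge> 1" using cL cW by (simp add: c_def)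
  then show ?thesis by (intro exI[of _ c] conjI allI impI main)
qed

theorem theorem4p7:
  fixes k d :: nat and T r :: real and u\<^sub>0 :: "real ^ 'n \<Rightarrow> real"
  assumes "k \<ge> 1" and "T > 0" and "r > 0"
    and "d = 1 + CARD('n) + CARD('D)"
    and "Ck_on 1 u\<^sub>0 UNIV" and "r_approximable r u\<^sub>0"
  shows "\<exists>c :: real \<Rightarrow> real \<Rightarrow> real \<Rightarrow> real. (\<forall>\<rho> v \<phi>. c \<rho> v \<phi> > 0) \<and>
    (\<forall>(V :: real \<times> (real ^ 'n) \<times> (real ^ 'D) \<Rightarrow> real ^ 'n) C
      (f :: real \<times> (real ^ 'n) \<times> (real ^ 'D) \<Rightarrow> real) s'
      (u :: real \<times> (real ^ 'n) \<times> (real ^ 'D) \<Rightarrow> real) K.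
       Ck_on k V (tx_dom T UNIV) \<longrightarrow>
       C > 0 \<longrightarrow>
       (\<forall>(t, x, \<eta>)\<in>tx_dom T UNIV. norm (V (t, x, \<eta>)) \<le> C * (1 + norm x)) \<longrightarrow>
       ((s' = nat \<lceil>real ((CARD('n) + 1) * k) / real d\<rceil> \<and>
         (\<exists>f\<^sub>1. Ck_on s' f\<^sub>1 ({0..T} \<times> UNIV) \<and> (\<forall>(t, x, \<eta>)\<in>tx_dom T UNIV. f (t, x, \<eta>) = f\<^sub>1 (t, x)))) \<or>
        (s' = k \<and> Ck_on s' f (tx_dom T UNIV))) \<longrightarrow>
       cauchy_solution T V f u\<^sub>0 u \<longrightarrow>
       compact K \<longrightarrow>
       (let G = growth_radius K C T;
            c' = c (set_size K)
                   (Ck_norm k (tx_dom T UNIV) (tx_dom T (cball 0 G)) V)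
                   (Ck_norm s' (tx_dom T UNIV) (tx_dom T (cball 0 G)) f)
        in \<forall>\<epsilon>. 0 < \<epsilon> \<and> \<epsilon> < 1 \<longrightarrow>
          (\<exists>\<Phi>. is_nn d \<Phi> \<and> nn_out_dim \<Phi> = 1 \<and>
             real (nn_layers \<Phi>) \<le> c' * (ln (1 / \<epsilon>) + 1) \<and>
             real (nn_weights \<Phi>)
               \<le> c' * (\<epsilon> powr (- (1 / r)) + \<epsilon> powr (- (real (d + 1) / real k) - 1)) * (ln (1 / \<epsilon>) + 1) \<and>
             Linf_norm (tx_dom T K) (\<lambda>p. u p - nn_fun \<Phi> p) < ereal \<epsilon>)))"
proof -
  let ?P = "\<lambda>\<rho> v \<phi> c. \<forall>(V :: real \<times> (real ^ 'n) \<times> (real ^ 'D) \<Rightarrow> real ^ 'n) C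
      (f :: real \<times> (real ^ 'n) \<times> (real ^ 'D) \<Rightarrow> real) s' u K \<epsilon>.
    Ck_on k V (tx_dom T UNIV) \<longrightarrow> C > 0 \<longrightarrow>
    (\<forall>(t, x, \<eta>)\<in>tx_dom T UNIV. norm (V (t, x, \<eta>)) \<le> C * (1 + norm x)) \<longrightarrow>
    source_ok k T s' f \<longrightarrow> cauchy_solution T V f u\<^sub>0 u \<longrightarrow> compact K \<longrightarrow> K \<noteq> {} \<longrightarrow> set_size K = \<rho> \<longrightarrow>
    Ck_norm k (tx_dom T UNIV) (tx_dom T (cball 0 (growth_radius K C T))) V = v \<longrightarrow>
    Ck_norm s' (tx_dom T UNIV) (tx_dom T (cball 0 (growth_radius K C T))) f = \<phi> \<longrightarrow>
    0 < \<epsilon> \<longrightarrow> \<epsilon> < 1 \<longrightarrow> approximable_at d r k c (tx_dom T K) u \<epsilon>"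
  \<comment> \<open>The constant has to be a positive function on all triples (\<rho>, v, \<phi>).
    Triples with a negative entry do not come from data with K nonempty and receive the value
    1.\<close>
  have "\<exists>c\<ge>1. 0 \<le> fst q \<and> 0 \<le> fst (snd q) \<and> 0 \<le> snd (snd q) \<longrightarrow> ?P (fst q) (fst (snd q)) (snd (snd q)) c" for q :: "real \<times> real \<times> real"
  proof (cases "0 \<le> fst q \<and> 0 \<le> fst (snd q) \<and> 0 \<le> snd (snd q)")
    case True
    then have n: "0 \<le> fst q" "0 \<le> fst (snd q)" "0 \<le> snd (snd q)" by simp_all
    from transport_rate[OF assms(1,2,3,5,6) n, where 'D = 'D, folded assms(4)]
    show ?thesis by (elim exE conjE) (intro exI conjI impI, assumption+)
  next
    case False
    then show ?thesis by (intro exI[of _ 1] conjI impI) (simp, rule notE)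
  qed
  \<comment> \<open>Choosing c for each triple before V, C, f and K are introduced is what expresses
    that it depends on them only through the three numbers.\<close>
  then have "\<exists>c. \<forall>q :: real \<times> real \<times> real. c q \<ge> 1 \<and>
      (0 \<le> fst q \<and> 0 \<le> fst (snd q) \<and> 0 \<le> snd (snd q) \<longrightarrow> ?P (fst q) (fst (snd q)) (snd (snd q)) (c q))"
    by (intro choice allI)
  then obtain c where c: "\<forall>q :: real \<times> real \<times> real. c q \<ge> 1 \<and>
      (0 \<le> fst q \<and> 0 \<le> fst (snd q) \<and> 0 \<le> snd (snd q) \<longrightarrow> ?P (fst q) (fst (snd q)) (snd (snd q)) (c q))"
    by (elim exE) (rule that)
  have c1: "c q \<ge> 1" for q by (rule c[THEN spec, THEN conjunct1])
  have main: "approximable_at d r k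
      (c (set_size K, Ck_norm k (tx_dom T UNIV) (tx_dom T (cball 0 (growth_radius K C T))) V,
          Ck_norm s' (tx_dom T UNIV) (tx_dom T (cball 0 (growth_radius K C T))) f)) (tx_dom T K) u \<epsilon>"
    if V: "Ck_on k V (tx_dom T UNIV)" "C > 0"
      "\<forall>(t, x, \<eta>)\<in>tx_dom T UNIV. norm (V (t, x, \<eta>)) \<le> C * (1 + norm x)"
      and ok: "source_ok k T s' f" and sol: "cauchy_solution T V f u\<^sub>0 u"
      and K: "compact K" and \<epsilon>: "0 < \<epsilon> \<and> \<epsilon> < 1"
    for V :: "real \<times> (real ^ 'n) \<times> (real ^ 'D) \<Rightarrow> real ^ 'n" and C
      and f u :: "real \<times> (real ^ 'n) \<times> (real ^ 'D) \<Rightarrow> real" and s' K \<epsilon>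
  \<comment> \<open>For empty K the value of \<open>set_size K\<close> is unspecified, so the rate
    is not applicable; any constant of at least 1 admits the zero network.\<close>
  proof (cases "K = {}")
    case True
    have "d \<ge> 1" using assms(4) by simp
    from approximable_at_empty[OF this c1 conjunct1[OF \<epsilon>] conjunct2[OF \<epsilon>]] show ?thesis by (simp add: True tx_dom_def)
  next
    case False
    let ?G = "growth_radius K C T"
    let ?S = "tx_dom T (cball 0 ?G) :: (real \<times> (real ^ 'n) \<times> (real ^ 'D)) set"
    have \<rho>: "set_size K \<ge> 0" by (rule set_size_nonneg[OF K False])
    have G0: "?G \<ge> 0" using \<rho> V(2) assms(2) by (simp add: growth_radius_def)
    have Sc: "compact ?S" unfolding tx_dom_def by (intro compact_Times) auto
    have S\<Omega>: "?S \<subseteq> tx_dom T UNIV" unfolding tx_dom_def by auto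
    have "(0, 0, 0) \<in> ?S" using assms(2) G0 by (simp add: tx_dom_def mem_box)
    then have Sne: "?S \<noteq> {}" by blast
    have "continuous_on (tx_dom T UNIV) V" using Ck_on_mono[OF V(1), of 0] by simp
    note nn = \<rho> Ck_norm_nonneg[OF this Sc S\<Omega> Sne, of k] Ck_norm_nonneg[OF source_ok_continuous[OF ok] Sc S\<Omega> Sne, of s']
    show ?thesis
      using c[THEN spec, THEN conjunct2, of "(set_size K, Ck_norm k (tx_dom T UNIV) ?S V, Ck_norm s' (tx_dom T UNIV) ?S f)",
          unfolded fst_conv snd_conv, THEN mp, OF conjI[OF nn(1) conjI[OF nn(2,3)]],
          THEN spec[of _ V], THEN spec[of _ C], THEN spec[of _ f], THEN spec[of _ s'], THEN spec[of _ u], THEN spec[of _ K], THEN spec[of _ \<epsilon>],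
          THEN mp, OF V(1), THEN mp, OF V(2), THEN mp, OF V(3), THEN mp, OF ok, THEN mp, OF sol, THEN mp, OF K, THEN mp, OF False,
          THEN mp, OF refl, THEN mp, OF refl, THEN mp, OF refl, THEN mp, OF conjunct1[OF \<epsilon>], THEN mp, OF conjunct2[OF \<epsilon>]] .
  qed
  have pos: "c (\<rho>, v, \<phi>) > 0" for \<rho> v \<phi> using c1[of "(\<rho>, v, \<phi>)"] by simp
  show ?thesis
    unfolding Let_def assms(4)[symmetric]
    by (intro exI[of _ "\<lambda>\<rho> v \<phi>. c (\<rho>, v, \<phi>)"] conjI allI impI pos
        main[unfolded approximable_at_def source_ok_def assms(4)[symmetric]])
      (elim conjE, assumption)+
qed

end
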